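(* Let $G$ be a finite group scheme over a field $k$ of characteristic $p>0$. Given $\pi$-points $\alpha$ and $\beta$ of $G$, the following conditions are equivalent: (1) The $\pi$-points $\alpha$ and $\beta$ are equivalent. (2) The subadditive functions $\chi_{\Delta_G(\alpha)}$ and $\chi_{\Delta_G(\beta)}$ are equivalent.
   Context: A finite group scheme $G$ over a field $k$ is an affine group scheme whose coordinate algebra $k[G]$ is finite dimensional over $k$. Its group algebra $kG$ is the $k$-linear dual of $k[G]$; $G$-modules are identified with $kG$-modules, and $\operatorname{mod} G$ is the category of finite dimensional $G$-modules. For a field extension $K/k$, $G_K$ denotes the group scheme over $K$ with group algebra $KG=kG\otimes_k K$. A $\pi$-point of $G$ is a flat algebra homomorphism $\alpha\colon K[t]/(t^p)\to KG$ for some field extension $K/k$ (depending on $\alpha$) such that $\alpha$ factors through the group algebra of a unipotent abelian subgroup scheme of $G_K$. Let $\alpha^*\colon\operatorname{mod} G_K\to\operatorname{mod} K[t]/(t^p)$ denote restriction along $\alpha$, and set \[\operatorname{Thick}(\alpha)=\{M\in\operatorname{mod} G\mid \alpha^*(M\otimes_k K)\text{ is projective}\}.\] Two $\pi$-points $\alpha$ and $\beta$ are equivalent if $\operatorname{Thick}(\alpha)=\operatorname{Thick}(\beta)$. The point module of a $\pi$-point $\alpha$ is the $G$-module \[\Delta_G(\alpha)=\operatorname{res}^K_k(\operatorname{Hom}_{K[t]/(t^p)}(KG,K)),\] where $K$ is the trivial $K[t]/(t^p)$-module (with $t$ acting as zero), $\operatorname{Hom}_{K[t]/(t^p)}(KG,K)$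 is the $G_K$-module coinduced from $K$ along $\alpha$, and $\operatorname{res}^K_k$ is restriction of $KG$-modules along $kG\to KG$. It is an endofinite $G$-module, where a $G$-module $M$ is endofinite if it has finite composition length as a left $\operatorname{End}_G(M)$-module. For an endofinite $G$-module $M$, $\chi_M\colon\operatorname{mod} G\to\mathbb N$ is the subadditive function $\chi_M(X)=\ell_{\operatorname{End}_G(M)}(\operatorname{Hom}_G(X,M))$, where $\ell$ denotes composition length. A subadditive function $\chi\colon\operatorname{mod} G\to\mathbb N$ is one that satisfies $\chi(X\oplus Y)=\chi(X)+\chi(Y)$ for all $X,Y$ and $\chi(X)+\chi(Z)\ge\chi(Y)$ for each exact sequence $X\to Y\to Z\to 0$ in $\operatorname{mod} G$. Its additive locus $\operatorname{Adloc}(\chi)$ is the full subcategory of objects $Z\in\operatorname{mod} G$ such that $\chi(X)-\chi(Y)+\chi(Z)=0$ for every exact sequence $0\to X\to Y\to Z\to 0$ in $\operatorname{mod} G$. Subadditive functions $\chi,\chi'$ are equivalent if $\operatorname{Adloc}(\chi)=\operatorname{Adloc}(\chi')$. *)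

theory Defs
  imports "HOL-Algebra.Algebra" "HOL-Algebra.Free_Abelian_Groups"
begin

section \<open>Modules and linear maps\<close>

text \<open>
  Modules are records of HOL-Algebra's type \<^typ>\<open>('r, 'm) module\<close>.  The fields \<^const>\<open>monoid.mult\<close> and
  \<^const>\<open>one\<close> of such a record carry no information unless it is used as an algebra.  HOL-Algebra's
  \<^locale>\<open>module\<close> requires a commutative ring, \<^locale>\<open>algebra\<close> a commutative algebra; the following
  locale is the version over an arbitrary ring.
\<close>

locale left_module = R?: ring R + M?: abelian_group M
  for R :: "('r, 'y) ring_scheme" (structure) and M :: "('r, 'm, 'x) module_scheme" (structure) +
  assumes smult_closed:
      "\<lbrakk>a \<in> carrier R; x \<in> carrier M\<rbrakk> \<Longrightarrow> a \<odot>\<^bsub>M\<^esub> x \<in> carrier M"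
    and smult_l_distr:
      "\<lbrakk>a \<in> carrier R; b \<in> carrier R; x \<in> carrier M\<rbrakk> \<Longrightarrow>
        (a \<oplus>\<^bsub>R\<^esub> b) \<odot>\<^bsub>M\<^esub> x = a \<odot>\<^bsub>M\<^esub> x \<oplus>\<^bsub>M\<^esub> b \<odot>\<^bsub>M\<^esub> x"
    and smult_r_distr:
      "\<lbrakk>a \<in> carrier R; x \<in> carrier M; y \<in> carrier M\<rbrakk> \<Longrightarrow>
        a \<odot>\<^bsub>M\<^esub> (x \<oplus>\<^bsub>M\<^esub> y) = a \<odot>\<^bsub>M\<^esub> x \<oplus>\<^bsub>M\<^esub> a \<odot>\<^bsub>M\<^esub> y"
    and smult_assoc:
      "\<lbrakk>a \<in> carrier R; b \<in> carrier R; x \<in> carrier M\<rbrakk> \<Longrightarrow>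
        (a \<otimes>\<^bsub>R\<^esub> b) \<odot>\<^bsub>M\<^esub> x = a \<odot>\<^bsub>M\<^esub> (b \<odot>\<^bsub>M\<^esub> x)"
    and smult_one:
      "x \<in> carrier M \<Longrightarrow> \<one>\<^bsub>R\<^esub> \<odot>\<^bsub>M\<^esub> x = x"

definition regular :: "('r, 'x) ring_scheme \<Rightarrow> ('r, 'r) module" where
  "regular R = \<lparr>carrier = carrier R, monoid.mult = monoid.mult R, one = one R,
     ring.zero = ring.zero R, add = add R, smult = monoid.mult R\<rparr>"

definition restr :: "('r \<Rightarrow> 's) \<Rightarrow> ('s, 'm, 'x) module_scheme \<Rightarrow> ('r, 'm) module" where
  "restr \<phi> M = \<lparr>carrier = carrier M, monoid.mult = monoid.mult M, one = one M,
     ring.zero = ring.zero M, add = add M, smult = (\<lambda>r m. \<phi> r \<odot>\<^bsub>M\<^esub> m)\<rparr>"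

definition linear_map :: "('r, 'x) ring_scheme \<Rightarrow> ('r, 'm, 'y) module_scheme \<Rightarrow>
    ('r, 'n, 'z) module_scheme \<Rightarrow> ('m \<Rightarrow> 'n) \<Rightarrow> bool" where
  "linear_map R M N f \<longleftrightarrow> f \<in> carrier M \<rightarrow> carrier N \<and>
     (\<forall>x\<in>carrier M. \<forall>y\<in>carrier M. f (x \<oplus>\<^bsub>M\<^esub> y) = f x \<oplus>\<^bsub>N\<^esub> f y) \<and>
     (\<forall>r\<in>carrier R. \<forall>x\<in>carrier M. f (r \<odot>\<^bsub>M\<^esub> x) = r \<odot>\<^bsub>N\<^esub> f x)"

text \<open>Homomorphisms are extensional, so that \<open>Hom\<close> and \<open>End\<close> are genuine groups and rings.\<close>

definition lhom :: "('r, 'x) ring_scheme \<Rightarrow> ('r, 'm, 'y) module_scheme \<Rightarrow>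
    ('r, 'n, 'z) module_scheme \<Rightarrow> ('m \<Rightarrow> 'n) set" where
  "lhom R M N = {f \<in> extensional (carrier M). linear_map R M N f}"

text \<open>The group \<open>Hom\<^sub>R(M, N)\<close> with pointwise addition; the scalar action is a parameter.\<close>

definition hom_module :: "('r, 'x) ring_scheme \<Rightarrow> ('r, 'm, 'y) module_scheme \<Rightarrow>
    ('r, 'n, 'z) module_scheme \<Rightarrow> ('s \<Rightarrow> ('m \<Rightarrow> 'n) \<Rightarrow> 'm \<Rightarrow> 'n) \<Rightarrow> ('s, 'm \<Rightarrow> 'n) module" where
  "hom_module R M N act = \<lparr>carrier = lhom R M N, monoid.mult = undefined, one = undefined,
     ring.zero = (\<lambda>x\<in>carrier M. \<zero>\<^bsub>N\<^esub>), add = (\<lambda>f g. \<lambda>x\<in>carrier M. f x \<oplus>\<^bsub>N\<^esub> g x), smult = act\<rparr>"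

definition end_ring :: "('r, 'x) ring_scheme \<Rightarrow> ('r, 'm, 'y) module_scheme \<Rightarrow> ('m \<Rightarrow> 'm) ring" where
  "end_ring R M = \<lparr>carrier = lhom R M M, monoid.mult = compose (carrier M), one = (\<lambda>x\<in>carrier M. x),
     ring.zero = (\<lambda>x\<in>carrier M. \<zero>\<^bsub>M\<^esub>), add = (\<lambda>f g. \<lambda>x\<in>carrier M. f x \<oplus>\<^bsub>M\<^esub> g x)\<rparr>"

definition coinduced :: "('r, 'x) ring_scheme \<Rightarrow> ('s, 'y) ring_scheme \<Rightarrow> ('r \<Rightarrow> 's) \<Rightarrow>
    ('r, 'n, 'z) module_scheme \<Rightarrow> ('s, 's \<Rightarrow> 'n) module" where
  "coinduced R S \<alpha> N = hom_module R (restr \<alpha> (regular S)) N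
     (\<lambda>s f. \<lambda>y\<in>carrier S. f (y \<otimes>\<^bsub>S\<^esub> s))"

definition finitely_generated :: "('r, 'x) ring_scheme \<Rightarrow> ('r, 'm, 'y) module_scheme \<Rightarrow> bool" where
  "finitely_generated R M \<longleftrightarrow> (\<exists>B. finite B \<and> B \<subseteq> carrier M \<and>
     (\<forall>x\<in>carrier M. \<exists>c\<in>B \<rightarrow> carrier R. x = (\<Oplus>\<^bsub>M\<^esub>b\<in>B. c b \<odot>\<^bsub>M\<^esub> b)))"

definition short_exact :: "('r, 'x) ring_scheme \<Rightarrow> ('r, 'l) module \<Rightarrow> ('r, 'm) module \<Rightarrow>
    ('r, 'n) module \<Rightarrow> ('l \<Rightarrow> 'm) \<Rightarrow> ('m \<Rightarrow> 'n) \<Rightarrow> bool" where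
  "short_exact R U V W f g \<longleftrightarrow> f \<in> lhom R U V \<and> g \<in> lhom R V W \<and>
     inj_on f (carrier U) \<and> f ` carrier U = {y \<in> carrier V. g y = \<zero>\<^bsub>W\<^esub>} \<and>
     g ` carrier V = carrier W"

text \<open>
  \<open>Q 0 \<subset> \<dots> \<subset> Q n\<close> is a composition series of \<open>M\<close> when no submodule lies strictly between
  consecutive terms.  By the Jordan-Hoelder theorem the least \<open>n\<close> below is the only one; its value
  is unspecified for modules without a composition series.
\<close>

definition composition_series :: "('r, 'x) ring_scheme \<Rightarrow> ('r, 'm) module \<Rightarrow> nat \<Rightarrow>
    (nat \<Rightarrow> 'm set) \<Rightarrow> bool" where
  "composition_series R M n Q \<longleftrightarrow> Q 0 = {\<zero>\<^bsub>M\<^esub>} \<and> Q n = carrier M \<and>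
     (\<forall>i\<le>n. submodule (Q i) R M) \<and>
     (\<forall>i<n. Q i \<subset> Q (Suc i) \<and>
       \<not> (\<exists>W. submodule W R M \<and> Q i \<subset> W \<and> W \<subset> Q (Suc i)))"

definition composition_length :: "('r, 'x) ring_scheme \<Rightarrow> ('r, 'm) module \<Rightarrow> nat" where
  "composition_length R M = (LEAST n. \<exists>Q. composition_series R M n Q)"

text \<open>
  The test modules live on \<open>nat \<Rightarrow> 'r\<close>.  For a nonzero ring this universe contains a copy of every
  countably generated module, in particular of all finitely generated ones.
  Hence for finitely generated \<open>P\<close> nothing is lost (test against a finite free cover of \<open>P\<close>), and
  likewise for flatness below (test against the inclusions of ideals into \<open>R\<close>).
\<close>

definition projective_module :: "('r, 'x) ring_scheme \<Rightarrow> ('r, 'm) module \<Rightarrow> bool" where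
  "projective_module R P \<longleftrightarrow> left_module R P \<and>
     (\<forall>(N :: ('r, nat \<Rightarrow> 'r) module) (N' :: ('r, nat \<Rightarrow> 'r) module) g f.
        left_module R N \<and> left_module R N' \<and> g \<in> lhom R N N' \<and> g ` carrier N = carrier N' \<and>
        f \<in> lhom R P N' \<longrightarrow>
        (\<exists>h\<in>lhom R P N. \<forall>x\<in>carrier P. g (h x) = f x))"


section \<open>Tensor products over commutative rings\<close>

text \<open>
  \<open>M \<otimes>\<^sub>R N\<close> is the free abelian group on \<open>carrier M \<times> carrier N\<close> modulo the subgroup generated by
  the bilinearity relations; its elements are cosets.
\<close>

type_synonym ('m, 'n) tens = "('m \<times> 'n \<Rightarrow>\<^sub>0 int) set"

definition tensor_relations :: "('r, 'x) ring_scheme \<Rightarrow> ('r, 'm, 'y) module_scheme \<Rightarrow>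
    ('r, 'n, 'z) module_scheme \<Rightarrow> ('m \<times> 'n \<Rightarrow>\<^sub>0 int) set" where
  "tensor_relations R M N =
     {frag_of (x \<oplus>\<^bsub>M\<^esub> x', y) - frag_of (x, y) - frag_of (x', y) | x x' y.
        x \<in> carrier M \<and> x' \<in> carrier M \<and> y \<in> carrier N} \<union>
     {frag_of (x, y \<oplus>\<^bsub>N\<^esub> y') - frag_of (x, y) - frag_of (x, y') | x y y'.
        x \<in> carrier M \<and> y \<in> carrier N \<and> y' \<in> carrier N} \<union>
     {frag_of (r \<odot>\<^bsub>M\<^esub> x, y) - frag_of (x, r \<odot>\<^bsub>N\<^esub> y) | r x y.
        r \<in> carrier R \<and> x \<in> carrier M \<and> y \<in> carrier N}"

definition tensor_subgroup :: "('r, 'x) ring_scheme \<Rightarrow> ('r, 'm, 'y) module_scheme \<Rightarrow>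
    ('r, 'n, 'z) module_scheme \<Rightarrow> ('m \<times> 'n \<Rightarrow>\<^sub>0 int) set" where
  "tensor_subgroup R M N =
     generate (free_Abelian_group (carrier M \<times> carrier N)) (tensor_relations R M N)"

definition tensor_group :: "('r, 'x) ring_scheme \<Rightarrow> ('r, 'm, 'y) module_scheme \<Rightarrow>
    ('r, 'n, 'z) module_scheme \<Rightarrow> ('m, 'n) tens monoid" where
  "tensor_group R M N = free_Abelian_group (carrier M \<times> carrier N) Mod tensor_subgroup R M N"

definition pure_tensor :: "('r, 'x) ring_scheme \<Rightarrow> ('r, 'm, 'y) module_scheme \<Rightarrow>
    ('r, 'n, 'z) module_scheme \<Rightarrow> 'm \<Rightarrow> 'n \<Rightarrow> ('m, 'n) tens" where
  "pure_tensor R M N x y =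
     tensor_subgroup R M N #>\<^bsub>free_Abelian_group (carrier M \<times> carrier N)\<^esub> frag_of (x, y)"

text \<open>
  \<open>tensor_lift P f\<close> is the additive map \<open>M \<otimes>\<^sub>R N \<rightarrow> P\<close> with \<open>x \<otimes> y \<mapsto> f x y\<close>, for \<open>f\<close> biadditive and
  \<open>R\<close>-balanced; the extension of such an \<open>f\<close> to the free abelian group is constant on cosets.
\<close>

definition tensor_lift :: "('p, 'x) ring_scheme \<Rightarrow> ('m \<Rightarrow> 'n \<Rightarrow> 'p) \<Rightarrow> ('m, 'n) tens \<Rightarrow> 'p" where
  "tensor_lift P f c = the_elem
     ((\<lambda>u. \<Oplus>\<^bsub>P\<^esub>z\<in>Poly_Mapping.keys u. [Poly_Mapping.lookup u z] \<cdot>\<^bsub>P\<^esub> f (fst z) (snd z)) ` c)"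

definition tensor_ab :: "('r, 'x) ring_scheme \<Rightarrow> ('r, 'm, 'y) module_scheme \<Rightarrow>
    ('r, 'n, 'z) module_scheme \<Rightarrow> ('m, 'n) tens ring" where
  "tensor_ab R M N = \<lparr>carrier = carrier (tensor_group R M N), monoid.mult = undefined, one = undefined,
     ring.zero = one (tensor_group R M N), add = monoid.mult (tensor_group R M N)\<rparr>"

definition tensor :: "('r, 'x) ring_scheme \<Rightarrow> ('r, 'm, 'y) module_scheme \<Rightarrow>
    ('r, 'n, 'z) module_scheme \<Rightarrow> ('r, ('m, 'n) tens) module" where
  "tensor R M N = (let T = tensor_ab R M N in
     \<lparr>carrier = carrier T, monoid.mult = undefined, one = undefined,
      ring.zero = ring.zero T, add = add T,
      smult = (\<lambda>r. tensor_lift T (\<lambda>x y. pure_tensor R M N (r \<odot>\<^bsub>M\<^esub> x) y))\<rparr>)"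

definition tensor_algebra :: "('r, 'x) ring_scheme \<Rightarrow> ('r, 'a, 'y) module_scheme \<Rightarrow>
    ('r, 'b, 'z) module_scheme \<Rightarrow> ('r, ('a, 'b) tens) module" where
  "tensor_algebra R A B = (tensor R A B)
     \<lparr>monoid.mult := (\<lambda>u v. tensor_lift (tensor R A B) (\<lambda>a b. tensor_lift (tensor R A B)
         (\<lambda>a' b'. pure_tensor R A B (a \<otimes>\<^bsub>A\<^esub> a') (b \<otimes>\<^bsub>B\<^esub> b')) v) u),
      one := pure_tensor R A B \<one>\<^bsub>A\<^esub> \<one>\<^bsub>B\<^esub>\<rparr>"

definition flat_module :: "('r, 'x) ring_scheme \<Rightarrow> ('r, 'm) module \<Rightarrow> bool" where
  "flat_module R M \<longleftrightarrow> module R M \<and>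
     (\<forall>(N :: ('r, nat \<Rightarrow> 'r) module) (N' :: ('r, nat \<Rightarrow> 'r) module) f.
        module R N \<and> module R N' \<and> f \<in> lhom R N N' \<and> inj_on f (carrier N) \<longrightarrow>
        inj_on (tensor_lift (tensor R M N') (\<lambda>x y. pure_tensor R M N' x (f y)))
          (carrier (tensor R M N)))"


section \<open>Algebras and extension of scalars\<close>

text \<open>Algebras over a field \<open>k\<close>, not necessarily commutative, are records with a product and a
  \<open>k\<close>-action.\<close>

definition algebra_hom :: "('c, 'x) ring_scheme \<Rightarrow> ('c, 'a, 'y) module_scheme \<Rightarrow>
    ('c, 'b, 'z) module_scheme \<Rightarrow> ('a \<Rightarrow> 'b) \<Rightarrow> bool" where
  "algebra_hom k A B f \<longleftrightarrow> linear_map k A B f \<and> f \<one>\<^bsub>A\<^esub> = \<one>\<^bsub>B\<^esub> \<and>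
     (\<forall>x\<in>carrier A. \<forall>y\<in>carrier A. f (x \<otimes>\<^bsub>A\<^esub> y) = f x \<otimes>\<^bsub>B\<^esub> f y)"

definition scalar :: "('c, 'b, 'x) module_scheme \<Rightarrow> 'c \<Rightarrow> 'b" where
  "scalar B c = c \<odot>\<^bsub>B\<^esub> \<one>\<^bsub>B\<^esub>"

text \<open>
  The category \<open>mod B\<close> of finite dimensional left modules over a finite dimensional \<open>k\<close>-algebra \<open>B\<close>.
  Every such module is isomorphic to one whose elements have type \<open>nat \<Rightarrow> 'c\<close>.
\<close>

definition fd_modules :: "('c, 'x) ring_scheme \<Rightarrow> ('c, 'b, 'y) module_scheme \<Rightarrow>
    ('b, nat \<Rightarrow> 'c) module set" where
  "fd_modules k B = {M. left_module B M \<and> finitely_generated k (restr (scalar B) M)}"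

text \<open>A field extension \<open>K/k\<close> is given by an embedding \<open>\<iota>\<close> of \<open>k\<close> into \<open>K\<close>.\<close>

definition ext_space :: "('d, 'x) ring_scheme \<Rightarrow> ('c \<Rightarrow> 'd) \<Rightarrow> ('c, 'd) module" where
  "ext_space K \<iota> = restr \<iota> (regular K)"

text \<open>The \<open>K\<close>-algebra \<open>B \<otimes>\<^sub>k K\<close>.\<close>

definition ext_algebra :: "('c, 'x) ring_scheme \<Rightarrow> ('d, 'y) ring_scheme \<Rightarrow> ('c \<Rightarrow> 'd) \<Rightarrow>
    ('c, 'b, 'z) module_scheme \<Rightarrow> ('d, ('b, 'd) tens) module" where
  "ext_algebra k K \<iota> B = (let T = tensor_algebra k B (ext_space K \<iota>) in
     \<lparr>carrier = carrier T, monoid.mult = monoid.mult T, one = one T, ring.zero = ring.zero T, add = add T,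
      smult = (\<lambda>d. tensor_lift T (\<lambda>b c. pure_tensor k B (ext_space K \<iota>) b (d \<otimes>\<^bsub>K\<^esub> c)))\<rparr>)"

text \<open>The \<open>B \<otimes>\<^sub>k K\<close>-module \<open>M \<otimes>\<^sub>k K\<close>, with \<open>(b \<otimes> d) (m \<otimes> c) = b m \<otimes> d c\<close>.\<close>

definition ext_module :: "('c, 'x) ring_scheme \<Rightarrow> ('d, 'y) ring_scheme \<Rightarrow> ('c \<Rightarrow> 'd) \<Rightarrow>
    ('c, 'b, 'z) module_scheme \<Rightarrow> ('b, 'm, 'w) module_scheme \<Rightarrow>
    (('b, 'd) tens, ('m, 'd) tens) module" where
  "ext_module k K \<iota> B M =
     (let V = restr (scalar B) M; E = ext_space K \<iota>; T = tensor k V E in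
     \<lparr>carrier = carrier T, monoid.mult = undefined, one = undefined,
      ring.zero = ring.zero T, add = add T,
      smult = (\<lambda>u v. tensor_lift T (\<lambda>b d. tensor_lift T
        (\<lambda>m c. pure_tensor k V E (b \<odot>\<^bsub>M\<^esub> m) (d \<otimes>\<^bsub>K\<^esub> c)) v) u)\<rparr>)"


section \<open>Finite group schemes\<close>

text \<open>
  An affine group scheme \<open>G\<close> is represented by its coordinate algebra \<open>k[G]\<close>, a commutative Hopf
  algebra.
\<close>

record ('c, 'a) hopf = "('c, 'a) module" +
  comult :: "'a \<Rightarrow> ('a, 'a) tens"
  counit :: "'a \<Rightarrow> 'c"
  antipode :: "'a \<Rightarrow> 'a"

locale finite_group_scheme = k?: field k + A?: algebra k G
  for k :: "'c ring" (structure) and G :: "('c, 'a) hopf" (structure) +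
  assumes finite_dim: "finitely_generated k G"
    and comult_hom: "algebra_hom k G (tensor_algebra k G G) (comult G)"
    and counit_hom: "algebra_hom k G (regular k) (counit G)"
    and antipode_linear: "linear_map k G G (antipode G)"
    and coassoc: "a \<in> carrier G \<Longrightarrow>
      tensor_lift (tensor k G (tensor k G G))
        (\<lambda>x y. tensor_lift (tensor k G (tensor k G G))
          (\<lambda>x' x''. pure_tensor k G (tensor k G G) x' (pure_tensor k G G x'' y)) (comult G x))
        (comult G a) =
      tensor_lift (tensor k G (tensor k G G))
        (\<lambda>x y. pure_tensor k G (tensor k G G) x (comult G y)) (comult G a)"
    and counit_left: "a \<in> carrier G \<Longrightarrow>
      tensor_lift G (\<lambda>x y. counit G x \<odot>\<^bsub>G\<^esub> y) (comult G a) = a"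
    and counit_right: "a \<in> carrier G \<Longrightarrow>
      tensor_lift G (\<lambda>x y. counit G y \<odot>\<^bsub>G\<^esub> x) (comult G a) = a"
    and antipode_left: "a \<in> carrier G \<Longrightarrow>
      tensor_lift G (\<lambda>x y. antipode G x \<otimes>\<^bsub>G\<^esub> y) (comult G a) = scalar G (counit G a)"
    and antipode_right: "a \<in> carrier G \<Longrightarrow>
      tensor_lift G (\<lambda>x y. x \<otimes>\<^bsub>G\<^esub> antipode G y) (comult G a) = scalar G (counit G a)"

text \<open>The group algebra \<open>kG = Hom\<^sub>k(k[G], k)\<close>, with the product dual to the comultiplication.\<close>

definition group_algebra :: "'c ring \<Rightarrow> ('c, 'a) hopf \<Rightarrow> ('c, 'a \<Rightarrow> 'c) module" where
  "group_algebra k G =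
     (hom_module k G (regular k) (\<lambda>c f. \<lambda>a\<in>carrier G. c \<otimes>\<^bsub>k\<^esub> f a))
     \<lparr>monoid.mult := (\<lambda>f g. \<lambda>a\<in>carrier G. tensor_lift k (\<lambda>x y. f x \<otimes>\<^bsub>k\<^esub> g y) (comult G a)),
      one := (\<lambda>a\<in>carrier G. counit G a)\<rparr>"

definition mod_G :: "'c ring \<Rightarrow> ('c, 'a) hopf \<Rightarrow> ('a \<Rightarrow> 'c, nat \<Rightarrow> 'c) module set" where
  "mod_G k G = fd_modules k (group_algebra k G)"

text \<open>The group scheme \<open>G\<^sub>K\<close>: the Hopf algebra \<open>K[G] = k[G] \<otimes>\<^sub>k K\<close> over \<open>K\<close>.\<close>

definition ext_scheme :: "'c ring \<Rightarrow> 'd ring \<Rightarrow> ('c \<Rightarrow> 'd) \<Rightarrow> ('c, 'a) hopf \<Rightarrow>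
    ('d, ('a, 'd) tens) hopf" where
  "ext_scheme k K \<iota> G =
     (let A = ext_algebra k K \<iota> G; pt = pure_tensor k G (ext_space K \<iota>) in
     \<lparr>carrier = carrier A, monoid.mult = monoid.mult A, one = one A, ring.zero = ring.zero A,
      add = add A, smult = smult A,
      comult = tensor_lift (tensor K A A) (\<lambda>a c. tensor_lift (tensor K A A)
        (\<lambda>x y. pure_tensor K A A (pt x \<one>\<^bsub>K\<^esub>) (pt y c)) (comult G a)),
      counit = tensor_lift K (\<lambda>a c. \<iota> (counit G a) \<otimes>\<^bsub>K\<^esub> c),
      antipode = tensor_lift A (\<lambda>a c. pt (antipode G a) c)\<rparr>)"

text \<open>The algebra \<open>KG = kG \<otimes>\<^sub>k K\<close>, the map \<open>kG \<rightarrow> KG\<close>, and the canonical identification of \<open>KG\<close>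
  with the \<open>K\<close>-dual of \<open>K[G]\<close>, the group algebra of \<open>G\<^sub>K\<close>.\<close>

definition ext_group_algebra :: "'c ring \<Rightarrow> 'd ring \<Rightarrow> ('c \<Rightarrow> 'd) \<Rightarrow> ('c, 'a) hopf \<Rightarrow>
    ('d, ('a \<Rightarrow> 'c, 'd) tens) module" where
  "ext_group_algebra k K \<iota> G = ext_algebra k K \<iota> (group_algebra k G)"

definition ext_incl :: "'c ring \<Rightarrow> 'd ring \<Rightarrow> ('c \<Rightarrow> 'd) \<Rightarrow> ('c, 'a) hopf \<Rightarrow>
    ('a \<Rightarrow> 'c) \<Rightarrow> ('a \<Rightarrow> 'c, 'd) tens" where
  "ext_incl k K \<iota> G x = pure_tensor k (group_algebra k G) (ext_space K \<iota>) x \<one>\<^bsub>K\<^esub>"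

definition ext_dual :: "'c ring \<Rightarrow> 'd ring \<Rightarrow> ('c \<Rightarrow> 'd) \<Rightarrow> ('c, 'a) hopf \<Rightarrow>
    ('a \<Rightarrow> 'c, 'd) tens \<Rightarrow> ('a, 'd) tens \<Rightarrow> 'd" where
  "ext_dual k K \<iota> G w = (\<lambda>u\<in>carrier (ext_scheme k K \<iota> G).
     tensor_lift K (\<lambda>x c. tensor_lift K (\<lambda>a d. \<iota> (x a) \<otimes>\<^bsub>K\<^esub> (c \<otimes>\<^bsub>K\<^esub> d)) u) w)"

definition hopf_hom :: "'c ring \<Rightarrow> ('c, 'a) hopf \<Rightarrow> ('c, 'b) hopf \<Rightarrow> ('a \<Rightarrow> 'b) \<Rightarrow> bool" where
  "hopf_hom k A B f \<longleftrightarrow> algebra_hom k A B f \<and>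
     (\<forall>a\<in>carrier A. comult B (f a) =
        tensor_lift (tensor k B B) (\<lambda>x y. pure_tensor k B B (f x) (f y)) (comult A a)) \<and>
     (\<forall>a\<in>carrier A. counit B (f a) = counit A a) \<and>
     (\<forall>a\<in>carrier A. antipode B (f a) = f (antipode A a))"

text \<open>A subgroup scheme \<open>H\<close> of \<open>G\<close> is given by a surjective Hopf algebra homomorphism from \<open>k[G]\<close>
  to \<open>k[H]\<close>.\<close>

definition closed_embedding :: "'c ring \<Rightarrow> ('c, 'b) hopf \<Rightarrow> ('c, 'a) hopf \<Rightarrow> ('a \<Rightarrow> 'b) \<Rightarrow> bool" where
  "closed_embedding k H G \<phi> \<longleftrightarrow> finite_group_scheme k H \<and> hopf_hom k G H \<phi> \<and>
     \<phi> ` carrier G = carrier H"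

definition abelian_scheme :: "'c ring \<Rightarrow> ('c, 'a) hopf \<Rightarrow> bool" where
  "abelian_scheme k G \<longleftrightarrow> (\<forall>a\<in>carrier G.
     tensor_lift (tensor k G G) (\<lambda>x y. pure_tensor k G G y x) (comult G a) = comult G a)"

text \<open>Unipotent: every nonzero module has a nonzero fixed vector, where \<open>m\<close> is fixed if every
  \<open>x \<in> kG\<close> acts on it through the augmentation \<open>x \<mapsto> x(1)\<close>.  Finite dimensional modules suffice,
  since every module is the union of its finite dimensional submodules.\<close>

definition unipotent_scheme :: "'c ring \<Rightarrow> ('c, 'a) hopf \<Rightarrow> bool" where
  "unipotent_scheme k G \<longleftrightarrow> (\<forall>M\<in>mod_G k G. carrier M \<noteq> {\<zero>\<^bsub>M\<^esub>} \<longrightarrow>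
     (\<exists>m\<in>carrier M. m \<noteq> \<zero>\<^bsub>M\<^esub> \<and>
       (\<forall>x\<in>carrier (group_algebra k G).
          x \<odot>\<^bsub>M\<^esub> m = scalar (group_algebra k G) (x \<one>\<^bsub>G\<^esub>) \<odot>\<^bsub>M\<^esub> m)))"


section \<open>Pi-points\<close>

text \<open>The \<open>K\<close>-algebra \<open>K[t]/(t^p)\<close>.\<close>

definition trunc_ring :: "'d ring \<Rightarrow> nat \<Rightarrow> (nat \<Rightarrow> 'd) set ring" where
  "trunc_ring K p = UP K Quot (PIdl\<^bsub>UP K\<^esub> (UnivPoly.monom (UP K) \<one>\<^bsub>K\<^esub> p))"

definition trunc_algebra :: "'d ring \<Rightarrow> nat \<Rightarrow> ('d, (nat \<Rightarrow> 'd) set) module" where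
  "trunc_algebra K p = (let R = trunc_ring K p in
     \<lparr>carrier = carrier R, monoid.mult = monoid.mult R, one = one R, ring.zero = ring.zero R, add = add R,
      smult = (\<lambda>c u. (PIdl\<^bsub>UP K\<^esub> (UnivPoly.monom (UP K) \<one>\<^bsub>K\<^esub> p)
        +>\<^bsub>UP K\<^esub> UnivPoly.monom (UP K) c 0) \<otimes>\<^bsub>R\<^esub> u)\<rparr>)"

text \<open>The trivial \<open>K[t]/(t^p)\<close>-module \<open>K\<close>: the class of a polynomial acts by its constant
  coefficient (for \<open>p > 0\<close>).\<close>

definition trunc_trivial :: "'d ring \<Rightarrow> nat \<Rightarrow> ((nat \<Rightarrow> 'd) set, 'd) module" where
  "trunc_trivial K p = restr (\<lambda>u. the_elem ((\<lambda>q. UnivPoly.coeff (UP K) q 0) ` u)) (regular K)"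

definition factors_unipotent_abelian :: "'c ring \<Rightarrow> ('c, 'a) hopf \<Rightarrow> nat \<Rightarrow> 'd ring \<Rightarrow> ('c \<Rightarrow> 'd) \<Rightarrow>
    ((nat \<Rightarrow> 'd) set \<Rightarrow> ('a \<Rightarrow> 'c, 'd) tens) \<Rightarrow> bool" where
  "factors_unipotent_abelian k G p K \<iota> \<alpha> \<longleftrightarrow>
     (\<exists>(H :: ('d, ('a, 'd) tens) hopf) \<phi> \<gamma>.
        closed_embedding K H (ext_scheme k K \<iota> G) \<phi> \<and>
        unipotent_scheme K H \<and> abelian_scheme K H \<and>
        algebra_hom K (trunc_algebra K p) (group_algebra K H) \<gamma> \<and>
        (\<forall>r\<in>carrier (trunc_algebra K p). ext_dual k K \<iota> G (\<alpha> r) =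
           (\<lambda>u\<in>carrier (ext_scheme k K \<iota> G). \<gamma> r (\<phi> u))))"

definition pi_point :: "'c ring \<Rightarrow> ('c, 'a) hopf \<Rightarrow> nat \<Rightarrow> 'd ring \<Rightarrow> ('c \<Rightarrow> 'd) \<Rightarrow>
    ((nat \<Rightarrow> 'd) set \<Rightarrow> ('a \<Rightarrow> 'c, 'd) tens) \<Rightarrow> bool" where
  "pi_point k G p K \<iota> \<alpha> \<longleftrightarrow> field K \<and> \<iota> \<in> ring_hom k K \<and>
     algebra_hom K (trunc_algebra K p) (ext_group_algebra k K \<iota> G) \<alpha> \<and>
     flat_module (trunc_ring K p) (restr \<alpha> (regular (ext_group_algebra k K \<iota> G))) \<and>
     factors_unipotent_abelian k G p K \<iota> \<alpha>"

definition Thick :: "'c ring \<Rightarrow> ('c, 'a) hopf \<Rightarrow> nat \<Rightarrow> 'd ring \<Rightarrow> ('c \<Rightarrow> 'd) \<Rightarrow>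
    ((nat \<Rightarrow> 'd) set \<Rightarrow> ('a \<Rightarrow> 'c, 'd) tens) \<Rightarrow> ('a \<Rightarrow> 'c, nat \<Rightarrow> 'c) module set" where
  "Thick k G p K \<iota> \<alpha> = {M \<in> mod_G k G.
     projective_module (trunc_ring K p) (restr \<alpha> (ext_module k K \<iota> (group_algebra k G) M))}"

definition pi_equivalent :: "'c ring \<Rightarrow> ('c, 'a) hopf \<Rightarrow> nat \<Rightarrow>
    'd ring \<Rightarrow> ('c \<Rightarrow> 'd) \<Rightarrow> ((nat \<Rightarrow> 'd) set \<Rightarrow> ('a \<Rightarrow> 'c, 'd) tens) \<Rightarrow>
    'e ring \<Rightarrow> ('c \<Rightarrow> 'e) \<Rightarrow> ((nat \<Rightarrow> 'e) set \<Rightarrow> ('a \<Rightarrow> 'c, 'e) tens) \<Rightarrow> bool" where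
  "pi_equivalent k G p K \<iota> \<alpha> L \<kappa> \<beta> \<longleftrightarrow> Thick k G p K \<iota> \<alpha> = Thick k G p L \<kappa> \<beta>"

definition point_module :: "'c ring \<Rightarrow> ('c, 'a) hopf \<Rightarrow> nat \<Rightarrow> 'd ring \<Rightarrow> ('c \<Rightarrow> 'd) \<Rightarrow>
    ((nat \<Rightarrow> 'd) set \<Rightarrow> ('a \<Rightarrow> 'c, 'd) tens) \<Rightarrow> ('a \<Rightarrow> 'c, ('a \<Rightarrow> 'c, 'd) tens \<Rightarrow> 'd) module" where
  "point_module k G p K \<iota> \<alpha> = restr (ext_incl k K \<iota> G)
     (coinduced (trunc_ring K p) (ext_group_algebra k K \<iota> G) \<alpha> (trunc_trivial K p))"


section \<open>Subadditive functions\<close>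

text \<open>\<open>\<chi>\<^sub>M(V)\<close> is the length of \<open>Hom\<^sub>G(V, M)\<close> over \<open>End\<^sub>G(M)\<close>, which acts by composition.  The length is
  finite when \<open>M\<close> is endofinite.\<close>

definition chi :: "'c ring \<Rightarrow> ('c, 'a) hopf \<Rightarrow> ('a \<Rightarrow> 'c, 'm) module \<Rightarrow>
    ('a \<Rightarrow> 'c, nat \<Rightarrow> 'c) module \<Rightarrow> nat" where
  "chi k G M V = composition_length (end_ring (group_algebra k G) M)
     (hom_module (group_algebra k G) V M (\<lambda>e f. compose (carrier V) e f))"

definition Adloc :: "'c ring \<Rightarrow> ('c, 'a) hopf \<Rightarrow> (('a \<Rightarrow> 'c, nat \<Rightarrow> 'c) module \<Rightarrow> nat) \<Rightarrow>
    ('a \<Rightarrow> 'c, nat \<Rightarrow> 'c) module set" where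
  "Adloc k G \<chi> = {W \<in> mod_G k G. \<forall>U\<in>mod_G k G. \<forall>V\<in>mod_G k G. \<forall>f g.
     short_exact (group_algebra k G) U V W f g \<longrightarrow> int (\<chi> U) - int (\<chi> V) + int (\<chi> W) = 0}"

definition subadditive_equivalent :: "'c ring \<Rightarrow> ('c, 'a) hopf \<Rightarrow>
    (('a \<Rightarrow> 'c, nat \<Rightarrow> 'c) module \<Rightarrow> nat) \<Rightarrow> (('a \<Rightarrow> 'c, nat \<Rightarrow> 'c) module \<Rightarrow> nat) \<Rightarrow> bool" where
  "subadditive_equivalent k G \<chi> \<chi>' \<longleftrightarrow> Adloc k G \<chi> = Adloc k G \<chi>'"

definition has_char :: "('c, 'x) ring_scheme \<Rightarrow> nat \<Rightarrow> bool" where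
  "has_char k p \<longleftrightarrow> (\<forall>n::nat. [n] \<cdot>\<^bsub>k\<^esub> \<one>\<^bsub>k\<^esub> = \<zero>\<^bsub>k\<^esub> \<longleftrightarrow> p dvd n)"

end

theory Submission
  imports Defs
begin

text \<open>
  For each \<open>\<pi>\<close>-point \<open>\<alpha>\<close> the additive locus of \<open>\<chi>\<close> of the point module \<open>\<Delta>\<close> equals \<open>Thick(\<alpha>)\<close>.
  By left exactness of \<open>Hom(-, \<Delta>)\<close> and additivity of the length, \<open>\<chi>\<close> is additive on
  \<open>0 \<rightarrow> U \<rightarrow> V \<rightarrow> W \<rightarrow> 0\<close> iff every homomorphism \<open>U \<rightarrow> \<Delta>\<close> extends to \<open>V\<close>; lengths are finite because
  \<open>K\<close> acts on \<open>\<Delta>\<close> by endomorphisms.  By adjunction this says that every homomorphism from \<open>U\<^sub>K\<close> to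
  the trivial module \<open>K\<close> over \<open>K[t]/(t^p)\<close> extends to \<open>V\<^sub>K\<close>, which holds if \<open>W\<^sub>K\<close> is projective.
  Conversely, take for \<open>V\<close> a free cover of \<open>W\<close>.  As \<open>\<alpha>\<close> is flat, the kernel of \<open>t\<close> on \<open>V\<^sub>K\<close> is
  \<open>t^(p-1) V\<^sub>K\<close>, and the extension property forces the kernel of \<open>t^(p-1)\<close> on \<open>W\<^sub>K\<close> to lie in
  \<open>t W\<^sub>K\<close>; then a minimal system of generators of \<open>W\<^sub>K\<close> is a basis.
\<close>

section \<open>Tensor products\<close>

text \<open>The field K may be infinite over k, so \<Delta> need not be finite dimensional over k,
  and its endomorphism ring is never computed. It enters in two ways only. Its submodules of Hom(X,
  \<Delta>) are K-subspaces of some K^n, which bounds chains. And the alternating sum of the three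
  lengths is the length of the cokernel of Hom(V, \<Delta>) \<rightarrow> Hom(U, \<Delta>), which is
  zero exactly when that cokernel is. Additivity thus turns into an extension property that mentions
  no endomorphisms, and the fields K and L are never compared with each other.

  A second constraint is that projectivity, flatness and mod G quantify over modules on fixed types.
  Finitely generated modules are therefore moved along injections of their carriers, kernels are
  kept as smaller carriers of the same record, and quotient modules are replaced by arguments modulo
  a submodule.\<close>

definition additive_map :: "('m, 'x) ring_scheme \<Rightarrow> ('n, 'y) ring_scheme \<Rightarrow> ('m \<Rightarrow> 'n) \<Rightarrow> bool" where
  "additive_map M N f \<longleftrightarrow> f \<in> carrier M \<rightarrow> carrier N \<and>
     (\<forall>x\<in>carrier M. \<forall>y\<in>carrier M. f (x \<oplus>\<^bsub>M\<^esub> y) = f x \<oplus>\<^bsub>N\<^esub> f y)"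

lemma additive_mapD:
  assumes "additive_map M N f"
  shows "x \<in> carrier M \<Longrightarrow> f x \<in> carrier N"
    and "x \<in> carrier M \<Longrightarrow> y \<in> carrier M \<Longrightarrow> f (x \<oplus>\<^bsub>M\<^esub> y) = f x \<oplus>\<^bsub>N\<^esub> f y"
  using assms by (auto simp: additive_map_def)

lemma additive_map_group_hom:
  assumes "abelian_group M" "abelian_group N" "additive_map M N f"
  shows "group_hom (add_monoid M) (add_monoid N) f"
  using assms by (auto simp: group_hom_def group_hom_axioms_def abelian_group.a_group hom_def additive_map_def)

lemma additive_map_zero:
  assumes "abelian_group M" "abelian_group N" "additive_map M N f"
  shows "f \<zero>\<^bsub>M\<^esub> = \<zero>\<^bsub>N\<^esub>"
  using group_hom.hom_one[OF additive_map_group_hom[OF assms]] by simp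

lemma additive_map_minus:
  assumes "abelian_group M" "abelian_group N" "additive_map M N f" "x \<in> carrier M"
  shows "f (\<ominus>\<^bsub>M\<^esub> x) = \<ominus>\<^bsub>N\<^esub> f x"
  using group_hom.hom_inv[OF additive_map_group_hom[OF assms(1-3)], of x] assms(4)
  by (simp add: a_inv_def)

lemma additive_map_diff:
  assumes "abelian_group M" "abelian_group N" "additive_map M N f" "x \<in> carrier M" "y \<in> carrier M"
  shows "f (x \<ominus>\<^bsub>M\<^esub> y) = f x \<ominus>\<^bsub>N\<^esub> f y"
  using assms by (simp add: a_minus_def additive_mapD additive_map_minus[OF assms(1-3)] abelian_group.a_inv_closed)

lemma additive_map_add:
  assumes "abelian_group N" "abelian_group P" "additive_map N P f" "additive_map N P g"
  shows "additive_map N P (\<lambda>x. f x \<oplus>\<^bsub>P\<^esub> g x)"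
proof -
  interpret P: abelian_group P by fact
  show ?thesis using assms(3,4) by (auto simp: additive_map_def P.a_ac Pi_iff)
qed

lemma additive_map_finsum:
  assumes "abelian_group M" "abelian_group N" "additive_map M N f" "finite A" "g \<in> A \<rightarrow> carrier M"
  shows "f (\<Oplus>\<^bsub>M\<^esub>i\<in>A. g i) = (\<Oplus>\<^bsub>N\<^esub>i\<in>A. f (g i))"
proof -
  interpret M: abelian_group M by fact
  interpret N: abelian_group N by fact
  show ?thesis using assms(4,5)
  proof (induction A)
    case empty
    then show ?case using additive_map_zero[OF assms(1-3)] by simp
  next
    case (insert a A)
    then have "g \<in> A \<rightarrow> carrier M" "g a \<in> carrier M" by auto
    moreover have "(\<lambda>i. f (g i)) \<in> A \<rightarrow> carrier N" "f (g a) \<in> carrier N"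
      using calculation additive_mapD[OF assms(3)] by auto
    ultimately show ?case using insert additive_mapD[OF assms(3)]
      by simp
  qed
qed

text \<open>These are the conditions whose defects are listed in \<open>tensor_relations\<close>.
  The target is a bare abelian group, so one notion serves for maps into k, into K and into another
  tensor product.\<close>

definition balanced_map :: "('r, 'x) ring_scheme \<Rightarrow> ('r, 'm, 'y) module_scheme \<Rightarrow>
    ('r, 'n, 'z) module_scheme \<Rightarrow> ('p, 'w) ring_scheme \<Rightarrow> ('m \<Rightarrow> 'n \<Rightarrow> 'p) \<Rightarrow> bool" where
  "balanced_map R M N P f \<longleftrightarrow>
     (\<forall>x\<in>carrier M. \<forall>y\<in>carrier N. f x y \<in> carrier P) \<and>
     (\<forall>x\<in>carrier M. \<forall>x'\<in>carrier M. \<forall>y\<in>carrier N. f (x \<oplus>\<^bsub>M\<^esub> x') y = f x y \<oplus>\<^bsub>P\<^esub> f x' y) \<and>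
     (\<forall>x\<in>carrier M. \<forall>y\<in>carrier N. \<forall>y'\<in>carrier N. f x (y \<oplus>\<^bsub>N\<^esub> y') = f x y \<oplus>\<^bsub>P\<^esub> f x y') \<and>
     (\<forall>r\<in>carrier R. \<forall>x\<in>carrier M. \<forall>y\<in>carrier N. f (r \<odot>\<^bsub>M\<^esub> x) y = f x (r \<odot>\<^bsub>N\<^esub> y))"

text \<open>The sum inside \<open>tensor_lift\<close>, isolated because it is a homomorphism on the
  free abelian group before any passage to cosets.\<close>

definition frag_eval :: "('p, 'w) ring_scheme \<Rightarrow> ('z \<Rightarrow> 'p) \<Rightarrow> ('z \<Rightarrow>\<^sub>0 int) \<Rightarrow> 'p" where
  "frag_eval P g u = (\<Oplus>\<^bsub>P\<^esub>z\<in>Poly_Mapping.keys u. [Poly_Mapping.lookup u z] \<cdot>\<^bsub>P\<^esub> g z)"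

section \<open>Evaluation homomorphisms on free abelian groups\<close>

lemma (in abelian_group) int_mult_zero: "add_pow G (0::int) x = \<zero>"
  by (simp add: add_pow_def int_pow_def2)

text \<open>Coefficients can cancel in a sum, so u, v and u + v have different keys; padding with
  zero coefficients over one finite set makes the three sums comparable.\<close>

lemma frag_eval_superset:
  assumes "abelian_group P" "finite S" "Poly_Mapping.keys u \<subseteq> S" "\<And>z. z \<in> S \<Longrightarrow> g z \<in> carrier P"
  shows "frag_eval P g u = (\<Oplus>\<^bsub>P\<^esub>z\<in>S. [Poly_Mapping.lookup u z] \<cdot>\<^bsub>P\<^esub> g z)"
proof -
  interpret P: abelian_group P by fact
  show ?thesis unfolding frag_eval_def
    by (rule P.add.finprod_mono_neutral_cong_left)
       (use assms in \<open>auto simp: in_keys_iff P.int_mult_zero intro!: P.add.int_pow_closed\<close>)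
qed

lemma frag_eval_closed:
  assumes "abelian_group P" "\<And>z. z \<in> S \<Longrightarrow> g z \<in> carrier P" "Poly_Mapping.keys u \<subseteq> S"
  shows "frag_eval P g u \<in> carrier P"
proof -
  interpret P: abelian_group P by fact
  show ?thesis unfolding frag_eval_def using assms
    by (intro P.finsum_closed) (auto intro!: P.add.int_pow_closed)
qed

lemma frag_eval_add:
  assumes "abelian_group P" "\<And>z. z \<in> S \<Longrightarrow> g z \<in> carrier P"
    "Poly_Mapping.keys u \<subseteq> S" "Poly_Mapping.keys v \<subseteq> S"
  shows "frag_eval P g (u + v) = frag_eval P g u \<oplus>\<^bsub>P\<^esub> frag_eval P g v"
proof -
  interpret P: abelian_group P by fact
  let ?T = "Poly_Mapping.keys u \<union> Poly_Mapping.keys v"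
  have T: "g z \<in> carrier P" if "z \<in> ?T" for z using that assms by auto
  have "frag_eval P g (u + v) = (\<Oplus>\<^bsub>P\<^esub>z\<in>?T. [Poly_Mapping.lookup (u + v) z] \<cdot>\<^bsub>P\<^esub> g z)"
    by (rule frag_eval_superset[OF assms(1)]) (use T keys_add[of u v] in auto)
  also have "\<dots> = (\<Oplus>\<^bsub>P\<^esub>z\<in>?T. [Poly_Mapping.lookup u z] \<cdot>\<^bsub>P\<^esub> g z \<oplus>\<^bsub>P\<^esub> [Poly_Mapping.lookup v z] \<cdot>\<^bsub>P\<^esub> g z)"
    by (rule P.finsum_cong') (use T in \<open>auto simp: lookup_add P.add.int_pow_mult intro!: P.a_closed P.add.int_pow_closed\<close>)
  also have "\<dots> = frag_eval P g u \<oplus>\<^bsub>P\<^esub> frag_eval P g v"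
    using T frag_eval_superset[OF assms(1), of ?T u g] frag_eval_superset[OF assms(1), of ?T v g]
    by (subst P.finsum_addf) (auto intro!: P.add.int_pow_closed)
  finally show ?thesis .
qed

lemma frag_eval_frag_of:
  assumes "abelian_group P" "g z \<in> carrier P"
  shows "frag_eval P g (frag_of z) = g z"
proof -
  interpret P: abelian_group P by fact
  show ?thesis using assms(2) by (simp add: frag_eval_def add_pow_def int_pow_def2)
qed

lemma frag_eval_hom:
  assumes "abelian_group P" "\<And>z. z \<in> S \<Longrightarrow> g z \<in> carrier P"
  shows "group_hom (free_Abelian_group S) (add_monoid P) (frag_eval P g)"
  using assms frag_eval_closed[OF assms] frag_eval_add[OF assms]
  by (auto simp: group_hom_def group_hom_axioms_def hom_def abelian_group.a_group)

lemma frag_eval_diff: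
  assumes "abelian_group P" "\<And>z. z \<in> S \<Longrightarrow> g z \<in> carrier P"
    "Poly_Mapping.keys u \<subseteq> S" "Poly_Mapping.keys v \<subseteq> S"
  shows "frag_eval P g (u - v) = frag_eval P g u \<ominus>\<^bsub>P\<^esub> frag_eval P g v"
proof -
  have "frag_eval P g (- v) = \<ominus>\<^bsub>P\<^esub> frag_eval P g v"
    using group_hom.hom_inv[OF frag_eval_hom[of P S g], of v] assms by (simp add: a_inv_def)
  then show ?thesis
    using frag_eval_add[of P S g u "- v"] assms by (simp add: a_minus_def)
qed

lemma tensor_simps:
  "carrier (tensor R M N) = carrier (tensor_group R M N)"
  "add (tensor R M N) = monoid.mult (tensor_group R M N)"
  "ring.zero (tensor R M N) = one (tensor_group R M N)"
  by (simp_all add: tensor_def Let_def tensor_ab_def)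

text \<open>\<open>tensor_lift\<close> reads only the additive fields of its target, while the
  definitions apply it to records that differ in product, unit or scalar action.\<close>

lemma tensor_lift_cong:
  fixes P P' :: "('p, 'w) ring_scheme" and f :: "'m \<Rightarrow> 'n \<Rightarrow> 'p"
  assumes "carrier P = carrier P'" "add P = add P'" "ring.zero P = ring.zero P'"
  shows "tensor_lift P f u = tensor_lift P' f u"
proof -
  have "finsum P g A = finsum P' g A" for g :: "'m \<times> 'n \<Rightarrow> 'p" and A
    by (simp only: finsum_def assms)
  moreover have "add_pow P (n :: int) x = add_pow P' n x" for n x
    by (simp only: add_pow_def assms)
  ultimately show ?thesis by (simp only: tensor_lift_def)
qed

lemma (in abelian_group) eq_of_diff_zero:
  assumes "a \<in> carrier G" "b \<in> carrier G" "a \<ominus> b = \<zero>"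
  shows "a = b"
proof -
  have "a = (a \<ominus> b) \<oplus> b" using assms(1,2) by (simp add: a_minus_def a_assoc l_neg)
  then show ?thesis using assms by simp
qed

text \<open>The form in which the vanishing coset of a relation from \<open>tensor_relations\<close>
  yields additivity.\<close>

lemma (in abelian_group) eq_add_of_diff_diff:
  assumes "a \<in> carrier G" "b \<in> carrier G" "c \<in> carrier G" "a \<ominus> b \<ominus> c = \<zero>"
  shows "a = b \<oplus> c"
proof -
  have "a = a \<ominus> b \<ominus> c \<oplus> (b \<oplus> c)"
    using assms(1-3) by (simp add: a_minus_def a_assoc a_lcomm[of "\<ominus> c"] l_neg r_neg2)
  then show ?thesis using assms by simp
qed

section \<open>The tensor product and its universal property\<close>

locale tensor_product = M?: module R M + N?: module R N for R M N
begin

abbreviation "FMN \<equiv> free_Abelian_group (carrier M \<times> carrier N)"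
abbreviation "T \<equiv> tensor R M N"
abbreviation "pt \<equiv> pure_tensor R M N"

lemma relations_subset: "tensor_relations R M N \<subseteq> carrier FMN"
proof -
  have *: "a \<in> carrier FMN \<Longrightarrow> b \<in> carrier FMN \<Longrightarrow> a - b \<in> carrier FMN" for a b
    using keys_diff[of a b] by auto
  show ?thesis unfolding tensor_relations_def
    by (auto simp del: carrier_free_Abelian_group_iff intro!: * simp: frag_of_in_free_Abelian_group)
qed

lemma subgroup_normal: "tensor_subgroup R M N \<lhd> FMN"
proof -
  interpret F: comm_group FMN by (rule abelian_free_Abelian_group)
  show ?thesis unfolding tensor_subgroup_def
    by (intro F.normal_iff_subgroup[THEN iffD2] F.generate_is_subgroup relations_subset)
qed

lemma tensor_abelian_group: "abelian_group T"
proof -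
  interpret F: comm_group FMN by (rule abelian_free_Abelian_group)
  interpret Q: normal "tensor_subgroup R M N" FMN by (rule subgroup_normal)
  have "comm_group (tensor_group R M N)"
    unfolding tensor_group_def by (rule F.abelian_FactGroup) (rule Q.subgroup_axioms)
  then interpret C: comm_group "tensor_group R M N" .
  show ?thesis
    by (rule abelian_groupI) (simp_all add: tensor_simps C.m_assoc C.l_inv_ex, rule C.m_comm)
qed

lemma abelian_groups: "abelian_group M" "abelian_group N" "abelian_group T"
  using M.module_axioms N.module_axioms tensor_abelian_group by (auto dest: module.axioms)

sublocale T: abelian_group T by (rule tensor_abelian_group)

lemma coset_hom: "group_hom FMN (add_monoid T) (\<lambda>u. tensor_subgroup R M N #>\<^bsub>FMN\<^esub> u)"
proof -
  interpret Q: normal "tensor_subgroup R M N" FMN by (rule subgroup_normal)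
  show ?thesis
    using Q.r_coset_hom_Mod T.a_group
    by (auto simp: group_hom_def group_hom_axioms_def tensor_simps tensor_group_def hom_def)
qed

lemma pure_tensor_closed: "x \<in> carrier M \<Longrightarrow> y \<in> carrier N \<Longrightarrow> pt x y \<in> carrier T"
  using group_hom.hom_closed[OF coset_hom, of "frag_of (x, y)"]
  by (simp add: pure_tensor_def)

lemma coset_diff:
  assumes "u \<in> carrier FMN" "v \<in> carrier FMN"
  shows "tensor_subgroup R M N #>\<^bsub>FMN\<^esub> (u - v) =
    (tensor_subgroup R M N #>\<^bsub>FMN\<^esub> u) \<ominus>\<^bsub>T\<^esub> (tensor_subgroup R M N #>\<^bsub>FMN\<^esub> v)"
proof -
  interpret h: group_hom FMN "add_monoid T" "\<lambda>u. tensor_subgroup R M N #>\<^bsub>FMN\<^esub> u" by (rule coset_hom)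
  show ?thesis
    using h.hom_mult[of u "-v"] h.hom_inv[of v] assms by (simp add: a_minus_def a_inv_def)
qed

lemma coset_relation:
  assumes "u \<in> tensor_relations R M N"
  shows "tensor_subgroup R M N #>\<^bsub>FMN\<^esub> u = \<zero>\<^bsub>T\<^esub>"
proof -
  interpret Q: normal "tensor_subgroup R M N" FMN by (rule subgroup_normal)
  have "u \<in> tensor_subgroup R M N" unfolding tensor_subgroup_def by (rule generate.incl[OF assms])
  then show ?thesis
    by (simp add: tensor_simps tensor_group_def FactGroup_def Q.rcos_const)
qed

lemma pure_tensor_add_left:
  assumes "x \<in> carrier M" "x' \<in> carrier M" "y \<in> carrier N"
  shows "pt (x \<oplus>\<^bsub>M\<^esub> x') y = pt x y \<oplus>\<^bsub>T\<^esub> pt x' y"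
proof -
  let ?a = "frag_of (x \<oplus>\<^bsub>M\<^esub> x', y)" and ?b = "frag_of (x, y)" and ?c = "frag_of (x', y)"
  have c: "?a \<in> carrier FMN" "?b \<in> carrier FMN" "?c \<in> carrier FMN" "?a - ?b \<in> carrier FMN"
    using assms keys_diff[of ?a ?b] by auto
  have "?a - ?b - ?c \<in> tensor_relations R M N"
    unfolding tensor_relations_def using assms by auto
  from coset_relation[OF this] have "pt (x \<oplus>\<^bsub>M\<^esub> x') y \<ominus>\<^bsub>T\<^esub> pt x y \<ominus>\<^bsub>T\<^esub> pt x' y = \<zero>\<^bsub>T\<^esub>"
    by (simp only: coset_diff c pure_tensor_def)
  then show ?thesis
    using assms pure_tensor_closed[of "x \<oplus>\<^bsub>M\<^esub> x'" y] pure_tensor_closed[of x y] pure_tensor_closed[of x' y]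
    by (rule_tac T.eq_add_of_diff_diff) simp_all
qed

lemma pure_tensor_add_right:
  assumes "x \<in> carrier M" "y \<in> carrier N" "y' \<in> carrier N"
  shows "pt x (y \<oplus>\<^bsub>N\<^esub> y') = pt x y \<oplus>\<^bsub>T\<^esub> pt x y'"
proof -
  let ?a = "frag_of (x, y \<oplus>\<^bsub>N\<^esub> y')" and ?b = "frag_of (x, y)" and ?c = "frag_of (x, y')"
  have c: "?a \<in> carrier FMN" "?b \<in> carrier FMN" "?c \<in> carrier FMN" "?a - ?b \<in> carrier FMN"
    using assms keys_diff[of ?a ?b] by auto
  have "?a - ?b - ?c \<in> tensor_relations R M N"
    unfolding tensor_relations_def using assms by auto
  from coset_relation[OF this] have "pt x (y \<oplus>\<^bsub>N\<^esub> y') \<ominus>\<^bsub>T\<^esub> pt x y \<ominus>\<^bsub>T\<^esub> pt x y' = \<zero>\<^bsub>T\<^esub>"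
    by (simp only: coset_diff c pure_tensor_def)
  then show ?thesis
    using assms pure_tensor_closed[of x "y \<oplus>\<^bsub>N\<^esub> y'"] pure_tensor_closed[of x y] pure_tensor_closed[of x y']
    by (rule_tac T.eq_add_of_diff_diff) simp_all
qed

lemma pure_tensor_smult:
  assumes "r \<in> carrier R" "x \<in> carrier M" "y \<in> carrier N"
  shows "pt (r \<odot>\<^bsub>M\<^esub> x) y = pt x (r \<odot>\<^bsub>N\<^esub> y)"
proof -
  let ?a = "frag_of (r \<odot>\<^bsub>M\<^esub> x, y)" and ?b = "frag_of (x, r \<odot>\<^bsub>N\<^esub> y)"
  have c: "?a \<in> carrier FMN" "?b \<in> carrier FMN"
    using assms by auto
  have "?a - ?b \<in> tensor_relations R M N"
    unfolding tensor_relations_def using assms by auto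
  from coset_relation[OF this] have "pt (r \<odot>\<^bsub>M\<^esub> x) y \<ominus>\<^bsub>T\<^esub> pt x (r \<odot>\<^bsub>N\<^esub> y) = \<zero>\<^bsub>T\<^esub>"
    by (simp only: coset_diff c pure_tensor_def)
  moreover have "pt (r \<odot>\<^bsub>M\<^esub> x) y \<in> carrier T" "pt x (r \<odot>\<^bsub>N\<^esub> y) \<in> carrier T"
    using assms by (simp_all only: pure_tensor_closed M.smult_closed N.smult_closed)
  ultimately show ?thesis by (metis T.eq_of_diff_zero)
qed

lemma pure_tensor_zero_left: "y \<in> carrier N \<Longrightarrow> pt \<zero>\<^bsub>M\<^esub> y = \<zero>\<^bsub>T\<^esub>"
  using additive_map_zero[of M T "\<lambda>x. pt x y"]
  by (simp add: additive_map_def pure_tensor_closed pure_tensor_add_left abelian_groups)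

lemma pure_tensor_minus_left: "x \<in> carrier M \<Longrightarrow> y \<in> carrier N \<Longrightarrow> pt (\<ominus>\<^bsub>M\<^esub> x) y = \<ominus>\<^bsub>T\<^esub> pt x y"
  using additive_map_minus[of M T "\<lambda>x. pt x y"]
  by (simp add: additive_map_def pure_tensor_closed pure_tensor_add_left abelian_groups)

lemma tensor_cases:
  assumes "w \<in> carrier T"
  obtains u where "u \<in> carrier FMN" "w = tensor_subgroup R M N #>\<^bsub>FMN\<^esub> u"
  using assms by (auto simp: tensor_simps tensor_group_def FactGroup_def RCOSETS_def)

text \<open>Negatives of pure tensors are pure, since -(x \<otimes> y) = (-x) \<otimes> y; hence
  closure under sums reaches every element.\<close>

lemma tensor_induct [consumes 1, case_names pure add]:
  assumes "w \<in> carrier T"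
    and pure: "\<And>x y. x \<in> carrier M \<Longrightarrow> y \<in> carrier N \<Longrightarrow> Q (pt x y)"
    and add: "\<And>v w. v \<in> carrier T \<Longrightarrow> w \<in> carrier T \<Longrightarrow> Q v \<Longrightarrow> Q w \<Longrightarrow> Q (v \<oplus>\<^bsub>T\<^esub> w)"
  shows "Q w"
proof -
  interpret h: group_hom FMN "add_monoid T" "\<lambda>u. tensor_subgroup R M N #>\<^bsub>FMN\<^esub> u" by (rule coset_hom)
  let ?c = "\<lambda>u. tensor_subgroup R M N #>\<^bsub>FMN\<^esub> u"
  obtain u where u: "u \<in> carrier FMN" "w = ?c u" using tensor_cases[OF assms(1)] .
  have "Poly_Mapping.keys u \<subseteq> carrier M \<times> carrier N" using u by simp
  \<comment> \<open>\<open>frag_induction\<close> builds elements by differences, so the claim is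
    carried for a coset and for its negative together.\<close>
  then have "?c u \<in> carrier T \<and> u \<in> carrier FMN \<and> Q (?c u) \<and> Q (\<ominus>\<^bsub>T\<^esub> ?c u)"
  proof (induction u rule: frag_induction)
    case zero
    have "Q \<zero>\<^bsub>T\<^esub>"
      using pure[of "\<zero>\<^bsub>M\<^esub>" "\<zero>\<^bsub>N\<^esub>"] by (simp add: pure_tensor_zero_left)
    moreover have "Q (\<ominus>\<^bsub>T\<^esub> \<zero>\<^bsub>T\<^esub>)"
      by (subst T.minus_equality[of "\<zero>\<^bsub>T\<^esub>" "\<zero>\<^bsub>T\<^esub>"]) (use \<open>Q \<zero>\<^bsub>T\<^esub>\<close> in simp_all)
    moreover have "?c 0 = \<zero>\<^bsub>T\<^esub>" using h.hom_one by simp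
    ultimately show ?case by simp
  next
    case (one z)
    then obtain x y where z: "z = (x, y)" "x \<in> carrier M" "y \<in> carrier N" by auto
    have "Q (\<ominus>\<^bsub>T\<^esub> pt x y)"
      using pure[of "\<ominus>\<^bsub>M\<^esub> x" y] z by (simp add: pure_tensor_minus_left)
    with pure[of x y] pure_tensor_closed[of x y] z show ?case by (simp add: pure_tensor_def)
  next
    case (diff a b)
    have "\<ominus>\<^bsub>T\<^esub> (?c a \<ominus>\<^bsub>T\<^esub> ?c b) = \<ominus>\<^bsub>T\<^esub> ?c a \<oplus>\<^bsub>T\<^esub> ?c b"
      using diff by (simp add: T.minus_add a_minus_def)
    moreover have "a - b \<in> carrier FMN" using diff keys_diff[of a b] by auto
    ultimately show ?case
      using diff add[of "?c a" "\<ominus>\<^bsub>T\<^esub> ?c b"] add[of "\<ominus>\<^bsub>T\<^esub> ?c a" "?c b"]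
      by (simp add: coset_diff a_minus_def del: carrier_free_Abelian_group_iff)
  qed
  then show ?thesis using u by simp
qed

lemma additive_map_tensor_eqI:
  assumes "additive_map T P f" "additive_map T P g" "w \<in> carrier T"
    and "\<And>x y. x \<in> carrier M \<Longrightarrow> y \<in> carrier N \<Longrightarrow> f (pt x y) = g (pt x y)"
  shows "f w = g w"
  using assms(3)
proof (induction rule: tensor_induct)
  case (pure x y)
  then show ?case by (rule assms(4))
next
  case (add v w)
  then show ?case using assms(1,2) by (simp add: additive_mapD)
qed

context
  fixes P f
  assumes P: "abelian_group P" and f: "balanced_map R M N P f"
begin

lemma balanced_in: "z \<in> carrier M \<times> carrier N \<Longrightarrow> f (fst z) (snd z) \<in> carrier P"
  using f by (auto simp: balanced_map_def)

lemma frag_eval_relation: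
  assumes "u \<in> tensor_relations R M N"
  shows "frag_eval P (\<lambda>z. f (fst z) (snd z)) u = \<zero>\<^bsub>P\<^esub>"
proof -
  interpret P: abelian_group P by (rule P)
  let ?F = "frag_eval P (\<lambda>z. f (fst z) (snd z))"
  have d: "?F (u - v) = ?F u \<ominus>\<^bsub>P\<^esub> ?F v" if "u \<in> carrier FMN" "v \<in> carrier FMN" for u v
    using frag_eval_diff[of P "carrier M \<times> carrier N" "\<lambda>z. f (fst z) (snd z)" u v] P balanced_in that by simp
  have o: "?F (frag_of (x, y)) = f x y" "frag_of (x, y) \<in> carrier FMN" "f x y \<in> carrier P"
    if "x \<in> carrier M" "y \<in> carrier N" for x y
    using that frag_eval_frag_of[of P "\<lambda>z. f (fst z) (snd z)" "(x, y)"] P balanced_in[of "(x, y)"] balanced_in[of "(x,y)"] by auto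
  have dd: "u - v \<in> carrier FMN" if "u \<in> carrier FMN" "v \<in> carrier FMN" for u v
    using keys_diff[of u v] that by auto
  have z: "a \<oplus>\<^bsub>P\<^esub> b \<ominus>\<^bsub>P\<^esub> a \<ominus>\<^bsub>P\<^esub> b = \<zero>\<^bsub>P\<^esub>" "a \<ominus>\<^bsub>P\<^esub> a = \<zero>\<^bsub>P\<^esub>" if "a \<in> carrier P" "b \<in> carrier P" for a b
    using that P.r_neg[of "a \<oplus>\<^bsub>P\<^esub> b"] by (simp_all add: a_minus_def P.a_assoc P.minus_add P.r_neg)
  consider x x' y where "x \<in> carrier M" "x' \<in> carrier M" "y \<in> carrier N"
      "u = frag_of (x \<oplus>\<^bsub>M\<^esub> x', y) - frag_of (x, y) - frag_of (x', y)"
    | x y y' where "x \<in> carrier M" "y \<in> carrier N" "y' \<in> carrier N"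
      "u = frag_of (x, y \<oplus>\<^bsub>N\<^esub> y') - frag_of (x, y) - frag_of (x, y')"
    | r x y where "r \<in> carrier R" "x \<in> carrier M" "y \<in> carrier N"
      "u = frag_of (r \<odot>\<^bsub>M\<^esub> x, y) - frag_of (x, r \<odot>\<^bsub>N\<^esub> y)"
    using assms unfolding tensor_relations_def by (elim UnE CollectE exE conjE)
  then show ?thesis
  proof cases
    case 1
    then have "f (x \<oplus>\<^bsub>M\<^esub> x') y = f x y \<oplus>\<^bsub>P\<^esub> f x' y" using f by (simp add: balanced_map_def)
    with 1 show ?thesis by (simp add: d o dd z del: carrier_free_Abelian_group_iff)
  next
    case 2
    then have "f x (y \<oplus>\<^bsub>N\<^esub> y') = f x y \<oplus>\<^bsub>P\<^esub> f x y'" using f by (simp add: balanced_map_def)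
    with 2 show ?thesis by (simp add: d o dd z del: carrier_free_Abelian_group_iff)
  next
    case 3
    then have "f (r \<odot>\<^bsub>M\<^esub> x) y = f x (r \<odot>\<^bsub>N\<^esub> y)" using f by (simp add: balanced_map_def)
    with 3 z(2)[of _ "\<zero>\<^bsub>P\<^esub>"] show ?thesis by (simp add: d o dd del: carrier_free_Abelian_group_iff)
  qed
qed

text \<open>The evaluation kills the generators of the relation subgroup, hence the whole subgroup,
  so it maps a coset to a singleton. This gives \<open>the_elem\<close> in
  \<open>tensor_lift\<close> its meaning.\<close>

lemma tensor_lift_coset:
  assumes "u \<in> carrier FMN"
  shows "tensor_lift P f (tensor_subgroup R M N #>\<^bsub>FMN\<^esub> u) = frag_eval P (\<lambda>z. f (fst z) (snd z)) u"
proof -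
  interpret F: comm_group FMN by (rule abelian_free_Abelian_group)
  interpret S: normal "tensor_subgroup R M N" FMN by (rule subgroup_normal)
  interpret h: group_hom FMN "add_monoid P" "frag_eval P (\<lambda>z. f (fst z) (snd z))"
    by (rule frag_eval_hom[OF P balanced_in])
  have "tensor_subgroup R M N \<subseteq> kernel FMN (add_monoid P) (frag_eval P (\<lambda>z. f (fst z) (snd z)))"
    unfolding tensor_subgroup_def
    using relations_subset frag_eval_relation
    by (intro F.generate_subgroup_incl h.subgroup_kernel) (auto simp: kernel_def simp del: carrier_free_Abelian_group_iff)
  then have "frag_eval P (\<lambda>z. f (fst z) (snd z)) v = frag_eval P (\<lambda>z. f (fst z) (snd z)) u"
    if v: "v \<in> tensor_subgroup R M N #>\<^bsub>FMN\<^esub> u" for v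
  proof -
    obtain s where s: "s \<in> tensor_subgroup R M N" "v = s \<otimes>\<^bsub>FMN\<^esub> u"
      using v by (auto simp: r_coset_def)
    then have "s \<in> carrier FMN" "frag_eval P (\<lambda>z. f (fst z) (snd z)) s = \<zero>\<^bsub>P\<^esub>"
      using \<open>_ \<subseteq> kernel _ _ _\<close> by (auto simp: kernel_def)
    then show ?thesis
      using h.hom_mult[of s u] s(2) assms h.hom_closed[of u] abelian_group.axioms(1)[OF P]
      by (simp add: abelian_monoid.l_zero)
  qed
  moreover have "u \<in> tensor_subgroup R M N #>\<^bsub>FMN\<^esub> u"
    using assms F.rcos_self[OF _ S.subgroup_axioms] by blast
  ultimately have "(\<lambda>u. frag_eval P (\<lambda>z. f (fst z) (snd z)) u) ` (tensor_subgroup R M N #>\<^bsub>FMN\<^esub> u) =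
      {frag_eval P (\<lambda>z. f (fst z) (snd z)) u}" by blast
  then show ?thesis unfolding tensor_lift_def frag_eval_def by simp
qed

lemma tensor_lift_pure:
  assumes "x \<in> carrier M" "y \<in> carrier N"
  shows "tensor_lift P f (pt x y) = f x y"
  using assms tensor_lift_coset[of "frag_of (x, y)"] frag_eval_frag_of[of P "\<lambda>z. f (fst z) (snd z)" "(x, y)"] P balanced_in[of "(x, y)"]
  by (simp add: pure_tensor_def)

lemma tensor_lift_additive: "additive_map T P (tensor_lift P f)"
proof -
  interpret h: group_hom FMN "add_monoid P" "frag_eval P (\<lambda>z. f (fst z) (snd z))"
    by (rule frag_eval_hom[OF P balanced_in])
  interpret c: group_hom FMN "add_monoid T" "\<lambda>u. tensor_subgroup R M N #>\<^bsub>FMN\<^esub> u" by (rule coset_hom)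
  have "tensor_lift P f (v \<oplus>\<^bsub>T\<^esub> w) = tensor_lift P f v \<oplus>\<^bsub>P\<^esub> tensor_lift P f w \<and> tensor_lift P f v \<in> carrier P"
    if vw: "v \<in> carrier T" "w \<in> carrier T" for v w
  proof -
    obtain a where a: "a \<in> carrier FMN" "v = tensor_subgroup R M N #>\<^bsub>FMN\<^esub> a"
      using tensor_cases[OF vw(1)] .
    obtain b where b: "b \<in> carrier FMN" "w = tensor_subgroup R M N #>\<^bsub>FMN\<^esub> b"
      using tensor_cases[OF vw(2)] .
    have "v \<oplus>\<^bsub>T\<^esub> w = tensor_subgroup R M N #>\<^bsub>FMN\<^esub> (a \<otimes>\<^bsub>FMN\<^esub> b)"
      using c.hom_mult[of a b] a b by simp
    moreover have "a \<otimes>\<^bsub>FMN\<^esub> b \<in> carrier FMN" using a b keys_add[of a b] by auto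
    ultimately show ?thesis
      using a b h.hom_mult[of a b] h.hom_closed[of a] by (simp only: tensor_lift_coset) simp
  qed
  then show ?thesis using T.zero_closed by (auto simp: additive_map_def)
qed

end

end

section \<open>Extension of scalars\<close>

text \<open>\<open>restr\<close>, \<open>regular\<close>, \<open>ext_module\<close> and
  \<open>ext_algebra\<close> copy the additive fields of a record into a new one; this carries the
  group structure across.\<close>

lemma abelian_group_cong:
  fixes M :: "('a, 'x) ring_scheme" and N :: "('a, 'y) ring_scheme"
  assumes "abelian_group M" "carrier N = carrier M" "add N = add M" "ring.zero N = ring.zero M"
  shows "abelian_group N"
proof -
  interpret M: abelian_group M by fact
  show ?thesis
    using assms(2-4) by (intro abelian_groupI) (auto simp: M.a_assoc intro: M.a_comm M.add.l_inv_ex)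
qed

lemma restr_simps [simp]:
  "carrier (restr \<phi> M) = carrier M" "add (restr \<phi> M) = add M" "ring.zero (restr \<phi> M) = ring.zero M"
  "smult (restr \<phi> M) r x = \<phi> r \<odot>\<^bsub>M\<^esub> x"
  by (simp_all add: restr_def)

lemma regular_simps [simp]:
  "carrier (regular R) = carrier R" "add (regular R) = add R" "ring.zero (regular R) = ring.zero R"
  "smult (regular R) = monoid.mult R" "monoid.mult (regular R) = monoid.mult R" "one (regular R) = one R"
  by (simp_all add: regular_def)

section \<open>Left modules over arbitrary rings\<close>

lemma left_module_ab: "left_module R M \<Longrightarrow> abelian_group M"
  by (auto simp: left_module_def)

lemma left_module_ring: "left_module R M \<Longrightarrow> ring R"
  by (auto simp: left_module_def)

lemma left_moduleI:
  assumes "ring R" "abelian_group M"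
    "\<And>a x. a \<in> carrier R \<Longrightarrow> x \<in> carrier M \<Longrightarrow> a \<odot>\<^bsub>M\<^esub> x \<in> carrier M"
    "\<And>a b x. a \<in> carrier R \<Longrightarrow> b \<in> carrier R \<Longrightarrow> x \<in> carrier M \<Longrightarrow>
        (a \<oplus>\<^bsub>R\<^esub> b) \<odot>\<^bsub>M\<^esub> x = a \<odot>\<^bsub>M\<^esub> x \<oplus>\<^bsub>M\<^esub> b \<odot>\<^bsub>M\<^esub> x"
    "\<And>a x y. a \<in> carrier R \<Longrightarrow> x \<in> carrier M \<Longrightarrow> y \<in> carrier M \<Longrightarrow>
        a \<odot>\<^bsub>M\<^esub> (x \<oplus>\<^bsub>M\<^esub> y) = a \<odot>\<^bsub>M\<^esub> x \<oplus>\<^bsub>M\<^esub> a \<odot>\<^bsub>M\<^esub> y"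
    "\<And>a b x. a \<in> carrier R \<Longrightarrow> b \<in> carrier R \<Longrightarrow> x \<in> carrier M \<Longrightarrow>
        (a \<otimes>\<^bsub>R\<^esub> b) \<odot>\<^bsub>M\<^esub> x = a \<odot>\<^bsub>M\<^esub> (b \<odot>\<^bsub>M\<^esub> x)"
    "\<And>x. x \<in> carrier M \<Longrightarrow> \<one>\<^bsub>R\<^esub> \<odot>\<^bsub>M\<^esub> x = x"
  shows "left_module R M"
  using assms by (simp add: left_module_def left_module_axioms_def)

lemma left_module_regular:
  assumes "ring R"
  shows "left_module R (regular R)"
proof -
  interpret R: ring R by fact
  show ?thesis
    by (rule left_moduleI)
       (simp_all add: R.l_distr R.r_distr R.m_assoc R.ring_axioms abelian_group_cong[OF R.abelian_group_axioms])
qed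

lemma left_module_restr:
  assumes "ring R" "ring S" "\<phi> \<in> ring_hom R S" "left_module S M"
  shows "left_module R (restr \<phi> M)"
proof -
  interpret M: left_module S M by fact
  show ?thesis
    using assms ring_hom_closed[OF assms(3)] ring_hom_add[OF assms(3)] ring_hom_mult[OF assms(3)] ring_hom_one[OF assms(3)]
    by (intro left_moduleI)
       (simp_all add: M.smult_l_distr M.smult_r_distr M.smult_assoc M.smult_one M.smult_closed
          abelian_group_cong[OF M.M.abelian_group_axioms])
qed

lemma module_of_left_module: "cring R \<Longrightarrow> left_module R M \<Longrightarrow> module R M"
  by (intro moduleI) (auto simp: left_module_def left_module_axioms_def)

lemma left_module_of_module: "module R M \<Longrightarrow> left_module R M"
  by (auto simp: left_module_def left_module_axioms_def module_def module_axioms_def cring_def)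

context left_module
begin

lemma smult_additive: "a \<in> carrier R \<Longrightarrow> additive_map M M (\<lambda>x. a \<odot>\<^bsub>M\<^esub> x)"
  by (simp add: additive_map_def smult_closed smult_r_distr)

lemma smult_additive_left: "x \<in> carrier M \<Longrightarrow> additive_map R M (\<lambda>a. a \<odot>\<^bsub>M\<^esub> x)"
  by (simp add: additive_map_def smult_closed smult_l_distr)

lemmas M_abelian = M.abelian_group_axioms
lemmas R_abelian = R.abelian_group_axioms

lemma smult_zero_right: "a \<in> carrier R \<Longrightarrow> a \<odot>\<^bsub>M\<^esub> \<zero>\<^bsub>M\<^esub> = \<zero>\<^bsub>M\<^esub>"
  using additive_map_zero[OF M_abelian M_abelian smult_additive] .

lemma smult_zero_left: "x \<in> carrier M \<Longrightarrow> \<zero>\<^bsub>R\<^esub> \<odot>\<^bsub>M\<^esub> x = \<zero>\<^bsub>M\<^esub>"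
  using additive_map_zero[OF R_abelian M_abelian smult_additive_left] .

lemma smult_minus_right: "a \<in> carrier R \<Longrightarrow> x \<in> carrier M \<Longrightarrow> a \<odot>\<^bsub>M\<^esub> (\<ominus>\<^bsub>M\<^esub> x) = \<ominus>\<^bsub>M\<^esub> (a \<odot>\<^bsub>M\<^esub> x)"
  using additive_map_minus[OF M_abelian M_abelian smult_additive] .

lemma smult_minus_left: "a \<in> carrier R \<Longrightarrow> x \<in> carrier M \<Longrightarrow> (\<ominus>\<^bsub>R\<^esub> a) \<odot>\<^bsub>M\<^esub> x = \<ominus>\<^bsub>M\<^esub> (a \<odot>\<^bsub>M\<^esub> x)"
  using additive_map_minus[OF R_abelian M_abelian smult_additive_left] .

lemma smult_diff_right:
  "a \<in> carrier R \<Longrightarrow> x \<in> carrier M \<Longrightarrow> y \<in> carrier M \<Longrightarrow> a \<odot>\<^bsub>M\<^esub> (x \<ominus>\<^bsub>M\<^esub> y) = a \<odot>\<^bsub>M\<^esub> x \<ominus>\<^bsub>M\<^esub> a \<odot>\<^bsub>M\<^esub> y"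
  using additive_map_diff[OF M_abelian M_abelian smult_additive] .

lemma smult_finsum_right:
  "a \<in> carrier R \<Longrightarrow> finite A \<Longrightarrow> g \<in> A \<rightarrow> carrier M \<Longrightarrow>
    a \<odot>\<^bsub>M\<^esub> (\<Oplus>\<^bsub>M\<^esub>i\<in>A. g i) = (\<Oplus>\<^bsub>M\<^esub>i\<in>A. a \<odot>\<^bsub>M\<^esub> g i)"
  using additive_map_finsum[OF M_abelian M_abelian smult_additive] .

end

lemma linear_map_additive: "linear_map R M N f \<Longrightarrow> additive_map M N f"
  by (simp add: linear_map_def additive_map_def)

lemma linear_mapD:
  assumes "linear_map R M N f"
  shows "x \<in> carrier M \<Longrightarrow> f x \<in> carrier N"
    and "x \<in> carrier M \<Longrightarrow> y \<in> carrier M \<Longrightarrow> f (x \<oplus>\<^bsub>M\<^esub> y) = f x \<oplus>\<^bsub>N\<^esub> f y"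
    and "r \<in> carrier R \<Longrightarrow> x \<in> carrier M \<Longrightarrow> f (r \<odot>\<^bsub>M\<^esub> x) = r \<odot>\<^bsub>N\<^esub> f x"
  using assms by (auto simp: linear_map_def)

lemma lhomD:
  assumes "f \<in> lhom R M N"
  shows "x \<in> carrier M \<Longrightarrow> f x \<in> carrier N"
    and "x \<in> carrier M \<Longrightarrow> y \<in> carrier M \<Longrightarrow> f (x \<oplus>\<^bsub>M\<^esub> y) = f x \<oplus>\<^bsub>N\<^esub> f y"
    and "r \<in> carrier R \<Longrightarrow> x \<in> carrier M \<Longrightarrow> f (r \<odot>\<^bsub>M\<^esub> x) = r \<odot>\<^bsub>N\<^esub> f x"
    and "x \<notin> carrier M \<Longrightarrow> f x = undefined"
    and "linear_map R M N f" and "additive_map M N f"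
  using assms by (auto simp: lhom_def linear_map_def extensional_def additive_map_def)

text \<open>The last two assumptions together say that the image of k in B is central. Centrality is
  what lets B \<otimes> K act on M \<otimes> K.\<close>

locale algebra_over = k: field k + B: ring B for k :: "'c ring" and B :: "('c, 'b, 'z) module_scheme" (structure) +
  assumes k_module: "module k B"
    and smult_mult_left: "c \<in> carrier k \<Longrightarrow> a \<in> carrier B \<Longrightarrow> b \<in> carrier B \<Longrightarrow>
        c \<odot>\<^bsub>B\<^esub> (a \<otimes>\<^bsub>B\<^esub> b) = (c \<odot>\<^bsub>B\<^esub> a) \<otimes>\<^bsub>B\<^esub> b"
    and smult_mult_right: "c \<in> carrier k \<Longrightarrow> a \<in> carrier B \<Longrightarrow> b \<in> carrier B \<Longrightarrow>
        c \<odot>\<^bsub>B\<^esub> (a \<otimes>\<^bsub>B\<^esub> b) = a \<otimes>\<^bsub>B\<^esub> (c \<odot>\<^bsub>B\<^esub> b)"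
begin

lemmas k_closed = module.smult_closed[OF k_module]

lemma scalar_closed: "c \<in> carrier k \<Longrightarrow> scalar B c \<in> carrier B"
  by (simp add: scalar_def k_closed)

lemma scalar_mult: "c \<in> carrier k \<Longrightarrow> b \<in> carrier B \<Longrightarrow> scalar B c \<otimes>\<^bsub>B\<^esub> b = c \<odot>\<^bsub>B\<^esub> b"
  by (simp add: scalar_def smult_mult_left[symmetric])

lemma mult_scalar: "c \<in> carrier k \<Longrightarrow> b \<in> carrier B \<Longrightarrow> b \<otimes>\<^bsub>B\<^esub> scalar B c = c \<odot>\<^bsub>B\<^esub> b"
  by (simp add: scalar_def smult_mult_right[symmetric])

lemma scalar_ring_hom: "scalar B \<in> ring_hom k B"
proof (rule ring_hom_memI)
  show "scalar B (x \<otimes>\<^bsub>k\<^esub> y) = scalar B x \<otimes>\<^bsub>B\<^esub> scalar B y" if "x \<in> carrier k" "y \<in> carrier k" for x y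
    using that scalar_closed[of y] by (simp only: scalar_mult) (simp add: scalar_def module.smult_assoc1[OF k_module])
qed (auto simp: scalar_closed, auto simp: scalar_def module.smult_l_distr[OF k_module] module.smult_one[OF k_module])

lemma restr_scalar_module: "left_module B M \<Longrightarrow> module k (restr (scalar B) M)"
  by (intro module_of_left_module left_module_restr[of k B] scalar_ring_hom k.is_cring k.is_ring B.ring_axioms)

lemma linear_map_scalar:
  "linear_map B M N f \<Longrightarrow> linear_map k (restr (scalar B) M) (restr (scalar B) N) f"
  by (auto simp: linear_map_def scalar_closed)

end

section \<open>Base change of algebras and modules from k to K\<close>

lemma ext_space_module: "field k \<Longrightarrow> field K \<Longrightarrow> \<iota> \<in> ring_hom k K \<Longrightarrow> module k (ext_space K \<iota>)"
  unfolding ext_space_def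
  by (intro module_of_left_module left_module_restr[of k K] left_module_regular)
     (auto simp: field.is_ring fieldE(1))

lemma ext_space_simps [simp]:
  "carrier (ext_space K \<iota>) = carrier K" "add (ext_space K \<iota>) = add K" "ring.zero (ext_space K \<iota>) = ring.zero K"
  "smult (ext_space K \<iota>) r x = \<iota> r \<otimes>\<^bsub>K\<^esub> x"
  by (simp_all add: ext_space_def)

locale scalar_extension = algebra_over k B + K: field K for k :: "'c ring" and K :: "'d ring" and B :: "('c, 'b, 'z) module_scheme" (structure) +
  fixes \<iota> :: "'c \<Rightarrow> 'd"
  assumes emb: "\<iota> \<in> ring_hom k K"
begin

abbreviation "E \<equiv> ext_space K \<iota>"
abbreviation "V M \<equiv> restr (scalar B) M"
abbreviation "Ext M \<equiv> ext_module k K \<iota> B M"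
abbreviation "KB \<equiv> ext_algebra k K \<iota> B"
abbreviation "tens M \<equiv> pure_tensor k (restr (scalar B) M) E"
abbreviation "ptB \<equiv> pure_tensor k B E"

lemmas E_module = ext_space_module[OF k.field_axioms K.field_axioms emb]

lemma tensor_V: "left_module B M \<Longrightarrow> tensor_product k (V M) E"
  by (simp add: tensor_product_def restr_scalar_module E_module)

sublocale BE: tensor_product k B E
  by (simp add: tensor_product_def k_module E_module)

lemma Ext_simps:
  "carrier (Ext M) = carrier (tensor k (V M) E)" "add (Ext M) = add (tensor k (V M) E)"
  "ring.zero (Ext M) = ring.zero (tensor k (V M) E)"
  "u \<odot>\<^bsub>Ext M\<^esub> v = tensor_lift (tensor k (V M) E) (\<lambda>b d. tensor_lift (tensor k (V M) E)
        (\<lambda>m c. tens M (b \<odot>\<^bsub>M\<^esub> m) (d \<otimes>\<^bsub>K\<^esub> c)) v) u"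
  by (simp_all add: ext_module_def Let_def)

lemma KB_simps:
  "carrier KB = carrier (tensor k B E)" "add KB = add (tensor k B E)" "ring.zero KB = ring.zero (tensor k B E)"
  "\<one>\<^bsub>KB\<^esub> = ptB \<one>\<^bsub>B\<^esub> \<one>\<^bsub>K\<^esub>"
  by (simp_all add: ext_algebra_def tensor_algebra_def Let_def ext_space_def restr_def)

text \<open>By \<open>scalar_mult\<close> the algebra B and the module \<open>regular B\<close>
  restricted along \<open>scalar B\<close> carry the same k-action, hence the same relations with E.
  This identifies B \<otimes> K with the extended regular module.\<close>

lemma tensor_V_regular:
  "tensor_subgroup k (V (regular B)) E = tensor_subgroup k B E"
proof -
  have "tensor_relations k (V (regular B)) E = tensor_relations k B E"
    by (auto simp: tensor_relations_def scalar_mult; metis scalar_mult)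
  then show ?thesis by (simp add: tensor_subgroup_def)
qed

lemma tens_regular: "tens (regular B) = ptB"
  by (simp add: pure_tensor_def tensor_V_regular fun_eq_iff)

lemma tensor_group_regular: "tensor_group k (V (regular B)) E = tensor_group k B E"
  by (simp add: tensor_group_def tensor_V_regular)

lemma Ext_regular_simps:
  "carrier (Ext (regular B)) = carrier KB" "add (Ext (regular B)) = add KB" "ring.zero (Ext (regular B)) = ring.zero KB"
  by (simp_all add: Ext_simps KB_simps tensor_simps tensor_group_regular)

text \<open>With the product of B \<otimes> K read as the action on the extended regular module,
  ring laws become instances of module laws.\<close>

lemma KB_mult: "u \<otimes>\<^bsub>KB\<^esub> v = u \<odot>\<^bsub>Ext (regular B)\<^esub> v"
proof -
  have "tensor_lift (tensor k B E) f w = tensor_lift (tensor k (V (regular B)) E) f w" for f :: "'b \<Rightarrow> 'd \<Rightarrow> _" and w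
    by (rule tensor_lift_cong) (simp_all add: tensor_simps tensor_group_regular)
  moreover have "u \<otimes>\<^bsub>KB\<^esub> v = tensor_lift (tensor k B E) (\<lambda>a b. tensor_lift (tensor k B E)
         (\<lambda>a' b'. ptB (a \<otimes>\<^bsub>B\<^esub> a') (b \<otimes>\<^bsub>K\<^esub> b')) v) u"
    by (simp add: ext_algebra_def tensor_algebra_def Let_def ext_space_def restr_def)
  ultimately show ?thesis by (simp add: Ext_simps tens_regular)
qed

lemma KB_abelian: "abelian_group KB"
  by (rule abelian_group_cong[OF BE.tensor_abelian_group]) (simp_all add: KB_simps)

lemma KB_induct [consumes 1, case_names pure add]:
  assumes "w \<in> carrier KB"
    and "\<And>b d. b \<in> carrier B \<Longrightarrow> d \<in> carrier K \<Longrightarrow> Q (ptB b d)"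
    and "\<And>v w. v \<in> carrier KB \<Longrightarrow> w \<in> carrier KB \<Longrightarrow> Q v \<Longrightarrow> Q w \<Longrightarrow> Q (v \<oplus>\<^bsub>KB\<^esub> w)"
  shows "Q w"
  using BE.tensor_induct[of w Q] assms by (simp add: KB_simps)

lemma ptB_closed: "b \<in> carrier B \<Longrightarrow> d \<in> carrier K \<Longrightarrow> ptB b d \<in> carrier KB"
  using BE.pure_tensor_closed by (simp add: KB_simps)

context
  fixes M :: "('b, 'm, 'w) module_scheme"
  assumes M: "left_module B M"
begin

interpretation M: left_module B M by (rule M)
interpretation T: tensor_product k "V M" E by (rule tensor_V[OF M])

lemma Ext_abelian: "abelian_group (Ext M)"
  by (rule abelian_group_cong[OF T.tensor_abelian_group]) (simp_all add: Ext_simps)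

lemma tens_closed: "m \<in> carrier M \<Longrightarrow> c \<in> carrier K \<Longrightarrow> tens M m c \<in> carrier (Ext M)"
  using T.pure_tensor_closed by (simp add: Ext_simps)

lemma tens_add_left: "m \<in> carrier M \<Longrightarrow> m' \<in> carrier M \<Longrightarrow> c \<in> carrier K \<Longrightarrow>
    tens M (m \<oplus>\<^bsub>M\<^esub> m') c = tens M m c \<oplus>\<^bsub>Ext M\<^esub> tens M m' c"
  using T.pure_tensor_add_left by (simp add: Ext_simps)

lemma tens_add_right: "m \<in> carrier M \<Longrightarrow> c \<in> carrier K \<Longrightarrow> c' \<in> carrier K \<Longrightarrow>
    tens M m (c \<oplus>\<^bsub>K\<^esub> c') = tens M m c \<oplus>\<^bsub>Ext M\<^esub> tens M m c'"
  using T.pure_tensor_add_right by (simp add: Ext_simps)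

lemma tens_scalar: "r \<in> carrier k \<Longrightarrow> m \<in> carrier M \<Longrightarrow> c \<in> carrier K \<Longrightarrow>
    tens M (scalar B r \<odot>\<^bsub>M\<^esub> m) c = tens M m (\<iota> r \<otimes>\<^bsub>K\<^esub> c)"
  using T.pure_tensor_smult[of r m c] by simp

lemma Ext_induct [consumes 1, case_names pure add]:
  assumes "w \<in> carrier (Ext M)"
    and "\<And>m c. m \<in> carrier M \<Longrightarrow> c \<in> carrier K \<Longrightarrow> Q (tens M m c)"
    and "\<And>v w. v \<in> carrier (Ext M) \<Longrightarrow> w \<in> carrier (Ext M) \<Longrightarrow> Q v \<Longrightarrow> Q w \<Longrightarrow> Q (v \<oplus>\<^bsub>Ext M\<^esub> w)"
  shows "Q w"
  using T.tensor_induct[of w Q] assms by (simp add: Ext_simps)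

lemma Ext_eqI:
  assumes "additive_map (Ext M) P f" "additive_map (Ext M) P g" "w \<in> carrier (Ext M)"
    and "\<And>m c. m \<in> carrier M \<Longrightarrow> c \<in> carrier K \<Longrightarrow> f (tens M m c) = g (tens M m c)"
  shows "f w = g w"
  using assms(3)
  by (induction rule: Ext_induct) (use assms(1,2,4) in \<open>simp_all add: additive_mapD\<close>)

lemma Ext_lift:
  assumes "abelian_group P" "balanced_map k (V M) E P f"
  shows "m \<in> carrier M \<Longrightarrow> c \<in> carrier K \<Longrightarrow> tensor_lift P f (tens M m c) = f m c"
    and "additive_map (Ext M) P (tensor_lift P f)"
  using T.tensor_lift_pure[OF assms] T.tensor_lift_additive[OF assms]
  by (simp_all add: Ext_simps additive_map_def)

lemma inner_balanced:
  assumes "b \<in> carrier B" "d \<in> carrier K"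
  shows "balanced_map k (V M) E (Ext M) (\<lambda>m c. tens M (b \<odot>\<^bsub>M\<^esub> m) (d \<otimes>\<^bsub>K\<^esub> c))"
  unfolding balanced_map_def
proof (intro conjI ballI)
  fix r m c assume "r \<in> carrier k" "m \<in> carrier (V M)" "c \<in> carrier E"
  \<comment> \<open>Centrality of k lets the action of b pass the scalar that is to be moved across
    the tensor sign.\<close>
  moreover have "b \<otimes>\<^bsub>B\<^esub> scalar B r = scalar B r \<otimes>\<^bsub>B\<^esub> b" if "r \<in> carrier k" for r
    using that assms by (simp add: scalar_mult mult_scalar)
  ultimately show "tens M (b \<odot>\<^bsub>M\<^esub> (r \<odot>\<^bsub>V M\<^esub> m)) (d \<otimes>\<^bsub>K\<^esub> c) = tens M (b \<odot>\<^bsub>M\<^esub> m) (d \<otimes>\<^bsub>K\<^esub> (r \<odot>\<^bsub>E\<^esub> c))"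
    using assms ring_hom_closed[OF emb]
    by (simp add: scalar_closed M.smult_closed M.smult_assoc[symmetric] tens_scalar[symmetric])
       (simp add: scalar_closed M.smult_closed M.smult_assoc tens_scalar K.m_lcomm)
qed (use assms in \<open>simp_all add: tens_closed tens_add_left tens_add_right M.smult_closed M.smult_r_distr K.r_distr\<close>)

text \<open>The inner of the two nested lifts in \<open>ext_module\<close>: the effect of b
  \<otimes> d on M \<otimes> K. The outer lift then varies b and d.\<close>

definition inner_lift where
  "inner_lift b d = tensor_lift (tensor k (V M) E) (\<lambda>m c. tens M (b \<odot>\<^bsub>M\<^esub> m) (d \<otimes>\<^bsub>K\<^esub> c))"

lemma balanced_T: "balanced_map k U W (Ext M) f \<Longrightarrow> balanced_map k U W (tensor k (V M) E) f"
  by (simp add: balanced_map_def Ext_simps)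

lemma inner_pure: "b \<in> carrier B \<Longrightarrow> d \<in> carrier K \<Longrightarrow> m \<in> carrier M \<Longrightarrow> c \<in> carrier K \<Longrightarrow>
    inner_lift b d (tens M m c) = tens M (b \<odot>\<^bsub>M\<^esub> m) (d \<otimes>\<^bsub>K\<^esub> c)"
  unfolding inner_lift_def using Ext_lift(1)[OF T.tensor_abelian_group balanced_T[OF inner_balanced]] .

lemma inner_additive: "b \<in> carrier B \<Longrightarrow> d \<in> carrier K \<Longrightarrow> additive_map (Ext M) (Ext M) (inner_lift b d)"
  unfolding inner_lift_def using Ext_lift(2)[OF T.tensor_abelian_group balanced_T[OF inner_balanced]]
  by (simp add: additive_map_def Ext_simps)

text \<open>Each condition on b and d is an identity between additive maps in v, so it is enough to
  check it when v is a pure tensor.\<close>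

lemma outer_balanced:
  assumes v: "v \<in> carrier (Ext M)"
  shows "balanced_map k B E (Ext M) (\<lambda>b d. inner_lift b d v)"
proof -
  note Ext_ab = Ext_abelian
  interpret X: abelian_group "Ext M" by (rule Ext_abelian)
  have ic: "inner_lift b d w \<in> carrier (Ext M)"
    if "b \<in> carrier B" "d \<in> carrier K" "w \<in> carrier (Ext M)" for b d w
    using additive_mapD(1)[OF inner_additive] that .
  have 1: "inner_lift (b \<oplus>\<^bsub>B\<^esub> b') d v = inner_lift b d v \<oplus>\<^bsub>Ext M\<^esub> inner_lift b' d v"
    if "b \<in> carrier B" "b' \<in> carrier B" "d \<in> carrier K" for b b' d
    by (rule Ext_eqI[OF inner_additive additive_map_add[OF Ext_ab Ext_ab inner_additive inner_additive] v])
       (use that in \<open>simp_all add: inner_pure M.smult_l_distr M.smult_closed tens_add_left\<close>)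
  have 2: "inner_lift b (d \<oplus>\<^bsub>K\<^esub> d') v = inner_lift b d v \<oplus>\<^bsub>Ext M\<^esub> inner_lift b d' v"
    if "b \<in> carrier B" "d' \<in> carrier K" "d \<in> carrier K" for b d' d
    by (rule Ext_eqI[OF inner_additive additive_map_add[OF Ext_ab Ext_ab inner_additive inner_additive] v])
       (use that in \<open>simp_all add: inner_pure K.l_distr M.smult_closed tens_add_right\<close>)
  have 3: "inner_lift (r \<odot>\<^bsub>B\<^esub> b) d v = inner_lift b (\<iota> r \<otimes>\<^bsub>K\<^esub> d) v"
    if "r \<in> carrier k" "b \<in> carrier B" "d \<in> carrier K" for r b d
    by (rule Ext_eqI[OF inner_additive inner_additive v])
       (use that ring_hom_closed[OF emb] in \<open>simp_all add: inner_pure k_closed M.smult_closed scalar_closed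
          scalar_mult[symmetric] M.smult_assoc tens_scalar K.m_assoc\<close>)
  show ?thesis unfolding balanced_map_def using ic v 1 2 3 by simp
qed

lemma smult_Ext: "u \<odot>\<^bsub>Ext M\<^esub> v = tensor_lift (tensor k (V M) E) (\<lambda>b d. inner_lift b d v) u"
  by (simp add: Ext_simps(4) inner_lift_def)

lemma smult_Ext_inner: "b \<in> carrier B \<Longrightarrow> d \<in> carrier K \<Longrightarrow> v \<in> carrier (Ext M) \<Longrightarrow>
    ptB b d \<odot>\<^bsub>Ext M\<^esub> v = inner_lift b d v"
  unfolding smult_Ext using BE.tensor_lift_pure[OF T.tensor_abelian_group balanced_T[OF outer_balanced]]
  by simp

lemma smult_Ext_pure:
  "b \<in> carrier B \<Longrightarrow> d \<in> carrier K \<Longrightarrow> m \<in> carrier M \<Longrightarrow> c \<in> carrier K \<Longrightarrow>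
    ptB b d \<odot>\<^bsub>Ext M\<^esub> tens M m c = tens M (b \<odot>\<^bsub>M\<^esub> m) (d \<otimes>\<^bsub>K\<^esub> c)"
  by (simp add: smult_Ext_inner inner_pure tens_closed)

lemma smult_Ext_additive_left: "v \<in> carrier (Ext M) \<Longrightarrow> additive_map KB (Ext M) (\<lambda>u. u \<odot>\<^bsub>Ext M\<^esub> v)"
  unfolding smult_Ext using BE.tensor_lift_additive[OF T.tensor_abelian_group balanced_T[OF outer_balanced]]
  by (simp add: additive_map_def Ext_simps KB_simps)

lemma smult_Ext_closed: "u \<in> carrier KB \<Longrightarrow> v \<in> carrier (Ext M) \<Longrightarrow> u \<odot>\<^bsub>Ext M\<^esub> v \<in> carrier (Ext M)"
  by (rule additive_mapD(1)[OF smult_Ext_additive_left])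

text \<open>For pure u the action is an \<open>inner_lift\<close>, additive by construction; sums of
  additive maps are additive, and pure tensors generate B \<otimes> K.\<close>

lemma smult_Ext_additive_right:
  assumes "u \<in> carrier KB"
  shows "additive_map (Ext M) (Ext M) (\<lambda>v. u \<odot>\<^bsub>Ext M\<^esub> v)"
proof -
  interpret X: abelian_group "Ext M" by (rule Ext_abelian)
  have "u \<odot>\<^bsub>Ext M\<^esub> (v \<oplus>\<^bsub>Ext M\<^esub> w) = u \<odot>\<^bsub>Ext M\<^esub> v \<oplus>\<^bsub>Ext M\<^esub> u \<odot>\<^bsub>Ext M\<^esub> w"
    if "v \<in> carrier (Ext M)" "w \<in> carrier (Ext M)" for v w
    using assms
  proof (induction rule: KB_induct)
    case (pure b d)
    then show ?case using that by (simp add: smult_Ext_inner additive_mapD[OF inner_additive])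
  next
    case (add p q)
    then show ?case
      using that by (simp add: additive_mapD(2)[OF smult_Ext_additive_left] smult_Ext_closed X.a_ac)
  qed
  then show ?thesis using assms by (simp add: additive_map_def smult_Ext_closed)
qed

end

lemma mult_KB_closed: "u \<in> carrier KB \<Longrightarrow> u' \<in> carrier KB \<Longrightarrow> u \<otimes>\<^bsub>KB\<^esub> u' \<in> carrier KB"
  using smult_Ext_closed[OF left_module_regular[OF B.ring_axioms], of u u'] by (simp add: KB_mult Ext_regular_simps)

lemma mult_KB_pure:
  "b \<in> carrier B \<Longrightarrow> d \<in> carrier K \<Longrightarrow> b' \<in> carrier B \<Longrightarrow> d' \<in> carrier K \<Longrightarrow>
    ptB b d \<otimes>\<^bsub>KB\<^esub> ptB b' d' = ptB (b \<otimes>\<^bsub>B\<^esub> b') (d \<otimes>\<^bsub>K\<^esub> d')"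
  using smult_Ext_pure[OF left_module_regular[OF B.ring_axioms], of b d b' d'] by (simp add: KB_mult tens_regular)

lemma mult_KB_add_left: "u \<in> carrier KB \<Longrightarrow> v \<in> carrier KB \<Longrightarrow> w \<in> carrier KB \<Longrightarrow>
    (u \<oplus>\<^bsub>KB\<^esub> v) \<otimes>\<^bsub>KB\<^esub> w = u \<otimes>\<^bsub>KB\<^esub> w \<oplus>\<^bsub>KB\<^esub> v \<otimes>\<^bsub>KB\<^esub> w"
  using additive_mapD(2)[OF smult_Ext_additive_left[OF left_module_regular[OF B.ring_axioms]], of w u v]
  by (simp add: KB_mult Ext_regular_simps)

lemma mult_KB_add_right: "u \<in> carrier KB \<Longrightarrow> v \<in> carrier KB \<Longrightarrow> w \<in> carrier KB \<Longrightarrow>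
    u \<otimes>\<^bsub>KB\<^esub> (v \<oplus>\<^bsub>KB\<^esub> w) = u \<otimes>\<^bsub>KB\<^esub> v \<oplus>\<^bsub>KB\<^esub> u \<otimes>\<^bsub>KB\<^esub> w"
  using additive_mapD(2)[OF smult_Ext_additive_right[OF left_module_regular[OF B.ring_axioms]], of u v w]
  by (simp add: KB_mult Ext_regular_simps)

text \<open>All three arguments are reduced to pure tensors, where the law splits into associativity
  of the B-action on M and of the product of K.\<close>

lemma smult_Ext_assoc:
  assumes M: "left_module B M" and u: "u \<in> carrier KB" and u': "u' \<in> carrier KB" and v: "v \<in> carrier (Ext M)"
  shows "(u \<otimes>\<^bsub>KB\<^esub> u') \<odot>\<^bsub>Ext M\<^esub> v = u \<odot>\<^bsub>Ext M\<^esub> (u' \<odot>\<^bsub>Ext M\<^esub> v)"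
proof -
  interpret M: left_module B M by (rule M)
  note closed = smult_Ext_closed[OF M] mult_KB_closed ptB_closed tens_closed[OF M] M.smult_closed
  note add_l = additive_mapD(2)[OF smult_Ext_additive_left[OF M]]
  note add_r = additive_mapD(2)[OF smult_Ext_additive_right[OF M]]
  show ?thesis using u
  proof (induction rule: KB_induct)
    case (pure b d)
    show ?case using u'
    proof (induction rule: KB_induct)
      case (pure b' d')
      show ?case using v
      proof (induction rule: Ext_induct[OF M, consumes 1, case_names pure add])
        case (pure m c)
        then show ?case using \<open>b \<in> _\<close> \<open>d \<in> _\<close> \<open>b' \<in> _\<close> \<open>d' \<in> _\<close>
          by (simp add: mult_KB_pure smult_Ext_pure[OF M] M.smult_closed M.smult_assoc K.m_assoc)
      next
        case (add v w)
        then show ?case using \<open>b \<in> _\<close> \<open>d \<in> _\<close> pure by (simp add: add_r closed)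
      qed
    next
      case (add p q)
      then show ?case using pure v by (simp add: add_l add_r closed mult_KB_add_right)
    qed
  next
    case (add p q)
    then show ?case using u' v by (simp add: add_l closed mult_KB_add_left)
  qed
qed

lemma one_KB_closed: "\<one>\<^bsub>KB\<^esub> \<in> carrier KB"
  using ptB_closed[of "\<one>\<^bsub>B\<^esub>" "\<one>\<^bsub>K\<^esub>"] by (simp add: KB_simps(4))

lemma smult_Ext_one:
  assumes M: "left_module B M" and v: "v \<in> carrier (Ext M)"
  shows "\<one>\<^bsub>KB\<^esub> \<odot>\<^bsub>Ext M\<^esub> v = v"
proof -
  interpret M: left_module B M by (rule M)
  note add_r = additive_mapD(2)[OF smult_Ext_additive_right[OF M]]
  show ?thesis using v
  proof (induction rule: Ext_induct[OF M, consumes 1, case_names pure add])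
    case (pure m c)
    then show ?case by (simp add: KB_simps(4) smult_Ext_pure[OF M] M.smult_one)
  next
    case (add v w)
    then show ?case by (simp add: add_r one_KB_closed)
  qed
qed

lemma KB_ring: "ring KB"
proof -
  interpret KB: abelian_group KB by (rule KB_abelian)
  note R = left_module_regular[OF B.ring_axioms]
  \<comment> \<open>The module laws of the regular module give associativity and the left unit; the
    right unit takes its own induction.\<close>
  have r1: "u \<otimes>\<^bsub>KB\<^esub> \<one>\<^bsub>KB\<^esub> = u" if "u \<in> carrier KB" for u
    using that
  proof (induction rule: KB_induct)
    case (pure b d)
    then show ?case by (simp add: KB_simps(4) mult_KB_pure)
  next
    case (add v w)
    then show ?case by (simp add: mult_KB_add_left one_KB_closed)
  qed
  have mon: "monoid KB"
    using smult_Ext_assoc[OF R] smult_Ext_one[OF R] mult_KB_closed one_KB_closed r1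
    by (intro monoidI) (simp_all add: KB_mult Ext_regular_simps)
  show ?thesis
    by (rule ringI[OF KB_abelian mon]) (simp_all add: mult_KB_add_left mult_KB_add_right)
qed

lemma Ext_left_module: "left_module B M \<Longrightarrow> left_module KB (Ext M)"
  by (rule left_moduleI)
     (simp_all add: KB_ring Ext_abelian smult_Ext_closed smult_Ext_assoc smult_Ext_one
       additive_mapD(2)[OF smult_Ext_additive_left] additive_mapD(2)[OF smult_Ext_additive_right])

text \<open>The map f \<otimes> id, made extensional so that it can lie in \<open>lhom\<close>. It
  makes sense for every k-linear f, also for splittings over k that do not commute with B.\<close>

definition extend_map where
  "extend_map M N f = (\<lambda>u\<in>carrier (Ext M). tensor_lift (tensor k (V N) E) (\<lambda>m c. tens N (f m) c) u)"

context
  fixes M :: "('b, 'm, 'w) module_scheme" and N :: "('b, 'n, 'v) module_scheme"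
  assumes M: "left_module B M" and N: "left_module B N"
begin

context
  fixes f assumes f: "linear_map k (V M) (V N) f"
begin

lemma extend_balanced: "balanced_map k (V M) E (Ext N) (\<lambda>m c. tens N (f m) c)"
  using linear_mapD[OF f] unfolding balanced_map_def
  by (simp add: tens_closed[OF N] tens_add_left[OF N] tens_add_right[OF N] tens_scalar[OF N])

lemma extend_map_pure: "m \<in> carrier M \<Longrightarrow> c \<in> carrier K \<Longrightarrow> extend_map M N f (tens M m c) = tens N (f m) c"
  using Ext_lift(1)[OF M tensor_product.tensor_abelian_group[OF tensor_V[OF N]] balanced_T[OF N extend_balanced]]
  by (simp add: extend_map_def tens_closed[OF M])

lemma extend_map_additive: "additive_map (Ext M) (Ext N) (extend_map M N f)"
  using Ext_lift(2)[OF M tensor_product.tensor_abelian_group[OF tensor_V[OF N]] balanced_T[OF N extend_balanced]]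
    abelian_monoid.a_closed[OF abelian_group.axioms(1)[OF Ext_abelian[OF M]]]
  by (simp add: additive_map_def extend_map_def Ext_simps Pi_iff)

end

lemma extend_map_lhom:
  assumes f: "linear_map B M N f"
  shows "extend_map M N f \<in> lhom KB (Ext M) (Ext N)"
proof -
  note fk = linear_map_scalar[OF f]
  interpret M: left_module B M by (rule M)
  note fc = linear_mapD[OF f]
  have "extend_map M N f (u \<odot>\<^bsub>Ext M\<^esub> v) = u \<odot>\<^bsub>Ext N\<^esub> extend_map M N f v"
    if u: "u \<in> carrier KB" and v: "v \<in> carrier (Ext M)" for u v
    using u
  proof (induction rule: KB_induct)
    case (pure b d)
    show ?case using v
    proof (induction rule: Ext_induct[OF M, consumes 1, case_names pure add])
      case (pure m c)
      then show ?case using \<open>b \<in> _\<close> \<open>d \<in> _\<close> fc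
        by (simp add: smult_Ext_pure[OF M] smult_Ext_pure[OF N] extend_map_pure[OF fk] M.smult_closed)
    next
      case (add v w)
      then show ?case using ptB_closed[OF pure]
        by (simp add: additive_mapD[OF smult_Ext_additive_right[OF M]] additive_mapD[OF smult_Ext_additive_right[OF N]]
             additive_mapD[OF extend_map_additive[OF fk]])
    qed
  next
    case (add p q)
    then show ?case using v
      by (simp add: additive_mapD[OF smult_Ext_additive_left[OF M]] additive_mapD[OF smult_Ext_additive_left[OF N]]
             additive_mapD[OF extend_map_additive[OF fk]])
  qed
  then show ?thesis
    using extend_map_additive[OF fk]
    by (simp add: lhom_def linear_map_def additive_map_def) (simp add: extend_map_def)
qed

end

end

section \<open>Generators and linear algebra\<close>

definition lincomb :: "('r, 'm, 'x) module_scheme \<Rightarrow> ('m \<Rightarrow> 'r) \<Rightarrow> 'm set \<Rightarrow> 'm" where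
  "lincomb M c B = (\<Oplus>\<^bsub>M\<^esub>b\<in>B. c b \<odot>\<^bsub>M\<^esub> b)"

lemma finitely_generated_lincomb: "finitely_generated R M \<longleftrightarrow> (\<exists>B. finite B \<and> B \<subseteq> carrier M \<and>
     (\<forall>x\<in>carrier M. \<exists>c\<in>B \<rightarrow> carrier R. x = lincomb M c B))"
  by (simp add: finitely_generated_def lincomb_def)

text \<open>Generation and independence relative to a submodule S stand in for statements about the
  quotient by S. With S = 0 they give bases, with S a subspace they give separating
  functionals.\<close>

definition generates_modulo :: "('r, 'y) ring_scheme \<Rightarrow> ('r, 'm, 'x) module_scheme \<Rightarrow> 'm set \<Rightarrow> 'm set \<Rightarrow> bool" where
  "generates_modulo R M S B \<longleftrightarrow> finite B \<and> B \<subseteq> carrier M \<and>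
     (\<forall>x\<in>carrier M. \<exists>s\<in>S. \<exists>c\<in>B \<rightarrow> carrier R. x = s \<oplus>\<^bsub>M\<^esub> lincomb M c B)"

definition independent_modulo :: "('r, 'y) ring_scheme \<Rightarrow> ('r, 'm, 'x) module_scheme \<Rightarrow> 'm set \<Rightarrow> 'm set \<Rightarrow> bool" where
  "independent_modulo R M S B \<longleftrightarrow>
     (\<forall>c\<in>B \<rightarrow> carrier R. lincomb M c B \<in> S \<longrightarrow> (\<forall>b\<in>B. c b = \<zero>\<^bsub>R\<^esub>))"

section \<open>Linear combinations, minimal generating sets and coordinates\<close>

context left_module
begin

lemma term_closed: "B \<subseteq> carrier M \<Longrightarrow> c \<in> B \<rightarrow> carrier R \<Longrightarrow> (\<lambda>b. c b \<odot>\<^bsub>M\<^esub> b) \<in> B \<rightarrow> carrier M"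
  by (auto intro!: smult_closed)

lemma lincomb_closed: "B \<subseteq> carrier M \<Longrightarrow> c \<in> B \<rightarrow> carrier R \<Longrightarrow> lincomb M c B \<in> carrier M"
  unfolding lincomb_def by (intro M.finsum_closed term_closed)

lemma lincomb_cong: "B \<subseteq> carrier M \<Longrightarrow> d \<in> B \<rightarrow> carrier R \<Longrightarrow> (\<And>b. b \<in> B \<Longrightarrow> c b = d b) \<Longrightarrow> lincomb M c B = lincomb M d B"
  unfolding lincomb_def by (intro M.finsum_cong') (auto intro!: smult_closed)

lemma lincomb_add:
  assumes "B \<subseteq> carrier M" "c \<in> B \<rightarrow> carrier R" "d \<in> B \<rightarrow> carrier R"
  shows "lincomb M (\<lambda>b. c b \<oplus>\<^bsub>R\<^esub> d b) B = lincomb M c B \<oplus>\<^bsub>M\<^esub> lincomb M d B"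
proof -
  have "lincomb M (\<lambda>b. c b \<oplus>\<^bsub>R\<^esub> d b) B = (\<Oplus>\<^bsub>M\<^esub>b\<in>B. c b \<odot>\<^bsub>M\<^esub> b \<oplus>\<^bsub>M\<^esub> d b \<odot>\<^bsub>M\<^esub> b)"
    unfolding lincomb_def
    by (intro M.finsum_cong') (use assms in \<open>auto simp: smult_l_distr Pi_iff subset_iff intro!: smult_closed M.a_closed\<close>)
  then show ?thesis
    unfolding lincomb_def by (simp add: M.finsum_addf term_closed[OF assms(1)] assms)
qed

lemma lincomb_smult:
  assumes "finite B" "B \<subseteq> carrier M" "c \<in> B \<rightarrow> carrier R" "r \<in> carrier R"
  shows "lincomb M (\<lambda>b. r \<otimes>\<^bsub>R\<^esub> c b) B = r \<odot>\<^bsub>M\<^esub> lincomb M c B"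
proof -
  have "lincomb M (\<lambda>b. r \<otimes>\<^bsub>R\<^esub> c b) B = (\<Oplus>\<^bsub>M\<^esub>b\<in>B. r \<odot>\<^bsub>M\<^esub> (c b \<odot>\<^bsub>M\<^esub> b))"
    unfolding lincomb_def
    by (intro M.finsum_cong') (use assms in \<open>auto simp: smult_assoc Pi_iff subset_iff intro!: smult_closed\<close>)
  then show ?thesis
    unfolding lincomb_def using smult_finsum_right[OF assms(4,1) term_closed[OF assms(2,3)]] by simp
qed

lemma lincomb_zero: "B \<subseteq> carrier M \<Longrightarrow> (\<And>b. b \<in> B \<Longrightarrow> c b = \<zero>\<^bsub>R\<^esub>) \<Longrightarrow> lincomb M c B = \<zero>\<^bsub>M\<^esub>"
proof -
  assume B: "B \<subseteq> carrier M" "\<And>b. b \<in> B \<Longrightarrow> c b = \<zero>\<^bsub>R\<^esub>"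
  have "lincomb M c B = (\<Oplus>\<^bsub>M\<^esub>b\<in>B. \<zero>\<^bsub>M\<^esub>)"
    unfolding lincomb_def by (intro M.finsum_cong') (use B in \<open>auto simp: smult_zero_left subset_iff\<close>)
  then show ?thesis by simp
qed

lemma lincomb_remove:
  assumes "finite B" "B \<subseteq> carrier M" "c \<in> B \<rightarrow> carrier R" "b0 \<in> B" "c b0 = \<zero>\<^bsub>R\<^esub>"
  shows "lincomb M c B = lincomb M c (B - {b0})"
proof -
  have B: "B = insert b0 (B - {b0})" using assms by auto
  have b0: "b0 \<in> carrier M" using assms by auto
  have "lincomb M c (insert b0 (B - {b0})) = c b0 \<odot>\<^bsub>M\<^esub> b0 \<oplus>\<^bsub>M\<^esub> lincomb M c (B - {b0})"
    unfolding lincomb_def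
    by (rule M.finsum_insert) (use assms term_closed[OF assms(2,3)] in \<open>auto intro!: smult_closed\<close>)
  then show ?thesis
    using B b0 assms lincomb_closed[of "B - {b0}" c] by (simp add: smult_zero_left) (metis DiffD1 Pi_iff subset_iff lincomb_closed[of "B - {b0}" c] M.l_zero)
qed

lemma lincomb_diff:
  assumes "B \<subseteq> carrier M" "finite B" "c \<in> B \<rightarrow> carrier R" "d \<in> B \<rightarrow> carrier R"
  shows "lincomb M (\<lambda>b. c b \<ominus>\<^bsub>R\<^esub> d b) B = lincomb M c B \<ominus>\<^bsub>M\<^esub> lincomb M d B"
proof -
  have "lincomb M c B = lincomb M (\<lambda>b. (c b \<ominus>\<^bsub>R\<^esub> d b) \<oplus>\<^bsub>R\<^esub> d b) B"
    by (rule lincomb_cong) (use assms in \<open>auto simp: a_minus_def R.a_assoc R.l_neg Pi_iff\<close>)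
  also have "\<dots> = lincomb M (\<lambda>b. c b \<ominus>\<^bsub>R\<^esub> d b) B \<oplus>\<^bsub>M\<^esub> lincomb M d B"
    by (rule lincomb_add) (use assms in auto)
  finally have e: "lincomb M c B = lincomb M (\<lambda>b. c b \<ominus>\<^bsub>R\<^esub> d b) B \<oplus>\<^bsub>M\<^esub> lincomb M d B" .
  have cl: "lincomb M (\<lambda>b. c b \<ominus>\<^bsub>R\<^esub> d b) B \<in> carrier M" "lincomb M d B \<in> carrier M"
    using assms by (auto intro!: lincomb_closed)
  show ?thesis unfolding e using cl by (simp add: a_minus_def M.a_assoc M.r_neg)
qed

lemma smult_diff_cancel: "x \<in> carrier M \<Longrightarrow> y \<in> carrier M \<Longrightarrow> x \<ominus>\<^bsub>M\<^esub> y = \<zero>\<^bsub>M\<^esub> \<longleftrightarrow> x = y"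
  using M.eq_of_diff_zero[of x y] by (auto simp: a_minus_def M.r_neg)

lemma submodule_closed:
  assumes "submodule S R M"
  shows "x \<in> S \<Longrightarrow> x \<in> carrier M" "\<zero>\<^bsub>M\<^esub> \<in> S" "x \<in> S \<Longrightarrow> y \<in> S \<Longrightarrow> x \<oplus>\<^bsub>M\<^esub> y \<in> S"
    "x \<in> S \<Longrightarrow> \<ominus>\<^bsub>M\<^esub> x \<in> S" "a \<in> carrier R \<Longrightarrow> x \<in> S \<Longrightarrow> a \<odot>\<^bsub>M\<^esub> x \<in> S"
    "x \<in> S \<Longrightarrow> y \<in> S \<Longrightarrow> x \<ominus>\<^bsub>M\<^esub> y \<in> S"
proof -
  interpret S: submodule S R M by fact
  show "x \<in> S \<Longrightarrow> x \<in> carrier M" "\<zero>\<^bsub>M\<^esub> \<in> S" and add: "\<And>x y. x \<in> S \<Longrightarrow> y \<in> S \<Longrightarrow> x \<oplus>\<^bsub>M\<^esub> y \<in> S"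
    and minus: "\<And>x. x \<in> S \<Longrightarrow> \<ominus>\<^bsub>M\<^esub> x \<in> S" and "a \<in> carrier R \<Longrightarrow> x \<in> S \<Longrightarrow> a \<odot>\<^bsub>M\<^esub> x \<in> S"
    using S.subset S.one_closed S.m_closed S.m_inv_closed S.smult_closed by (auto simp: a_inv_def)
  show "x \<in> S \<Longrightarrow> y \<in> S \<Longrightarrow> x \<ominus>\<^bsub>M\<^esub> y \<in> S" using add[OF _ minus] by (simp add: a_minus_def)
qed

text \<open>Take a generating set of least cardinality. A relation with a unit at b0 would express
  b0 through the other generators, so no such relation exists. Over a field this is independence;
  over K[t]/(t^p) it says that the coefficients of a relation lie in (t).\<close>

lemma minimal_generators:
  assumes S: "submodule S R M" and gen: "generates_modulo R M S B0"
  obtains B where "generates_modulo R M S B"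
    "\<forall>c\<in>B \<rightarrow> carrier R. lincomb M c B \<in> S \<longrightarrow> (\<forall>b\<in>B. c b \<notin> Units R)"
proof -
  define B where "B = arg_min card (generates_modulo R M S)"
  have B: "generates_modulo R M S B"
    unfolding B_def by (rule arg_min_natI[where k = B0]) (rule gen)
  have min: "card B \<le> card B'" if "generates_modulo R M S B'" for B'
    unfolding B_def by (rule arg_min_nat_le) (rule that)
  have fin: "finite B" "B \<subseteq> carrier M" using B by (auto simp: generates_modulo_def)
  have "c b0 \<notin> Units R" if c: "c \<in> B \<rightarrow> carrier R" "lincomb M c B \<in> S" and b0: "b0 \<in> B" for c b0
  proof
    assume "c b0 \<in> Units R"
    then obtain u where u: "u \<in> carrier R" "u \<otimes>\<^bsub>R\<^esub> c b0 = \<one>\<^bsub>R\<^esub>" by (auto simp: Units_def)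
    have "generates_modulo R M S (B - {b0})" unfolding generates_modulo_def
    proof (intro conjI ballI)
      fix x assume x: "x \<in> carrier M"
      then obtain s d where d: "s \<in> S" "d \<in> B \<rightarrow> carrier R" "x = s \<oplus>\<^bsub>M\<^esub> lincomb M d B"
        using B unfolding generates_modulo_def by blast
      \<comment> \<open>With u inverse to c b0, subtracting r times the relation cancels the
        coefficient d b0; the subtracted element lies in S and is absorbed into s.\<close>
      define r where "r = d b0 \<otimes>\<^bsub>R\<^esub> u"
      have r: "r \<in> carrier R" "r \<otimes>\<^bsub>R\<^esub> c b0 = d b0" using d b0 u c by (auto simp: r_def R.m_assoc Pi_iff)
      define e where "e b = d b \<ominus>\<^bsub>R\<^esub> r \<otimes>\<^bsub>R\<^esub> c b" for b
      have rc: "(\<lambda>b. r \<otimes>\<^bsub>R\<^esub> c b) \<in> B \<rightarrow> carrier R" using r c by auto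
      have e: "e \<in> B \<rightarrow> carrier R" using d(2) c(1) r(1) by (auto simp: e_def Pi_iff)
      have "lincomb M e B = lincomb M d B \<ominus>\<^bsub>M\<^esub> r \<odot>\<^bsub>M\<^esub> lincomb M c B"
        unfolding e_def lincomb_diff[OF fin(2,1) d(2) rc] lincomb_smult[OF fin c(1) r(1)] ..
      moreover have "e b0 = \<zero>\<^bsub>R\<^esub>" using d b0 r by (auto simp: e_def a_minus_def R.r_neg Pi_iff)
      ultimately have E: "lincomb M e (B - {b0}) = lincomb M d B \<ominus>\<^bsub>M\<^esub> r \<odot>\<^bsub>M\<^esub> lincomb M c B"
        using lincomb_remove[OF fin e b0] by simp
      have rS: "r \<odot>\<^bsub>M\<^esub> lincomb M c B \<in> S" using submodule_closed(5)[OF S r(1) c(2)] .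
      have "x = (s \<oplus>\<^bsub>M\<^esub> r \<odot>\<^bsub>M\<^esub> lincomb M c B) \<oplus>\<^bsub>M\<^esub> lincomb M e (B - {b0})"
        using submodule_closed(1)[OF S rS] submodule_closed(1)[OF S d(1)] lincomb_closed[OF fin(2) d(2)] unfolding E d(3)
        by (simp add: a_minus_def M.a_ac M.r_neg M.r_neg1 M.r_neg2)
      moreover have "s \<oplus>\<^bsub>M\<^esub> r \<odot>\<^bsub>M\<^esub> lincomb M c B \<in> S" using rS d(1) submodule_closed(3)[OF S] by simp
      ultimately show "\<exists>s\<in>S. \<exists>c\<in>B - {b0} \<rightarrow> carrier R. x = s \<oplus>\<^bsub>M\<^esub> lincomb M c (B - {b0})"
        using e by (intro bexI[of _ "s \<oplus>\<^bsub>M\<^esub> r \<odot>\<^bsub>M\<^esub> lincomb M c B"] bexI[of _ e]) auto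
    qed (use fin in auto)
    from min[OF this] show False
      using fin b0 by (metis card_Diff1_less not_less)
  qed
  then show ?thesis using that B by blast
qed

lemma finitely_generated_modulo:
  assumes "finitely_generated R M" "submodule S R M"
  obtains B where "generates_modulo R M S B"
proof -
  obtain B where B: "finite B" "B \<subseteq> carrier M" "\<forall>x\<in>carrier M. \<exists>c\<in>B \<rightarrow> carrier R. x = lincomb M c B"
    using assms(1) unfolding finitely_generated_lincomb by (elim exE conjE)
  have "\<exists>s\<in>S. \<exists>c\<in>B \<rightarrow> carrier R. x = s \<oplus>\<^bsub>M\<^esub> lincomb M c B" if x: "x \<in> carrier M" for x
  proof -
    obtain c where c: "c \<in> B \<rightarrow> carrier R" "x = lincomb M c B" using bspec[OF B(3) x] by blast
    have "x = \<zero>\<^bsub>M\<^esub> \<oplus>\<^bsub>M\<^esub> lincomb M c B" using c(2) x by simp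
    then show ?thesis using c(1) submodule_closed(2)[OF assms(2)] by blast
  qed
  then show ?thesis using that[of B] B(1,2) by (simp add: generates_modulo_def)
qed

lemma zero_submodule: "submodule {\<zero>\<^bsub>M\<^esub>} R M"
  using M.add.triv_subgroup by (auto simp: submodule_def submodule_axioms_def smult_zero_right)

lemma submoduleI':
  assumes "H \<subseteq> carrier M" "\<zero>\<^bsub>M\<^esub> \<in> H" "\<And>x y. x \<in> H \<Longrightarrow> y \<in> H \<Longrightarrow> x \<oplus>\<^bsub>M\<^esub> y \<in> H"
    "\<And>a x. a \<in> carrier R \<Longrightarrow> x \<in> H \<Longrightarrow> a \<odot>\<^bsub>M\<^esub> x \<in> H"
  shows "submodule H R M"
proof -
  have "\<ominus>\<^bsub>M\<^esub> x \<in> H" if "x \<in> H" for x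
    using assms(4)[of "\<ominus>\<^bsub>R\<^esub> \<one>\<^bsub>R\<^esub>" x] that assms(1) by (auto simp: smult_minus_left smult_one subset_iff)
  then show ?thesis
    using assms by (intro submodule.intro subgroup.intro) (auto simp: submodule_axioms_def a_inv_def[symmetric])
qed

text \<open>The coefficients of \<open>x\<close> modulo \<open>S\<close> are unique, so choosing them is linear in \<open>x\<close>.\<close>

lemma coordinates:
  assumes S: "submodule S R M" and B: "generates_modulo R M S B"
    and ind: "independent_modulo R M S B"
  obtains co where "\<forall>x\<in>carrier M. co x \<in> B \<rightarrow> carrier R"
    "\<forall>x\<in>carrier M. x \<ominus>\<^bsub>M\<^esub> lincomb M (co x) B \<in> S"
    "\<forall>x\<in>carrier M. \<forall>c\<in>B \<rightarrow> carrier R. x \<ominus>\<^bsub>M\<^esub> lincomb M c B \<in> S \<longrightarrow> (\<forall>b\<in>B. co x b = c b)"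
    "\<forall>x\<in>carrier M. \<forall>y\<in>carrier M. \<forall>b\<in>B. co (x \<oplus>\<^bsub>M\<^esub> y) b = co x b \<oplus>\<^bsub>R\<^esub> co y b"
    "\<forall>r\<in>carrier R. \<forall>x\<in>carrier M. \<forall>b\<in>B. co (r \<odot>\<^bsub>M\<^esub> x) b = r \<otimes>\<^bsub>R\<^esub> co x b"
proof -
  have fin: "finite B" "B \<subseteq> carrier M" using B by (auto simp: generates_modulo_def)
  have ex: "\<exists>c. c \<in> B \<rightarrow> carrier R \<and> x \<ominus>\<^bsub>M\<^esub> lincomb M c B \<in> S" if "x \<in> carrier M" for x
  proof -
    obtain s c where sc: "s \<in> S" "c \<in> B \<rightarrow> carrier R" "x = s \<oplus>\<^bsub>M\<^esub> lincomb M c B"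
      using B \<open>x \<in> carrier M\<close> by (force simp: generates_modulo_def)
    then have "x \<ominus>\<^bsub>M\<^esub> lincomb M c B = s"
      using submodule_closed(1)[OF S sc(1)] lincomb_closed[OF fin(2) sc(2)]
      by (simp add: a_minus_def M.a_assoc M.r_neg)
    then show ?thesis using sc by auto
  qed
  define co where "co x = (SOME c. c \<in> B \<rightarrow> carrier R \<and> x \<ominus>\<^bsub>M\<^esub> lincomb M c B \<in> S)" for x
  have co: "co x \<in> B \<rightarrow> carrier R" "x \<ominus>\<^bsub>M\<^esub> lincomb M (co x) B \<in> S" if "x \<in> carrier M" for x
    using someI_ex[OF ex[OF that]] by (auto simp: co_def)
  have uniq: "co x b = c b" if x: "x \<in> carrier M" and c: "c \<in> B \<rightarrow> carrier R" "x \<ominus>\<^bsub>M\<^esub> lincomb M c B \<in> S" and b: "b \<in> B" for x c b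
  proof -
    have cl: "lincomb M c B \<in> carrier M" "lincomb M (co x) B \<in> carrier M"
      using lincomb_closed[OF fin(2)] c(1) co(1)[OF x] by auto
    have "(x \<ominus>\<^bsub>M\<^esub> lincomb M c B) \<ominus>\<^bsub>M\<^esub> (x \<ominus>\<^bsub>M\<^esub> lincomb M (co x) B) \<in> S"
      by (rule submodule_closed(6)[OF S c(2) co(2)[OF x]])
    also have "(x \<ominus>\<^bsub>M\<^esub> lincomb M c B) \<ominus>\<^bsub>M\<^esub> (x \<ominus>\<^bsub>M\<^esub> lincomb M (co x) B) = lincomb M (co x) B \<ominus>\<^bsub>M\<^esub> lincomb M c B"
      using cl x by (simp add: a_minus_def M.minus_add M.a_ac M.r_neg1 M.r_neg2)
    also have "\<dots> = lincomb M (\<lambda>b. co x b \<ominus>\<^bsub>R\<^esub> c b) B"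
      by (rule lincomb_diff[OF fin(2,1) co(1)[OF x] c(1), symmetric])
    finally have "co x b \<ominus>\<^bsub>R\<^esub> c b = \<zero>\<^bsub>R\<^esub>"
      using co(1)[OF x] c(1) b by (intro ind[unfolded independent_modulo_def, rule_format, of "\<lambda>b. co x b \<ominus>\<^bsub>R\<^esub> c b"]) (auto simp: Pi_iff)
    then show ?thesis using co(1)[OF x] c(1) b R.eq_of_diff_zero[of "co x b" "c b"] by auto
  qed
  show ?thesis
  proof (rule that[of co]; intro ballI impI)
    fix x y b assume xy: "x \<in> carrier M" "y \<in> carrier M" "b \<in> B"
    note cl = lincomb_closed[OF fin(2) co(1)[OF xy(1)]] lincomb_closed[OF fin(2) co(1)[OF xy(2)]]
    have "(x \<ominus>\<^bsub>M\<^esub> lincomb M (co x) B) \<oplus>\<^bsub>M\<^esub> (y \<ominus>\<^bsub>M\<^esub> lincomb M (co y) B) \<in> S"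
      by (rule submodule_closed(3)[OF S co(2)[OF xy(1)] co(2)[OF xy(2)]])
    also have "(x \<ominus>\<^bsub>M\<^esub> lincomb M (co x) B) \<oplus>\<^bsub>M\<^esub> (y \<ominus>\<^bsub>M\<^esub> lincomb M (co y) B) =
       (x \<oplus>\<^bsub>M\<^esub> y) \<ominus>\<^bsub>M\<^esub> lincomb M (\<lambda>b. co x b \<oplus>\<^bsub>R\<^esub> co y b) B"
      using cl xy by (simp add: lincomb_add[OF fin(2) co(1)[OF xy(1)] co(1)[OF xy(2)]] a_minus_def M.minus_add M.a_ac)
    finally show "co (x \<oplus>\<^bsub>M\<^esub> y) b = co x b \<oplus>\<^bsub>R\<^esub> co y b"
      using xy co(1)[OF xy(1)] co(1)[OF xy(2)] by (intro uniq) auto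
  next
    fix r x b assume r: "r \<in> carrier R" and x: "x \<in> carrier M" and b: "b \<in> B"
    have "r \<odot>\<^bsub>M\<^esub> (x \<ominus>\<^bsub>M\<^esub> lincomb M (co x) B) \<in> S"
      by (rule submodule_closed(5)[OF S r co(2)[OF x]])
    also have "r \<odot>\<^bsub>M\<^esub> (x \<ominus>\<^bsub>M\<^esub> lincomb M (co x) B) = r \<odot>\<^bsub>M\<^esub> x \<ominus>\<^bsub>M\<^esub> lincomb M (\<lambda>b. r \<otimes>\<^bsub>R\<^esub> co x b) B"
      using x r lincomb_closed[OF fin(2) co(1)[OF x]]
      by (simp add: smult_diff_right lincomb_smult[OF fin co(1)[OF x] r])
    finally show "co (r \<odot>\<^bsub>M\<^esub> x) b = r \<otimes>\<^bsub>R\<^esub> co x b"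
      using x r b co(1)[OF x] by (intro uniq) (auto intro: smult_closed)
    next
    fix x c b assume "x \<in> carrier M" "c \<in> B \<rightarrow> carrier R" "x \<ominus>\<^bsub>M\<^esub> lincomb M c B \<in> S" "b \<in> B"
    then show "co x b = c b" by (rule uniq)
  qed (use co in blast)+
qed

text \<open>Choose preimages of the values of f on the basis and extend by the coordinate functions.
  The types of the two target modules are unrestricted.\<close>

lemma lift_free:
  assumes B: "generates_modulo R M {\<zero>\<^bsub>M\<^esub>} B"
    and ind: "independent_modulo R M {\<zero>\<^bsub>M\<^esub>} B"
    and N: "left_module R N" and N': "left_module R N'"
    and g: "linear_map R N N' g" "g ` carrier N = carrier N'" and f: "linear_map R M N' f"
  obtains h where "h \<in> lhom R M N" "\<And>x. x \<in> carrier M \<Longrightarrow> g (h x) = f x"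
proof -
  interpret N: left_module R N by (rule N)
  interpret N': left_module R N' by (rule N')
  have fin: "finite B" "B \<subseteq> carrier M" using B by (auto simp: generates_modulo_def)
  obtain co where co': "\<forall>x\<in>carrier M. co x \<in> B \<rightarrow> carrier R"
    "\<forall>x\<in>carrier M. x \<ominus>\<^bsub>M\<^esub> lincomb M (co x) B \<in> {\<zero>\<^bsub>M\<^esub>}"
    "\<forall>x\<in>carrier M. \<forall>c\<in>B \<rightarrow> carrier R. x \<ominus>\<^bsub>M\<^esub> lincomb M c B \<in> {\<zero>\<^bsub>M\<^esub>} \<longrightarrow> (\<forall>b\<in>B. co x b = c b)"
    "\<forall>x\<in>carrier M. \<forall>y\<in>carrier M. \<forall>b\<in>B. co (x \<oplus>\<^bsub>M\<^esub> y) b = co x b \<oplus>\<^bsub>R\<^esub> co y b"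
    "\<forall>r\<in>carrier R. \<forall>x\<in>carrier M. \<forall>b\<in>B. co (r \<odot>\<^bsub>M\<^esub> x) b = r \<otimes>\<^bsub>R\<^esub> co x b"
    using coordinates[OF zero_submodule B ind] .
  note co = co'[rule_format]
  define n where "n b = (SOME y. y \<in> carrier N \<and> g y = f b)" for b
  have n: "n b \<in> carrier N" "g (n b) = f b" if "b \<in> B" for b
  proof -
    have "f b \<in> g ` carrier N" unfolding g(2) using that fin linear_mapD(1)[OF f] by auto
    then have "\<exists>y. y \<in> carrier N \<and> g y = f b" by auto
    then show "n b \<in> carrier N" "g (n b) = f b" unfolding n_def by (metis (mono_tags, lifting) someI_ex)+
  qed
  define h where "h = (\<lambda>x\<in>carrier M. \<Oplus>\<^bsub>N\<^esub>b\<in>B. co x b \<odot>\<^bsub>N\<^esub> n b)"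
  have tc: "(\<lambda>b. co x b \<odot>\<^bsub>N\<^esub> n b) \<in> B \<rightarrow> carrier N" if "x \<in> carrier M" for x
    using co(1)[OF that] n by (auto intro!: N.smult_closed)
  have "h \<in> lhom R M N" unfolding lhom_def linear_map_def
  proof (intro CollectI conjI ballI)
    show "h \<in> carrier M \<rightarrow> carrier N" using tc by (auto simp: h_def)
  next
    fix x y assume xy: "x \<in> carrier M" "y \<in> carrier M"
    have "(\<Oplus>\<^bsub>N\<^esub>b\<in>B. co (x \<oplus>\<^bsub>M\<^esub> y) b \<odot>\<^bsub>N\<^esub> n b) = (\<Oplus>\<^bsub>N\<^esub>b\<in>B. co x b \<odot>\<^bsub>N\<^esub> n b \<oplus>\<^bsub>N\<^esub> co y b \<odot>\<^bsub>N\<^esub> n b)"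
      using xy co(1)[OF xy(1)] co(1)[OF xy(2)] n tc[of x] tc[of y]
      by (intro N.finsum_cong') (auto simp: co(4) N.smult_l_distr Pi_iff)
    then show "h (x \<oplus>\<^bsub>M\<^esub> y) = h x \<oplus>\<^bsub>N\<^esub> h y"
      using xy N.finsum_addf[OF tc[OF xy(1)] tc[OF xy(2)]] by (simp add: h_def)
  next
    fix r x assume r: "r \<in> carrier R" and x: "x \<in> carrier M"
    have "(\<Oplus>\<^bsub>N\<^esub>b\<in>B. co (r \<odot>\<^bsub>M\<^esub> x) b \<odot>\<^bsub>N\<^esub> n b) = (\<Oplus>\<^bsub>N\<^esub>b\<in>B. r \<odot>\<^bsub>N\<^esub> (co x b \<odot>\<^bsub>N\<^esub> n b))"
      using x r co(1)[OF x] n tc[of x]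
      by (intro N.finsum_cong') (auto simp: co(5) N.smult_assoc Pi_iff intro!: N.smult_closed)
    then show "h (r \<odot>\<^bsub>M\<^esub> x) = r \<odot>\<^bsub>N\<^esub> h x"
      using r x N.smult_finsum_right[OF r fin(1) tc[OF x]] smult_closed[OF r x] by (simp add: h_def)
  qed (simp add: h_def)
  moreover have "g (h x) = f x" if x: "x \<in> carrier M" for x
  proof -
    have "g (h x) = (\<Oplus>\<^bsub>N'\<^esub>b\<in>B. g (co x b \<odot>\<^bsub>N\<^esub> n b))"
      using x additive_map_finsum[OF N.M_abelian N'.M_abelian linear_map_additive[OF g(1)] fin(1) tc[OF x]] by (simp add: h_def)
    also have "\<dots> = (\<Oplus>\<^bsub>N'\<^esub>b\<in>B. f (co x b \<odot>\<^bsub>M\<^esub> b))"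
      using co(1)[OF x] n fin linear_mapD[OF g(1)] linear_mapD[OF f]
      by (intro N'.finsum_cong') (auto simp: Pi_iff subset_iff intro!: smult_closed N'.smult_closed)
    also have "\<dots> = f (lincomb M (co x) B)"
      unfolding lincomb_def
      by (rule additive_map_finsum[OF M_abelian N'.M_abelian linear_map_additive[OF f] fin(1) term_closed[OF fin(2) co(1)[OF x]], symmetric])
    also have "lincomb M (co x) B = x"
      using M.eq_of_diff_zero[OF x lincomb_closed[OF fin(2) co(1)[OF x]]] co(2)[OF x] by simp
    finally show ?thesis .
  qed
  ultimately show ?thesis using that by blast
qed

end

text \<open>An element is recovered from one chosen tuple of coefficients along an enumeration of
  the generators, and such a tuple is a sequence in R. The injection respects no structure; that is
  transported afterwards.\<close>

lemma finitely_generated_embedding: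
  fixes R :: "('r, 'y) ring_scheme" and M :: "('r, 'm, 'x) module_scheme"
  assumes "left_module R M" "finitely_generated R M"
  shows "\<exists>j :: 'm \<Rightarrow> nat \<Rightarrow> 'r. inj_on j (carrier M)"
proof -
  interpret left_module R M by fact
  obtain B where B: "finite B" "B \<subseteq> carrier M" "\<forall>x\<in>carrier M. \<exists>c\<in>B \<rightarrow> carrier R. x = lincomb M c B"
    using assms(2) unfolding finitely_generated_lincomb by (elim exE conjE)
  obtain e :: "nat \<Rightarrow> 'm" where e: "B = e ` {..<card B}"
    using ex_bij_betw_nat_finite[OF B(1)] by (auto simp: bij_betw_def atLeast0LessThan)
  obtain co where co: "\<And>x. x \<in> carrier M \<Longrightarrow> co x \<in> B \<rightarrow> carrier R \<and> x = lincomb M (co x) B"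
    using B(3) by metis
  have "inj_on (\<lambda>x n. co x (e n)) (carrier M)"
  proof (rule inj_onI)
    fix x y assume xy: "x \<in> carrier M" "y \<in> carrier M" and eq: "(\<lambda>n. co x (e n)) = (\<lambda>n. co y (e n))"
    have "co x b = co y b" if "b \<in> B" for b using that eq e by (metis imageE)
    then have "lincomb M (co x) B = lincomb M (co y) B" using co[OF xy(2)] B(2) by (intro lincomb_cong) auto
    then show "x = y" using co xy by metis
  qed
  then show ?thesis by blast
qed

text \<open>Makes j an isomorphism onto its image. It serves to move finitely generated modules to
  the type of the test modules for projectivity and flatness, and free covers to the type of
  \<open>fd_modules\<close>.\<close>

definition transport_module :: "('m \<Rightarrow> 'n) \<Rightarrow> ('r, 'm, 'x) module_scheme \<Rightarrow> ('r, 'n) module" where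
  "transport_module j M = (let i = inv_into (carrier M) j in
     \<lparr>carrier = j ` carrier M, monoid.mult = undefined, one = undefined, ring.zero = j \<zero>\<^bsub>M\<^esub>,
      add = (\<lambda>x y. j (i x \<oplus>\<^bsub>M\<^esub> i y)), smult = (\<lambda>r x. j (r \<odot>\<^bsub>M\<^esub> i x))\<rparr>)"

lemma transport_module:
  assumes M: "left_module R M" and j: "inj_on j (carrier M)"
  shows "left_module R (transport_module j M)"
    and "(\<lambda>x\<in>carrier M. j x) \<in> lhom R M (transport_module j M)"
    and "(\<lambda>x\<in>j ` carrier M. inv_into (carrier M) j x) \<in> lhom R (transport_module j M) M"
    and "carrier (transport_module j M) = j ` carrier M"
proof -
  interpret M: left_module R M by (rule M)
  let ?N = "transport_module j M"
  have i: "inv_into (carrier M) j (j x) = x" if "x \<in> carrier M" for x using j that by simp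
  have c: "carrier ?N = j ` carrier M" "\<zero>\<^bsub>?N\<^esub> = j \<zero>\<^bsub>M\<^esub>"
    by (simp_all add: transport_module_def Let_def)
  have a: "j x \<oplus>\<^bsub>?N\<^esub> j y = j (x \<oplus>\<^bsub>M\<^esub> y)" if "x \<in> carrier M" "y \<in> carrier M" for x y
    using that i by (simp add: transport_module_def Let_def)
  have s: "r \<odot>\<^bsub>?N\<^esub> j x = j (r \<odot>\<^bsub>M\<^esub> x)" if "x \<in> carrier M" for r x
    using that i by (simp add: transport_module_def Let_def)
  note cl = M.smult_closed
  have ab: "abelian_group ?N"
  proof (rule abelian_groupI)
    fix x assume "x \<in> carrier ?N"
    then obtain u where u: "u \<in> carrier M" "x = j u" by (auto simp: c)
    then show "\<exists>y\<in>carrier ?N. y \<oplus>\<^bsub>?N\<^esub> x = \<zero>\<^bsub>?N\<^esub>"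
      by (intro bexI[of _ "j (\<ominus>\<^bsub>M\<^esub> u)"]) (simp_all add: a c M.l_neg)
  qed (auto simp: c a M.a_ac)
  show "left_module R ?N"
    by (rule left_moduleI[OF M.R.ring_axioms ab])
       (auto simp: c a s cl M.smult_l_distr M.smult_r_distr M.smult_assoc M.smult_one)
  show "(\<lambda>x\<in>carrier M. j x) \<in> lhom R M ?N"
    by (auto simp: lhom_def linear_map_def c a s cl)
  show "(\<lambda>x\<in>j ` carrier M. inv_into (carrier M) j x) \<in> lhom R ?N M"
    by (auto simp: lhom_def linear_map_def c a s cl i)
  show "carrier ?N = j ` carrier M" by (rule c)
qed

lemma lhom_compose:
  assumes "f \<in> lhom R L M" "g \<in> lhom R M N" and cl: "left_module R L"
  shows "compose (carrier L) g f \<in> lhom R L N"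
proof -
  interpret L: left_module R L by (rule cl)
  show ?thesis
    using lhomD(1-3)[OF assms(1)] lhomD(1-3)[OF assms(2)] L.smult_closed
    by (auto simp: lhom_def linear_map_def compose_def)
qed

text \<open>\<^const>\<open>projective_module\<close> only tests modules on \<open>nat \<Rightarrow> 'r\<close>; finitely generated ones are moved
  there.\<close>

lemma projective_lift:
  fixes R :: "('r, 'y) ring_scheme"
  assumes P: "projective_module R P" and N: "left_module R N" and N': "left_module R N'"
    and fg: "finitely_generated R N" "finitely_generated R N'"
    and g: "g \<in> lhom R N N'" "g ` carrier N = carrier N'" and f: "f \<in> lhom R P N'"
  obtains h where "h \<in> lhom R P N" "\<And>x. x \<in> carrier P \<Longrightarrow> g (h x) = f x"
proof -
  obtain j :: "_ \<Rightarrow> nat \<Rightarrow> 'r" where j: "inj_on j (carrier N)"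
    using finitely_generated_embedding[OF N fg(1)] by blast
  obtain j' :: "_ \<Rightarrow> nat \<Rightarrow> 'r" where j': "inj_on j' (carrier N')"
    using finitely_generated_embedding[OF N' fg(2)] by blast
  let ?N = "transport_module j N" and ?N' = "transport_module j' N'"
  note t = transport_module[OF N j] and t' = transport_module[OF N' j']
  have LP: "left_module R P" using P by (simp add: projective_module_def)
  let ?i = "\<lambda>x\<in>j ` carrier N. inv_into (carrier N) j x" and ?j' = "\<lambda>x\<in>carrier N'. j' x"
  let ?g = "compose (carrier ?N) ?j' (compose (carrier ?N) g ?i)"
  have g': "?g \<in> lhom R ?N ?N'" by (rule lhom_compose[OF lhom_compose[OF t(3) g(1) t(1)] t'(2) t(1)])
  have ge: "?g (j y) = j' (g y)" if "y \<in> carrier N" for y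
    using that j lhomD(1)[OF g(1)] by (simp add: compose_def t(4))
  have gs: "?g ` carrier ?N = carrier ?N'"
  proof -
    have "?g ` carrier ?N = (\<lambda>y. j' (g y)) ` carrier N"
      unfolding t(4) image_image using ge[unfolded t(4)] by (intro image_cong) auto
    also have "\<dots> = j' ` carrier N'" unfolding g(2)[symmetric] by auto
    finally show ?thesis by (simp add: t'(4))
  qed
  let ?f = "compose (carrier P) ?j' f"
  have f': "?f \<in> lhom R P ?N'" by (rule lhom_compose[OF f t'(2) LP])
  obtain h where h: "h \<in> lhom R P ?N" "\<forall>x\<in>carrier P. ?g (h x) = ?f x"
    using P t(1) t'(1) g' gs f' unfolding projective_module_def by blast
  let ?h = "compose (carrier P) ?i h"
  have "?h \<in> lhom R P N" by (rule lhom_compose[OF h(1) t(3) LP])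
  moreover have "g (?h x) = f x" if x: "x \<in> carrier P" for x
  proof -
    obtain y where y: "y \<in> carrier N" "h x = j y" using lhomD(1)[OF h(1) x] by (auto simp: t(4))
    have "j' (g y) = j' (f x)" using bspec[OF h(2) x] x ge[OF y(1)] unfolding y(2) by (simp add: compose_eq lhomD(1)[OF f x])
    then have "g y = f x" using inj_onD[OF j'] lhomD(1)[OF f x] lhomD(1)[OF g(1) y(1)] by blast
    then show ?thesis using x y j by (simp add: compose_def)
  qed
  ultimately show ?thesis using that by blast
qed

text \<open>A basis of M modulo S has a coordinate that does not vanish at x, for otherwise x would
  lie in S. All coordinates vanish on S by uniqueness.\<close>

lemma (in field) separate:
  assumes M: "left_module R M" and fg: "finitely_generated R M" and S: "submodule S R M"
    and x: "x \<in> carrier M" "x \<notin> S"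
  obtains l where "linear_map R M (regular R) l" "\<And>y. y \<in> S \<Longrightarrow> l y = \<zero>" "l x \<noteq> \<zero>"
proof -
  interpret M: left_module R M by (rule M)
  obtain B0 where B0: "generates_modulo R M S B0" using M.finitely_generated_modulo[OF fg S] .
  obtain B where B: "generates_modulo R M S B"
    and min: "\<forall>c\<in>B \<rightarrow> carrier R. lincomb M c B \<in> S \<longrightarrow> (\<forall>b\<in>B. c b \<notin> Units R)"
    using M.minimal_generators[OF S B0] .
  have fin: "finite B" "B \<subseteq> carrier M" using B by (auto simp: generates_modulo_def)
  \<comment> \<open>Over a field the only non-unit is zero, so minimality is independence.\<close>
  have ind: "independent_modulo R M S B"
    using min unfolding independent_modulo_def field_Units by blast
  obtain co where co': "\<forall>x\<in>carrier M. co x \<in> B \<rightarrow> carrier R"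
    "\<forall>x\<in>carrier M. x \<ominus>\<^bsub>M\<^esub> lincomb M (co x) B \<in> S"
    "\<forall>x\<in>carrier M. \<forall>c\<in>B \<rightarrow> carrier R. x \<ominus>\<^bsub>M\<^esub> lincomb M c B \<in> S \<longrightarrow> (\<forall>b\<in>B. co x b = c b)"
    "\<forall>x\<in>carrier M. \<forall>y\<in>carrier M. \<forall>b\<in>B. co (x \<oplus>\<^bsub>M\<^esub> y) b = co x b \<oplus>\<^bsub>R\<^esub> co y b"
    "\<forall>r\<in>carrier R. \<forall>x\<in>carrier M. \<forall>b\<in>B. co (r \<odot>\<^bsub>M\<^esub> x) b = r \<otimes>\<^bsub>R\<^esub> co x b"
    using M.coordinates[OF S B ind] .
  note co = co'(1,2)[rule_format] and uniq = co'(3)[rule_format] and lin = co'(4,5)[rule_format]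
  have "\<exists>b\<in>B. co x b \<noteq> \<zero>"
  proof (rule ccontr)
    assume "\<not> ?thesis"
    then have "lincomb M (co x) B = \<zero>\<^bsub>M\<^esub>" by (intro M.lincomb_zero[OF fin(2)]) auto
    then show False using co(2)[OF x(1)] x
      by (simp add: a_minus_def M.M.minus_equality[of "\<zero>\<^bsub>M\<^esub>" "\<zero>\<^bsub>M\<^esub>"])
  qed
  then obtain b where b: "b \<in> B" "co x b \<noteq> \<zero>" by blast
  have "linear_map R M (regular R) (\<lambda>y. co y b)"
    using lin co(1) b by (auto simp: linear_map_def Pi_iff)
  moreover have "co y b = \<zero>" if "y \<in> S" for y
  proof (rule uniq)
    have "lincomb M (\<lambda>_. \<zero>) B = \<zero>\<^bsub>M\<^esub>" by (rule M.lincomb_zero[OF fin(2)]) simp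
    then show "y \<ominus>\<^bsub>M\<^esub> lincomb M (\<lambda>_. \<zero>) B \<in> S"
      using that M.submodule_closed(1,2,6)[OF S] by simp
  qed (use that b M.submodule_closed(1)[OF S] in auto)
  ultimately show ?thesis using that b by blast
qed

text \<open>Applied to the identity in place of f, this splits surjections of finite dimensional
  spaces.\<close>

lemma (in field) lift_vector_space:
  assumes M: "left_module R M" and fg: "finitely_generated R M"
    and N: "left_module R N" and N': "left_module R N'"
    and g: "linear_map R N N' g" "g ` carrier N = carrier N'" and f: "linear_map R M N' f"
  obtains h where "h \<in> lhom R M N" "\<And>x. x \<in> carrier M \<Longrightarrow> g (h x) = f x"
proof -
  interpret M: left_module R M by (rule M)
  obtain B0 where B0: "generates_modulo R M {\<zero>\<^bsub>M\<^esub>} B0" using M.finitely_generated_modulo[OF fg M.zero_submodule] .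
  obtain B where B: "generates_modulo R M {\<zero>\<^bsub>M\<^esub>} B"
    and min: "\<forall>c\<in>B \<rightarrow> carrier R. lincomb M c B \<in> {\<zero>\<^bsub>M\<^esub>} \<longrightarrow> (\<forall>b\<in>B. c b \<notin> Units R)"
    using M.minimal_generators[OF M.zero_submodule B0] .
  have ind: "independent_modulo R M {\<zero>\<^bsub>M\<^esub>} B"
    using min unfolding independent_modulo_def field_Units by blast
  show ?thesis using M.lift_free[OF B ind N N' g f] that by blast
qed

section \<open>Truncated polynomial rings\<close>

text \<open>Characterises K[t]/(t^p) without cosets of polynomials: a K-algebra with augmentation
  ideal (t) and t^p = 0. The condition on the annihilator of t excludes K[t]/(t^q) with 0 < q < p,
  where t^(q-1) is killed by t although t^(p-1) = 0.\<close>

locale truncated_ring = K: field K + R: cring R for K :: "'d ring" and R :: "'r ring" +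
  fixes \<epsilon> :: "'d \<Rightarrow> 'r" and aug :: "'r \<Rightarrow> 'd" and t :: 'r and p :: nat
  assumes eps_hom: "\<epsilon> \<in> ring_hom K R" and aug_hom: "aug \<in> ring_hom R K"
    and aug_eps: "c \<in> carrier K \<Longrightarrow> aug (\<epsilon> c) = c"
    and t_closed: "t \<in> carrier R" and aug_t: "aug t = \<zero>\<^bsub>K\<^esub>" and p_pos: "p > 0"
    and t_nilpotent: "t [^]\<^bsub>R\<^esub> p = \<zero>\<^bsub>R\<^esub>"
    and aug_zero: "r \<in> carrier R \<Longrightarrow> aug r = \<zero>\<^bsub>K\<^esub> \<Longrightarrow> \<exists>s\<in>carrier R. r = t \<otimes>\<^bsub>R\<^esub> s"
    and annihilator: "r \<in> carrier R \<Longrightarrow> t \<otimes>\<^bsub>R\<^esub> r = \<zero>\<^bsub>R\<^esub> \<Longrightarrow> \<exists>s\<in>carrier R. r = t [^]\<^bsub>R\<^esub> (p - 1) \<otimes>\<^bsub>R\<^esub> s"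
begin

lemma eps_closed: "c \<in> carrier K \<Longrightarrow> \<epsilon> c \<in> carrier R"
  using ring_hom_closed[OF eps_hom] .

lemma aug_closed: "r \<in> carrier R \<Longrightarrow> aug r \<in> carrier K"
  using ring_hom_closed[OF aug_hom] .

lemma pow_t_closed: "t [^]\<^bsub>R\<^esub> (n::nat) \<in> carrier R"
  using t_closed by simp

lemma decompose:
  assumes "r \<in> carrier R"
  obtains s where "s \<in> carrier R" "r = \<epsilon> (aug r) \<oplus>\<^bsub>R\<^esub> t \<otimes>\<^bsub>R\<^esub> s"
proof -
  have e: "\<epsilon> (aug r) \<in> carrier R" using assms eps_closed aug_closed by simp
  interpret h: ring_hom_cring R K aug
    using aug_hom by (unfold_locales) 
  have "aug (r \<ominus>\<^bsub>R\<^esub> \<epsilon> (aug r)) = \<zero>\<^bsub>K\<^esub>"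
    using assms e aug_closed by (simp add: a_minus_def aug_eps K.r_neg)
  then obtain s where s: "s \<in> carrier R" "r \<ominus>\<^bsub>R\<^esub> \<epsilon> (aug r) = t \<otimes>\<^bsub>R\<^esub> s"
    using aug_zero[of "r \<ominus>\<^bsub>R\<^esub> \<epsilon> (aug r)"] assms e by auto
  have "r = \<epsilon> (aug r) \<oplus>\<^bsub>R\<^esub> (r \<ominus>\<^bsub>R\<^esub> \<epsilon> (aug r))"
    using assms e by (simp add: a_minus_def R.a_lcomm[of "\<epsilon> (aug r)"] R.r_neg)
  then show ?thesis using s that by simp
qed

text \<open>R is local with maximal ideal (t): an inverse modulo t is improved to an inverse modulo
  ever higher powers of t, until t^p = 0 makes it exact.\<close>

lemma unit_of_aug:
  assumes r: "r \<in> carrier R" and "aug r \<noteq> \<zero>\<^bsub>K\<^esub>"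
  shows "r \<in> Units R"
proof -
  have ar: "aug r \<in> Units K" using assms aug_closed by (auto simp: K.field_Units)
  interpret h: ring_hom_cring R K aug
    using aug_hom by (unfold_locales)
  have approx: "\<exists>u\<in>carrier R. \<exists>w\<in>carrier R. u \<otimes>\<^bsub>R\<^esub> r = \<one>\<^bsub>R\<^esub> \<oplus>\<^bsub>R\<^esub> t [^]\<^bsub>R\<^esub> Suc j \<otimes>\<^bsub>R\<^esub> w" for j
  proof (induction j)
    case 0
    let ?u = "\<epsilon> (inv\<^bsub>K\<^esub> aug r)"
    have u: "?u \<in> carrier R" using ar eps_closed by simp
    have "aug (?u \<otimes>\<^bsub>R\<^esub> r \<ominus>\<^bsub>R\<^esub> \<one>\<^bsub>R\<^esub>) = \<zero>\<^bsub>K\<^esub>"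
      using u r ar by (simp add: a_minus_def aug_eps K.r_neg)
    then obtain w where w: "w \<in> carrier R" "?u \<otimes>\<^bsub>R\<^esub> r \<ominus>\<^bsub>R\<^esub> \<one>\<^bsub>R\<^esub> = t \<otimes>\<^bsub>R\<^esub> w"
      using aug_zero[of "?u \<otimes>\<^bsub>R\<^esub> r \<ominus>\<^bsub>R\<^esub> \<one>\<^bsub>R\<^esub>"] u r by auto
    have "?u \<otimes>\<^bsub>R\<^esub> r = \<one>\<^bsub>R\<^esub> \<oplus>\<^bsub>R\<^esub> (?u \<otimes>\<^bsub>R\<^esub> r \<ominus>\<^bsub>R\<^esub> \<one>\<^bsub>R\<^esub>)"
      using u r by (simp add: a_minus_def R.a_lcomm[of "\<one>\<^bsub>R\<^esub>"] R.r_neg)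
    then show ?case using u w t_closed by (intro bexI[of _ ?u] bexI[of _ w]) auto
  next
    case (Suc j)
    then obtain u w where uw: "u \<in> carrier R" "w \<in> carrier R"
      "u \<otimes>\<^bsub>R\<^esub> r = \<one>\<^bsub>R\<^esub> \<oplus>\<^bsub>R\<^esub> t [^]\<^bsub>R\<^esub> Suc j \<otimes>\<^bsub>R\<^esub> w" by blast
    \<comment> \<open>If u r = 1 + z, then (1 - z) u r = 1 - z^2. The error z is divisible by
      t^(j+1), so z^2 is divisible by t^(2j+2), in particular by t^(j+2).\<close>
    let ?q = "t [^]\<^bsub>R\<^esub> j" and ?z = "t [^]\<^bsub>R\<^esub> Suc j \<otimes>\<^bsub>R\<^esub> w"
    have q: "?q \<in> carrier R" "?z \<in> carrier R" using pow_t_closed uw t_closed by simp_all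
    have "(\<one>\<^bsub>R\<^esub> \<ominus>\<^bsub>R\<^esub> ?z) \<otimes>\<^bsub>R\<^esub> u \<otimes>\<^bsub>R\<^esub> r = (\<one>\<^bsub>R\<^esub> \<ominus>\<^bsub>R\<^esub> ?z) \<otimes>\<^bsub>R\<^esub> (\<one>\<^bsub>R\<^esub> \<oplus>\<^bsub>R\<^esub> ?z)"
      using uw q r by (simp add: R.m_assoc)
    also have "\<dots> = \<one>\<^bsub>R\<^esub> \<oplus>\<^bsub>R\<^esub> \<ominus>\<^bsub>R\<^esub> (?z \<otimes>\<^bsub>R\<^esub> ?z)"
      using q by (simp add: R.r_distr R.l_distr a_minus_def R.l_minus R.a_assoc R.r_neg2 R.r_neg1)
    also have "?z \<otimes>\<^bsub>R\<^esub> ?z = t [^]\<^bsub>R\<^esub> Suc (Suc j) \<otimes>\<^bsub>R\<^esub> (?q \<otimes>\<^bsub>R\<^esub> w \<otimes>\<^bsub>R\<^esub> w)"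
      using uw q t_closed by (simp add: R.m_ac)
    also have "\<ominus>\<^bsub>R\<^esub> \<dots> = t [^]\<^bsub>R\<^esub> Suc (Suc j) \<otimes>\<^bsub>R\<^esub> (\<ominus>\<^bsub>R\<^esub> (?q \<otimes>\<^bsub>R\<^esub> w \<otimes>\<^bsub>R\<^esub> w))"
      using uw q t_closed by (simp add: R.r_minus)
    finally show ?case
      using uw q by (intro bexI[of _ "(\<one>\<^bsub>R\<^esub> \<ominus>\<^bsub>R\<^esub> ?z) \<otimes>\<^bsub>R\<^esub> u"] bexI[of _ "\<ominus>\<^bsub>R\<^esub> (?q \<otimes>\<^bsub>R\<^esub> w \<otimes>\<^bsub>R\<^esub> w)"]) auto
  qed
  obtain u w where uw: "u \<in> carrier R" "w \<in> carrier R" "u \<otimes>\<^bsub>R\<^esub> r = \<one>\<^bsub>R\<^esub> \<oplus>\<^bsub>R\<^esub> t [^]\<^bsub>R\<^esub> Suc (p - 1) \<otimes>\<^bsub>R\<^esub> w"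
    using approx[of "p - 1"] by blast
  have "Suc (p - 1) = p" using p_pos by simp
  then have "u \<otimes>\<^bsub>R\<^esub> r = \<one>\<^bsub>R\<^esub>" using uw t_nilpotent by simp
  then show ?thesis using uw r R.m_comm[of u r] unfolding Units_def by auto
qed

lemma pow_smult:
  assumes "left_module R M" "m \<in> carrier M"
  shows "t [^]\<^bsub>R\<^esub> Suc n \<odot>\<^bsub>M\<^esub> m = t [^]\<^bsub>R\<^esub> n \<odot>\<^bsub>M\<^esub> (t \<odot>\<^bsub>M\<^esub> m)"
    "t [^]\<^bsub>R\<^esub> Suc n \<odot>\<^bsub>M\<^esub> m = t \<odot>\<^bsub>M\<^esub> (t [^]\<^bsub>R\<^esub> n \<odot>\<^bsub>M\<^esub> m)"
proof -
  interpret M: left_module R M by fact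
  show "t [^]\<^bsub>R\<^esub> Suc n \<odot>\<^bsub>M\<^esub> m = t [^]\<^bsub>R\<^esub> n \<odot>\<^bsub>M\<^esub> (t \<odot>\<^bsub>M\<^esub> m)"
    using assms(2) t_closed pow_t_closed by (simp add: M.smult_assoc)
  show "t [^]\<^bsub>R\<^esub> Suc n \<odot>\<^bsub>M\<^esub> m = t \<odot>\<^bsub>M\<^esub> (t [^]\<^bsub>R\<^esub> n \<odot>\<^bsub>M\<^esub> m)"
    using assms(2) t_closed pow_t_closed by (simp add: M.smult_assoc[symmetric] R.m_comm)
qed

text \<open>Divide a relation among minimal generators by the largest power of \<open>t\<close> dividing all its
  coefficients and multiply by the complementary power: the hypothesis turns what is left into a
  relation with a unit coefficient.\<close>

lemma minimal_independent:
  assumes M: "left_module R M" and B: "generates_modulo R M {\<zero>\<^bsub>M\<^esub>} B"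
    and min: "\<forall>c\<in>B \<rightarrow> carrier R. lincomb M c B \<in> {\<zero>\<^bsub>M\<^esub>} \<longrightarrow> (\<forall>b\<in>B. c b \<notin> Units R)"
    and tor: "\<And>m. m \<in> carrier M \<Longrightarrow> t [^]\<^bsub>R\<^esub> (p - 1) \<odot>\<^bsub>M\<^esub> m = \<zero>\<^bsub>M\<^esub> \<Longrightarrow> \<exists>m'\<in>carrier M. m = t \<odot>\<^bsub>M\<^esub> m'"
  shows "independent_modulo R M {\<zero>\<^bsub>M\<^esub>} B"
proof -
  interpret M: left_module R M by (rule M)
  interpret h: ring_hom_cring R K aug
    using aug_hom by (unfold_locales)
  have fin: "finite B" "B \<subseteq> carrier M" using B by (auto simp: generates_modulo_def)
  \<comment> \<open>Divisibility of all coefficients by t^j is raised from j to j + 1; at j = p it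
    says that they vanish.\<close>
  have key: "\<exists>c'\<in>B \<rightarrow> carrier R. \<forall>b\<in>B. c b = t [^]\<^bsub>R\<^esub> j \<otimes>\<^bsub>R\<^esub> c' b"
    if c: "c \<in> B \<rightarrow> carrier R" "lincomb M c B = \<zero>\<^bsub>M\<^esub>" and j: "j \<le> p" for c j
    using j
  proof (induction j)
    case 0
    then show ?case using c(1) by (intro bexI[of _ c]) (auto simp: Pi_iff)
  next
    case (Suc j)
    then obtain c' where c': "c' \<in> B \<rightarrow> carrier R" "\<forall>b\<in>B. c b = t [^]\<^bsub>R\<^esub> j \<otimes>\<^bsub>R\<^esub> c' b" by auto
    have cl: "lincomb M c' B \<in> carrier M" by (rule M.lincomb_closed[OF fin(2) c'(1)])
    have "\<zero>\<^bsub>M\<^esub> = lincomb M (\<lambda>b. t [^]\<^bsub>R\<^esub> j \<otimes>\<^bsub>R\<^esub> c' b) B"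
      unfolding c(2)[symmetric] using c' pow_t_closed by (intro M.lincomb_cong[OF fin(2)]) auto
    also have "\<dots> = t [^]\<^bsub>R\<^esub> j \<odot>\<^bsub>M\<^esub> lincomb M c' B"
      by (rule M.lincomb_smult[OF fin c'(1) pow_t_closed])
    finally have z: "t [^]\<^bsub>R\<^esub> j \<odot>\<^bsub>M\<^esub> lincomb M c' B = \<zero>\<^bsub>M\<^esub>" by simp
    have "t [^]\<^bsub>R\<^esub> (p - 1) \<odot>\<^bsub>M\<^esub> lincomb M c' B = t [^]\<^bsub>R\<^esub> (p - 1 - j) \<odot>\<^bsub>M\<^esub> (t [^]\<^bsub>R\<^esub> j \<odot>\<^bsub>M\<^esub> lincomb M c' B)"
      using Suc.prems cl t_closed by (subst M.smult_assoc[symmetric]) (simp_all add: R.nat_pow_mult)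
    also have "\<dots> = \<zero>\<^bsub>M\<^esub>" by (simp add: z M.smult_zero_right pow_t_closed)
    finally obtain m where m: "m \<in> carrier M" "lincomb M c' B = t \<odot>\<^bsub>M\<^esub> m" using tor[OF cl] by blast
    obtain d where d: "d \<in> B \<rightarrow> carrier R" "m = lincomb M d B"
      using B m(1) M.lincomb_closed[OF fin(2)] by (force simp: generates_modulo_def)
    have td: "(\<lambda>b. t \<otimes>\<^bsub>R\<^esub> d b) \<in> B \<rightarrow> carrier R" using d(1) t_closed by auto
    \<comment> \<open>Replacing c' by c' - t d gives a genuine relation, so minimality forbids units
      among its coefficients. As t d has augmentation zero, c' then has it too and is divisible by
      t.\<close>
    have "lincomb M (\<lambda>b. c' b \<ominus>\<^bsub>R\<^esub> t \<otimes>\<^bsub>R\<^esub> d b) B = \<zero>\<^bsub>M\<^esub>"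
      unfolding M.lincomb_diff[OF fin(2,1) c'(1) td] M.lincomb_smult[OF fin d(1) t_closed] d(2)[symmetric] m(2)
      using m(1) t_closed M.smult_closed by (simp add: M.smult_diff_cancel)
    moreover have e: "(\<lambda>b. c' b \<ominus>\<^bsub>R\<^esub> t \<otimes>\<^bsub>R\<^esub> d b) \<in> B \<rightarrow> carrier R" using c'(1) td by (auto simp: Pi_iff)
    ultimately have nu: "c' b \<ominus>\<^bsub>R\<^esub> t \<otimes>\<^bsub>R\<^esub> d b \<notin> Units R" if "b \<in> B" for b
      using min that by blast
    have "\<exists>s\<in>carrier R. c' b = t \<otimes>\<^bsub>R\<^esub> s" if "b \<in> B" for b
    proof (rule aug_zero)
      have cd: "c' b \<in> carrier R" "d b \<in> carrier R" using c'(1) d(1) that by auto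
      have "aug (c' b \<ominus>\<^bsub>R\<^esub> t \<otimes>\<^bsub>R\<^esub> d b) = \<zero>\<^bsub>K\<^esub>"
        using nu[OF that] unit_of_aug cd t_closed by (metis R.m_closed R.minus_closed)
      then show "aug (c' b) = \<zero>\<^bsub>K\<^esub>" using cd t_closed by (simp add: a_minus_def aug_t aug_closed)
      show "c' b \<in> carrier R" by (rule cd)
    qed
    then obtain s where s: "\<And>b. b \<in> B \<Longrightarrow> s b \<in> carrier R \<and> c' b = t \<otimes>\<^bsub>R\<^esub> s b" by metis
    show ?case
    proof (rule bexI[of _ s], rule ballI)
      fix b assume "b \<in> B"
      then show "c b = t [^]\<^bsub>R\<^esub> Suc j \<otimes>\<^bsub>R\<^esub> s b" using s[of b] c' t_closed by (simp add: R.m_assoc)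
    qed (use s in auto)
  qed
  have "c b = \<zero>\<^bsub>R\<^esub>" if cb: "c \<in> B \<rightarrow> carrier R" "lincomb M c B = \<zero>\<^bsub>M\<^esub>" "b \<in> B" for c b
  proof -
    obtain c' where "c' \<in> B \<rightarrow> carrier R" "\<forall>b\<in>B. c b = t [^]\<^bsub>R\<^esub> p \<otimes>\<^bsub>R\<^esub> c' b" using key[OF cb(1,2), of p] by auto
    then show ?thesis using cb(3) by (auto simp: t_nilpotent Pi_iff)
  qed
  then show ?thesis unfolding independent_modulo_def by blast
qed

text \<open>The assumption on torsion rules out every summand K[t]/(t^q) with q < p: its generator
  is killed by t^(p-1) but is no multiple of t. What remains is free, and
  \<open>minimal_independent\<close> finds the basis without a classification of modules.\<close>

lemma projective_criterion:
  fixes M :: "('r, 'm) module"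
  assumes M: "left_module R M" and fg: "finitely_generated R M"
    and tor: "\<And>m. m \<in> carrier M \<Longrightarrow> t [^]\<^bsub>R\<^esub> (p - 1) \<odot>\<^bsub>M\<^esub> m = \<zero>\<^bsub>M\<^esub> \<Longrightarrow> \<exists>m'\<in>carrier M. m = t \<odot>\<^bsub>M\<^esub> m'"
  shows "projective_module R M"
  unfolding projective_module_def
proof (intro conjI allI impI; (elim conjE)?)
  interpret M: left_module R M by (rule M)
  fix N N' :: "('r, nat \<Rightarrow> 'r) module" and g f
  assume *: "left_module R N" "left_module R N'" "g \<in> lhom R N N'" "g ` carrier N = carrier N'" "f \<in> lhom R M N'"
  obtain B0 where B0: "generates_modulo R M {\<zero>\<^bsub>M\<^esub>} B0" using M.finitely_generated_modulo[OF fg M.zero_submodule] .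
  obtain B where B: "generates_modulo R M {\<zero>\<^bsub>M\<^esub>} B"
    and min: "\<forall>c\<in>B \<rightarrow> carrier R. lincomb M c B \<in> {\<zero>\<^bsub>M\<^esub>} \<longrightarrow> (\<forall>b\<in>B. c b \<notin> Units R)"
    using M.minimal_generators[OF M.zero_submodule B0] .
  obtain h where "h \<in> lhom R M N" "\<And>x. x \<in> carrier M \<Longrightarrow> g (h x) = f x"
    using M.lift_free[OF B minimal_independent[OF M B min tor] *(1,2) lhomD(5)[OF *(3)] *(4) lhomD(5)[OF *(5)]]
    by metis
  then show "\<exists>h\<in>lhom R M N. \<forall>x\<in>carrier M. g (h x) = f x" by (intro bexI[of _ h]) simp_all
qed (rule M)

end

definition trunc_eps :: "'d ring \<Rightarrow> nat \<Rightarrow> 'd \<Rightarrow> (nat \<Rightarrow> 'd) set" where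
  "trunc_eps K p c = PIdl\<^bsub>UP K\<^esub> (UnivPoly.monom (UP K) \<one>\<^bsub>K\<^esub> p) +>\<^bsub>UP K\<^esub> UnivPoly.monom (UP K) c 0"

text \<open>For p > 0 the elements of (X^p) have no constant term, so the constant coefficient is
  constant on cosets. This is the map along which \<open>trunc_trivial\<close> restricts.\<close>

definition trunc_aug :: "'d ring \<Rightarrow> (nat \<Rightarrow> 'd) set \<Rightarrow> 'd" where
  "trunc_aug K u = the_elem ((\<lambda>q. UnivPoly.coeff (UP K) q 0) ` u)"

definition trunc_var :: "'d ring \<Rightarrow> nat \<Rightarrow> (nat \<Rightarrow> 'd) set" where
  "trunc_var K p = PIdl\<^bsub>UP K\<^esub> (UnivPoly.monom (UP K) \<one>\<^bsub>K\<^esub> p) +>\<^bsub>UP K\<^esub> UnivPoly.monom (UP K) \<one>\<^bsub>K\<^esub> 1"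

section \<open>The quotient of K[X] by (X^p) as a truncated ring\<close>

lemma UP_carrier: "carrier (UP K) = up K"
  by (simp add: UP_def)

lemma coeff_UP: "f \<in> up K \<Longrightarrow> UnivPoly.coeff (UP K) f = f"
  by (simp add: UP_def)

lemma truncated_ring_trunc:
  assumes K: "field K" and p: "p > 0"
  shows "truncated_ring K (trunc_ring K p) (trunc_eps K p) (trunc_aug K) (trunc_var K p) p"
proof -
  interpret K: field K by fact
  interpret U: UP_domain K "UP K" by unfold_locales simp
  let ?P = "UP K" and ?x = "\<lambda>n. UnivPoly.monom (UP K) \<one>\<^bsub>K\<^esub> n" and ?co = "UnivPoly.coeff (UP K)"
  let ?I = "PIdl\<^bsub>?P\<^esub> (?x p)"
  interpret I: ideal ?I ?P by (rule U.P.cgenideal_ideal) simp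
  let ?c = "\<lambda>q. ?I +>\<^bsub>?P\<^esub> q"
  have R: "trunc_ring K p = ?P Quot ?I" by (simp add: trunc_ring_def)
  have cR: "cring (?P Quot ?I)" by (rule I.quotient_is_cring) (rule U.P.is_cring)
  have qh: "ring_hom_cring ?P (?P Quot ?I) ?c" by (rule I.rcos_ring_hom_cring[OF U.P.is_cring])
  have hq: "?c \<in> ring_hom ?P (?P Quot ?I)" by (rule I.rcos_ring_hom)
  note q_closed = ring_hom_closed[OF hq] and q_mult = ring_hom_mult[OF hq]
    and q_add = ring_hom_add[OF hq] and q_one = ring_hom_one[OF hq]
  have surj: "\<exists>q\<in>carrier ?P. u = ?c q" if "u \<in> carrier (?P Quot ?I)" for u
    using that by (simp add: FactRing_def A_RCOSETS_def')
  have Imem: "a \<in> ?I \<longleftrightarrow> (\<exists>b\<in>carrier ?P. a = b \<otimes>\<^bsub>?P\<^esub> ?x p)" for a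
    unfolding cgenideal_def by blast
  \<comment> \<open>Multiplication by X^n shifts coefficients by n; both division by X and
    cancellation of X are read off from this.\<close>
  have xp: "?co (?x n \<otimes>\<^bsub>?P\<^esub> q) (n + m) = ?co q m" if "q \<in> carrier ?P" for q n m
    using that U.coeff_monom_mult[of "\<one>\<^bsub>K\<^esub>" q n m] by (simp add: add.commute[of n] del: U.coeff_mult)
  have x0: "?co (?x (Suc n) \<otimes>\<^bsub>?P\<^esub> q) 0 = \<zero>\<^bsub>K\<^esub>" if "q \<in> carrier ?P" for q n
    using that by simp
  have I0: "?co a 0 = \<zero>\<^bsub>K\<^esub>" "a \<in> carrier ?P" if a: "a \<in> ?I" for a
  proof -
    obtain b where b: "b \<in> carrier ?P" "a = ?x p \<otimes>\<^bsub>?P\<^esub> b" using a U.P.m_comm by (auto simp: Imem)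
    then show "?co a 0 = \<zero>\<^bsub>K\<^esub>" "a \<in> carrier ?P" using x0[OF b(1), of "p - 1"] p by (simp_all del: U.coeff_mult)
  qed
  have aug: "trunc_aug K (?c q) = ?co q 0" if q: "q \<in> carrier ?P" for q
  proof -
    have "?co v 0 = ?co q 0" if "v \<in> ?c q" for v
    proof -
      obtain a where a: "a \<in> ?I" "v = a \<oplus>\<^bsub>?P\<^esub> q" using \<open>v \<in> ?c q\<close> by (auto simp: a_r_coset_def')
      then show ?thesis using I0[OF a(1)] q by simp
    qed
    moreover have "q \<in> ?c q" by (rule I.a_rcos_self[OF q])
    ultimately have "(\<lambda>q. ?co q 0) ` (?c q) = {?co q 0}" by blast
    then show ?thesis by (simp add: trunc_aug_def)
  qed
  note cU = UP_carrier[of K] and coU = coeff_UP[of _ K]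
  \<comment> \<open>A polynomial without constant term is X times its shifted coefficient sequence.
    Elements of \<open>up K\<close> are coefficient functions, so the shift is itself the
    quotient.\<close>
  have shift: "\<exists>s\<in>carrier ?P. q = ?x 1 \<otimes>\<^bsub>?P\<^esub> s" if q: "q \<in> carrier ?P" "?co q 0 = \<zero>\<^bsub>K\<^esub>" for q
  proof -
    let ?s = "\<lambda>n. ?co q (Suc n)"
    obtain n where n: "bound \<zero>\<^bsub>K\<^esub> n (?co q)" using K.bound_upD[of q] q(1) unfolding cU by (auto simp only: coU)
    have "bound \<zero>\<^bsub>K\<^esub> n ?s" using n by (auto simp: bound_def)
    then have "?s \<in> up K" using U.coeff_closed[OF q(1)] by (intro mem_upI) blast+
    then have s: "?s \<in> carrier ?P" unfolding cU .
    have cs: "?co ?s m = ?co q (Suc m)" for m using s unfolding cU by (simp only: coU)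
    have "q = ?x 1 \<otimes>\<^bsub>?P\<^esub> ?s"
    proof (rule U.up_eqI)
      fix m show "?co q m = ?co (?x 1 \<otimes>\<^bsub>?P\<^esub> ?s) m"
        using q(2) x0[OF s, of 0] xp[OF s, of 1 "m - 1"] cs by (cases m) auto
    qed (use q s in auto)
    then show ?thesis using s by blast
  qed
  show ?thesis unfolding R
  proof (intro truncated_ring.intro truncated_ring_axioms.intro)
    show "trunc_eps K p \<in> ring_hom K (?P Quot ?I)"
    proof (rule ring_hom_memI)
      fix x y assume xy: "x \<in> carrier K" "y \<in> carrier K"
      show "trunc_eps K p x \<in> carrier (?P Quot ?I)" unfolding trunc_eps_def using xy by (intro q_closed) simp
      have "UnivPoly.monom ?P (x \<otimes>\<^bsub>K\<^esub> y) 0 = UnivPoly.monom ?P x 0 \<otimes>\<^bsub>?P\<^esub> UnivPoly.monom ?P y 0"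
        using U.monom_mult[of x y 0 0] xy by simp
      then show "trunc_eps K p (x \<otimes>\<^bsub>K\<^esub> y) = trunc_eps K p x \<otimes>\<^bsub>?P Quot ?I\<^esub> trunc_eps K p y"
        unfolding trunc_eps_def using xy by (simp only: q_mult U.monom_closed)
      show "trunc_eps K p (x \<oplus>\<^bsub>K\<^esub> y) = trunc_eps K p x \<oplus>\<^bsub>?P Quot ?I\<^esub> trunc_eps K p y"
        unfolding trunc_eps_def using xy by (simp only: U.monom_add q_add U.monom_closed)
    next
      show "trunc_eps K p \<one>\<^bsub>K\<^esub> = \<one>\<^bsub>?P Quot ?I\<^esub>" unfolding trunc_eps_def U.monom_one by (rule q_one)
    qed
    show "trunc_aug K \<in> ring_hom (?P Quot ?I) K"
    proof (rule ring_hom_memI)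
      fix u assume "u \<in> carrier (?P Quot ?I)"
      then show "trunc_aug K u \<in> carrier K" using surj aug by force
    next
      fix u v assume "u \<in> carrier (?P Quot ?I)" "v \<in> carrier (?P Quot ?I)"
      then obtain a b where ab: "a \<in> carrier ?P" "b \<in> carrier ?P" "u = ?c a" "v = ?c b" using surj by metis
      show "trunc_aug K (u \<otimes>\<^bsub>?P Quot ?I\<^esub> v) = trunc_aug K u \<otimes>\<^bsub>K\<^esub> trunc_aug K v"
        "trunc_aug K (u \<oplus>\<^bsub>?P Quot ?I\<^esub> v) = trunc_aug K u \<oplus>\<^bsub>K\<^esub> trunc_aug K v"
        unfolding ab(3,4) q_mult[OF ab(1,2), symmetric] q_add[OF ab(1,2), symmetric]
        using ab by (simp_all add: aug)
    next
      show "trunc_aug K \<one>\<^bsub>?P Quot ?I\<^esub> = \<one>\<^bsub>K\<^esub>" unfolding q_one[symmetric] by (subst aug) simp_all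
    qed
    show "trunc_aug K (trunc_eps K p c) = c" if "c \<in> carrier K" for c
      using that by (simp add: trunc_eps_def aug)
    show "trunc_var K p \<in> carrier (?P Quot ?I)" unfolding trunc_var_def by (rule q_closed) simp
    show "trunc_aug K (trunc_var K p) = \<zero>\<^bsub>K\<^esub>" by (simp add: trunc_var_def aug)
    have pw: "trunc_var K p [^]\<^bsub>?P Quot ?I\<^esub> n = ?c (?x n)" for n
      unfolding trunc_var_def ring_hom_cring.hom_pow[OF qh U.monom_closed[OF K.one_closed], symmetric]
      using U.monom_pow[of "\<one>\<^bsub>K\<^esub>" 1 n] by simp
    have c0: "?c a = \<zero>\<^bsub>?P Quot ?I\<^esub> \<longleftrightarrow> a \<in> ?I" if "a \<in> carrier ?P" for a
      using that I.a_rcos_self[OF that] I.a_rcos_const by (auto simp: FactRing_def)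
    show "trunc_var K p [^]\<^bsub>?P Quot ?I\<^esub> p = \<zero>\<^bsub>?P Quot ?I\<^esub>"
      unfolding pw by (subst c0) (auto simp: Imem intro!: bexI[of _ "\<one>\<^bsub>?P\<^esub>"])
    show "\<exists>s\<in>carrier (?P Quot ?I). r = trunc_var K p \<otimes>\<^bsub>?P Quot ?I\<^esub> s"
      if r: "r \<in> carrier (?P Quot ?I)" "trunc_aug K r = \<zero>\<^bsub>K\<^esub>" for r
    proof -
      obtain q where q: "q \<in> carrier ?P" "r = ?c q" using surj r(1) by blast
      obtain s where s: "s \<in> carrier ?P" "q = ?x 1 \<otimes>\<^bsub>?P\<^esub> s" using shift[OF q(1)] aug[OF q(1)] q(2) r(2) by auto
      have "r = trunc_var K p \<otimes>\<^bsub>?P Quot ?I\<^esub> ?c s"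
        unfolding q(2) s(2) trunc_var_def using s(1) by (intro q_mult) simp_all
      then show ?thesis using q_closed[OF s(1)] by blast
    qed
    show "\<exists>s\<in>carrier (?P Quot ?I). r = trunc_var K p [^]\<^bsub>?P Quot ?I\<^esub> (p - 1) \<otimes>\<^bsub>?P Quot ?I\<^esub> s"
      if r: "r \<in> carrier (?P Quot ?I)" "trunc_var K p \<otimes>\<^bsub>?P Quot ?I\<^esub> r = \<zero>\<^bsub>?P Quot ?I\<^esub>" for r
    proof -
      obtain q where q: "q \<in> carrier ?P" "r = ?c q" using surj r(1) by blast
      have "?c (?x 1 \<otimes>\<^bsub>?P\<^esub> q) = \<zero>\<^bsub>?P Quot ?I\<^esub>"
        using r(2) q(1) unfolding q(2) trunc_var_def by (subst q_mult) simp_all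
      then obtain s where s: "s \<in> carrier ?P" "?x 1 \<otimes>\<^bsub>?P\<^esub> q = s \<otimes>\<^bsub>?P\<^esub> ?x p"
        using q(1) c0[of "?x 1 \<otimes>\<^bsub>?P\<^esub> q"] by (auto simp: Imem)
      have "?x p = ?x 1 \<otimes>\<^bsub>?P\<^esub> ?x (p - 1)"
        using U.monom_mult[of "\<one>\<^bsub>K\<^esub>" "\<one>\<^bsub>K\<^esub>" 1 "p - 1"] p by simp
      then have e: "?x 1 \<otimes>\<^bsub>?P\<^esub> q = ?x 1 \<otimes>\<^bsub>?P\<^esub> (?x (p - 1) \<otimes>\<^bsub>?P\<^esub> s)"
        using s q by (simp add: U.P.m_ac)
      \<comment> \<open>Comparing coefficients m + 1 in X q = X (X^(p-1) s) cancels X.\<close>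
      have "q = ?x (p - 1) \<otimes>\<^bsub>?P\<^esub> s"
      proof (rule U.up_eqI)
        fix m show "?co q m = ?co (?x (p - 1) \<otimes>\<^bsub>?P\<^esub> s) m"
          using xp[OF q(1), of 1 m] xp[of "?x (p - 1) \<otimes>\<^bsub>?P\<^esub> s" 1 m] e s(1) by (simp del: U.coeff_mult)
      qed (use q s in auto)
      then have "r = trunc_var K p [^]\<^bsub>?P Quot ?I\<^esub> (p - 1) \<otimes>\<^bsub>?P Quot ?I\<^esub> ?c s"
        unfolding q(2) pw using s(1) by (simp add: q_mult)
      then show ?thesis using q_closed[OF s(1)] by blast
    qed
  qed (use p K cR in simp_all)
qed

lemma trunc_algebra_simps:
  "carrier (trunc_algebra K p) = carrier (trunc_ring K p)" "add (trunc_algebra K p) = add (trunc_ring K p)"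
  "monoid.mult (trunc_algebra K p) = monoid.mult (trunc_ring K p)" "one (trunc_algebra K p) = one (trunc_ring K p)"
  "c \<odot>\<^bsub>trunc_algebra K p\<^esub> u = trunc_eps K p c \<otimes>\<^bsub>trunc_ring K p\<^esub> u"
  by (simp_all add: trunc_algebra_def Let_def trunc_eps_def)

lemma trunc_trivial_eq: "trunc_trivial K p = restr (trunc_aug K) (regular K)"
  by (simp add: trunc_trivial_def trunc_aug_def[abs_def])

section \<open>Composition length\<close>

definition covers :: "('r, 'y) ring_scheme \<Rightarrow> ('r, 'm) module \<Rightarrow> 'm set \<Rightarrow> 'm set \<Rightarrow> bool" where
  "covers R M A B \<longleftrightarrow> submodule A R M \<and> submodule B R M \<and> A \<subset> B \<and>
     \<not> (\<exists>W. submodule W R M \<and> A \<subset> W \<and> W \<subset> B)"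

text \<open>Composition series of the interval from A to B, with the top B fixed while the bottom A
  moves. This suits both concatenation and the induction in the Jordan-Hoelder theorem.\<close>

inductive comp_chain :: "('r, 'y) ring_scheme \<Rightarrow> ('r, 'm) module \<Rightarrow> 'm set \<Rightarrow> 'm set \<Rightarrow> nat \<Rightarrow> bool"
  for R :: "('r, 'y) ring_scheme" and M :: "('r, 'm) module" and B :: "'m set" where
  comp_refl: "submodule B R M \<Longrightarrow> comp_chain R M B B 0"
| comp_step: "covers R M A A' \<Longrightarrow> comp_chain R M B A' n \<Longrightarrow> comp_chain R M B A (Suc n)"

section \<open>Chains of covers and composition series\<close>

lemma comp_chainD:
  "comp_chain R M B A n \<Longrightarrow> submodule A R M \<and> submodule B R M \<and> A \<subseteq> B \<and> (A = B \<longleftrightarrow> n = 0)"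
  by (induction rule: comp_chain.induct) (auto simp: covers_def)

lemma comp_chain_append:
  "comp_chain R M B A n \<Longrightarrow> comp_chain R M C B m \<Longrightarrow> comp_chain R M C A (n + m)"
  by (induction rule: comp_chain.induct) (auto intro: comp_chain.comp_step)

lemma comp_chain_of_series:
  assumes Q: "\<forall>i\<le>n. submodule (Q i) R M" "\<forall>i<n. covers R M (Q i) (Q (Suc i))"
  shows "comp_chain R M (Q n) (Q 0) n"
  using assms
proof (induction n arbitrary: Q)
  case 0
  then show ?case by (simp add: comp_chain.comp_refl)
next
  case (Suc n)
  have "comp_chain R M (Q (Suc n)) (Q (Suc 0)) n"
    using Suc.IH[of "\<lambda>i. Q (Suc i)"] Suc.prems by auto
  then show ?case using Suc.prems(2) by (auto intro: comp_chain.comp_step)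
qed

lemma series_of_comp_chain:
  "comp_chain R M B A n \<Longrightarrow> \<exists>Q. Q 0 = A \<and> Q n = B \<and> (\<forall>i\<le>n. submodule (Q i) R M) \<and> (\<forall>i<n. covers R M (Q i) (Q (Suc i)))"
proof (induction rule: comp_chain.induct)
  case comp_refl
  then show ?case by (intro exI[of _ "\<lambda>_. B"]) auto
next
  case (comp_step A A' n)
  then obtain Q where Q: "Q 0 = A'" "Q n = B" "\<forall>i\<le>n. submodule (Q i) R M" "\<forall>i<n. covers R M (Q i) (Q (Suc i))" by auto
  have "submodule (case_nat A Q i) R M" if "i \<le> Suc n" for i
    using that Q(3) comp_step.hyps(1) by (cases i) (auto simp: covers_def)
  moreover have "covers R M (case_nat A Q i) (case_nat A Q (Suc i))" if "i < Suc n" for i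
    using that Q(1,4) comp_step.hyps(1) by (cases i) auto
  ultimately show ?case using Q(2) by (intro exI[of _ "case_nat A Q"]) auto
qed

lemma composition_series_iff:
  "(\<exists>Q. composition_series R M n Q) \<longleftrightarrow> comp_chain R M (carrier M) {\<zero>\<^bsub>M\<^esub>} n"
proof -
  have e: "composition_series R M n Q \<longleftrightarrow> Q 0 = {\<zero>\<^bsub>M\<^esub>} \<and> Q n = carrier M \<and> (\<forall>i\<le>n. submodule (Q i) R M) \<and>
      (\<forall>i<n. covers R M (Q i) (Q (Suc i)))" for Q
    unfolding composition_series_def covers_def using less_imp_le Suc_leI by meson
  show ?thesis unfolding e
    using comp_chain_of_series[of n _ R M] series_of_comp_chain[of R M "carrier M" "{\<zero>\<^bsub>M\<^esub>}" n] by metis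
qed

text \<open>A group with operators. Composition length depends only on the lattice of stable
  subgroups, and this is the structure that \<open>end_ring\<close> induces on Hom(X, \<Delta>) by
  composition.\<close>

locale operator_group = M: abelian_group M for R :: "('r, 'y) ring_scheme" and M :: "('r, 'm) module" +
  assumes op_closed: "a \<in> carrier R \<Longrightarrow> x \<in> carrier M \<Longrightarrow> a \<odot>\<^bsub>M\<^esub> x \<in> carrier M"
    and op_add: "a \<in> carrier R \<Longrightarrow> x \<in> carrier M \<Longrightarrow> y \<in> carrier M \<Longrightarrow>
      a \<odot>\<^bsub>M\<^esub> (x \<oplus>\<^bsub>M\<^esub> y) = a \<odot>\<^bsub>M\<^esub> x \<oplus>\<^bsub>M\<^esub> a \<odot>\<^bsub>M\<^esub> y"
begin

lemma submodule_iff: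
  "submodule S R M \<longleftrightarrow> S \<subseteq> carrier M \<and> \<zero>\<^bsub>M\<^esub> \<in> S \<and> (\<forall>x\<in>S. \<forall>y\<in>S. x \<oplus>\<^bsub>M\<^esub> y \<in> S) \<and>
     (\<forall>x\<in>S. \<ominus>\<^bsub>M\<^esub> x \<in> S) \<and> (\<forall>a\<in>carrier R. \<forall>x\<in>S. a \<odot>\<^bsub>M\<^esub> x \<in> S)"
  unfolding submodule_def subgroup_def submodule_axioms_def a_inv_def by auto

lemma op_zero: "a \<in> carrier R \<Longrightarrow> a \<odot>\<^bsub>M\<^esub> \<zero>\<^bsub>M\<^esub> = \<zero>\<^bsub>M\<^esub>"
  using additive_map_zero[of M M "\<lambda>x. a \<odot>\<^bsub>M\<^esub> x"] M.abelian_group_axioms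
  by (simp add: additive_map_def op_closed op_add)

lemma op_minus: "a \<in> carrier R \<Longrightarrow> x \<in> carrier M \<Longrightarrow> a \<odot>\<^bsub>M\<^esub> (\<ominus>\<^bsub>M\<^esub> x) = \<ominus>\<^bsub>M\<^esub> (a \<odot>\<^bsub>M\<^esub> x)"
  using additive_map_minus[of M M "\<lambda>x. a \<odot>\<^bsub>M\<^esub> x"] M.abelian_group_axioms
  by (simp add: additive_map_def op_closed op_add)

lemma minus_zero: "\<ominus>\<^bsub>M\<^esub> \<zero>\<^bsub>M\<^esub> = \<zero>\<^bsub>M\<^esub>"
  by (rule M.minus_equality) auto

lemma submodule_zero: "submodule {\<zero>\<^bsub>M\<^esub>} R M"
  by (simp add: submodule_iff op_zero minus_zero)

lemma submodule_carrier: "submodule (carrier M) R M"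
  by (simp add: submodule_iff op_closed)

lemma submodule_inter: "submodule A R M \<Longrightarrow> submodule B R M \<Longrightarrow> submodule (A \<inter> B) R M"
  unfolding submodule_iff by blast

definition sum_set :: "'m set \<Rightarrow> 'm set \<Rightarrow> 'm set" where
  "sum_set A B = {x \<oplus>\<^bsub>M\<^esub> y | x y. x \<in> A \<and> y \<in> B}"

lemma submodule_sum:
  assumes A: "submodule A R M" and B: "submodule B R M"
  shows "submodule (sum_set A B) R M"
proof -
  have c: "x \<in> carrier M" if "x \<in> A \<or> x \<in> B" for x using A B that by (auto simp: submodule_iff)
  show ?thesis unfolding submodule_iff
  proof (intro conjI ballI)
    show "sum_set A B \<subseteq> carrier M" using c by (auto simp: sum_set_def)
    have "\<zero>\<^bsub>M\<^esub> = \<zero>\<^bsub>M\<^esub> \<oplus>\<^bsub>M\<^esub> \<zero>\<^bsub>M\<^esub>" "\<zero>\<^bsub>M\<^esub> \<in> A" "\<zero>\<^bsub>M\<^esub> \<in> B" using A B by (simp_all add: submodule_iff)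
    then show "\<zero>\<^bsub>M\<^esub> \<in> sum_set A B" unfolding sum_set_def by blast
  next
    fix u v assume "u \<in> sum_set A B" "v \<in> sum_set A B"
    then obtain a b a' b' where *: "u = a \<oplus>\<^bsub>M\<^esub> b" "v = a' \<oplus>\<^bsub>M\<^esub> b'" "a \<in> A" "a' \<in> A" "b \<in> B" "b' \<in> B"
      by (auto simp: sum_set_def)
    have "u \<oplus>\<^bsub>M\<^esub> v = (a \<oplus>\<^bsub>M\<^esub> a') \<oplus>\<^bsub>M\<^esub> (b \<oplus>\<^bsub>M\<^esub> b')" using * c by (simp add: M.a_ac)
    moreover have "a \<oplus>\<^bsub>M\<^esub> a' \<in> A" "b \<oplus>\<^bsub>M\<^esub> b' \<in> B" using * A B by (auto simp: submodule_iff)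
    ultimately show "u \<oplus>\<^bsub>M\<^esub> v \<in> sum_set A B" unfolding sum_set_def by blast
  next
    fix u assume "u \<in> sum_set A B"
    then obtain a b where *: "u = a \<oplus>\<^bsub>M\<^esub> b" "a \<in> A" "b \<in> B" by (auto simp: sum_set_def)
    have "\<ominus>\<^bsub>M\<^esub> u = \<ominus>\<^bsub>M\<^esub> a \<oplus>\<^bsub>M\<^esub> \<ominus>\<^bsub>M\<^esub> b" using * c by (simp add: M.minus_add)
    moreover have "\<ominus>\<^bsub>M\<^esub> a \<in> A" "\<ominus>\<^bsub>M\<^esub> b \<in> B" using * A B by (auto simp: submodule_iff)
    ultimately show "\<ominus>\<^bsub>M\<^esub> u \<in> sum_set A B" unfolding sum_set_def by blast
  next
    fix r u assume r: "r \<in> carrier R" and "u \<in> sum_set A B"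
    then obtain a b where *: "u = a \<oplus>\<^bsub>M\<^esub> b" "a \<in> A" "b \<in> B" by (auto simp: sum_set_def)
    have "r \<odot>\<^bsub>M\<^esub> u = r \<odot>\<^bsub>M\<^esub> a \<oplus>\<^bsub>M\<^esub> r \<odot>\<^bsub>M\<^esub> b" using * c r by (simp add: op_add)
    moreover have "r \<odot>\<^bsub>M\<^esub> a \<in> A" "r \<odot>\<^bsub>M\<^esub> b \<in> B" using * A B r by (auto simp: submodule_iff)
    ultimately show "r \<odot>\<^bsub>M\<^esub> u \<in> sum_set A B" unfolding sum_set_def by blast
  qed
qed

lemma sum_set_upper:
  assumes "submodule A R M" "submodule B R M"
  shows "A \<subseteq> sum_set A B" "B \<subseteq> sum_set A B"
proof -
  have z: "\<zero>\<^bsub>M\<^esub> \<in> A" "\<zero>\<^bsub>M\<^esub> \<in> B" "A \<subseteq> carrier M" "B \<subseteq> carrier M" using assms by (auto simp: submodule_iff)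
  have "x = x \<oplus>\<^bsub>M\<^esub> \<zero>\<^bsub>M\<^esub>" if "x \<in> A" for x using that z by auto
  then show "A \<subseteq> sum_set A B" unfolding sum_set_def using z by blast
  have "x = \<zero>\<^bsub>M\<^esub> \<oplus>\<^bsub>M\<^esub> x" if "x \<in> B" for x using that z by auto
  then show "B \<subseteq> sum_set A B" unfolding sum_set_def using z by blast
qed

lemma sum_set_least: "submodule W R M \<Longrightarrow> A \<subseteq> W \<Longrightarrow> B \<subseteq> W \<Longrightarrow> sum_set A B \<subseteq> W"
  unfolding sum_set_def submodule_iff by blast

text \<open>The diamond step of Jordan-Hoelder: the lattice is modular, so the interval from Q to P
  + Q looks like the one from P \<inter> Q = A to P, where nothing lies in between.\<close>

lemma covers_sum:
  assumes AP: "covers R M A P" and AQ: "covers R M A Q" and "P \<noteq> Q"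
  shows "covers R M Q (sum_set P Q)"
proof -
  have s: "submodule A R M" "submodule P R M" "submodule Q R M" "A \<subset> P" "A \<subset> Q"
    using AP AQ by (auto simp: covers_def)
  note u = sum_set_upper[OF s(2,3)]
  have "\<not> P \<subseteq> Q" using AQ s \<open>P \<noteq> Q\<close> unfolding covers_def by blast
  then have "Q \<subset> sum_set P Q" using u by blast
  moreover have False if W: "submodule W R M" "Q \<subset> W" "W \<subset> sum_set P Q" for W
  proof -
    have WP: "submodule (W \<inter> P) R M" "A \<subseteq> W \<inter> P" "W \<inter> P \<subseteq> P"
      using submodule_inter[OF W(1) s(2)] s W(2) by auto
    then consider "W \<inter> P = A" | "W \<inter> P = P" using AP unfolding covers_def by blast
    then show False
    proof cases
      case 1
      \<comment> \<open>Modular law: in w = x + y with y \<in> Q \<subseteq> W the element x lies in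
        W \<inter> P = A, hence in Q.\<close>
      have "W \<subseteq> Q"
      proof
        fix w assume w: "w \<in> W"
        then obtain x y where xy: "x \<in> P" "y \<in> Q" "w = x \<oplus>\<^bsub>M\<^esub> y"
          using W(3) w unfolding sum_set_def by blast
        have c: "x \<in> carrier M" "y \<in> carrier M" using xy s by (auto simp: submodule_iff)
        have yW: "\<ominus>\<^bsub>M\<^esub> y \<in> W" using xy W(1,2) by (auto simp: submodule_iff)
        have "x = w \<oplus>\<^bsub>M\<^esub> \<ominus>\<^bsub>M\<^esub> y" using c xy(3) by (simp add: M.a_assoc M.r_neg)
        then have "x \<in> W" using w yW W(1) by (auto simp: submodule_iff)
        then have "x \<in> Q" using xy 1 s(5) by blast
        then show "w \<in> Q" using xy s(3) by (auto simp: submodule_iff)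
      qed
      then show False using W(2) by blast
    next
      case 2
      then have "sum_set P Q \<subseteq> W" using W by (intro sum_set_least) auto
      then show False using W(3) by blast
    qed
  qed
  ultimately show ?thesis using s(3) submodule_sum[OF s(2,3)] unfolding covers_def by blast
qed

end

text \<open>Such a d bounds the length of chains from A to B by d B - d A. It takes the place of a
  dimension over K.\<close>

definition finite_height :: "('r, 'y) ring_scheme \<Rightarrow> ('r, 'm) module \<Rightarrow> bool" where
  "finite_height R M \<longleftrightarrow> (\<exists>d :: 'm set \<Rightarrow> nat. \<forall>A B. submodule A R M \<longrightarrow> submodule B R M \<longrightarrow> A \<subset> B \<longrightarrow> d A < d B)"

section \<open>Existence and uniqueness of composition length\<close>

locale finite_operator_group = operator_group R M for R :: "('r, 'y) ring_scheme" and M :: "('r, 'm) module" +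
  assumes fin_height: "finite_height R M"
begin

lemma comp_chain_exists:
  assumes "submodule A R M" "submodule B R M" "A \<subseteq> B"
  shows "\<exists>n. comp_chain R M B A n"
proof -
  obtain d :: "'m set \<Rightarrow> nat" where d: "\<And>A B. submodule A R M \<Longrightarrow> submodule B R M \<Longrightarrow> A \<subset> B \<Longrightarrow> d A < d B"
    using fin_height unfolding finite_height_def by blast
  show ?thesis using assms
  proof (induction "d B - d A" arbitrary: A rule: less_induct)
    case less
    show ?case
    proof (cases "A = B")
      case True
      then show ?thesis using less.prems comp_chain.comp_refl by blast
    next
      case False
      let ?P = "\<lambda>C. submodule C R M \<and> A \<subset> C \<and> C \<subseteq> B"
      \<comment> \<open>A submodule of least height strictly above A covers A, since anything
        strictly between would have smaller height.\<close>
      define C where "C = arg_min d ?P"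
      have C: "?P C" unfolding C_def by (rule arg_min_natI[where k = B]) (use False less.prems in auto)
      have min: "d C \<le> d W" if "?P W" for W unfolding C_def by (rule arg_min_nat_le) (rule that)
      have "covers R M A C"
        using C less.prems(1) min d unfolding covers_def
        by (metis leD psubset_subset_trans psubset_imp_subset)
      moreover have "d A < d C" using d C less.prems by blast
      moreover have "d C \<le> d B" using min False less.prems by auto
      ultimately have "d B - d C < d B - d A" by linarith
      then obtain n where "comp_chain R M B C n" using less.hyps C less.prems(2) by metis
      then show ?thesis using \<open>covers R M A C\<close> comp_chain.comp_step by blast
    qed
  qed
qed

text \<open>If the first steps P and Q differ, both continue through P + Q by a chain of some length
  r. The induction hypothesis at P gives n = r + 1, so the chain from Q through P + Q also has
  length n, and the hypothesis at Q gives n = m'.\<close>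

lemma comp_chain_unique:
  "comp_chain R M B A n \<Longrightarrow> comp_chain R M B A m \<Longrightarrow> n = m"
proof (induction n arbitrary: A m)
  case 0
  then show ?case using comp_chainD by blast
next
  case (Suc n)
  then obtain m' where m: "m = Suc m'" using comp_chainD by (metis not0_implies_Suc)
  obtain P where P: "covers R M A P" "comp_chain R M B P n" using Suc.prems(1) by (cases rule: comp_chain.cases) auto
  obtain Q where Q: "covers R M A Q" "comp_chain R M B Q m'"
    using Suc.prems(2) unfolding m by (cases rule: comp_chain.cases) auto
  show ?case
  proof (cases "P = Q")
    case True
    then show ?thesis using Suc.IH[OF P(2)] Q(2) m by simp
  next
    case False
    have s: "submodule P R M" "submodule Q R M" "submodule B R M" "P \<subseteq> B" "Q \<subseteq> B"
      using comp_chainD[OF P(2)] comp_chainD[OF Q(2)] by auto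
    obtain r where r: "comp_chain R M B (sum_set P Q) r"
      using comp_chain_exists[OF submodule_sum[OF s(1,2)] s(3)] sum_set_least[OF s(3,4,5)] by blast
    have "sum_set Q P = sum_set P Q" using s unfolding sum_set_def submodule_iff
      by (metis (no_types, lifting) M.a_comm subsetD)
    then have "comp_chain R M B P (Suc r)" "comp_chain R M B Q (Suc r)"
      using comp_chain.comp_step[OF covers_sum[OF P(1) Q(1) False] r] comp_chain.comp_step[OF covers_sum[OF Q(1) P(1)], of B r] r False
      by auto
    then have "n = Suc r" using Suc.IH[OF P(2)] by blast
    then have "n = m'" using Suc.IH[OF _ Q(2)] \<open>comp_chain R M B Q (Suc r)\<close> by blast
    then show ?thesis using m by simp
  qed
qed

lemma composition_length_eq:
  assumes "comp_chain R M (carrier M) {\<zero>\<^bsub>M\<^esub>} n"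
  shows "composition_length R M = n"
  unfolding composition_length_def composition_series_iff
  by (rule Least_equality) (use assms comp_chain_unique in auto)

end

text \<open>An isomorphism between two intervals of submodule lattices carries composition series
  over. The map \<phi> acts on sets, so that both images under an injection and preimages under any
  homomorphism are instances.\<close>

lemma comp_chain_transport:
  assumes chain: "comp_chain R M B A0 n"
    and sub: "\<And>C. submodule C R M \<Longrightarrow> A0 \<subseteq> C \<Longrightarrow> C \<subseteq> B \<Longrightarrow> submodule (\<phi> C) R' M'"
    and mono: "\<And>C D. submodule C R M \<Longrightarrow> A0 \<subseteq> C \<Longrightarrow> C \<subseteq> B \<Longrightarrow> submodule D R M \<Longrightarrow> A0 \<subseteq> D \<Longrightarrow> D \<subseteq> B \<Longrightarrow>
        \<phi> C \<subseteq> \<phi> D \<longleftrightarrow> C \<subseteq> D"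
    and surj: "\<And>W. submodule W R' M' \<Longrightarrow> \<phi> A0 \<subseteq> W \<Longrightarrow> W \<subseteq> \<phi> B \<Longrightarrow>
        \<exists>C. submodule C R M \<and> A0 \<subseteq> C \<and> C \<subseteq> B \<and> W = \<phi> C"
  shows "comp_chain R' M' (\<phi> B) (\<phi> A0) n"
proof -
  have A0: "submodule A0 R M" "submodule B R M" "A0 \<subseteq> B" using comp_chainD[OF chain] by auto
  have "comp_chain R' M' (\<phi> B) (\<phi> A) n" if "comp_chain R M B A n" "A0 \<subseteq> A" for A n
    using that
  proof (induction rule: comp_chain.induct)
    case comp_refl
    then show ?case using A0 sub by (intro comp_chain.comp_refl) auto
  next
    case (comp_step A A' n)
    have AA: "submodule A R M" "submodule A' R M" "A \<subset> A'" "A' \<subseteq> B"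
      using comp_step.hyps comp_chainD[OF comp_step.hyps(2)] by (auto simp: covers_def)
    have I: "A0 \<subseteq> A" "A \<subseteq> B" "A0 \<subseteq> A'" using AA comp_step.prems by auto
    have "\<not> (\<exists>W. submodule W R' M' \<and> \<phi> A \<subset> W \<and> W \<subset> \<phi> A')"
    proof
      assume "\<exists>W. submodule W R' M' \<and> \<phi> A \<subset> W \<and> W \<subset> \<phi> A'"
      then obtain W where W: "submodule W R' M'" "\<phi> A \<subset> W" "W \<subset> \<phi> A'" by blast
      have "\<phi> A0 \<subseteq> \<phi> A" "\<phi> A' \<subseteq> \<phi> B" using mono AA A0 I by auto
      then obtain C where C: "submodule C R M" "A0 \<subseteq> C" "C \<subseteq> B" "W = \<phi> C"
        using surj[OF W(1)] W(2,3) by blast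
      have "A \<subset> C" "C \<subset> A'" using W(2,3) mono C AA I unfolding C(4) by (metis psubsetE psubsetI)+
      then show False using comp_step.hyps(1) C(1) unfolding covers_def by blast
    qed
    moreover have "\<phi> A \<subset> \<phi> A'" using mono AA I by (metis psubsetE psubsetI)
    ultimately have "covers R' M' (\<phi> A) (\<phi> A')" using sub AA I unfolding covers_def by auto
    then show ?case using comp_step.IH I by (auto intro: comp_chain.comp_step)
  qed
  then show ?thesis using chain by blast
qed

section \<open>Length along homomorphisms\<close>

locale operator_hom = M: operator_group R M + N: operator_group R N
  for R :: "('r, 'y) ring_scheme" and M :: "('r, 'm) module" and N :: "('r, 'n) module" +
  fixes f assumes f: "linear_map R M N f"
begin

lemmas fD = linear_mapD[OF f]

lemma f_zero: "f \<zero>\<^bsub>M\<^esub> = \<zero>\<^bsub>N\<^esub>"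
  using additive_map_zero[OF _ _ linear_map_additive[OF f]] M.M.abelian_group_axioms N.M.abelian_group_axioms by blast

lemma f_minus: "x \<in> carrier M \<Longrightarrow> f (\<ominus>\<^bsub>M\<^esub> x) = \<ominus>\<^bsub>N\<^esub> f x"
  using additive_map_minus[OF _ _ linear_map_additive[OF f]] M.M.abelian_group_axioms N.M.abelian_group_axioms by blast

lemma submodule_image:
  assumes "submodule C R M"
  shows "submodule (f ` C) R N"
proof -
  have c: "x \<in> carrier M" if "x \<in> C" for x using assms that by (auto simp: M.submodule_iff)
  show ?thesis unfolding N.submodule_iff
  proof (intro conjI ballI)
    show "f ` C \<subseteq> carrier N" using c fD by auto
    show "\<zero>\<^bsub>N\<^esub> \<in> f ` C" using f_zero assms by (metis M.submodule_iff imageI)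
  next
    fix x y assume "x \<in> f ` C" "y \<in> f ` C"
    then obtain a b where "a \<in> C" "b \<in> C" "x = f a" "y = f b" by blast
    moreover from this have "a \<oplus>\<^bsub>M\<^esub> b \<in> C" using assms by (simp add: M.submodule_iff)
    ultimately show "x \<oplus>\<^bsub>N\<^esub> y \<in> f ` C" using c fD(2) by (metis imageI)
  next
    fix x assume "x \<in> f ` C"
    then obtain a where "a \<in> C" "x = f a" by blast
    moreover from this have "\<ominus>\<^bsub>M\<^esub> a \<in> C" using assms by (simp add: M.submodule_iff)
    ultimately show "\<ominus>\<^bsub>N\<^esub> x \<in> f ` C" using c f_minus by (metis imageI)
  next
    fix r x assume "r \<in> carrier R" "x \<in> f ` C"
    then obtain a where "a \<in> C" "x = f a" by blast
    moreover from this have "r \<odot>\<^bsub>M\<^esub> a \<in> C" using assms \<open>r \<in> _\<close> by (simp add: M.submodule_iff)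
    ultimately show "r \<odot>\<^bsub>N\<^esub> x \<in> f ` C" using c fD(3) \<open>r \<in> _\<close> by (metis imageI)
  qed
qed

lemma submodule_vimage:
  assumes "submodule C R N"
  shows "submodule {x \<in> carrier M. f x \<in> C} R M"
  using assms fD f_zero f_minus unfolding M.submodule_iff N.submodule_iff
  by (auto simp: M.op_closed)

lemma comp_chain_image:
  assumes inj: "inj_on f (carrier M)" and "comp_chain R M (carrier M) {\<zero>\<^bsub>M\<^esub>} n"
  shows "comp_chain R N (f ` carrier M) {\<zero>\<^bsub>N\<^esub>} n"
proof -
  have "comp_chain R N (f ` carrier M) (f ` {\<zero>\<^bsub>M\<^esub>}) n"
  proof (rule comp_chain_transport[OF assms(2)])
    show "submodule (f ` C) R N" if "submodule C R M" for C using submodule_image that .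
    show "f ` C \<subseteq> f ` D \<longleftrightarrow> C \<subseteq> D" if "C \<subseteq> carrier M" "D \<subseteq> carrier M" for C D
      using inj that unfolding inj_on_def by blast
    fix W assume W: "submodule W R N" "f ` {\<zero>\<^bsub>M\<^esub>} \<subseteq> W" "W \<subseteq> f ` carrier M"
    have "W = f ` {x \<in> carrier M. f x \<in> W}" using W(3) by auto
    then show "\<exists>C. submodule C R M \<and> {\<zero>\<^bsub>M\<^esub>} \<subseteq> C \<and> C \<subseteq> carrier M \<and> W = f ` C"
      using submodule_vimage[OF W(1)] W(2) by (intro exI[of _ "{x \<in> carrier M. f x \<in> W}"]) auto
  qed
  then show ?thesis by (simp add: f_zero)
qed

text \<open>Submodules above the kernel correspond to submodules of the image. Stated with
  preimages, this is the isomorphism theorem without a quotient module.\<close>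

lemma comp_chain_vimage:
  assumes "comp_chain R N (f ` carrier M) {\<zero>\<^bsub>N\<^esub>} n"
  shows "comp_chain R M (carrier M) {x \<in> carrier M. f x = \<zero>\<^bsub>N\<^esub>} n"
proof -
  let ?v = "\<lambda>C. {x \<in> carrier M. f x \<in> C}"
  have "comp_chain R M (?v (f ` carrier M)) (?v {\<zero>\<^bsub>N\<^esub>}) n"
  proof (rule comp_chain_transport[OF assms])
    show "submodule (?v C) R M" if "submodule C R N" for C using submodule_vimage that .
    show "?v C \<subseteq> ?v D \<longleftrightarrow> C \<subseteq> D" if "C \<subseteq> f ` carrier M" "D \<subseteq> f ` carrier M" for C D
      using that by auto
    fix W assume W: "submodule W R M" "?v {\<zero>\<^bsub>N\<^esub>} \<subseteq> W" "W \<subseteq> ?v (f ` carrier M)"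
    have Wc: "W \<subseteq> carrier M" using W(3) by auto
    \<comment> \<open>W contains the kernel of f, so it is saturated: x and w with f x = f w differ
      by an element of W.\<close>
    have "?v (f ` W) \<subseteq> W"
    proof
      fix x assume "x \<in> ?v (f ` W)"
      then obtain w where w: "x \<in> carrier M" "w \<in> W" "f x = f w" by auto
      have wc: "w \<in> carrier M" using w Wc by auto
      have "f (x \<oplus>\<^bsub>M\<^esub> \<ominus>\<^bsub>M\<^esub> w) = \<zero>\<^bsub>N\<^esub>"
        using w wc fD(1)[OF wc] by (simp add: fD f_minus N.M.r_neg)
      then have "x \<oplus>\<^bsub>M\<^esub> \<ominus>\<^bsub>M\<^esub> w \<in> W" using W(2) w wc by auto
      then have "(x \<oplus>\<^bsub>M\<^esub> \<ominus>\<^bsub>M\<^esub> w) \<oplus>\<^bsub>M\<^esub> w \<in> W" using w W(1) by (simp add: M.submodule_iff)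
      then show "x \<in> W" using w wc by (simp add: M.M.a_assoc M.M.l_neg)
    qed
    then have "W = ?v (f ` W)" using Wc by auto
    then show "\<exists>C. submodule C R N \<and> {\<zero>\<^bsub>N\<^esub>} \<subseteq> C \<and> C \<subseteq> f ` carrier M \<and> W = ?v C"
      using submodule_image[OF W(1)] Wc N.submodule_iff[of "f ` W"] by (intro exI[of _ "f ` W"]) auto
  qed
  moreover have "?v (f ` carrier M) = carrier M" by auto
  ultimately show ?thesis by simp
qed

end

text \<open>Let a be the length of P, b that of the image of j, and c that of the interval from this
  image to N. Then M has length a + b and N has length b + c, so the alternating sum is c, and c = 0
  means that j is onto.\<close>

lemma length_additive_iff:
  assumes P: "finite_operator_group R P" and M: "finite_operator_group R M" and N: "finite_operator_group R N"
    and i: "linear_map R P M i" "inj_on i (carrier P)" and j: "linear_map R M N j"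
    and exact: "i ` carrier P = {x \<in> carrier M. j x = \<zero>\<^bsub>N\<^esub>}"
  shows "int (composition_length R N) - int (composition_length R M) + int (composition_length R P) = 0 \<longleftrightarrow>
    j ` carrier M = carrier N"
proof -
  interpret P: finite_operator_group R P by (rule P)
  interpret M: finite_operator_group R M by (rule M)
  interpret N: finite_operator_group R N by (rule N)
  interpret i: operator_hom R P M i by unfold_locales (rule i)
  interpret j: operator_hom R M N j by unfold_locales (rule j)
  have jsub: "submodule (j ` carrier M) R N" by (rule j.submodule_image[OF M.submodule_carrier])
  have jc: "j ` carrier M \<subseteq> carrier N" "{\<zero>\<^bsub>N\<^esub>} \<subseteq> j ` carrier M" using jsub by (auto simp: N.submodule_iff)
  obtain a where a: "comp_chain R P (carrier P) {\<zero>\<^bsub>P\<^esub>} a"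
    using P.comp_chain_exists[OF P.submodule_zero P.submodule_carrier] by auto
  obtain b where b: "comp_chain R N (j ` carrier M) {\<zero>\<^bsub>N\<^esub>} b"
    using N.comp_chain_exists[OF N.submodule_zero jsub jc(2)] by auto
  obtain c where c: "comp_chain R N (carrier N) (j ` carrier M) c"
    using N.comp_chain_exists[OF jsub N.submodule_carrier jc(1)] by auto
  have "comp_chain R M (carrier M) {\<zero>\<^bsub>M\<^esub>} (a + b)"
    using comp_chain_append[OF i.comp_chain_image[OF i(2) a, unfolded exact] j.comp_chain_vimage[OF b]] .
  then have "composition_length R M = a + b" by (rule M.composition_length_eq)
  moreover have "composition_length R N = b + c" by (rule N.composition_length_eq[OF comp_chain_append[OF b c]])
  moreover have "composition_length R P = a" by (rule P.composition_length_eq[OF a])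
  ultimately show ?thesis using comp_chainD[OF c] by auto
qed

section \<open>Homomorphisms into the point module\<close>

lemma operator_group_left_module: "left_module R M \<Longrightarrow> operator_group R M"
  by (simp add: left_module_def left_module_axioms_def operator_group_def operator_group_axioms_def)

lemma hom_module_simps [simp]:
  "carrier (hom_module R M N act) = lhom R M N"
  "f \<oplus>\<^bsub>hom_module R M N act\<^esub> g = (\<lambda>x\<in>carrier M. f x \<oplus>\<^bsub>N\<^esub> g x)"
  "\<zero>\<^bsub>hom_module R M N act\<^esub> = (\<lambda>x\<in>carrier M. \<zero>\<^bsub>N\<^esub>)"
  "smult (hom_module R M N act) = act"
  by (simp_all add: hom_module_def)

lemma coinduced_simps [simp]:
  "carrier (coinduced R S \<alpha> N) = lhom R (restr \<alpha> (regular S)) N"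
  "f \<oplus>\<^bsub>coinduced R S \<alpha> N\<^esub> g = (\<lambda>x\<in>carrier S. f x \<oplus>\<^bsub>N\<^esub> g x)"
  "\<zero>\<^bsub>coinduced R S \<alpha> N\<^esub> = (\<lambda>x\<in>carrier S. \<zero>\<^bsub>N\<^esub>)"
  "s \<odot>\<^bsub>coinduced R S \<alpha> N\<^esub> f = (\<lambda>y\<in>carrier S. f (y \<otimes>\<^bsub>S\<^esub> s))"
  by (simp_all add: coinduced_def)

lemma lhom_eqI:
  assumes "f \<in> lhom R M N" "g \<in> lhom R M N" "\<And>x. x \<in> carrier M \<Longrightarrow> f x = g x"
  shows "f = g"
  using assms by (auto simp: lhom_def intro: extensionalityI[of _ "carrier M"])

lemma restrict_lhom:
  assumes M: "left_module R M" and f: "linear_map R M N f"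
  shows "restrict f (carrier M) \<in> lhom R M N"
proof -
  interpret M: left_module R M by fact
  show ?thesis using f M.smult_closed by (simp add: lhom_def linear_map_def Pi_iff)
qed

lemma hom_module_abelian:
  assumes M: "left_module R M" and N: "operator_group R N"
  shows "abelian_group (hom_module R M N act)"
proof -
  interpret M: left_module R M by fact
  interpret N: operator_group R N by fact
  have add: "(\<lambda>x\<in>carrier M. f x \<oplus>\<^bsub>N\<^esub> g x) \<in> lhom R M N" if "f \<in> lhom R M N" "g \<in> lhom R M N" for f g
    using lhomD(1-3)[OF that(1)] lhomD(1-3)[OF that(2)]
    by (intro restrict_lhom[OF M]) (simp add: linear_map_def N.op_add N.M.a_ac)
  let ?H = "hom_module R M N act"
  have cl: "f x \<in> carrier N" if "f \<in> carrier ?H" "x \<in> carrier M" for f x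
    using lhomD(1)[of f R M N x] that by simp
  have ext: "f x = undefined" if "f \<in> carrier ?H" "x \<notin> carrier M" for f x
    using lhomD(4)[of f R M N x] that by simp
  show ?thesis
  proof (rule abelian_groupI)
    show "f \<oplus>\<^bsub>?H\<^esub> g \<in> carrier ?H" if "f \<in> carrier ?H" "g \<in> carrier ?H" for f g
      using add that by simp
    show "\<zero>\<^bsub>?H\<^esub> \<in> carrier ?H"
      unfolding hom_module_simps by (intro restrict_lhom[OF M]) (simp add: linear_map_def N.op_zero)
    show "f \<oplus>\<^bsub>?H\<^esub> g \<oplus>\<^bsub>?H\<^esub> h = f \<oplus>\<^bsub>?H\<^esub> (g \<oplus>\<^bsub>?H\<^esub> h)"
      if "f \<in> carrier ?H" "g \<in> carrier ?H" "h \<in> carrier ?H" for f g h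
      unfolding hom_module_simps(2) using that by (intro restrict_ext) (simp add: cl N.M.a_assoc del: hom_module_simps(1))
    show "f \<oplus>\<^bsub>?H\<^esub> g = g \<oplus>\<^bsub>?H\<^esub> f" if "f \<in> carrier ?H" "g \<in> carrier ?H" for f g
      unfolding hom_module_simps(2) using that by (intro restrict_ext N.M.a_comm cl)
    show "\<zero>\<^bsub>?H\<^esub> \<oplus>\<^bsub>?H\<^esub> f = f" if f: "f \<in> carrier ?H" for f
    proof
      fix x show "(\<zero>\<^bsub>?H\<^esub> \<oplus>\<^bsub>?H\<^esub> f) x = f x"
        using cl[OF f, of x] ext[OF f, of x] by (cases "x \<in> carrier M") simp_all
    qed
    show "\<exists>g\<in>carrier ?H. g \<oplus>\<^bsub>?H\<^esub> f = \<zero>\<^bsub>?H\<^esub>" if f: "f \<in> carrier ?H" for f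
    proof
      show "(\<lambda>x\<in>carrier M. \<ominus>\<^bsub>N\<^esub> f x) \<in> carrier ?H"
        unfolding hom_module_simps using lhomD(1-3)[of f R M N] f
        by (intro restrict_lhom[OF M]) (simp add: linear_map_def N.op_minus N.M.minus_add)
      show "(\<lambda>x\<in>carrier M. \<ominus>\<^bsub>N\<^esub> f x) \<oplus>\<^bsub>?H\<^esub> f = \<zero>\<^bsub>?H\<^esub>"
        unfolding hom_module_simps using cl[OF f] by (intro restrict_ext) (simp add: N.M.l_neg)
    qed
  qed
qed

lemma hom_module_operator_group:
  assumes M: "left_module R M" and N: "operator_group R N"
  shows "operator_group (end_ring R N) (hom_module R M N (\<lambda>e f. compose (carrier M) e f))"
proof -
  have E: "carrier (end_ring R N) = lhom R N N" by (simp add: end_ring_def)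
  interpret M: left_module R M by fact
  show ?thesis unfolding operator_group_def operator_group_axioms_def E hom_module_simps
  proof (intro conjI allI impI)
    show "abelian_group (hom_module R M N (\<lambda>e f. compose (carrier M) e f))" by (rule hom_module_abelian[OF assms])
    fix e f assume e: "e \<in> lhom R N N" and f: "f \<in> lhom R M N"
    show "compose (carrier M) e f \<in> lhom R M N" by (rule lhom_compose[OF f e M])
    fix g assume g: "g \<in> lhom R M N"
    show "compose (carrier M) e (\<lambda>x\<in>carrier M. f x \<oplus>\<^bsub>N\<^esub> g x) =
      (\<lambda>x\<in>carrier M. compose (carrier M) e f x \<oplus>\<^bsub>N\<^esub> compose (carrier M) e g x)"
      unfolding compose_def using lhomD(2)[OF e] lhomD(1)[OF f] lhomD(1)[OF g] by (intro restrict_ext) simp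
  qed
qed

text \<open>A subspace of \<open>K^n\<close> is determined up to inclusion by its set of pivot positions: reduce a
  vector with the vectors of the smaller space, from the left.\<close>

lemma finite_height_pivots:
  fixes M :: "('r, 'm) module" and ev :: "'m \<Rightarrow> nat \<Rightarrow> 'd" and n :: nat and K :: "'d ring"
  assumes M: "operator_group R M" and K: "field K"
    and ev: "\<And>x i. x \<in> carrier M \<Longrightarrow> i < n \<Longrightarrow> ev x i \<in> carrier K"
    and ev_add: "\<And>x y i. x \<in> carrier M \<Longrightarrow> y \<in> carrier M \<Longrightarrow> i < n \<Longrightarrow> ev (x \<oplus>\<^bsub>M\<^esub> y) i = ev x i \<oplus>\<^bsub>K\<^esub> ev y i"
    and ev_inj: "\<And>x. x \<in> carrier M \<Longrightarrow> (\<And>i. i < n \<Longrightarrow> ev x i = \<zero>\<^bsub>K\<^esub>) \<Longrightarrow> x = \<zero>\<^bsub>M\<^esub>"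
    and scale: "\<And>S x c. submodule S R M \<Longrightarrow> x \<in> S \<Longrightarrow> c \<in> carrier K \<Longrightarrow>
        \<exists>y\<in>S. \<forall>i<n. ev y i = c \<otimes>\<^bsub>K\<^esub> ev x i"
  shows "finite_height R M"
proof -
  interpret M: operator_group R M by fact
  interpret K: field K by fact
  have ev_minus: "ev (x \<oplus>\<^bsub>M\<^esub> \<ominus>\<^bsub>M\<^esub> y) i = ev x i \<ominus>\<^bsub>K\<^esub> ev y i" if "x \<in> carrier M" "y \<in> carrier M" "i < n" for x y i
    using additive_map_diff[OF M.M.abelian_group_axioms K.abelian_group_axioms, of "\<lambda>x. ev x i" x y] that ev ev_add
    by (simp add: additive_map_def a_minus_def)
  define piv where "piv S = {i. i < n \<and> (\<exists>v\<in>S. ev v i \<noteq> \<zero>\<^bsub>K\<^esub> \<and> (\<forall>j<i. ev v j = \<zero>\<^bsub>K\<^esub>))}" for S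
  have "card (piv A) < card (piv B)" if A: "submodule A R M" and B: "submodule B R M" and AB: "A \<subset> B" for A B
  proof (rule psubset_card_mono)
    show "finite (piv B)" by (simp add: piv_def)
    have "piv A \<noteq> piv B"
    proof
      assume eq: "piv A = piv B"
      have cB: "x \<in> carrier M" if "x \<in> B" for x using B that by (auto simp: M.submodule_iff)
      \<comment> \<open>Induction from the right end: m = 0 concerns vectors without nonzero
        coordinates, that is the zero vector, and m = n concerns all of B.\<close>
      have "\<forall>v\<in>B. (\<forall>j<n - m. ev v j = \<zero>\<^bsub>K\<^esub>) \<longrightarrow> v \<in> A" if "m \<le> n" for m
        using that
      proof (induction m)
        case 0
        show ?case
        proof (intro ballI impI)
          fix v assume "v \<in> B" "\<forall>j<n - 0. ev v j = \<zero>\<^bsub>K\<^esub>"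
          then have "v = \<zero>\<^bsub>M\<^esub>" using ev_inj cB by simp
          then show "v \<in> A" using A by (simp add: M.submodule_iff)
        qed
      next
        case (Suc m)
        show ?case
        proof (intro ballI impI)
          fix v assume v: "v \<in> B" "\<forall>j<n - Suc m. ev v j = \<zero>\<^bsub>K\<^esub>"
          let ?i = "n - Suc m"
          have i: "?i < n" using Suc.prems by simp
          have step: "u \<in> A" if u: "u \<in> B" "\<forall>j<?i. ev u j = \<zero>\<^bsub>K\<^esub>" "ev u ?i = \<zero>\<^bsub>K\<^esub>" for u
          proof -
            have "ev u j = \<zero>\<^bsub>K\<^esub>" if "j < n - m" for j
              using that u(2,3) Suc.prems by (cases "j = ?i") auto
            then show ?thesis using Suc.IH Suc.prems u(1) by simp
          qed
          show "v \<in> A"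
          proof (cases "ev v ?i = \<zero>\<^bsub>K\<^esub>")
            case True
            then show ?thesis using step v by blast
          next
            case False
            then have "?i \<in> piv B" using v i by (auto simp: piv_def)
            then have "?i \<in> piv A" by (simp only: eq)
            then obtain w where w: "w \<in> A" "ev w ?i \<noteq> \<zero>\<^bsub>K\<^esub>" "\<forall>j<?i. ev w j = \<zero>\<^bsub>K\<^esub>"
              by (auto simp: piv_def)
            have wc: "w \<in> carrier M" using w cB AB by auto
            have wi: "ev w ?i \<in> Units K" using w(2) ev[OF wc i] by (simp add: K.field_Units)
            \<comment> \<open>The factor that makes c w agree with v at the pivot; both vanish
              before it, so the difference starts further to the right.\<close>
            define c where "c = ev v ?i \<otimes>\<^bsub>K\<^esub> inv\<^bsub>K\<^esub> ev w ?i"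
            have c: "c \<in> carrier K" "c \<otimes>\<^bsub>K\<^esub> ev w ?i = ev v ?i"
              using wi ev[OF cB[OF v(1)] i] ev[OF wc i] by (simp_all add: c_def K.m_assoc)
            \<comment> \<open>M has no K-action of its own; \<open>scale\<close> provides an element
              of A with the coordinates of c w.\<close>
            obtain y where y: "y \<in> A" "\<forall>i<n. ev y i = c \<otimes>\<^bsub>K\<^esub> ev w i" using scale[OF A w(1) c(1)] by blast
            have yB: "y \<in> B" "\<ominus>\<^bsub>M\<^esub> y \<in> B" using y AB B by (auto simp: M.submodule_iff)
            have "v \<oplus>\<^bsub>M\<^esub> \<ominus>\<^bsub>M\<^esub> y \<in> A"
            proof (rule step)
              show "v \<oplus>\<^bsub>M\<^esub> \<ominus>\<^bsub>M\<^esub> y \<in> B" using v yB B by (simp add: M.submodule_iff)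
              show "\<forall>j<?i. ev (v \<oplus>\<^bsub>M\<^esub> \<ominus>\<^bsub>M\<^esub> y) j = \<zero>\<^bsub>K\<^esub>"
                using v y w c cB yB i by (simp add: ev_minus a_minus_def K.r_neg)
              show "ev (v \<oplus>\<^bsub>M\<^esub> \<ominus>\<^bsub>M\<^esub> y) ?i = \<zero>\<^bsub>K\<^esub>"
                using v y c cB yB i ev[OF cB[OF v(1)] i] by (simp add: ev_minus a_minus_def K.r_neg)
            qed
            then have "(v \<oplus>\<^bsub>M\<^esub> \<ominus>\<^bsub>M\<^esub> y) \<oplus>\<^bsub>M\<^esub> y \<in> A" using y A by (simp add: M.submodule_iff)
            then show ?thesis using cB v yB by (simp add: M.M.a_assoc M.M.l_neg)
          qed
        qed
      qed
      from this[of n] have "B \<subseteq> A" by auto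
      then show False using AB by blast
    qed
    moreover have "piv A \<subseteq> piv B" using AB by (auto simp: piv_def)
    ultimately show "piv A \<subset> piv B" by (simp add: psubset_eq)
  qed
  then show ?thesis unfolding finite_height_def by (intro exI[of _ "\<lambda>S. card (piv S)"]) simp
qed

text \<open>B stands for kG and R for K[t]/(t^p). Together with \<open>alpha_hom\<close>, the
  condition on \<epsilon> says that \<alpha> is a map of K-algebras.\<close>

locale pi_setting = scalar_extension k K B \<iota> + truncated_ring K R \<epsilon> aug t p
  for k :: "'c ring" and K :: "'d ring" and B :: "('c, 'b, 'z) module_scheme" (structure)
    and \<iota> :: "'c \<Rightarrow> 'd" and R :: "'r ring" and \<epsilon> aug t p +
  fixes \<alpha> :: "'r \<Rightarrow> ('b, 'd) tens"
  assumes alpha_hom: "\<alpha> \<in> ring_hom R KB"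
    and alpha_eps: "c \<in> carrier K \<Longrightarrow> \<alpha> (\<epsilon> c) = ptB \<one>\<^bsub>B\<^esub> c"
begin

abbreviation "RExt M \<equiv> restr \<alpha> (Ext M)"
abbreviation "Ktriv \<equiv> restr aug (regular K)"
abbreviation "incl b \<equiv> ptB b \<one>\<^bsub>K\<^esub>"
abbreviation "Delta \<equiv> restr (\<lambda>b. ptB b \<one>\<^bsub>K\<^esub>) (coinduced R KB \<alpha> Ktriv)"

lemma RExt_left_module: "left_module B M \<Longrightarrow> left_module R (RExt M)"
  by (rule left_module_restr[OF R.ring_axioms KB_ring alpha_hom Ext_left_module])

lemma Ktriv_left_module: "left_module R Ktriv"
  by (rule left_module_restr[OF R.ring_axioms K.ring_axioms aug_hom left_module_regular[OF K.ring_axioms]])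

lemma RKB_left_module: "left_module R (restr \<alpha> (regular KB))"
  by (rule left_module_restr[OF R.ring_axioms KB_ring alpha_hom left_module_regular[OF KB_ring]])

lemma alpha_closed: "r \<in> carrier R \<Longrightarrow> \<alpha> r \<in> carrier KB"
  using ring_hom_closed[OF alpha_hom] .

lemma Delta_simps:
  "carrier Delta = lhom R (restr \<alpha> (regular KB)) Ktriv"
  "f \<oplus>\<^bsub>Delta\<^esub> g = (\<lambda>x\<in>carrier KB. f x \<oplus>\<^bsub>K\<^esub> g x)"
  "\<zero>\<^bsub>Delta\<^esub> = (\<lambda>x\<in>carrier KB. \<zero>\<^bsub>K\<^esub>)"
  "b \<odot>\<^bsub>Delta\<^esub> f = (\<lambda>y\<in>carrier KB. f (y \<otimes>\<^bsub>KB\<^esub> incl b))"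
  by simp_all

lemma DeltaD:
  assumes "f \<in> carrier Delta"
  shows "u \<in> carrier KB \<Longrightarrow> f u \<in> carrier K"
    and "u \<in> carrier KB \<Longrightarrow> v \<in> carrier KB \<Longrightarrow> f (u \<oplus>\<^bsub>KB\<^esub> v) = f u \<oplus>\<^bsub>K\<^esub> f v"
    and "r \<in> carrier R \<Longrightarrow> u \<in> carrier KB \<Longrightarrow> f (\<alpha> r \<otimes>\<^bsub>KB\<^esub> u) = aug r \<otimes>\<^bsub>K\<^esub> f u"
    and "u \<notin> carrier KB \<Longrightarrow> f u = undefined"
  using lhomD[OF assms[unfolded Delta_simps]] by simp_all

lemma DeltaI:
  assumes "\<And>u. u \<in> carrier KB \<Longrightarrow> f u \<in> carrier K"
    and "\<And>u v. u \<in> carrier KB \<Longrightarrow> v \<in> carrier KB \<Longrightarrow> f (u \<oplus>\<^bsub>KB\<^esub> v) = f u \<oplus>\<^bsub>K\<^esub> f v"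
    and "\<And>r u. r \<in> carrier R \<Longrightarrow> u \<in> carrier KB \<Longrightarrow> f (\<alpha> r \<otimes>\<^bsub>KB\<^esub> u) = aug r \<otimes>\<^bsub>K\<^esub> f u"
  shows "(\<lambda>u\<in>carrier KB. f u) \<in> carrier Delta"
proof -
  have "restrict f (carrier (restr \<alpha> (regular KB))) \<in> lhom R (restr \<alpha> (regular KB)) Ktriv"
    by (rule restrict_lhom[OF RKB_left_module]) (use assms in \<open>simp add: linear_map_def\<close>)
  then show ?thesis by (simp add: Delta_simps)
qed

lemma incl_closed: "b \<in> carrier B \<Longrightarrow> incl b \<in> carrier KB"
  by (simp add: ptB_closed)

lemma Delta_operator_group: "operator_group B Delta"
proof -
  interpret KB: ring KB by (rule KB_ring)
  have "abelian_group Delta"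
    using abelian_group_cong[OF hom_module_abelian[OF RKB_left_module operator_group_left_module[OF Ktriv_left_module]]]
    by (metis restr_simps(1-3) coinduced_def)
  moreover have "b \<odot>\<^bsub>Delta\<^esub> f \<in> carrier Delta" if "b \<in> carrier B" "f \<in> carrier Delta" for b f
    unfolding Delta_simps(4) using DeltaD[OF that(2)] incl_closed[OF that(1)] alpha_closed
    by (intro DeltaI) (simp_all add: KB.l_distr KB.m_assoc)
  moreover have "b \<odot>\<^bsub>Delta\<^esub> (f \<oplus>\<^bsub>Delta\<^esub> g) = b \<odot>\<^bsub>Delta\<^esub> f \<oplus>\<^bsub>Delta\<^esub> b \<odot>\<^bsub>Delta\<^esub> g" if "b \<in> carrier B" for b f g
    unfolding Delta_simps(2,4) using incl_closed[OF that] by (intro restrict_ext) simp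
  ultimately show ?thesis unfolding operator_group_def operator_group_axioms_def by blast
qed

section \<open>The adjunction between homomorphisms into the point module and functionals on M
  \<otimes> K\<close>

context
  fixes M :: "('b, 'm) module"
  assumes M: "left_module B M"
begin

interpretation M: left_module B M by (rule M)

text \<open>The last claim, K-linearity, is a case of R-linearity: c acts on M \<otimes> K as
  \<alpha> (\<epsilon> c), and its augmentation is c.\<close>

lemma functionalD:
  assumes l: "l \<in> lhom R (RExt M) Ktriv"
  shows "v \<in> carrier (Ext M) \<Longrightarrow> l v \<in> carrier K"
    and "v \<in> carrier (Ext M) \<Longrightarrow> w \<in> carrier (Ext M) \<Longrightarrow> l (v \<oplus>\<^bsub>Ext M\<^esub> w) = l v \<oplus>\<^bsub>K\<^esub> l w"
    and "r \<in> carrier R \<Longrightarrow> v \<in> carrier (Ext M) \<Longrightarrow> l (\<alpha> r \<odot>\<^bsub>Ext M\<^esub> v) = aug r \<otimes>\<^bsub>K\<^esub> l v"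
    and "m \<in> carrier M \<Longrightarrow> c \<in> carrier K \<Longrightarrow> l (tens M m c) = c \<otimes>\<^bsub>K\<^esub> l (tens M m \<one>\<^bsub>K\<^esub>)"
proof -
  show *: "r \<in> carrier R \<Longrightarrow> v \<in> carrier (Ext M) \<Longrightarrow> l (\<alpha> r \<odot>\<^bsub>Ext M\<^esub> v) = aug r \<otimes>\<^bsub>K\<^esub> l v" for r v
    using lhomD(3)[OF l] by simp
  show "v \<in> carrier (Ext M) \<Longrightarrow> l v \<in> carrier K"
    "v \<in> carrier (Ext M) \<Longrightarrow> w \<in> carrier (Ext M) \<Longrightarrow> l (v \<oplus>\<^bsub>Ext M\<^esub> w) = l v \<oplus>\<^bsub>K\<^esub> l w"
    using lhomD(1,2)[OF l] by simp_all
  show "l (tens M m c) = c \<otimes>\<^bsub>K\<^esub> l (tens M m \<one>\<^bsub>K\<^esub>)" if "m \<in> carrier M" "c \<in> carrier K"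
    using *[OF eps_closed[OF that(2)] tens_closed[OF M that(1) K.one_closed]] that
    by (simp add: alpha_eps aug_eps smult_Ext_pure[OF M] M.smult_one)
qed

text \<open>The adjunction for base change along k \<rightarrow> K followed by the one for
  coinduction along \<alpha>: a functional l on M \<otimes> K gives x \<mapsto> (y \<mapsto> l (y (x
  \<otimes> 1))).\<close>

definition to_Delta :: "(('m, 'd) tens \<Rightarrow> 'd) \<Rightarrow> 'm \<Rightarrow> ('b, 'd) tens \<Rightarrow> 'd" where
  "to_Delta l = (\<lambda>x\<in>carrier M. \<lambda>y\<in>carrier KB. l (y \<odot>\<^bsub>Ext M\<^esub> tens M x \<one>\<^bsub>K\<^esub>))"

lemma to_Delta_lhom:
  assumes l: "l \<in> lhom R (RExt M) Ktriv"
  shows "to_Delta l \<in> lhom B M Delta"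
proof -
  interpret KB: ring KB by (rule KB_ring)
  interpret X: left_module KB "Ext M" by (rule Ext_left_module[OF M])
  note lD = functionalD[OF l]
  have t1: "tens M x \<one>\<^bsub>K\<^esub> \<in> carrier (Ext M)" if "x \<in> carrier M" for x using tens_closed[OF M that] by simp
  show ?thesis unfolding to_Delta_def
  proof (rule restrict_lhom[OF M], unfold linear_map_def, intro conjI ballI funcsetI)
    fix x assume x: "x \<in> carrier M"
    show "(\<lambda>y\<in>carrier KB. l (y \<odot>\<^bsub>Ext M\<^esub> tens M x \<one>\<^bsub>K\<^esub>)) \<in> carrier Delta"
      using t1[OF x] lD alpha_closed by (intro DeltaI) (simp_all add: X.smult_closed X.smult_l_distr X.smult_assoc)
  next
    fix x y assume xy: "x \<in> carrier M" "y \<in> carrier M"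
    show "(\<lambda>u\<in>carrier KB. l (u \<odot>\<^bsub>Ext M\<^esub> tens M (x \<oplus>\<^bsub>M\<^esub> y) \<one>\<^bsub>K\<^esub>)) =
      (\<lambda>u\<in>carrier KB. l (u \<odot>\<^bsub>Ext M\<^esub> tens M x \<one>\<^bsub>K\<^esub>)) \<oplus>\<^bsub>Delta\<^esub> (\<lambda>u\<in>carrier KB. l (u \<odot>\<^bsub>Ext M\<^esub> tens M y \<one>\<^bsub>K\<^esub>))"
      unfolding Delta_simps(2) using xy t1 lD
      by (intro restrict_ext) (simp add: tens_add_left[OF M] X.smult_r_distr X.smult_closed)
  next
    fix b x assume b: "b \<in> carrier B" and x: "x \<in> carrier M"
    have "tens M (b \<odot>\<^bsub>M\<^esub> x) \<one>\<^bsub>K\<^esub> = incl b \<odot>\<^bsub>Ext M\<^esub> tens M x \<one>\<^bsub>K\<^esub>"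
      using b x by (simp add: smult_Ext_pure[OF M])
    then show "(\<lambda>u\<in>carrier KB. l (u \<odot>\<^bsub>Ext M\<^esub> tens M (b \<odot>\<^bsub>M\<^esub> x) \<one>\<^bsub>K\<^esub>)) =
      b \<odot>\<^bsub>Delta\<^esub> (\<lambda>u\<in>carrier KB. l (u \<odot>\<^bsub>Ext M\<^esub> tens M x \<one>\<^bsub>K\<^esub>))"
      unfolding Delta_simps(4) using incl_closed[OF b] t1[OF x] by (intro restrict_ext) (simp add: X.smult_assoc)
  qed
qed

text \<open>The inverse of the adjunction evaluates at the unit of B \<otimes> K. The explicit
  formula in the last conclusion serves to compare two functionals on pure tensors.\<close>

lemma from_Delta:
  assumes \<phi>: "\<phi> \<in> lhom B M Delta"
  obtains l where "l \<in> lhom R (RExt M) Ktriv" "to_Delta l = \<phi>"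
    "\<And>x c. x \<in> carrier M \<Longrightarrow> c \<in> carrier K \<Longrightarrow> l (tens M x c) = c \<otimes>\<^bsub>K\<^esub> \<phi> x \<one>\<^bsub>KB\<^esub>"
proof -
  interpret KB: ring KB by (rule KB_ring)
  interpret X: left_module KB "Ext M" by (rule Ext_left_module[OF M])
  have phi: "\<phi> x \<in> carrier Delta" if "x \<in> carrier M" for x using lhomD(1)[OF \<phi> that] .
  note D = DeltaD[OF phi]
  have phi_b: "\<phi> (b \<odot>\<^bsub>M\<^esub> x) u = \<phi> x (u \<otimes>\<^bsub>KB\<^esub> incl b)" if "b \<in> carrier B" "x \<in> carrier M" "u \<in> carrier KB" for b x u
    using lhomD(3)[OF \<phi> that(1,2)] that(3) by (simp add: Delta_simps)
  have phi_add: "\<phi> (x \<oplus>\<^bsub>M\<^esub> y) u = \<phi> x u \<oplus>\<^bsub>K\<^esub> \<phi> y u" if "x \<in> carrier M" "y \<in> carrier M" "u \<in> carrier KB" for x y u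
    using lhomD(2)[OF \<phi> that(1,2)] that(3) by (simp add: Delta_simps)
  have phi_c: "\<phi> x (ptB b d) = d \<otimes>\<^bsub>K\<^esub> \<phi> x (incl b)" if "x \<in> carrier M" "b \<in> carrier B" "d \<in> carrier K" for x b d
  proof -
    have "ptB b d = \<alpha> (\<epsilon> d) \<otimes>\<^bsub>KB\<^esub> incl b" using that by (simp add: alpha_eps mult_KB_pure)
    then show ?thesis using D(3)[OF that(1) eps_closed[OF that(3)] incl_closed[OF that(2)]] that by (simp add: aug_eps)
  qed
  have bal: "balanced_map k (V M) E K (\<lambda>x c. c \<otimes>\<^bsub>K\<^esub> \<phi> x \<one>\<^bsub>KB\<^esub>)"
    unfolding balanced_map_def
  proof (intro conjI ballI)
    fix r x c assume "r \<in> carrier k" "x \<in> carrier (V M)" "c \<in> carrier E"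
    then have r: "r \<in> carrier k" and x: "x \<in> carrier M" and c: "c \<in> carrier K" by simp_all
    have ri: "\<iota> r \<in> carrier K" using ring_hom_closed[OF emb r] .
    \<comment> \<open>The scalar r moves from B to K across the tensor sign; there it is \<alpha>
      (\<epsilon> (\<iota> r)), and R-linearity of \<phi> x extracts it.\<close>
    have "incl (scalar B r) = ptB \<one>\<^bsub>B\<^esub> (\<iota> r)"
      using BE.pure_tensor_smult[of r "\<one>\<^bsub>B\<^esub>" "\<one>\<^bsub>K\<^esub>"] r ri by (simp add: scalar_def)
    then have "\<phi> (scalar B r \<odot>\<^bsub>M\<^esub> x) \<one>\<^bsub>KB\<^esub> = \<iota> r \<otimes>\<^bsub>K\<^esub> \<phi> x \<one>\<^bsub>KB\<^esub>"
      using phi_b[OF scalar_closed[OF r] x KB.one_closed] phi_c[OF x B.one_closed ri] incl_closed[OF scalar_closed[OF r]]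
      using ri by (simp add: KB_simps(4) mult_KB_pure)
    then show "c \<otimes>\<^bsub>K\<^esub> \<phi> (r \<odot>\<^bsub>V M\<^esub> x) \<one>\<^bsub>KB\<^esub> = r \<odot>\<^bsub>E\<^esub> c \<otimes>\<^bsub>K\<^esub> \<phi> x \<one>\<^bsub>KB\<^esub>"
      using D(1)[OF x KB.one_closed] ri c by (simp add: K.m_ac)
  qed (simp_all add: D(1) phi_add K.r_distr K.l_distr)
  define l0 where "l0 = tensor_lift K (\<lambda>x c. c \<otimes>\<^bsub>K\<^esub> \<phi> x \<one>\<^bsub>KB\<^esub>)"
  have l0: "l0 (tens M x c) = c \<otimes>\<^bsub>K\<^esub> \<phi> x \<one>\<^bsub>KB\<^esub>" if "x \<in> carrier M" "c \<in> carrier K" for x c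
    unfolding l0_def using Ext_lift(1)[OF M K.abelian_group_axioms bal that] .
  have l0a: "additive_map (Ext M) K l0" unfolding l0_def by (rule Ext_lift(2)[OF M K.abelian_group_axioms bal])
  note l0D = additive_mapD[OF l0a]
  \<comment> \<open>This recovers the values of \<phi> x on all of B \<otimes> K from
    \<open>l0\<close>, and at u = \<alpha> r it turns R-linearity of \<phi> x into that of
    \<open>l0\<close>.\<close>
  have key: "l0 (u \<odot>\<^bsub>Ext M\<^esub> tens M x c) = c \<otimes>\<^bsub>K\<^esub> \<phi> x u" if u: "u \<in> carrier KB" and x: "x \<in> carrier M" and c: "c \<in> carrier K" for u x c
    using u
  proof (induction rule: KB_induct)
    case (pure b d)
    have "\<phi> (b \<odot>\<^bsub>M\<^esub> x) \<one>\<^bsub>KB\<^esub> = \<phi> x (incl b)"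
      using phi_b[OF pure(1) x KB.one_closed] incl_closed[OF pure(1)] by simp
    then show ?case using pure x c D(1)[OF x incl_closed[OF pure(1)]]
      unfolding phi_c[OF x pure] by (simp add: smult_Ext_pure[OF M] l0 M.smult_closed K.m_ac)
  next
    case (add v w)
    then show ?case using x c tens_closed[OF M x c]
      by (simp add: X.smult_l_distr l0D X.smult_closed D(1,2) K.r_distr)
  qed
  have l0R: "l0 (\<alpha> r \<odot>\<^bsub>Ext M\<^esub> v) = aug r \<otimes>\<^bsub>K\<^esub> l0 v" if r: "r \<in> carrier R" and v: "v \<in> carrier (Ext M)" for r v
    using v
  proof (induction rule: Ext_induct[OF M, consumes 1, case_names pure add])
    case (pure x c)
    have "\<phi> x (\<alpha> r) = aug r \<otimes>\<^bsub>K\<^esub> \<phi> x \<one>\<^bsub>KB\<^esub>"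
      using D(3)[OF pure(1) r KB.one_closed] alpha_closed[OF r] by simp
    then show ?case using pure alpha_closed[OF r] aug_closed[OF r] D(1)[OF pure(1) KB.one_closed]
      by (simp add: key l0 K.m_ac)
  next
    case (add v w)
    then show ?case using alpha_closed[OF r] aug_closed[OF r]
      by (simp add: X.smult_r_distr l0D X.smult_closed K.r_distr)
  qed
  define l where "l = restrict l0 (carrier (Ext M))"
  have lE: "l v = l0 v" if "v \<in> carrier (Ext M)" for v using that by (simp add: l_def)
  have "restrict l0 (carrier (RExt M)) \<in> lhom R (RExt M) Ktriv"
    by (rule restrict_lhom[OF RExt_left_module[OF M]]) (use l0D l0R in \<open>simp add: linear_map_def\<close>)
  then have lh: "l \<in> lhom R (RExt M) Ktriv" by (simp add: l_def)
  have toD: "to_Delta l = \<phi>"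
  proof (rule lhom_eqI[OF to_Delta_lhom[OF lh] \<phi>])
    fix x assume x: "x \<in> carrier M"
    note tc = tens_closed[OF M x K.one_closed]
    show "to_Delta l x = \<phi> x"
    proof
      fix u show "to_Delta l x u = \<phi> x u"
        using x D(1)[OF x, of u] D(4)[OF x, of u] tc
        by (cases "u \<in> carrier KB") (simp_all add: to_Delta_def lE X.smult_closed key)
    qed
  qed
  have lt: "l (tens M x c) = c \<otimes>\<^bsub>K\<^esub> \<phi> x \<one>\<^bsub>KB\<^esub>" if "x \<in> carrier M" "c \<in> carrier K" for x c
    using l0[OF that] lE[OF tens_closed[OF M that]] by simp
  show ?thesis by (rule that[OF lh toD lt])
qed

end

end

section \<open>Finite generation and flatness\<close>

lemma (in left_module) submodule_lincomb:
  assumes S: "submodule S R M" and B: "finite B" "B \<subseteq> S" and c: "c \<in> B \<rightarrow> carrier R"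
  shows "lincomb M c B \<in> S"
  using B c
proof (induction B)
  case empty
  then show ?case using submodule_closed(2)[OF S] by (simp add: lincomb_def)
next
  case (insert b B)
  have BM: "insert b B \<subseteq> carrier M" using insert.prems(1) submodule_closed(1)[OF S] by auto
  have "lincomb M c (insert b B) = c b \<odot>\<^bsub>M\<^esub> b \<oplus>\<^bsub>M\<^esub> lincomb M c B"
    unfolding lincomb_def using insert.hyps insert.prems term_closed[of B c] BM
    by (intro M.finsum_insert) (auto intro!: smult_closed)
  then show ?case
    using insert submodule_closed(3,5)[OF S] by auto
qed

text \<open>Generation expressed through submodules: images, restrictions and base changes can then
  be treated by pulling submodules back, without handling coefficients.\<close>

lemma finitely_generated_iff:
  assumes "left_module R M"
  shows "finitely_generated R M \<longleftrightarrow>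
    (\<exists>B. finite B \<and> B \<subseteq> carrier M \<and> (\<forall>S. submodule S R M \<longrightarrow> B \<subseteq> S \<longrightarrow> carrier M \<subseteq> S))"
proof -
  interpret left_module R M by fact
  show ?thesis
  proof
    assume "finitely_generated R M"
    then obtain B where B: "finite B" "B \<subseteq> carrier M" "\<forall>x\<in>carrier M. \<exists>c\<in>B \<rightarrow> carrier R. x = lincomb M c B"
      unfolding finitely_generated_lincomb by (elim exE conjE)
    have "carrier M \<subseteq> S" if "submodule S R M" "B \<subseteq> S" for S
      using B(3) submodule_lincomb[OF that(1) B(1) that(2)] by (metis subsetI)
    then show "\<exists>B. finite B \<and> B \<subseteq> carrier M \<and> (\<forall>S. submodule S R M \<longrightarrow> B \<subseteq> S \<longrightarrow> carrier M \<subseteq> S)"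
      using B by blast
  next
    assume "\<exists>B. finite B \<and> B \<subseteq> carrier M \<and> (\<forall>S. submodule S R M \<longrightarrow> B \<subseteq> S \<longrightarrow> carrier M \<subseteq> S)"
    then obtain B where B: "finite B" "B \<subseteq> carrier M" "\<And>S. submodule S R M \<Longrightarrow> B \<subseteq> S \<Longrightarrow> carrier M \<subseteq> S" by blast
    let ?S = "{lincomb M c B | c. c \<in> B \<rightarrow> carrier R}"
    have "submodule ?S R M"
    proof (rule submoduleI')
      show "?S \<subseteq> carrier M" using lincomb_closed[OF B(2)] by auto
      have "lincomb M (\<lambda>_. \<zero>\<^bsub>R\<^esub>) B = \<zero>\<^bsub>M\<^esub>" using B(2) by (rule lincomb_zero) simp
      moreover have "(\<lambda>_. \<zero>\<^bsub>R\<^esub>) \<in> B \<rightarrow> carrier R" by simp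
      ultimately show "\<zero>\<^bsub>M\<^esub> \<in> ?S" by (metis (mono_tags, lifting) mem_Collect_eq)
    next
      fix x y assume "x \<in> ?S" "y \<in> ?S"
      then obtain c d where cd: "x = lincomb M c B" "y = lincomb M d B" "c \<in> B \<rightarrow> carrier R" "d \<in> B \<rightarrow> carrier R" by blast
      have "x \<oplus>\<^bsub>M\<^esub> y = lincomb M (\<lambda>b. c b \<oplus>\<^bsub>R\<^esub> d b) B" using lincomb_add[OF B(2)] cd by simp
      moreover have "(\<lambda>b. c b \<oplus>\<^bsub>R\<^esub> d b) \<in> B \<rightarrow> carrier R" using cd by auto
      ultimately show "x \<oplus>\<^bsub>M\<^esub> y \<in> ?S" by blast
    next
      fix r x assume r: "r \<in> carrier R" and "x \<in> ?S"
      then obtain c where c: "x = lincomb M c B" "c \<in> B \<rightarrow> carrier R" by blast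
      have "r \<odot>\<^bsub>M\<^esub> x = lincomb M (\<lambda>b. r \<otimes>\<^bsub>R\<^esub> c b) B" using lincomb_smult[OF B(1,2) c(2) r] c by simp
      moreover have "(\<lambda>b. r \<otimes>\<^bsub>R\<^esub> c b) \<in> B \<rightarrow> carrier R" using c r by auto
      ultimately show "r \<odot>\<^bsub>M\<^esub> x \<in> ?S" by blast
    qed
    moreover have "B \<subseteq> ?S"
    proof
      fix b assume b: "b \<in> B"
      let ?c = "\<lambda>x. if x = b then \<one>\<^bsub>R\<^esub> else \<zero>\<^bsub>R\<^esub>"
      have bM: "b \<in> carrier M" using b B(2) by auto
      have "lincomb M ?c B = (\<Oplus>\<^bsub>M\<^esub>x\<in>B. if b = x then x else \<zero>\<^bsub>M\<^esub>)"
        unfolding lincomb_def using B(2)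
        by (intro M.finsum_cong') (auto simp: smult_one smult_zero_left subset_iff)
      also have "\<dots> = b" using M.finsum_singleton[OF b B(1), of "\<lambda>x. x"] B(2) by auto
      finally show "b \<in> ?S" by (intro CollectI exI[of _ ?c]) auto
    qed
    ultimately have "carrier M \<subseteq> ?S" using B(3) by blast
    then show "finitely_generated R M" unfolding finitely_generated_lincomb using B(1,2) by blast
  qed
qed

lemma submodule_vimage_linear:
  assumes M: "left_module R M" and N: "left_module R N" and f: "linear_map R M N f" and S: "submodule S R N"
  shows "submodule {x \<in> carrier M. f x \<in> S} R M"
proof -
  interpret M: left_module R M by fact
  interpret N: left_module R N by fact
  have z: "f \<zero>\<^bsub>M\<^esub> = \<zero>\<^bsub>N\<^esub>" by (rule additive_map_zero[OF M.M_abelian N.M_abelian linear_map_additive[OF f]])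
  show ?thesis
    by (rule M.submoduleI') (auto simp: z linear_mapD[OF f] M.smult_closed N.submodule_closed[OF S])
qed

lemma finitely_generated_image:
  assumes M: "left_module R M" and N: "left_module R N" and f: "linear_map R M N f" "f ` carrier M = carrier N"
    and fg: "finitely_generated R M"
  shows "finitely_generated R N"
proof -
  obtain B where B: "finite B" "B \<subseteq> carrier M" "\<And>S. submodule S R M \<Longrightarrow> B \<subseteq> S \<Longrightarrow> carrier M \<subseteq> S"
    using fg unfolding finitely_generated_iff[OF M] by blast
  have "carrier N \<subseteq> S" if S: "submodule S R N" "f ` B \<subseteq> S" for S
  proof -
    have "carrier M \<subseteq> {x \<in> carrier M. f x \<in> S}"
      by (rule B(3)[OF submodule_vimage_linear[OF M N f(1) S(1)]]) (use B(2) S(2) in auto)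
    then have "f ` carrier M \<subseteq> S" by blast
    then show ?thesis using f(2) by simp
  qed
  then show ?thesis unfolding finitely_generated_iff[OF N]
    using B(1,2) linear_mapD(1)[OF f(1)] by (intro exI[of _ "f ` B"]) auto
qed

lemma left_module_submodule:
  fixes M :: "('r, 'm) module"
  assumes M: "left_module R M" and S: "submodule S R M"
  shows "left_module R (M\<lparr>carrier := S\<rparr>)"
proof -
  interpret M: left_module R M by fact
  note c = M.submodule_closed[OF S]
  have "abelian_group (M\<lparr>carrier := S\<rparr>)"
  proof (rule abelian_groupI)
    show "\<exists>y\<in>carrier (M\<lparr>carrier := S\<rparr>). y \<oplus>\<^bsub>M\<lparr>carrier := S\<rparr>\<^esub> x = \<zero>\<^bsub>M\<lparr>carrier := S\<rparr>\<^esub>" if "x \<in> carrier (M\<lparr>carrier := S\<rparr>)" for x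
      using that c by (intro bexI[of _ "\<ominus>\<^bsub>M\<^esub> x"]) (simp_all add: M.M.l_neg)
  qed (use c in \<open>simp_all add: M.M.a_assoc, simp add: M.M.a_comm\<close>)
  then show ?thesis
    using c by (intro left_moduleI) (simp_all add: M.R.ring_axioms M.smult_l_distr M.smult_r_distr M.smult_assoc M.smult_one)
qed

text \<open>Over a field g has a linear section s, and v \<mapsto> v - s (g v) maps V onto the
  kernel; so the kernel is a homomorphic image of V.\<close>

lemma finitely_generated_kernel:
  fixes V :: "('c, 'v) module"
  assumes k: "field k" and V: "left_module k V" and W: "left_module k W"
    and fg: "finitely_generated k V" "finitely_generated k W"
    and g: "linear_map k V W g" "g ` carrier V = carrier W"
  shows "finitely_generated k (V\<lparr>carrier := {x \<in> carrier V. g x = \<zero>\<^bsub>W\<^esub>}\<rparr>)"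
proof -
  interpret V: left_module k V by fact
  interpret W: left_module k W by fact
  let ?S = "{x \<in> carrier V. g x = \<zero>\<^bsub>W\<^esub>}"
  have S: "submodule ?S k V"
    using submodule_vimage_linear[OF V W g(1) W.zero_submodule] by simp
  have id: "linear_map k W W (\<lambda>x. x)" by (simp add: linear_map_def)
  obtain s where s: "s \<in> lhom k W V" "\<And>x. x \<in> carrier W \<Longrightarrow> g (s x) = x"
    using field.lift_vector_space[OF k W fg(2) V W g id] by metis
  let ?r = "\<lambda>v. v \<oplus>\<^bsub>V\<^esub> \<ominus>\<^bsub>V\<^esub> s (g v)"
  note gD = linear_mapD[OF g(1)] and sD = lhomD(1-3)[OF s(1)]
  have gm: "g (\<ominus>\<^bsub>V\<^esub> x) = \<ominus>\<^bsub>W\<^esub> g x" if "x \<in> carrier V" for x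
    by (rule additive_map_minus[OF V.M_abelian W.M_abelian linear_map_additive[OF g(1)] that])
  have s0: "s \<zero>\<^bsub>W\<^esub> = \<zero>\<^bsub>V\<^esub>" by (rule additive_map_zero[OF W.M_abelian V.M_abelian lhomD(6)[OF s(1)]])
  have mz: "\<ominus>\<^bsub>V\<^esub> \<zero>\<^bsub>V\<^esub> = \<zero>\<^bsub>V\<^esub>" by (rule V.M.minus_equality) auto
  have rS: "?r v \<in> ?S" if "v \<in> carrier V" for v
    using that by (simp add: gD sD gm s(2) W.M.r_neg)
  have lin: "linear_map k V (V\<lparr>carrier := ?S\<rparr>) ?r"
    unfolding linear_map_def
  proof (intro conjI ballI)
    show "?r \<in> carrier V \<rightarrow> carrier (V\<lparr>carrier := ?S\<rparr>)" using rS by simp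
  qed (simp_all add: gD sD V.M.minus_add V.M.a_ac V.smult_r_distr V.smult_minus_right V.smult_closed)
  have "?r ` carrier V = ?S"
  proof
    show "?r ` carrier V \<subseteq> ?S" using rS by blast
    show "?S \<subseteq> ?r ` carrier V"
    proof
      fix x assume "x \<in> ?S"
      then have "x = ?r x" "x \<in> carrier V" by (simp_all add: s0 mz)
      then show "x \<in> ?r ` carrier V" by blast
    qed
  qed
  then show ?thesis
    using finitely_generated_image[OF V left_module_submodule[OF V S] lin _ fg(1)] by simp
qed

lemma submodule_restr:
  assumes "ring R" "ring S" "\<phi> \<in> ring_hom R S" "left_module S M" "submodule N S M"
  shows "submodule N R (restr \<phi> M)"
proof -
  interpret M: left_module S M by fact
  interpret RM: left_module R "restr \<phi> M" by (rule left_module_restr[OF assms(1-4)])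
  show ?thesis
    by (rule RM.submoduleI') (auto simp: M.submodule_closed[OF assms(5)] ring_hom_closed[OF assms(3)])
qed

section \<open>Finiteness over K, and the kernel of t on a flat module\<close>

context pi_setting
begin

text \<open>The tensors m \<otimes> 1 with m a generator over k suffice: for a K-subspace S
  containing them, the m with all m \<otimes> c in S form a k-subspace of M.\<close>

lemma KExt_fg:
  assumes M: "left_module B M" and fg: "finitely_generated k (V M)"
  shows "finitely_generated K (restr \<epsilon> (RExt M))"
proof -
  interpret M: left_module B M by fact
  have VM: "left_module k (V M)" by (rule left_module_of_module[OF restr_scalar_module[OF M]])
  interpret VM: left_module k "V M" by (rule VM)
  have XM: "left_module K (restr \<epsilon> (RExt M))"
    by (rule left_module_restr[OF K.ring_axioms R.ring_axioms eps_hom RExt_left_module[OF M]])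
  interpret XM: left_module K "restr \<epsilon> (RExt M)" by (rule XM)
  obtain G where G: "finite G" "G \<subseteq> carrier (V M)" "\<And>S. submodule S k (V M) \<Longrightarrow> G \<subseteq> S \<Longrightarrow> carrier (V M) \<subseteq> S"
    using fg unfolding finitely_generated_iff[OF VM] by blast
  have GM: "G \<subseteq> carrier M" using G(2) by simp
  let ?G = "(\<lambda>m. tens M m \<one>\<^bsub>K\<^esub>) ` G"
  have "carrier (restr \<epsilon> (RExt M)) \<subseteq> S" if S: "submodule S K (restr \<epsilon> (RExt M))" "?G \<subseteq> S" for S
  proof -
    note c = XM.submodule_closed[OF S(1), simplified]
    let ?T = "{m \<in> carrier M. \<forall>c\<in>carrier K. tens M m c \<in> S}"
    have "submodule ?T k (V M)"
    proof (rule VM.submoduleI')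
      show "?T \<subseteq> carrier (V M)" by auto
      interpret TP: tensor_product k "V M" E by (rule tensor_V[OF M])
      have "tens M \<zero>\<^bsub>M\<^esub> c = \<zero>\<^bsub>Ext M\<^esub>" if "c \<in> carrier K" for c
        using TP.pure_tensor_zero_left[of c] that by (simp add: Ext_simps)
      then show "\<zero>\<^bsub>V M\<^esub> \<in> ?T" using c(2) by simp
      show "x \<oplus>\<^bsub>V M\<^esub> y \<in> ?T" if "x \<in> ?T" "y \<in> ?T" for x y
        using that c(3) by (simp add: tens_add_left[OF M])
      show "r \<odot>\<^bsub>V M\<^esub> x \<in> ?T" if "r \<in> carrier k" "x \<in> ?T" for r x
        using that ring_hom_closed[OF emb that(1)] by (simp add: tens_scalar[OF M] M.smult_closed scalar_closed)
    qed
    moreover have "G \<subseteq> ?T"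
    proof
      fix m assume m: "m \<in> G"
      have mM: "m \<in> carrier M" using m GM by blast
      have "tens M m c \<in> S" if cK: "c \<in> carrier K" for c
      proof -
        have "\<alpha> (\<epsilon> c) \<odot>\<^bsub>Ext M\<^esub> tens M m \<one>\<^bsub>K\<^esub> \<in> S" by (rule c(5)[OF cK]) (use m S(2) in blast)
        then show ?thesis using mM cK by (simp add: alpha_eps smult_Ext_pure[OF M] M.smult_one)
      qed
      then show "m \<in> ?T" using mM by simp
    qed
    ultimately have T: "carrier M \<subseteq> ?T" using G(3)[of ?T] by simp
    have "w \<in> S" if "w \<in> carrier (Ext M)" for w
      using that
    proof (induction rule: Ext_induct[OF M, consumes 1, case_names pure add])
      case (pure m c)
      then show ?case using T by blast
    next
      case (add v w)
      then show ?case using c(3) by simp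
    qed
    then show ?thesis by auto
  qed
  then show ?thesis unfolding finitely_generated_iff[OF XM]
    using G(1) GM by (intro exI[of _ ?G]) (auto intro!: tens_closed[OF M])
qed

lemmas submodule_eps = submodule_restr[OF K.ring_axioms R.ring_axioms eps_hom]

text \<open>An R-submodule is stable under the image of \<epsilon>, hence a K-subspace; so
  generators over K also generate over R.\<close>

lemma RExt_fg:
  assumes M: "left_module B M" and fg: "finitely_generated k (V M)"
  shows "finitely_generated R (RExt M)"
proof -
  have XM: "left_module K (restr \<epsilon> (RExt M))"
    by (rule left_module_restr[OF K.ring_axioms R.ring_axioms eps_hom RExt_left_module[OF M]])
  have "submodule S K (restr \<epsilon> (RExt M))" if "submodule S R (RExt M)" for S
    by (rule submodule_eps[OF RExt_left_module[OF M] that])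
  then show ?thesis
    using KExt_fg[OF assms] unfolding finitely_generated_iff[OF XM] finitely_generated_iff[OF RExt_left_module[OF M]]
    by (metis restr_simps(1))
qed

lemma image_submodule:
  assumes M: "left_module R M" and r: "r \<in> carrier R"
  shows "submodule ((\<lambda>x. r \<odot>\<^bsub>M\<^esub> x) ` carrier M) R M"
proof -
  interpret M: left_module R M by fact
  show ?thesis
  proof (rule M.submoduleI')
    show "(\<lambda>x. r \<odot>\<^bsub>M\<^esub> x) ` carrier M \<subseteq> carrier M" using r M.smult_closed by auto
    show "\<zero>\<^bsub>M\<^esub> \<in> (\<lambda>x. r \<odot>\<^bsub>M\<^esub> x) ` carrier M"
      using M.smult_zero_right[OF r] M.M.zero_closed by (metis imageI)
  next
    fix x y assume "x \<in> (\<lambda>x. r \<odot>\<^bsub>M\<^esub> x) ` carrier M" "y \<in> (\<lambda>x. r \<odot>\<^bsub>M\<^esub> x) ` carrier M"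
    then obtain a b where ab: "a \<in> carrier M" "b \<in> carrier M" "x = r \<odot>\<^bsub>M\<^esub> a" "y = r \<odot>\<^bsub>M\<^esub> b" by (elim imageE)
    have "x \<oplus>\<^bsub>M\<^esub> y = r \<odot>\<^bsub>M\<^esub> (a \<oplus>\<^bsub>M\<^esub> b)" using ab M.smult_r_distr[OF r] by simp
    then show "x \<oplus>\<^bsub>M\<^esub> y \<in> (\<lambda>x. r \<odot>\<^bsub>M\<^esub> x) ` carrier M" using M.M.a_closed[OF ab(1,2)] by (rule image_eqI)
  next
    fix a x assume a: "a \<in> carrier R" and "x \<in> (\<lambda>x. r \<odot>\<^bsub>M\<^esub> x) ` carrier M"
    then obtain y where y: "y \<in> carrier M" "x = r \<odot>\<^bsub>M\<^esub> y" by blast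
    have "a \<odot>\<^bsub>M\<^esub> x = r \<odot>\<^bsub>M\<^esub> (a \<odot>\<^bsub>M\<^esub> y)"
      using y a r by (simp add: M.smult_assoc[symmetric] R.m_comm)
    then show "a \<odot>\<^bsub>M\<^esub> x \<in> (\<lambda>x. r \<odot>\<^bsub>M\<^esub> x) ` carrier M" using M.smult_closed[OF a y(1)] by blast
  qed
qed

text \<open>Test flatness on the inclusion of the ideal \<open>(t)\<close>: if \<open>t u = 0\<close> then \<open>u \<otimes> t = 0\<close> in
  \<open>M \<otimes> (t)\<close>, so every functional on \<open>M / t^(p-1) M\<close> vanishes at \<open>u\<close>.\<close>

lemma flat_kernel:
  fixes M :: "('r, 'm) module"
  assumes flat: "flat_module R M" and fg: "finitely_generated K (restr \<epsilon> M)"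
    and u: "u \<in> carrier M" "t \<odot>\<^bsub>M\<^esub> u = \<zero>\<^bsub>M\<^esub>"
  shows "\<exists>y\<in>carrier M. u = t [^]\<^bsub>R\<^esub> (p - 1) \<odot>\<^bsub>M\<^esub> y"
proof (rule ccontr)
  assume contra: "\<not> ?thesis"
  have mM: "module R M" using flat by (simp add: flat_module_def)
  have M: "left_module R M" by (rule left_module_of_module[OF mM])
  interpret M: left_module R M by (rule M)
  have KM: "left_module K (restr \<epsilon> M)" by (rule left_module_restr[OF K.ring_axioms R.ring_axioms eps_hom M])
  let ?S = "(\<lambda>x. t [^]\<^bsub>R\<^esub> (p - 1) \<odot>\<^bsub>M\<^esub> x) ` carrier M"
  have S: "submodule ?S K (restr \<epsilon> M)" by (rule submodule_eps[OF M image_submodule[OF M pow_t_closed]])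
  have uS: "u \<notin> ?S" "u \<in> carrier (restr \<epsilon> M)" using contra u by auto
  obtain l where l: "linear_map K (restr \<epsilon> M) (regular K) l" "\<And>y. y \<in> ?S \<Longrightarrow> l y = \<zero>\<^bsub>K\<^esub>" "l u \<noteq> \<zero>\<^bsub>K\<^esub>"
    using K.separate[OF KM fg S uS(2,1)] by metis
  have lD: "x \<in> carrier M \<Longrightarrow> l x \<in> carrier K" "x \<in> carrier M \<Longrightarrow> y \<in> carrier M \<Longrightarrow> l (x \<oplus>\<^bsub>M\<^esub> y) = l x \<oplus>\<^bsub>K\<^esub> l y" for x y
    using linear_mapD(1,2)[OF l(1)] by simp_all
  \<comment> \<open>The test modules for flatness consist of sequences in R, so R and its ideal (t)
    are moved there as constant sequences.\<close>
  let ?j = "\<lambda>r::'r. \<lambda>_::nat. r"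
  have inj: "inj_on ?j A" for A by (rule inj_onI) metis
  let ?RR = "regular R" and ?I = "(\<lambda>x. t \<otimes>\<^bsub>R\<^esub> x) ` carrier R"
  have RR: "left_module R ?RR" by (rule left_module_regular[OF R.ring_axioms])
  have I: "submodule ?I R ?RR" using image_submodule[OF RR t_closed] by simp
  let ?A = "?RR\<lparr>carrier := ?I\<rparr>"
  have A: "left_module R ?A" by (rule left_module_submodule[OF RR I])
  have Isub: "x \<in> carrier R" if "x \<in> ?I" for x using that t_closed by auto
  let ?N = "transport_module ?j ?A" and ?N' = "transport_module ?j ?RR"
  note tN = transport_module[OF A inj] and tN' = transport_module[OF RR inj]
  let ?i = "\<lambda>x\<in>?j ` carrier ?A. inv_into (carrier ?A) ?j x" and ?j' = "\<lambda>x\<in>carrier ?RR. ?j x"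
  let ?e = "\<lambda>x\<in>carrier ?A. x"
  have e: "?e \<in> lhom R ?A ?RR"
    by (rule restrict_lhom[OF A]) (use Isub in \<open>simp add: linear_map_def\<close>)
  define f where "f = compose (carrier ?N) ?j' (compose (carrier ?N) ?e ?i)"
  have f: "f \<in> lhom R ?N ?N'"
    unfolding f_def by (rule lhom_compose[OF lhom_compose[OF tN(3) e tN(1)] tN'(2) tN(1)])
  have inv: "inv_into (carrier ?A) ?j (?j x) = x" if "x \<in> ?I" for x using inv_into_f_f[OF inj] that by simp
  have cN: "carrier ?N = ?j ` ?I" using tN(4) by simp
  have fe: "f (?j x) = ?j x" if x: "x \<in> ?I" for x
    using x inv[OF x] Isub[OF x] by (simp add: f_def compose_def cN)
  have finj: "inj_on f (carrier ?N)" unfolding cN using fe by (intro inj_onI) (metis (no_types, lifting) imageE)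
  have mN: "module R ?N" "module R ?N'" using module_of_left_module[OF R.is_cring] tN(1) tN'(1) by blast+
  interpret T: tensor_product R M ?N by (simp add: tensor_product_def mM mN)
  interpret T': tensor_product R M ?N' by (simp add: tensor_product_def mM mN)
  let ?F = "tensor_lift T'.T (\<lambda>x y. T'.pt x (f y))"
  have bal: "balanced_map R M ?N T'.T (\<lambda>x y. T'.pt x (f y))"
    using lhomD(1-3)[OF f]
    by (simp add: balanced_map_def T'.pure_tensor_closed T'.pure_tensor_add_left T'.pure_tensor_add_right T'.pure_tensor_smult)
  have Finj: "inj_on ?F (carrier T.T)"
    using flat mN f finj unfolding flat_module_def by blast
  have tI: "t \<in> ?I" using t_closed by (intro image_eqI[of _ _ "\<one>\<^bsub>R\<^esub>"]) simp_all
  have jt: "?j t \<in> carrier ?N" using tI cN by auto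
  have j1: "?j \<one>\<^bsub>R\<^esub> \<in> carrier ?N'" using tN'(4) by simp
  have "t \<odot>\<^bsub>?N'\<^esub> ?j \<one>\<^bsub>R\<^esub> = ?j t"
    using lhomD(3)[OF tN'(2) t_closed, of "\<one>\<^bsub>R\<^esub>"] t_closed by simp
  \<comment> \<open>In M \<otimes> R one has u \<otimes> t = t u \<otimes> 1 = 0, and flatness pulls
    this vanishing back to M \<otimes> (t).\<close>
  then have "?F (T.pt u (?j t)) = T'.pt u (t \<odot>\<^bsub>?N'\<^esub> ?j \<one>\<^bsub>R\<^esub>)"
    using T.tensor_lift_pure[OF T'.tensor_abelian_group bal u(1) jt] fe[OF tI] by simp
  also have "\<dots> = T'.pt (t \<odot>\<^bsub>M\<^esub> u) (?j \<one>\<^bsub>R\<^esub>)" by (rule T'.pure_tensor_smult[OF t_closed u(1) j1, symmetric])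
  also have "\<dots> = \<zero>\<^bsub>T'.T\<^esub>" using u(2) T'.pure_tensor_zero_left[OF j1] by simp
  also have "\<dots> = ?F \<zero>\<^bsub>T.T\<^esub>"
    by (rule additive_map_zero[OF T.tensor_abelian_group T'.tensor_abelian_group T.tensor_lift_additive[OF T'.tensor_abelian_group bal], symmetric])
  finally have zero: "T.pt u (?j t) = \<zero>\<^bsub>T.T\<^esub>"
    by (rule inj_onD[OF Finj]) (simp_all add: T.pure_tensor_closed u(1) jt)
  \<comment> \<open>A chosen quotient by t. Two choices differ by an annihilator of t, hence by a
    multiple of t^(p-1), and l vanishes on t^(p-1) M; so l (s x) depends on s only through t s,
    which is \<open>wd\<close>.\<close>
  define q where "q y = (SOME s. s \<in> carrier R \<and> y = ?j (t \<otimes>\<^bsub>R\<^esub> s))" for y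
  have q: "q y \<in> carrier R" "y = ?j (t \<otimes>\<^bsub>R\<^esub> q y)" if "y \<in> carrier ?N" for y
  proof -
    have "\<exists>s. s \<in> carrier R \<and> y = ?j (t \<otimes>\<^bsub>R\<^esub> s)" using that unfolding cN by blast
    from someI_ex[OF this] show "q y \<in> carrier R" "y = ?j (t \<otimes>\<^bsub>R\<^esub> q y)" unfolding q_def by blast+
  qed
  have wd: "l (s \<odot>\<^bsub>M\<^esub> x) = l (s' \<odot>\<^bsub>M\<^esub> x)"
    if s: "s \<in> carrier R" "s' \<in> carrier R" "t \<otimes>\<^bsub>R\<^esub> s = t \<otimes>\<^bsub>R\<^esub> s'" and x: "x \<in> carrier M" for s s' x
  proof -
    have "t \<otimes>\<^bsub>R\<^esub> (s \<ominus>\<^bsub>R\<^esub> s') = \<zero>\<^bsub>R\<^esub>" using s t_closed by (simp add: a_minus_def R.r_distr R.r_minus R.r_neg)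
    then obtain w where w: "w \<in> carrier R" "s \<ominus>\<^bsub>R\<^esub> s' = t [^]\<^bsub>R\<^esub> (p - 1) \<otimes>\<^bsub>R\<^esub> w" using annihilator[of "s \<ominus>\<^bsub>R\<^esub> s'"] s by auto
    have "s = (s \<ominus>\<^bsub>R\<^esub> s') \<oplus>\<^bsub>R\<^esub> s'" using s by (simp add: a_minus_def R.a_assoc R.l_neg)
    then have "s \<odot>\<^bsub>M\<^esub> x = (s \<ominus>\<^bsub>R\<^esub> s') \<odot>\<^bsub>M\<^esub> x \<oplus>\<^bsub>M\<^esub> s' \<odot>\<^bsub>M\<^esub> x"
      using M.smult_l_distr[of "s \<ominus>\<^bsub>R\<^esub> s'" s' x] s x by simp
    also have "(s \<ominus>\<^bsub>R\<^esub> s') \<odot>\<^bsub>M\<^esub> x = t [^]\<^bsub>R\<^esub> (p - 1) \<odot>\<^bsub>M\<^esub> (w \<odot>\<^bsub>M\<^esub> x)"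
      unfolding w(2) using w(1) x pow_t_closed by (simp add: M.smult_assoc)
    finally show ?thesis
      using lD x s w pow_t_closed M.smult_closed l(2)[of "t [^]\<^bsub>R\<^esub> (p - 1) \<odot>\<^bsub>M\<^esub> (w \<odot>\<^bsub>M\<^esub> x)"] by simp
  qed
  have jD: "?j a = ?j b \<Longrightarrow> a = b" for a b by metis
  have Nadd: "?j a \<oplus>\<^bsub>?N\<^esub> ?j b = ?j (a \<oplus>\<^bsub>R\<^esub> b)" if "a \<in> ?I" "b \<in> ?I" for a b
    using inv[OF that(1)] inv[OF that(2)] by (simp add: transport_module_def Let_def)
  have Nsm: "r \<odot>\<^bsub>?N\<^esub> ?j a = ?j (r \<otimes>\<^bsub>R\<^esub> a)" if "a \<in> ?I" for r a
    using inv[OF that] by (simp add: transport_module_def Let_def)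
  \<comment> \<open>On x \<otimes> t s this is l (s x). It defines a functional on M \<otimes> (t)
    with value l u \<noteq> 0 at u \<otimes> t, although that tensor has just been shown to
    vanish.\<close>
  let ?H = "\<lambda>x y. l (q y \<odot>\<^bsub>M\<^esub> x)"
  have balH: "balanced_map R M ?N K ?H"
    unfolding balanced_map_def
  proof (intro conjI ballI)
    fix x y assume x: "x \<in> carrier M" and y: "y \<in> carrier ?N"
    show "?H x y \<in> carrier K" using x q(1)[OF y] lD M.smult_closed by simp
    fix x' assume x': "x' \<in> carrier M"
    show "?H (x \<oplus>\<^bsub>M\<^esub> x') y = ?H x y \<oplus>\<^bsub>K\<^esub> ?H x' y"
      using x x' q(1)[OF y] lD M.smult_closed by (simp add: M.smult_r_distr)
  next
    fix x y y' assume x: "x \<in> carrier M" and y: "y \<in> carrier ?N" and y': "y' \<in> carrier ?N"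
    have yy: "y \<oplus>\<^bsub>?N\<^esub> y' \<in> carrier ?N" using y y' by simp
    have "?j (t \<otimes>\<^bsub>R\<^esub> q (y \<oplus>\<^bsub>?N\<^esub> y')) = ?j (t \<otimes>\<^bsub>R\<^esub> q y) \<oplus>\<^bsub>?N\<^esub> ?j (t \<otimes>\<^bsub>R\<^esub> q y')"
      using q(2)[OF y] q(2)[OF y'] q(2)[OF yy] by metis
    also have "\<dots> = ?j (t \<otimes>\<^bsub>R\<^esub> (q y \<oplus>\<^bsub>R\<^esub> q y'))"
      using q(1)[OF y] q(1)[OF y'] t_closed by (subst Nadd) (simp_all add: R.r_distr)
    finally have "t \<otimes>\<^bsub>R\<^esub> q (y \<oplus>\<^bsub>?N\<^esub> y') = t \<otimes>\<^bsub>R\<^esub> (q y \<oplus>\<^bsub>R\<^esub> q y')" by (rule jD)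
    then have "?H x (y \<oplus>\<^bsub>?N\<^esub> y') = l ((q y \<oplus>\<^bsub>R\<^esub> q y') \<odot>\<^bsub>M\<^esub> x)"
      using q(1)[OF y] q(1)[OF y'] q(1)[OF yy] x by (intro wd) auto
    then show "?H x (y \<oplus>\<^bsub>?N\<^esub> y') = ?H x y \<oplus>\<^bsub>K\<^esub> ?H x y'"
      using q(1)[OF y] q(1)[OF y'] x lD M.smult_closed by (simp add: M.smult_l_distr)
  next
    fix r x y assume r: "r \<in> carrier R" and x: "x \<in> carrier M" and y: "y \<in> carrier ?N"
    have ry: "r \<odot>\<^bsub>?N\<^esub> y \<in> carrier ?N" using T.N.smult_closed[OF r y] .
    have "?j (t \<otimes>\<^bsub>R\<^esub> q (r \<odot>\<^bsub>?N\<^esub> y)) = r \<odot>\<^bsub>?N\<^esub> ?j (t \<otimes>\<^bsub>R\<^esub> q y)"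
      using q(2)[OF y] q(2)[OF ry] by metis
    also have "\<dots> = ?j (t \<otimes>\<^bsub>R\<^esub> (q y \<otimes>\<^bsub>R\<^esub> r))"
    proof -
      have "t \<otimes>\<^bsub>R\<^esub> q y \<in> ?I" using q(1)[OF y] by blast
      from Nsm[OF this] show ?thesis using q(1)[OF y] r t_closed by (simp add: R.m_ac)
    qed
    finally have "t \<otimes>\<^bsub>R\<^esub> q (r \<odot>\<^bsub>?N\<^esub> y) = t \<otimes>\<^bsub>R\<^esub> (q y \<otimes>\<^bsub>R\<^esub> r)" by (rule jD)
    then have "?H x (r \<odot>\<^bsub>?N\<^esub> y) = l ((q y \<otimes>\<^bsub>R\<^esub> r) \<odot>\<^bsub>M\<^esub> x)"
      using q(1)[OF y] q(1)[OF ry] r x by (intro wd) auto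
    then show "?H (r \<odot>\<^bsub>M\<^esub> x) y = ?H x (r \<odot>\<^bsub>?N\<^esub> y)"
      using q(1)[OF y] r x by (simp add: M.smult_assoc)
  qed
  have "?H u (?j t) = tensor_lift K ?H \<zero>\<^bsub>T.T\<^esub>"
    using T.tensor_lift_pure[OF K.abelian_group_axioms balH u(1) jt] zero by simp
  also have "\<dots> = \<zero>\<^bsub>K\<^esub>"
    by (rule additive_map_zero[OF T.tensor_abelian_group K.abelian_group_axioms T.tensor_lift_additive[OF K.abelian_group_axioms balH]])
  finally have "?H u (?j t) = \<zero>\<^bsub>K\<^esub>" .
  moreover have "t \<otimes>\<^bsub>R\<^esub> q (?j t) = t \<otimes>\<^bsub>R\<^esub> \<one>\<^bsub>R\<^esub>" using q(2)[OF jt] t_closed by (simp add: jD)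
  then have "?H u (?j t) = l u"
    using wd[OF q(1)[OF jt] R.one_closed _ u(1)] u(1) by (simp add: M.smult_one)
  ultimately show False using l(3) by simp
qed

end

section \<open>Free covers\<close>

lemma (in left_module) submodule_finsum:
  assumes S: "submodule S R M" and "finite I" "\<And>i. i \<in> I \<Longrightarrow> h i \<in> S"
  shows "(\<Oplus>\<^bsub>M\<^esub>i\<in>I. h i) \<in> S"
  using assms(2,3)
proof (induction I)
  case empty
  then show ?case using submodule_closed(2)[OF S] by simp
next
  case (insert i I)
  then have "h \<in> I \<rightarrow> carrier M" "h i \<in> carrier M" using submodule_closed(1)[OF S] by auto
  then show ?case using insert submodule_closed(3)[OF S] by simp
qed

lemma finsum_restr:
  assumes "abelian_group M" "finite A" "h \<in> A \<rightarrow> carrier M"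
  shows "finsum (restr \<phi> M) h A = finsum M h A"
  using additive_map_finsum[of "restr \<phi> M" M "\<lambda>x. x" A h] assms abelian_group_cong[OF assms(1), of "restr \<phi> M"]
  by (simp add: additive_map_def)

definition power_module :: "nat \<Rightarrow> ('b, 'z) ring_scheme \<Rightarrow> ('b, nat \<Rightarrow> 'b) module" where
  "power_module n B = \<lparr>carrier = {..<n} \<rightarrow>\<^sub>E carrier B, monoid.mult = undefined, one = undefined,
     ring.zero = (\<lambda>i\<in>{..<n}. \<zero>\<^bsub>B\<^esub>), add = (\<lambda>x y. \<lambda>i\<in>{..<n}. x i \<oplus>\<^bsub>B\<^esub> y i),
     smult = (\<lambda>b x. \<lambda>i\<in>{..<n}. b \<otimes>\<^bsub>B\<^esub> x i)\<rparr>"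

definition unit_vector :: "nat \<Rightarrow> ('b, 'z) ring_scheme \<Rightarrow> nat \<Rightarrow> nat \<Rightarrow> 'b" where
  "unit_vector n B i = (\<lambda>j\<in>{..<n}. if j = i then \<one>\<^bsub>B\<^esub> else \<zero>\<^bsub>B\<^esub>)"

lemma power_module_simps:
  "carrier (power_module n B) = {..<n} \<rightarrow>\<^sub>E carrier B"
  "\<zero>\<^bsub>power_module n B\<^esub> = (\<lambda>i\<in>{..<n}. \<zero>\<^bsub>B\<^esub>)"
  "x \<oplus>\<^bsub>power_module n B\<^esub> y = (\<lambda>i\<in>{..<n}. x i \<oplus>\<^bsub>B\<^esub> y i)"
  "b \<odot>\<^bsub>power_module n B\<^esub> x = (\<lambda>i\<in>{..<n}. b \<otimes>\<^bsub>B\<^esub> x i)"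
  by (simp_all add: power_module_def)

lemma power_module_eqI:
  assumes "x \<in> carrier (power_module n B)" "y \<in> carrier (power_module n B)" "\<And>i. i < n \<Longrightarrow> x i = y i"
  shows "x = y"
  using assms unfolding power_module_simps by (intro PiE_ext[of x "{..<n}" "\<lambda>_. carrier B" y]) auto

lemma power_module_left_module:
  assumes "ring B"
  shows "left_module B (power_module n B)"
proof -
  interpret B: ring B by fact
  let ?P = "power_module n B"
  have c: "x i \<in> carrier B" if "x \<in> carrier ?P" "i < n" for x i
    using that by (auto simp: power_module_simps)
  have I: "(\<lambda>i\<in>{..<n}. h i) \<in> carrier ?P" if "\<And>i. i < n \<Longrightarrow> h i \<in> carrier B" for h
    using that by (auto simp: power_module_simps)
  have ac: "x \<oplus>\<^bsub>?P\<^esub> y \<in> carrier ?P" if "x \<in> carrier ?P" "y \<in> carrier ?P" for x y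
    unfolding power_module_simps(3) using c that by (intro I) auto
  have sc: "b \<odot>\<^bsub>?P\<^esub> y \<in> carrier ?P" if "b \<in> carrier B" "y \<in> carrier ?P" for b y
    unfolding power_module_simps(4) using c that by (intro I) auto
  have zc: "\<zero>\<^bsub>?P\<^esub> \<in> carrier ?P" unfolding power_module_simps(2) by (intro I) auto
  have e: "(x \<oplus>\<^bsub>?P\<^esub> y) i = x i \<oplus>\<^bsub>B\<^esub> y i" "(b \<odot>\<^bsub>?P\<^esub> x) i = b \<otimes>\<^bsub>B\<^esub> x i" "\<zero>\<^bsub>?P\<^esub> i = \<zero>\<^bsub>B\<^esub>"
    if "i < n" for x y b i using that by (simp_all add: power_module_simps)
  note eqI = power_module_eqI[where n = n and B = B]
  have "abelian_group ?P"
  proof (rule abelian_groupI)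
    show "\<exists>y\<in>carrier ?P. y \<oplus>\<^bsub>?P\<^esub> x = \<zero>\<^bsub>?P\<^esub>" if x: "x \<in> carrier ?P" for x
    proof
      show m: "(\<lambda>i\<in>{..<n}. \<ominus>\<^bsub>B\<^esub> x i) \<in> carrier ?P" using c[OF x] by (intro I) auto
      show "(\<lambda>i\<in>{..<n}. \<ominus>\<^bsub>B\<^esub> x i) \<oplus>\<^bsub>?P\<^esub> x = \<zero>\<^bsub>?P\<^esub>"
        by (rule power_module_eqI[OF ac[OF m x] zc]) (use c[OF x] in \<open>simp add: e B.l_neg\<close>)
    qed
    show "x \<oplus>\<^bsub>?P\<^esub> y \<oplus>\<^bsub>?P\<^esub> z = x \<oplus>\<^bsub>?P\<^esub> (y \<oplus>\<^bsub>?P\<^esub> z)" if "x \<in> carrier ?P" "y \<in> carrier ?P" "z \<in> carrier ?P" for x y z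
      by (rule eqI) (use that c ac in \<open>simp_all add: e B.a_assoc\<close>)
    show "x \<oplus>\<^bsub>?P\<^esub> y = y \<oplus>\<^bsub>?P\<^esub> x" if "x \<in> carrier ?P" "y \<in> carrier ?P" for x y
      by (rule eqI) (use that c ac in \<open>simp_all add: e B.a_comm\<close>)
    show "\<zero>\<^bsub>?P\<^esub> \<oplus>\<^bsub>?P\<^esub> x = x" if "x \<in> carrier ?P" for x
      by (rule eqI) (use that c ac zc in \<open>simp_all add: e\<close>)
  qed (rule ac zc; assumption)+
  then show ?thesis
  proof (rule left_moduleI[OF B.ring_axioms])
    show "a \<odot>\<^bsub>?P\<^esub> x \<in> carrier ?P" if "a \<in> carrier B" "x \<in> carrier ?P" for a x by (rule sc[OF that])
    show "(a \<oplus>\<^bsub>B\<^esub> b) \<odot>\<^bsub>?P\<^esub> x = a \<odot>\<^bsub>?P\<^esub> x \<oplus>\<^bsub>?P\<^esub> b \<odot>\<^bsub>?P\<^esub> x"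
      if "a \<in> carrier B" "b \<in> carrier B" "x \<in> carrier ?P" for a b x
      by (rule eqI) (use that c ac sc in \<open>simp_all add: e B.l_distr\<close>)
    show "a \<odot>\<^bsub>?P\<^esub> (x \<oplus>\<^bsub>?P\<^esub> y) = a \<odot>\<^bsub>?P\<^esub> x \<oplus>\<^bsub>?P\<^esub> a \<odot>\<^bsub>?P\<^esub> y"
      if "a \<in> carrier B" "x \<in> carrier ?P" "y \<in> carrier ?P" for a x y
      by (rule eqI) (use that c ac sc in \<open>simp_all add: e B.r_distr\<close>)
    show "(a \<otimes>\<^bsub>B\<^esub> b) \<odot>\<^bsub>?P\<^esub> x = a \<odot>\<^bsub>?P\<^esub> (b \<odot>\<^bsub>?P\<^esub> x)"
      if "a \<in> carrier B" "b \<in> carrier B" "x \<in> carrier ?P" for a b x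
      by (rule eqI) (use that c ac sc in \<open>simp_all add: e B.m_assoc\<close>)
    show "\<one>\<^bsub>B\<^esub> \<odot>\<^bsub>?P\<^esub> x = x" if "x \<in> carrier ?P" for x
      by (rule eqI) (use that c sc in \<open>simp_all add: e\<close>)
  qed
qed

lemma unit_vector_closed: "ring B \<Longrightarrow> unit_vector n B i \<in> carrier (power_module n B)"
  by (auto simp: unit_vector_def power_module_simps ring.ring_simprules)

lemma power_module_expand:
  assumes B: "ring B" and x: "x \<in> carrier (power_module n B)"
  shows "x = (\<Oplus>\<^bsub>power_module n B\<^esub>i\<in>{..<n}. x i \<odot>\<^bsub>power_module n B\<^esub> unit_vector n B i)"
proof -
  let ?P = "power_module n B"
  interpret B: ring B by fact
  interpret P: left_module B ?P by (rule power_module_left_module[OF B])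
  have xc: "x i \<in> carrier B" if "i < n" for i using x that by (auto simp: power_module_simps)
  have h: "(\<lambda>i. x i \<odot>\<^bsub>?P\<^esub> unit_vector n B i) \<in> {..<n} \<rightarrow> carrier ?P"
    using xc unit_vector_closed[OF B] P.smult_closed by auto
  show ?thesis
  proof (rule power_module_eqI[OF x P.M.finsum_closed[OF h]])
    fix j assume j: "j < n"
    have "additive_map ?P B (\<lambda>x. x j)" using j by (auto simp: additive_map_def power_module_simps)
    from additive_map_finsum[OF P.M_abelian B.abelian_group_axioms this _ h]
    have "(\<Oplus>\<^bsub>?P\<^esub>i\<in>{..<n}. x i \<odot>\<^bsub>?P\<^esub> unit_vector n B i) j = (\<Oplus>\<^bsub>B\<^esub>i\<in>{..<n}. (x i \<odot>\<^bsub>?P\<^esub> unit_vector n B i) j)"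
      by simp
    also have "\<dots> = (\<Oplus>\<^bsub>B\<^esub>i\<in>{..<n}. if j = i then x i else \<zero>\<^bsub>B\<^esub>)"
      using j xc by (intro B.finsum_cong') (auto simp: power_module_simps unit_vector_def)
    also have "\<dots> = x j"
      using B.finsum_singleton[of j "{..<n}" x] j xc by auto
    finally show "x j = (\<Oplus>\<^bsub>?P\<^esub>i\<in>{..<n}. x i \<odot>\<^bsub>?P\<^esub> unit_vector n B i) j" by simp
  qed
qed

section \<open>Free modules of finite rank in the category mod B\<close>

context algebra_over
begin

lemma V_left_module: "left_module B M \<Longrightarrow> left_module k (restr (scalar B) M)"
  by (rule left_module_of_module[OF restr_scalar_module])

lemma power_module_fg:
  assumes fg: "finitely_generated k (restr (scalar B) (regular B))"
  shows "finitely_generated k (restr (scalar B) (power_module n B))"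
proof -
  let ?P = "power_module n B" and ?u = "unit_vector n B"
  note PL = power_module_left_module[OF B.ring_axioms, of n] and RL = left_module_regular[OF B.ring_axioms]
  interpret P: left_module B ?P by (rule PL)
  interpret VP: left_module k "restr (scalar B) ?P" by (rule V_left_module[OF PL])
  obtain G where G: "finite G" "G \<subseteq> carrier B"
    "\<And>S. submodule S k (restr (scalar B) (regular B)) \<Longrightarrow> G \<subseteq> S \<Longrightarrow> carrier B \<subseteq> S"
    using fg unfolding finitely_generated_iff[OF V_left_module[OF RL]] by auto
  let ?G = "(\<lambda>(b, i). b \<odot>\<^bsub>?P\<^esub> ?u i) ` (G \<times> {..<n})"
  note uc = unit_vector_closed[OF B.ring_axioms]
  have xc: "x i \<in> carrier B" if "x \<in> carrier ?P" "i < n" for x i using that by (auto simp: power_module_simps)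
  have "carrier ?P \<subseteq> S" if S: "submodule S k (restr (scalar B) ?P)" "?G \<subseteq> S" for S
  proof
    fix x assume x: "x \<in> carrier ?P"
    have "b \<odot>\<^bsub>?P\<^esub> ?u i \<in> S" if "b \<in> carrier B" "i < n" for b i
    proof -
      have lin: "linear_map B (regular B) ?P (\<lambda>b. b \<odot>\<^bsub>?P\<^esub> ?u i)"
        using uc by (simp add: linear_map_def P.smult_closed P.smult_l_distr P.smult_assoc)
      have "submodule {b \<in> carrier (restr (scalar B) (regular B)). b \<odot>\<^bsub>?P\<^esub> ?u i \<in> S} k (restr (scalar B) (regular B))"
        by (rule submodule_vimage_linear[OF V_left_module[OF RL] V_left_module[OF PL] linear_map_scalar[OF lin] S(1)])
      moreover have "G \<subseteq> {b \<in> carrier (restr (scalar B) (regular B)). b \<odot>\<^bsub>?P\<^esub> ?u i \<in> S}"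
        using G(2) S(2) \<open>i < n\<close> by auto
      ultimately have "carrier B \<subseteq> {b \<in> carrier (restr (scalar B) (regular B)). b \<odot>\<^bsub>?P\<^esub> ?u i \<in> S}" by (rule G(3))
      then show ?thesis using that(1) by blast
    qed
    then have "(\<Oplus>\<^bsub>restr (scalar B) ?P\<^esub>i\<in>{..<n}. x i \<odot>\<^bsub>?P\<^esub> ?u i) \<in> S"
      using x by (intro VP.submodule_finsum[OF S(1)]) (auto simp: power_module_simps(1))
    also have "(\<Oplus>\<^bsub>restr (scalar B) ?P\<^esub>i\<in>{..<n}. x i \<odot>\<^bsub>?P\<^esub> ?u i) = (\<Oplus>\<^bsub>?P\<^esub>i\<in>{..<n}. x i \<odot>\<^bsub>?P\<^esub> ?u i)"
      using xc[OF x] uc by (intro finsum_restr[OF P.M_abelian]) (auto intro!: P.smult_closed)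
    also have "\<dots> = x" by (rule power_module_expand[OF B.ring_axioms x, symmetric])
    finally show "x \<in> S" .
  qed
  moreover have "?G \<subseteq> carrier ?P" using G(2) uc P.smult_closed by auto
  ultimately show ?thesis unfolding finitely_generated_iff[OF V_left_module[OF PL]]
    using G(1) by (intro exI[of _ ?G]) simp
qed

text \<open>Freeness is recorded by a dual basis: vectors v and functionals \<pi> with x equal to
  the sum of \<pi> i x times v i. In this form it survives both the transport to another type and
  base change to K.\<close>

lemma free_cover:
  fixes W :: "('b, 'w) module"
  assumes W: "left_module B W" and fgW: "finitely_generated k (restr (scalar B) W)"
    and fgB: "finitely_generated k (restr (scalar B) (regular B))"
  obtains F :: "('b, nat \<Rightarrow> 'c) module" and g n v \<pi> where
    "left_module B F" "finitely_generated k (restr (scalar B) F)" "g \<in> lhom B F W" "g ` carrier F = carrier W"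
    "\<forall>i<n. v i \<in> carrier F" "\<forall>i<n. \<pi> i \<in> lhom B F (regular B)"
    "\<forall>x\<in>carrier F. x = (\<Oplus>\<^bsub>F\<^esub>i\<in>{..<n::nat}. \<pi> i x \<odot>\<^bsub>F\<^esub> v i)"
proof -
  interpret W: left_module B W by (rule W)
  obtain G where G: "finite G" "G \<subseteq> carrier W"
    "\<And>S. submodule S k (restr (scalar B) W) \<Longrightarrow> G \<subseteq> S \<Longrightarrow> carrier W \<subseteq> S"
    using fgW unfolding finitely_generated_iff[OF V_left_module[OF W]] by auto
  \<comment> \<open>Generators over k also generate over B, so W is covered by as many copies of B
    as it has generators over k.\<close>
  define n where "n = card G"
  obtain w :: "nat \<Rightarrow> 'w" where w: "G = w ` {..<n}"
    using ex_bij_betw_nat_finite[OF G(1)] by (auto simp: bij_betw_def atLeast0LessThan n_def)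
  have wc: "w i \<in> carrier W" if "i < n" for i using that w G(2) by auto
  let ?P = "power_module n B" and ?u = "unit_vector n B"
  note PL = power_module_left_module[OF B.ring_axioms, of n]
  note uc = unit_vector_closed[OF B.ring_axioms, of n]
  interpret P: left_module B ?P by (rule PL)
  have xc: "x i \<in> carrier B" if "x \<in> carrier ?P" "i < n" for x i using that by (auto simp: power_module_simps)
  define g0 where "g0 x = (\<Oplus>\<^bsub>W\<^esub>i\<in>{..<n}. x i \<odot>\<^bsub>W\<^esub> w i)" for x
  have tc: "(\<lambda>i. x i \<odot>\<^bsub>W\<^esub> w i) \<in> {..<n} \<rightarrow> carrier W" if "x \<in> carrier ?P" for x
    using xc[OF that] wc W.smult_closed by auto
  have g0: "linear_map B ?P W g0" unfolding linear_map_def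
  proof (intro conjI ballI)
    show "g0 \<in> carrier ?P \<rightarrow> carrier W" using W.M.finsum_closed[OF tc] by (auto simp: g0_def)
    fix x assume x: "x \<in> carrier ?P"
    show "g0 (x \<oplus>\<^bsub>?P\<^esub> y) = g0 x \<oplus>\<^bsub>W\<^esub> g0 y" if y: "y \<in> carrier ?P" for y
    proof -
      have "g0 (x \<oplus>\<^bsub>?P\<^esub> y) = (\<Oplus>\<^bsub>W\<^esub>i\<in>{..<n}. x i \<odot>\<^bsub>W\<^esub> w i \<oplus>\<^bsub>W\<^esub> y i \<odot>\<^bsub>W\<^esub> w i)"
        unfolding g0_def using xc[OF x] xc[OF y] wc
        by (intro W.M.finsum_cong') (auto simp: power_module_simps W.smult_l_distr W.smult_closed)
      then show ?thesis unfolding g0_def using W.M.finsum_addf[OF tc[OF x] tc[OF y]] by simp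
    qed
    show "g0 (b \<odot>\<^bsub>?P\<^esub> x) = b \<odot>\<^bsub>W\<^esub> g0 x" if b: "b \<in> carrier B" for b
    proof -
      have "g0 (b \<odot>\<^bsub>?P\<^esub> x) = (\<Oplus>\<^bsub>W\<^esub>i\<in>{..<n}. b \<odot>\<^bsub>W\<^esub> (x i \<odot>\<^bsub>W\<^esub> w i))"
        unfolding g0_def using xc[OF x] wc b
        by (intro W.M.finsum_cong') (auto simp: power_module_simps W.smult_assoc W.smult_closed)
      then show ?thesis unfolding g0_def using W.smult_finsum_right[OF b _ tc[OF x]] by simp
    qed
  qed
  have g0u: "g0 (?u i) = w i" if "i < n" for i
  proof -
    have "g0 (?u i) = (\<Oplus>\<^bsub>W\<^esub>j\<in>{..<n}. if i = j then w j else \<zero>\<^bsub>W\<^esub>)"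
      unfolding g0_def using wc
      by (intro W.M.finsum_cong') (auto simp: unit_vector_def W.smult_one W.smult_zero_left)
    also have "\<dots> = w i" using W.M.finsum_singleton[of i "{..<n}" w] that wc by auto
    finally show ?thesis .
  qed
  have g0s: "g0 ` carrier ?P = carrier W"
  proof
    show "g0 ` carrier ?P \<subseteq> carrier W" using linear_mapD(1)[OF g0] by auto
    interpret h: operator_hom B ?P W g0
      using operator_group_left_module[OF PL] operator_group_left_module[OF W] g0
      by (simp add: operator_hom_def operator_hom_axioms_def)
    have "submodule (g0 ` carrier ?P) B W" by (rule h.submodule_image[OF h.M.submodule_carrier])
    from submodule_restr[OF k.ring_axioms B.ring_axioms scalar_ring_hom W this]
    show "carrier W \<subseteq> g0 ` carrier ?P"
    proof (rule G(3))
      show "G \<subseteq> g0 ` carrier ?P"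
      proof
        fix x assume "x \<in> G"
        then obtain i where "i < n" "x = w i" using w by (metis imageE lessThan_iff)
        then show "x \<in> g0 ` carrier ?P" using g0u[of i] uc[of i] by (metis imageI)
      qed
    qed
  qed
  \<comment> \<open>B^n consists of sequences in B, whereas members of \<open>fd_modules\<close>
    consist of sequences in k; finite dimension over k supplies an injection.\<close>
  obtain j :: "(nat \<Rightarrow> 'b) \<Rightarrow> nat \<Rightarrow> 'c" where j: "inj_on j (carrier ?P)"
    using finitely_generated_embedding[OF V_left_module[OF PL] power_module_fg[OF fgB]] by auto
  let ?F = "transport_module j ?P"
  note t = transport_module[OF PL j]
  let ?j = "\<lambda>x\<in>carrier ?P. j x" and ?i = "\<lambda>x\<in>j ` carrier ?P. inv_into (carrier ?P) j x"
  have ij: "?i (j x) = x" if "x \<in> carrier ?P" for x using j that by simp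
  interpret F: left_module B ?F by (rule t(1))
  have fgF: "finitely_generated k (restr (scalar B) ?F)"
    by (rule finitely_generated_image[OF V_left_module[OF PL] V_left_module[OF t(1)] linear_map_scalar[OF lhomD(5)[OF t(2)]] _ power_module_fg[OF fgB]])
       (simp add: t(4))
  have g0h: "restrict g0 (carrier ?P) \<in> lhom B ?P W" by (rule restrict_lhom[OF PL g0])
  define g where "g = compose (carrier ?F) (restrict g0 (carrier ?P)) ?i"
  have g: "g \<in> lhom B ?F W" unfolding g_def by (rule lhom_compose[OF t(3) g0h t(1)])
  have gj: "g (j x) = g0 x" if "x \<in> carrier ?P" for x
    using that ij[OF that] by (simp add: g_def compose_def t(4))
  have "(\<lambda>x. g (j x)) ` carrier ?P = g0 ` carrier ?P" by (rule image_cong[OF refl gj])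
  then have gs: "g ` carrier ?F = carrier W"
    by (simp only: t(4) image_image g0s)
  define \<pi> where "\<pi> = (\<lambda>i. compose (carrier ?F) (\<lambda>x\<in>carrier ?P. x i) ?i)"
  have pr: "(\<lambda>x\<in>carrier ?P. x i) \<in> lhom B ?P (regular B)" if "i < n" for i
    using that xc by (intro restrict_lhom[OF PL]) (simp add: linear_map_def power_module_simps)
  have p: "\<pi> i \<in> lhom B ?F (regular B)" if "i < n" for i
    unfolding \<pi>_def by (rule lhom_compose[OF t(3) pr[OF that] t(1)])
  have pj: "\<pi> i (j x) = x i" if "x \<in> carrier ?P" for i x
    using that ij[OF that] by (simp add: \<pi>_def compose_def t(4))
  have vc: "j (?u i) \<in> carrier ?F" for i using uc[of i] by (simp add: t(4))
  have ex: "x = (\<Oplus>\<^bsub>?F\<^esub>i\<in>{..<n}. \<pi> i x \<odot>\<^bsub>?F\<^esub> j (?u i))" if xF: "x \<in> carrier ?F" for x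
  proof -
    obtain y where y: "y \<in> carrier ?P" "x = j y" using xF unfolding t(4) by blast
    have h: "(\<lambda>i. y i \<odot>\<^bsub>?P\<^esub> ?u i) \<in> {..<n} \<rightarrow> carrier ?P" using xc[OF y(1)] uc P.smult_closed by auto
    have "?j y = ?j (\<Oplus>\<^bsub>?P\<^esub>i\<in>{..<n}. y i \<odot>\<^bsub>?P\<^esub> ?u i)"
      using power_module_expand[OF B.ring_axioms y(1)] by simp
    also have "\<dots> = (\<Oplus>\<^bsub>?F\<^esub>i\<in>{..<n}. ?j (y i \<odot>\<^bsub>?P\<^esub> ?u i))"
      by (rule additive_map_finsum[OF P.M_abelian F.M_abelian lhomD(6)[OF t(2)] _ h]) simp
    also have "\<dots> = (\<Oplus>\<^bsub>?F\<^esub>i\<in>{..<n}. \<pi> i x \<odot>\<^bsub>?F\<^esub> j (?u i))"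
    proof (rule F.M.finsum_cong'[OF refl])
      have jj: "?j (y i \<odot>\<^bsub>?P\<^esub> ?u i) = y i \<odot>\<^bsub>?F\<^esub> j (?u i)" if "i < n" for i
        using lhomD(3)[OF t(2) xc[OF y(1) that] uc[of i]] uc[of i] by simp
      show "(\<lambda>i. \<pi> i x \<odot>\<^bsub>?F\<^esub> j (?u i)) \<in> {..<n} \<rightarrow> carrier ?F"
        unfolding y(2) pj[OF y(1)] using xc[OF y(1)] vc by (auto intro!: F.smult_closed)
      show "?j (y i \<odot>\<^bsub>?P\<^esub> ?u i) = \<pi> i x \<odot>\<^bsub>?F\<^esub> j (?u i)" if "i \<in> {..<n}" for i
        unfolding y(2) pj[OF y(1)] using jj that by simp
    qed
    finally show ?thesis using y by simp
  qed
  have "\<forall>i<n. j (?u i) \<in> carrier ?F" "\<forall>i<n. \<pi> i \<in> lhom B ?F (regular B)"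
    "\<forall>x\<in>carrier ?F. x = (\<Oplus>\<^bsub>?F\<^esub>i\<in>{..<n}. \<pi> i x \<odot>\<^bsub>?F\<^esub> j (?u i))"
    using vc p ex by blast+
  with t(1) fgF g gs show ?thesis by (rule that[of ?F g n "\<lambda>i. j (?u i)" \<pi>])
qed

end

section \<open>The subadditive function of the point module\<close>

lemma end_ring_carrier: "carrier (end_ring R M) = lhom R M M"
  by (simp add: end_ring_def)

context pi_setting
begin

abbreviation "HomD M \<equiv> hom_module B M Delta (\<lambda>e f. compose (carrier M) e f)"

text \<open>K acts on the values of the functions in \<Delta> and B on their arguments, so the two
  commute. Hence every submodule over the endomorphism ring is stable under K.\<close>

lemma scale_Delta:
  assumes c: "c \<in> carrier K"
  shows "(\<lambda>f\<in>carrier Delta. \<lambda>y\<in>carrier KB. c \<otimes>\<^bsub>K\<^esub> f y) \<in> lhom B Delta Delta"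
proof -
  interpret KB: ring KB by (rule KB_ring)
  interpret D: operator_group B Delta by (rule Delta_operator_group)
  let ?s = "\<lambda>f. \<lambda>y\<in>carrier KB. c \<otimes>\<^bsub>K\<^esub> f y"
  have cl: "?s f \<in> carrier Delta" if "f \<in> carrier Delta" for f
    using DeltaD[OF that] c aug_closed alpha_closed by (intro DeltaI) (simp_all add: K.r_distr K.m_lcomm)
  have add: "?s (f \<oplus>\<^bsub>Delta\<^esub> g) = ?s f \<oplus>\<^bsub>Delta\<^esub> ?s g" if "f \<in> carrier Delta" "g \<in> carrier Delta" for f g
    unfolding Delta_simps(2) using DeltaD(1)[OF that(1)] DeltaD(1)[OF that(2)] c
    by (intro restrict_ext) (simp add: K.r_distr)
  have act: "?s (b \<odot>\<^bsub>Delta\<^esub> f) = b \<odot>\<^bsub>Delta\<^esub> ?s f" if "b \<in> carrier B" for b f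
    unfolding Delta_simps(4) using incl_closed[OF that] by (intro restrict_ext) simp
  show ?thesis
    unfolding lhom_def linear_map_def using cl add act D.op_closed D.M.a_closed
    by (simp del: restr_simps coinduced_simps add: Pi_iff)
qed

text \<open>By adjunction \<phi> is determined by the values \<phi> (e i) 1 in K at generators e i
  of M, which embeds Hom(M, \<Delta>) in K^n. Submodules over the endomorphism ring are K-stable by
  \<open>scale_Delta\<close>, so pivots bound their chains.\<close>

lemma HomD_finite:
  fixes M :: "('b, 'm) module"
  assumes M: "left_module B M" and fg: "finitely_generated k (V M)"
  shows "finite_operator_group (end_ring B Delta) (HomD M)"
proof -
  interpret M: left_module B M by (rule M)
  have og: "operator_group (end_ring B Delta) (HomD M)"
    by (rule hom_module_operator_group[OF M Delta_operator_group])
  interpret og: operator_group "end_ring B Delta" "HomD M" by (rule og)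
  obtain G where G: "finite G" "G \<subseteq> carrier M" "\<And>S. submodule S k (V M) \<Longrightarrow> G \<subseteq> S \<Longrightarrow> carrier M \<subseteq> S"
    using fg unfolding finitely_generated_iff[OF V_left_module[OF M]] by auto
  define n where "n = card G"
  obtain e :: "nat \<Rightarrow> 'm" where e: "G = e ` {..<n}"
    using ex_bij_betw_nat_finite[OF G(1)] by (auto simp: bij_betw_def atLeast0LessThan n_def)
  have ec: "e i \<in> carrier M" if "i < n" for i using that e G(2) by auto
  have D: "\<phi> x \<in> carrier Delta" if "\<phi> \<in> lhom B M Delta" "x \<in> carrier M" for \<phi> x
    using lhomD(1)[OF that] .
  have "finite_height (end_ring B Delta) (HomD M)"
  proof (rule finite_height_pivots[OF og K.field_axioms, of n "\<lambda>\<phi> i. \<phi> (e i) \<one>\<^bsub>KB\<^esub>"])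
    show "\<phi> (e i) \<one>\<^bsub>KB\<^esub> \<in> carrier K" if "\<phi> \<in> carrier (HomD M)" "i < n" for \<phi> i
      using DeltaD(1)[OF D one_KB_closed] that ec by simp
    show "(\<phi> \<oplus>\<^bsub>HomD M\<^esub> \<psi>) (e i) \<one>\<^bsub>KB\<^esub> = \<phi> (e i) \<one>\<^bsub>KB\<^esub> \<oplus>\<^bsub>K\<^esub> \<psi> (e i) \<one>\<^bsub>KB\<^esub>"
      if "i < n" for \<phi> \<psi> i
      using ec[OF that] one_KB_closed by simp
    show "\<phi> = \<zero>\<^bsub>HomD M\<^esub>" if phi: "\<phi> \<in> carrier (HomD M)" and z: "\<And>i. i < n \<Longrightarrow> \<phi> (e i) \<one>\<^bsub>KB\<^esub> = \<zero>\<^bsub>K\<^esub>" for \<phi>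
    proof -
      have ph: "\<phi> \<in> lhom B M Delta" using phi by simp
      obtain l where l: "l \<in> lhom R (RExt M) Ktriv" "to_Delta M l = \<phi>"
        "\<And>x c. x \<in> carrier M \<Longrightarrow> c \<in> carrier K \<Longrightarrow> l (tens M x c) = c \<otimes>\<^bsub>K\<^esub> \<phi> x \<one>\<^bsub>KB\<^esub>"
        using from_Delta[OF M ph] by metis
      note lD = functionalD[OF M l(1)]
      interpret VM: left_module k "V M" by (rule V_left_module[OF M])
      interpret X: left_module KB "Ext M" by (rule Ext_left_module[OF M])
      \<comment> \<open>The zeros of x \<mapsto> l (x \<otimes> 1) form a k-subspace, so vanishing
        spreads from the generators to M, and by K-linearity to M \<otimes> K.\<close>
      let ?T = "{x \<in> carrier M. l (tens M x \<one>\<^bsub>K\<^esub>) = \<zero>\<^bsub>K\<^esub>}"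
      have "submodule ?T k (V M)"
      proof (rule VM.submoduleI')
        have "\<phi> \<zero>\<^bsub>M\<^esub> = \<zero>\<^bsub>Delta\<^esub>"
          by (rule additive_map_zero[OF M.M_abelian operator_group.axioms(1)[OF Delta_operator_group] lhomD(6)[OF ph]])
        then show "\<zero>\<^bsub>V M\<^esub> \<in> ?T" using l(3)[of "\<zero>\<^bsub>M\<^esub>" "\<one>\<^bsub>K\<^esub>"] one_KB_closed by simp
        show "x \<oplus>\<^bsub>V M\<^esub> y \<in> ?T" if "x \<in> ?T" "y \<in> ?T" for x y
          using that lD(2) tens_closed[OF M] by (simp add: tens_add_left[OF M])
        show "r \<odot>\<^bsub>V M\<^esub> x \<in> ?T" if "r \<in> carrier k" "x \<in> ?T" for r x
          using that lD(4)[of x "\<iota> r"] ring_hom_closed[OF emb that(1)]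
          by (simp add: tens_scalar[OF M] M.smult_closed scalar_closed)
      qed auto
      moreover have "G \<subseteq> ?T"
      proof
        fix x assume "x \<in> G"
        then obtain i where i: "i < n" "x = e i" using e by (metis imageE lessThan_iff)
        then show "x \<in> ?T" using ec[OF i(1)] z[OF i(1)] l(3)[OF ec[OF i(1)] K.one_closed] by simp
      qed
      ultimately have T: "carrier M \<subseteq> ?T" by (rule G(3))
      have l0: "l w = \<zero>\<^bsub>K\<^esub>" if "w \<in> carrier (Ext M)" for w
        using that
      proof (induction rule: Ext_induct[OF M, consumes 1, case_names pure add])
        case (pure m c)
        have "l (tens M m \<one>\<^bsub>K\<^esub>) = \<zero>\<^bsub>K\<^esub>" using T pure(1) by blast
        then show ?case using lD(4)[OF pure] pure(2) by simp
      next
        case (add v w)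
        then show ?case using lD(2) by simp
      qed
      show ?thesis
      proof (rule lhom_eqI[OF ph])
        show "\<zero>\<^bsub>HomD M\<^esub> \<in> lhom B M Delta" using og.M.zero_closed by (simp only: hom_module_simps(1))
        fix x assume x: "x \<in> carrier M"
        have "to_Delta M l x = (\<lambda>y\<in>carrier KB. \<zero>\<^bsub>K\<^esub>)"
          unfolding to_Delta_def[OF M] using x l0 tens_closed[OF M x K.one_closed]
          by (simp add: X.smult_closed cong: restrict_cong)
        then show "\<phi> x = \<zero>\<^bsub>HomD M\<^esub> x" using x l(2) by simp
      qed
    qed
    show "\<exists>\<psi>\<in>S. \<forall>i<n. \<psi> (e i) \<one>\<^bsub>KB\<^esub> = c \<otimes>\<^bsub>K\<^esub> \<phi> (e i) \<one>\<^bsub>KB\<^esub>"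
      if S: "submodule S (end_ring B Delta) (HomD M)" and ph: "\<phi> \<in> S" and c: "c \<in> carrier K" for S \<phi> c
    proof -
      let ?s = "\<lambda>f\<in>carrier Delta. \<lambda>y\<in>carrier KB. c \<otimes>\<^bsub>K\<^esub> f y"
      have phl: "\<phi> \<in> lhom B M Delta" using S ph og.submodule_iff by auto
      have "?s \<in> carrier (end_ring B Delta)" unfolding end_ring_carrier by (rule scale_Delta[OF c])
      then have "compose (carrier M) ?s \<phi> \<in> S" using S ph og.submodule_iff by auto
      moreover have "compose (carrier M) ?s \<phi> (e i) \<one>\<^bsub>KB\<^esub> = c \<otimes>\<^bsub>K\<^esub> \<phi> (e i) \<one>\<^bsub>KB\<^esub>" if "i < n" for i
        using ec[OF that] D[OF phl ec[OF that]] one_KB_closed by (simp add: compose_def)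
      ultimately show ?thesis by blast
    qed
  qed
  then show ?thesis using og by (simp add: finite_operator_group_def finite_operator_group_axioms_def)
qed

text \<open>Hom(-, \<Delta>) is left exact, so the three groups satisfy
  \<open>length_additive_iff\<close> with injection from Hom(W, \<Delta>); surjectivity onto Hom(U,
  \<Delta>) is extendability along f.\<close>

lemma chi_exact_iff:
  fixes U :: "('b, 'u) module" and M :: "('b, 'm) module" and W :: "('b, 'w) module"
  assumes U: "left_module B U" "finitely_generated k (V U)" and M: "left_module B M" "finitely_generated k (V M)"
    and W: "left_module B W" "finitely_generated k (V W)"
    and f: "f \<in> lhom B U M" and g: "g \<in> lhom B M W"
    and exact: "inj_on f (carrier U)" "f ` carrier U = {y \<in> carrier M. g y = \<zero>\<^bsub>W\<^esub>}" "g ` carrier M = carrier W"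
  shows "int (composition_length (end_ring B Delta) (HomD U)) - int (composition_length (end_ring B Delta) (HomD M)) +
      int (composition_length (end_ring B Delta) (HomD W)) = 0 \<longleftrightarrow>
    (\<forall>\<phi>\<in>lhom B U Delta. \<exists>\<psi>\<in>lhom B M Delta. \<forall>x\<in>carrier U. \<psi> (f x) = \<phi> x)"
proof -
  interpret U: left_module B U by (rule U(1))
  interpret M: left_module B M by (rule M(1))
  interpret W: left_module B W by (rule W(1))
  interpret D: operator_group B Delta by (rule Delta_operator_group)
  let ?E = "end_ring B Delta"
  let ?i = "\<lambda>\<psi>. compose (carrier M) \<psi> g" and ?j = "\<lambda>\<phi>. compose (carrier U) \<phi> f"
  note fD = lhomD(1-3)[OF f] and gD = lhomD(1-3)[OF g]
  have comp_lin: "linear_map ?E (HomD Y) (HomD Z) (\<lambda>\<psi>. compose (carrier Z) \<psi> h)"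
    if h: "h \<in> lhom B Z Y" and Z: "left_module B Z" for Y :: "('b, 'y) module" and Z :: "('b, 'z1) module" and h
    unfolding linear_map_def
  proof (intro conjI ballI)
    show "(\<lambda>\<psi>. compose (carrier Z) \<psi> h) \<in> carrier (HomD Y) \<rightarrow> carrier (HomD Z)"
      unfolding hom_module_simps by (intro funcsetI lhom_compose[OF h _ Z])
    show "compose (carrier Z) (\<phi> \<oplus>\<^bsub>HomD Y\<^esub> \<psi>) h = compose (carrier Z) \<phi> h \<oplus>\<^bsub>HomD Z\<^esub> compose (carrier Z) \<psi> h" for \<phi> \<psi>
      unfolding hom_module_simps(2) compose_def using lhomD(1)[OF h] by (intro restrict_ext) simp
    show "compose (carrier Z) (r \<odot>\<^bsub>HomD Y\<^esub> \<phi>) h = r \<odot>\<^bsub>HomD Z\<^esub> compose (carrier Z) \<phi> h" for r \<phi>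
      unfolding hom_module_simps(4) compose_def using lhomD(1)[OF h] by (intro restrict_ext) simp
  qed
  have inj: "inj_on ?i (carrier (HomD W))"
  proof (rule inj_onI)
    fix \<phi> \<psi> assume a: "\<phi> \<in> carrier (HomD W)" "\<psi> \<in> carrier (HomD W)" "?i \<phi> = ?i \<psi>"
    have "\<phi> (g x) = \<psi> (g x)" if "x \<in> carrier M" for x
      using fun_cong[OF a(3), of x] that by (simp add: compose_def)
    then have "\<phi> w = \<psi> w" if "w \<in> carrier W" for w
      using that exact(3) by (metis imageE)
    then show "\<phi> = \<psi>" using a(1,2) by (intro lhom_eqI[of \<phi> B W Delta \<psi>]) simp_all
  qed
  have fz: "g (f x) = \<zero>\<^bsub>W\<^esub>" if "x \<in> carrier U" for x using exact(2) that by auto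
  have ex: "?i ` carrier (HomD W) = {\<phi> \<in> carrier (HomD M). ?j \<phi> = \<zero>\<^bsub>HomD U\<^esub>}"
  proof (intro equalityI subsetI)
    fix \<phi> assume "\<phi> \<in> ?i ` carrier (HomD W)"
    then obtain \<psi> where p: "\<psi> \<in> lhom B W Delta" "\<phi> = ?i \<psi>" by auto
    have "\<psi> \<zero>\<^bsub>W\<^esub> = \<zero>\<^bsub>Delta\<^esub>" by (rule additive_map_zero[OF W.M_abelian D.M.abelian_group_axioms lhomD(6)[OF p(1)]])
    then have "?j \<phi> = \<zero>\<^bsub>HomD U\<^esub>"
      unfolding p(2) hom_module_simps(3) compose_def using fD(1) fz by (intro restrict_ext) (simp del: restr_simps)
    then show "\<phi> \<in> {\<phi> \<in> carrier (HomD M). ?j \<phi> = \<zero>\<^bsub>HomD U\<^esub>}"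
      unfolding p(2) using lhom_compose[OF g p(1) M(1)] by (simp del: restr_simps)
  next
    fix \<phi> assume "\<phi> \<in> {\<phi> \<in> carrier (HomD M). ?j \<phi> = \<zero>\<^bsub>HomD U\<^esub>}"
    then have p: "\<phi> \<in> lhom B M Delta" and z: "?j \<phi> = \<zero>\<^bsub>HomD U\<^esub>" by simp_all
    have pz: "\<phi> y = \<zero>\<^bsub>Delta\<^esub>" if "y \<in> carrier M" "g y = \<zero>\<^bsub>W\<^esub>" for y
    proof -
      obtain x where x: "x \<in> carrier U" "y = f x" using exact(2) \<open>y \<in> carrier M\<close> \<open>g y = _\<close> by blast
      then show ?thesis using fun_cong[OF z, of x] unfolding hom_module_simps(3) by (simp add: compose_def del: restr_simps)
    qed
    have peq: "\<phi> y = \<phi> y'" if y: "y \<in> carrier M" "y' \<in> carrier M" "g y = g y'" for y y'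
    proof -
      have "g (y \<ominus>\<^bsub>M\<^esub> y') = \<zero>\<^bsub>W\<^esub>"
        using additive_map_diff[OF M.M_abelian W.M_abelian lhomD(6)[OF g] y(1,2)] y gD(1) by (simp add: a_minus_def W.M.r_neg)
      then have "\<phi> y \<ominus>\<^bsub>Delta\<^esub> \<phi> y' = \<zero>\<^bsub>Delta\<^esub>"
        using pz[of "y \<ominus>\<^bsub>M\<^esub> y'"] additive_map_diff[OF M.M_abelian D.M.abelian_group_axioms lhomD(6)[OF p] y(1,2)] y by simp
      then show ?thesis using D.M.eq_of_diff_zero[OF lhomD(1)[OF p y(1)] lhomD(1)[OF p y(2)]] by simp
    qed
    \<comment> \<open>An arbitrary set-theoretic section of g. By \<open>peq\<close> the map \<phi>
      is constant on the fibres of g, so its composite with s is linear even if s is not.\<close>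
    define s where "s w = (SOME y. y \<in> carrier M \<and> g y = w)" for w
    have s: "s w \<in> carrier M" "g (s w) = w" if "w \<in> carrier W" for w
    proof -
      have "w \<in> g ` carrier M" using that exact(3) by simp
      then have "\<exists>y. y \<in> carrier M \<and> g y = w" by (elim imageE) auto
      from someI_ex[OF this] show "s w \<in> carrier M" "g (s w) = w" by (simp_all add: s_def)
    qed
    let ?\<psi> = "\<lambda>w\<in>carrier W. \<phi> (s w)"
    have psi: "?\<psi> \<in> lhom B W Delta"
    proof (rule restrict_lhom[OF W(1)], unfold linear_map_def, intro conjI ballI)
      show "(\<lambda>w. \<phi> (s w)) \<in> carrier W \<rightarrow> carrier Delta" using s lhomD(1)[OF p] by blast
      show "\<phi> (s (x \<oplus>\<^bsub>W\<^esub> y)) = \<phi> (s x) \<oplus>\<^bsub>Delta\<^esub> \<phi> (s y)" if "x \<in> carrier W" "y \<in> carrier W" for x y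
        using peq[of "s (x \<oplus>\<^bsub>W\<^esub> y)" "s x \<oplus>\<^bsub>M\<^esub> s y"] s that gD lhomD(2)[OF p, of "s x" "s y"] by simp
      show "\<phi> (s (r \<odot>\<^bsub>W\<^esub> x)) = r \<odot>\<^bsub>Delta\<^esub> \<phi> (s x)" if "r \<in> carrier B" "x \<in> carrier W" for r x
        using peq[of "s (r \<odot>\<^bsub>W\<^esub> x)" "r \<odot>\<^bsub>M\<^esub> s x"] s that gD lhomD(3)[OF p, of r "s x"] by (simp add: M.smult_closed W.smult_closed)
    qed
    have "\<phi> = ?i ?\<psi>"
    proof (rule lhom_eqI[OF p lhom_compose[OF g psi M(1)]])
      show "\<phi> x = ?i ?\<psi> x" if "x \<in> carrier M" for x
        using peq[OF that s(1)] s(2) gD(1) that by (simp add: compose_def)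
    qed
    then show "\<phi> \<in> ?i ` carrier (HomD W)" using psi by (auto simp del: restr_simps)
  qed
  have "(?j ` carrier (HomD M) = carrier (HomD U)) \<longleftrightarrow>
      (\<forall>\<phi>\<in>lhom B U Delta. \<exists>\<psi>\<in>lhom B M Delta. \<forall>x\<in>carrier U. \<psi> (f x) = \<phi> x)" (is "?L \<longleftrightarrow> ?R")
  proof
    assume L: ?L
    show ?R
    proof
      fix \<phi> assume "\<phi> \<in> lhom B U Delta"
      then have "\<phi> \<in> ?j ` carrier (HomD M)" unfolding L by simp
      then obtain \<psi> where "\<psi> \<in> lhom B M Delta" "\<phi> = ?j \<psi>" by auto
      then show "\<exists>\<psi>\<in>lhom B M Delta. \<forall>x\<in>carrier U. \<psi> (f x) = \<phi> x" by (intro bexI[of _ \<psi>]) (simp_all add: compose_def)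
    qed
  next
    assume ?R
    show ?L
    proof (intro equalityI subsetI)
      show "\<phi> \<in> carrier (HomD U)" if "\<phi> \<in> ?j ` carrier (HomD M)" for \<phi>
        using that lhom_compose[OF f _ U(1)] by auto
      fix \<phi> assume "\<phi> \<in> carrier (HomD U)"
      then have p: "\<phi> \<in> lhom B U Delta" by simp
      then obtain \<psi> where psi: "\<psi> \<in> lhom B M Delta" "\<forall>x\<in>carrier U. \<psi> (f x) = \<phi> x" using \<open>?R\<close> by blast
      have "\<phi> = ?j \<psi>"
        by (rule lhom_eqI[OF p lhom_compose[OF f psi(1) U(1)]]) (use psi(2) in \<open>simp add: compose_def\<close>)
      then show "\<phi> \<in> ?j ` carrier (HomD M)" using psi(1) by (auto simp del: restr_simps)
    qed
  qed
  then show ?thesis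
    using length_additive_iff[OF HomD_finite[OF W] HomD_finite[OF M] HomD_finite[OF U]
        comp_lin[OF g M(1)] inj comp_lin[OF f U(1)] ex] by simp
qed

text \<open>Naturality of the adjunction: restriction along f on one side is restriction along f
  \<otimes> id on the other, so the two extension problems correspond.\<close>

lemma extension_iff:
  fixes U :: "('b, 'u) module" and M :: "('b, 'm) module"
  assumes U: "left_module B U" and M: "left_module B M" and f: "f \<in> lhom B U M"
  shows "(\<forall>\<phi>\<in>lhom B U Delta. \<exists>\<psi>\<in>lhom B M Delta. \<forall>x\<in>carrier U. \<psi> (f x) = \<phi> x) \<longleftrightarrow>
    (\<forall>l\<in>lhom R (RExt U) Ktriv. \<exists>m\<in>lhom R (RExt M) Ktriv. \<forall>u\<in>carrier (Ext U). m (extend_map U M f u) = l u)"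
    (is "?L \<longleftrightarrow> ?R")
proof -
  note f0 = linear_map_scalar[OF lhomD(5)[OF f]]
  note fe = extend_map_lhom[OF U M lhomD(5)[OF f]] and fp = extend_map_pure[OF U M f0]
  interpret XU: left_module KB "Ext U" by (rule Ext_left_module[OF U])
  show ?thesis
  proof
    assume L: ?L
    show ?R
    proof
      fix l assume l: "l \<in> lhom R (RExt U) Ktriv"
      obtain \<psi> where psi: "\<psi> \<in> lhom B M Delta" "\<forall>x\<in>carrier U. \<psi> (f x) = to_Delta U l x"
        using L to_Delta_lhom[OF U l] by blast
      obtain m where m: "m \<in> lhom R (RExt M) Ktriv" "to_Delta M m = \<psi>"
        "\<And>x c. x \<in> carrier M \<Longrightarrow> c \<in> carrier K \<Longrightarrow> m (tens M x c) = c \<otimes>\<^bsub>K\<^esub> \<psi> x \<one>\<^bsub>KB\<^esub>"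
        using from_Delta[OF M psi(1)] by metis
      have "m (extend_map U M f u) = l u" if "u \<in> carrier (Ext U)" for u
        using that
      proof (induction rule: Ext_induct[OF U, consumes 1, case_names pure add])
        case (pure x c)
        have "\<psi> (f x) \<one>\<^bsub>KB\<^esub> = l (tens U x \<one>\<^bsub>K\<^esub>)"
          using psi(2) pure one_KB_closed XU.smult_one tens_closed[OF U pure(1) K.one_closed]
          by (simp add: to_Delta_def[OF U])
        then show ?case
          using pure m(3)[OF lhomD(1)[OF f pure(1)] pure(2)] functionalD(4)[OF U l pure] by (simp add: fp)
      next
        case (add v w)
        then show ?case
          using lhomD(1,2)[OF fe] functionalD(2)[OF M m(1)] functionalD(2)[OF U l] by simp
      qed
      then show "\<exists>m\<in>lhom R (RExt M) Ktriv. \<forall>u\<in>carrier (Ext U). m (extend_map U M f u) = l u" using m(1) by blast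
    qed
  next
    assume R': ?R
    show ?L
    proof
      fix \<phi> assume phi: "\<phi> \<in> lhom B U Delta"
      obtain l where l: "l \<in> lhom R (RExt U) Ktriv" "to_Delta U l = \<phi>"
        using from_Delta[OF U phi] by metis
      obtain m where m: "m \<in> lhom R (RExt M) Ktriv" "\<forall>u\<in>carrier (Ext U). m (extend_map U M f u) = l u"
        using R' l(1) by blast
      have "to_Delta M m (f x) = \<phi> x" if x: "x \<in> carrier U" for x
      proof -
        have t: "tens U x \<one>\<^bsub>K\<^esub> \<in> carrier (Ext U)" by (rule tens_closed[OF U x K.one_closed])
        have "to_Delta M m (f x) = (\<lambda>y\<in>carrier KB. m (extend_map U M f (y \<odot>\<^bsub>Ext U\<^esub> tens U x \<one>\<^bsub>K\<^esub>)))"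
          unfolding to_Delta_def[OF M] using lhomD(1)[OF f x] lhomD(3)[OF fe _ t] fp[OF x K.one_closed]
          by (simp cong: restrict_cong)
        also have "\<dots> = to_Delta U l x"
          unfolding to_Delta_def[OF U] using x m(2) XU.smult_closed[OF _ t] by (simp cong: restrict_cong)
        finally show ?thesis using l(2) by simp
      qed
      then show "\<exists>\<psi>\<in>lhom B M Delta. \<forall>x\<in>carrier U. \<psi> (f x) = \<phi> x" using to_Delta_lhom[OF M m(1)] by blast
    qed
  qed
qed

end

section \<open>Projectivity and extension of homomorphisms\<close>

lemma (in abelian_group) add_diff_add:
  assumes "a \<in> carrier G" "b \<in> carrier G" "c \<in> carrier G" "d \<in> carrier G"
  shows "(a \<oplus> b) \<ominus> (c \<oplus> d) = (a \<ominus> c) \<oplus> (b \<ominus> d)"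
  using assms by (simp add: a_minus_def minus_add a_ac)

context pi_setting
begin

lemma RExt_lhom: "h \<in> lhom KB (Ext M) (Ext N) \<Longrightarrow> h \<in> lhom R (RExt M) (RExt N)"
  using alpha_closed by (auto simp: lhom_def linear_map_def)

text \<open>Over k the sequence splits, and splittings survive base change; this replaces exactness
  of the functor - \<otimes> K. The retraction \<rho> comes from a k-linear map that need not
  respect B, hence it is only claimed to be additive.\<close>

lemma Ext_split:
  fixes U :: "('b, 'u) module" and M :: "('b, 'm) module" and W :: "('b, 'w) module"
  assumes U: "left_module B U" and M: "left_module B M"
    and W: "left_module B W" "finitely_generated k (V W)"
    and f: "f \<in> lhom B U M" and g: "g \<in> lhom B M W"
    and exact: "inj_on f (carrier U)" "f ` carrier U = {y \<in> carrier M. g y = \<zero>\<^bsub>W\<^esub>}" "g ` carrier M = carrier W"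
  obtains \<rho> where "additive_map (Ext M) (Ext U) \<rho>"
    "\<forall>u\<in>carrier (Ext U). \<rho> (extend_map U M f u) = u"
    "\<forall>v\<in>carrier (Ext M). extend_map M W g v = \<zero>\<^bsub>Ext W\<^esub> \<longrightarrow> extend_map U M f (\<rho> v) = v"
    "\<forall>u\<in>carrier (Ext U). extend_map M W g (extend_map U M f u) = \<zero>\<^bsub>Ext W\<^esub>"
    "extend_map M W g ` carrier (Ext M) = carrier (Ext W)"
proof -
  interpret U: left_module B U by (rule U)
  interpret M: left_module B M by (rule M)
  interpret W: left_module B W by (rule W(1))
  interpret XU: left_module KB "Ext U" by (rule Ext_left_module[OF U])
  interpret XM: left_module KB "Ext M" by (rule Ext_left_module[OF M])
  interpret XW: left_module KB "Ext W" by (rule Ext_left_module[OF W(1)])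
  note fD = lhomD(1-3)[OF f] and gD = lhomD(1-3)[OF g]
  note fk = linear_map_scalar[OF lhomD(5)[OF f]] and gk = linear_map_scalar[OF lhomD(5)[OF g]]
  have id: "linear_map k (V W) (V W) (\<lambda>x. x)" by (simp add: linear_map_def)
  have gs: "g ` carrier (V M) = carrier (V W)" using exact(3) by simp
  obtain s where s: "s \<in> lhom k (V W) (V M)" "\<And>x. x \<in> carrier (V W) \<Longrightarrow> g (s x) = x"
    using k.lift_vector_space[OF V_left_module[OF W(1)] W(2) V_left_module[OF M] V_left_module[OF W(1)] gk gs id] by metis
  have sD: "x \<in> carrier W \<Longrightarrow> s x \<in> carrier M" "x \<in> carrier W \<Longrightarrow> g (s x) = x"
    "x \<in> carrier W \<Longrightarrow> y \<in> carrier W \<Longrightarrow> s (x \<oplus>\<^bsub>W\<^esub> y) = s x \<oplus>\<^bsub>M\<^esub> s y"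
    "c \<in> carrier k \<Longrightarrow> x \<in> carrier W \<Longrightarrow> s (scalar B c \<odot>\<^bsub>W\<^esub> x) = scalar B c \<odot>\<^bsub>M\<^esub> s x" for x y c
    using lhomD(1-3)[OF s(1)] s(2) by simp_all
  have sk: "linear_map k (V W) (V M) s" by (rule lhomD(5)[OF s(1)])
  \<comment> \<open>The projection of M onto the kernel of g along the section s; \<open>r\<close>
    below reads its values in U through f.\<close>
  define q where "q x = x \<oplus>\<^bsub>M\<^esub> \<ominus>\<^bsub>M\<^esub> s (g x)" for x
  have q: "q x \<in> carrier M" "g (q x) = \<zero>\<^bsub>W\<^esub>" if "x \<in> carrier M" for x
    using that gD sD additive_map_minus[OF M.M_abelian W.M_abelian lhomD(6)[OF g], of "s (g x)"]
    by (simp_all add: q_def W.M.r_neg)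
  define r where "r x = inv_into (carrier U) f (q x)" for x
  have r: "r x \<in> carrier U" "f (r x) = q x" if "x \<in> carrier M" for x
  proof -
    have "q x \<in> f ` carrier U" using q[OF that] exact(2) by simp
    then show "r x \<in> carrier U" "f (r x) = q x" unfolding r_def by (rule inv_into_into, rule f_inv_into_f)
  qed
  have finj: "x = y" if "f x = f y" "x \<in> carrier U" "y \<in> carrier U" for x y
    using exact(1) that by (simp add: inj_on_def)
  have rk: "linear_map k (V M) (V U) r"
    unfolding linear_map_def
  proof (intro conjI ballI)
    show "r \<in> carrier (V M) \<rightarrow> carrier (V U)" using r(1) by simp
    fix x assume x: "x \<in> carrier (V M)"
    show "r (x \<oplus>\<^bsub>V M\<^esub> y) = r x \<oplus>\<^bsub>V U\<^esub> r y" if y: "y \<in> carrier (V M)" for y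
    proof (rule finj)
      have "q (x \<oplus>\<^bsub>M\<^esub> y) = q x \<oplus>\<^bsub>M\<^esub> q y"
        using x y gD sD by (simp add: q_def M.M.minus_add M.M.a_ac)
      then show "f (r (x \<oplus>\<^bsub>V M\<^esub> y)) = f (r x \<oplus>\<^bsub>V U\<^esub> r y)" using x y r fD by simp
    qed (use x y r in simp_all)
    show "r (c \<odot>\<^bsub>V M\<^esub> x) = c \<odot>\<^bsub>V U\<^esub> r x" if c: "c \<in> carrier k" for c
    proof (rule finj)
      have "q (scalar B c \<odot>\<^bsub>M\<^esub> x) = scalar B c \<odot>\<^bsub>M\<^esub> q x"
        using x c gD sD scalar_closed by (simp add: q_def M.smult_r_distr M.smult_minus_right)
      then show "f (r (c \<odot>\<^bsub>V M\<^esub> x)) = f (c \<odot>\<^bsub>V U\<^esub> r x)"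
        using x c r fD scalar_closed by (simp add: M.smult_closed)
    qed (use x c r scalar_closed in \<open>simp_all add: M.smult_closed U.smult_closed\<close>)
  qed
  let ?f = "extend_map U M f" and ?g = "extend_map M W g" and ?s = "extend_map W M s" and ?r = "extend_map M U r"
  note fp = extend_map_pure[OF U M fk] and gp = extend_map_pure[OF M W(1) gk]
    and sp = extend_map_pure[OF W(1) M sk] and rp = extend_map_pure[OF M U rk]
  note fa = additive_mapD[OF extend_map_additive[OF U M fk]] and ga = additive_mapD[OF extend_map_additive[OF M W(1) gk]]
    and sa = additive_mapD[OF extend_map_additive[OF W(1) M sk]] and ra = additive_mapD[OF extend_map_additive[OF M U rk]]
  have gf0: "g (f x) = \<zero>\<^bsub>W\<^esub>" if "x \<in> carrier U" for x using exact(2) that by auto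
  have s0: "s \<zero>\<^bsub>W\<^esub> = \<zero>\<^bsub>M\<^esub>"
    using additive_map_zero[OF left_module_ab[OF V_left_module[OF W(1)]] left_module_ab[OF V_left_module[OF M]] lhomD(6)[OF s(1)]] by simp
  have rf: "r (f x) = x" if "x \<in> carrier U" for x
  proof (rule finj)
    have "\<ominus>\<^bsub>M\<^esub> \<zero>\<^bsub>M\<^esub> = \<zero>\<^bsub>M\<^esub>" by (rule M.M.minus_equality) auto
    then show "f (r (f x)) = f x" using r(2)[OF fD(1)[OF that]] gf0[OF that] fD(1)[OF that] by (simp add: q_def s0)
  qed (use that r fD in simp_all)
  have frsg: "f (r x) \<oplus>\<^bsub>M\<^esub> s (g x) = x" if "x \<in> carrier M" for x
    using that r gD sD by (simp add: q_def M.M.a_assoc M.M.l_neg)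
  have 1: "?r (?f u) = u" if "u \<in> carrier (Ext U)" for u
    using that
  proof (induction rule: Ext_induct[OF U, consumes 1, case_names pure add])
    case (pure m c)
    then show ?case using fD by (simp add: fp rp rf)
  next
    case (add v w)
    then show ?case by (simp add: fa ra)
  qed
  \<comment> \<open>The identity f r + s g = id holds on M and passes to M \<otimes> K by
    additivity; on the kernel of the extended g only f r remains.\<close>
  have 2: "?f (?r v) \<oplus>\<^bsub>Ext M\<^esub> ?s (?g v) = v" if "v \<in> carrier (Ext M)" for v
    using that
  proof (induction rule: Ext_induct[OF M, consumes 1, case_names pure add])
    case (pure m c)
    then show ?case using r(1) fD(1) gD(1) sD(1) frsg[OF pure(1)]
      by (simp add: fp rp sp gp tens_add_left[OF M, symmetric])
  next
    case (add v w)
    have "?f (?r (v \<oplus>\<^bsub>Ext M\<^esub> w)) \<oplus>\<^bsub>Ext M\<^esub> ?s (?g (v \<oplus>\<^bsub>Ext M\<^esub> w)) =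
      (?f (?r v) \<oplus>\<^bsub>Ext M\<^esub> ?s (?g v)) \<oplus>\<^bsub>Ext M\<^esub> (?f (?r w) \<oplus>\<^bsub>Ext M\<^esub> ?s (?g w))"
      using add(1,2) by (simp add: fa ra ga sa XM.M.a_ac)
    then show ?case by (simp only: add.IH)
  qed
  have 3: "?g (?f u) = \<zero>\<^bsub>Ext W\<^esub>" if "u \<in> carrier (Ext U)" for u
    using that
  proof (induction rule: Ext_induct[OF U, consumes 1, case_names pure add])
    case (pure m c)
    have "tens W \<zero>\<^bsub>W\<^esub> c = \<zero>\<^bsub>Ext W\<^esub>"
      using tensor_product.pure_tensor_zero_left[OF tensor_V[OF W(1)], of c] pure by (simp add: Ext_simps)
    then show ?case using pure fD by (simp add: fp gp gf0)
  next
    case (add v w)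
    then show ?case by (simp add: fa ga)
  qed
  have 4: "w \<in> ?g ` carrier (Ext M)" if "w \<in> carrier (Ext W)" for w
    using that
  proof (induction rule: Ext_induct[OF W(1), consumes 1, case_names pure add])
    case (pure m c)
    have "tens W m c = ?g (tens M (s m) c)" using pure sD by (simp add: gp)
    then show ?case using tens_closed[OF M sD(1)[OF pure(1)] pure(2)] by (rule image_eqI)
  next
    case (add v w)
    then obtain a b where ab: "a \<in> carrier (Ext M)" "b \<in> carrier (Ext M)" "v = ?g a" "w = ?g b" by (elim imageE)
    have "v \<oplus>\<^bsub>Ext W\<^esub> w = ?g (a \<oplus>\<^bsub>Ext M\<^esub> b)" using ab by (simp add: ga)
    then show ?case using XM.M.a_closed[OF ab(1,2)] by (rule image_eqI)
  qed
  have sz: "?s \<zero>\<^bsub>Ext W\<^esub> = \<zero>\<^bsub>Ext M\<^esub>"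
    by (rule additive_map_zero[OF XW.M_abelian XM.M_abelian extend_map_additive[OF W(1) M sk]])
  have 5: "?f (?r v) = v" if "v \<in> carrier (Ext M)" "?g v = \<zero>\<^bsub>Ext W\<^esub>" for v
    using 2[OF that(1)] that sz fa(1) ra(1) by simp
  have 6: "?g ` carrier (Ext M) = carrier (Ext W)"
    using 4 ga(1) by (intro equalityI subsetI) (elim imageE, simp)
  have "\<forall>u\<in>carrier (Ext U). ?r (?f u) = u"
    "\<forall>v\<in>carrier (Ext M). ?g v = \<zero>\<^bsub>Ext W\<^esub> \<longrightarrow> ?f (?r v) = v"
    "\<forall>u\<in>carrier (Ext U). ?g (?f u) = \<zero>\<^bsub>Ext W\<^esub>"
    by (intro ballI impI, (rule 1 5 3; assumption))+
  from that[OF extend_map_additive[OF M U rk] this 6] show ?thesis .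
qed

text \<open>Projectivity yields an R-linear section h of the extended g. Then v - h (g v) projects
  onto the image of U \<otimes> K, and l composed with this projection is the extension
  sought.\<close>

lemma extend_of_projective:
  fixes U :: "('b, 'u) module" and M :: "('b, 'm) module" and W :: "('b, 'w) module"
  assumes U: "left_module B U" and M: "left_module B M" "finitely_generated k (V M)"
    and W: "left_module B W" "finitely_generated k (V W)"
    and f: "f \<in> lhom B U M" and g: "g \<in> lhom B M W"
    and exact: "inj_on f (carrier U)" "f ` carrier U = {y \<in> carrier M. g y = \<zero>\<^bsub>W\<^esub>}" "g ` carrier M = carrier W"
    and proj: "projective_module R (RExt W)" and l: "l \<in> lhom R (RExt U) Ktriv"
  shows "\<exists>m\<in>lhom R (RExt M) Ktriv. \<forall>u\<in>carrier (Ext U). m (extend_map U M f u) = l u"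
proof -
  let ?f = "extend_map U M f" and ?g = "extend_map M W g"
  have fh: "?f \<in> lhom R (RExt U) (RExt M)" and gh: "?g \<in> lhom R (RExt M) (RExt W)"
    using RExt_lhom extend_map_lhom[OF U M(1) lhomD(5)[OF f]] extend_map_lhom[OF M(1) W(1) lhomD(5)[OF g]] by blast+
  interpret RU: left_module R "RExt U" by (rule RExt_left_module[OF U])
  interpret RM: left_module R "RExt M" by (rule RExt_left_module[OF M(1)])
  interpret RW: left_module R "RExt W" by (rule RExt_left_module[OF W(1)])
  obtain \<rho> where \<rho>: "additive_map (Ext M) (Ext U) \<rho>"
    "\<forall>u\<in>carrier (Ext U). \<rho> (?f u) = u"
    "\<forall>v\<in>carrier (Ext M). ?g v = \<zero>\<^bsub>Ext W\<^esub> \<longrightarrow> ?f (\<rho> v) = v"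
    "\<forall>u\<in>carrier (Ext U). ?g (?f u) = \<zero>\<^bsub>Ext W\<^esub>"
    "?g ` carrier (Ext M) = carrier (Ext W)"
    using Ext_split[OF U M(1) W f g exact] .
  have id: "(\<lambda>x\<in>carrier (RExt W). x) \<in> lhom R (RExt W) (RExt W)"
    by (rule restrict_lhom[OF RW.left_module_axioms]) (simp add: linear_map_def)
  have gsurj: "?g ` carrier (RExt M) = carrier (RExt W)" using \<rho>(5) by simp
  obtain h where h: "h \<in> lhom R (RExt W) (RExt M)" "\<And>x. x \<in> carrier (RExt W) \<Longrightarrow> ?g (h x) = (\<lambda>x\<in>carrier (RExt W). x) x"
    using projective_lift[OF proj RM.left_module_axioms RW.left_module_axioms RExt_fg[OF M] RExt_fg[OF W] gh gsurj id] by metis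
  have gD: "v \<in> carrier (Ext M) \<Longrightarrow> ?g v \<in> carrier (Ext W)" for v using lhomD(1)[OF gh] by simp
  have hD: "w \<in> carrier (Ext W) \<Longrightarrow> h w \<in> carrier (Ext M)" "w \<in> carrier (Ext W) \<Longrightarrow> ?g (h w) = w" for w
    using lhomD(1)[OF h(1)] h(2) by simp_all
  define q where "q v = v \<ominus>\<^bsub>RExt M\<^esub> h (?g v)" for v
  have qc: "q v \<in> carrier (RExt M)" if "v \<in> carrier (Ext M)" for v unfolding q_def using that gD hD by (intro RM.M.minus_closed) simp_all
  have q0: "?g (q v) = \<zero>\<^bsub>RExt W\<^esub>" if "v \<in> carrier (Ext M)" for v
    unfolding q_def using additive_map_diff[OF RM.M_abelian RW.M_abelian lhomD(6)[OF gh], of v "h (?g v)"] that gD hD RW.M.r_neg[of "?g v"]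
    by (simp add: a_minus_def)
  have qadd: "q (v \<oplus>\<^bsub>RExt M\<^esub> w) = q v \<oplus>\<^bsub>RExt M\<^esub> q w" if "v \<in> carrier (RExt M)" "w \<in> carrier (RExt M)" for v w
  proof -
    note gv = lhomD(1)[OF gh that(1)] lhomD(1)[OF gh that(2)]
    have "h (?g (v \<oplus>\<^bsub>RExt M\<^esub> w)) = h (?g v) \<oplus>\<^bsub>RExt M\<^esub> h (?g w)"
      using lhomD(2)[OF gh that] lhomD(2)[OF h(1) gv] by (simp only:)
    then show ?thesis
      unfolding q_def using RM.M.add_diff_add[OF that lhomD(1)[OF h(1) gv(1)] lhomD(1)[OF h(1) gv(2)]] by (simp only:)
  qed
  have qsm: "q (a \<odot>\<^bsub>RExt M\<^esub> v) = a \<odot>\<^bsub>RExt M\<^esub> q v" if "a \<in> carrier R" "v \<in> carrier (RExt M)" for a v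
    unfolding q_def using that lhomD(1,3)[OF gh] lhomD(1,3)[OF h(1)] by (simp only: RM.smult_diff_right)
  have rc: "\<rho> v \<in> carrier (RExt U)" if "v \<in> carrier (RExt M)" for v
    using additive_mapD(1)[OF \<rho>(1)] that by simp
  have fr: "?f (\<rho> (q v)) = q v" if "v \<in> carrier (RExt M)" for v
    using \<rho>(3) qc q0 that by simp
  \<comment> \<open>R-linearity is not known for \<rho>, but it holds for \<rho> after q: the
    extended f is R-linear and injective, and it takes \<rho> (q v) to q v.\<close>
  have rsm: "\<rho> (q (a \<odot>\<^bsub>RExt M\<^esub> v)) = a \<odot>\<^bsub>RExt U\<^esub> \<rho> (q v)" if a: "a \<in> carrier R" and v: "v \<in> carrier (RExt M)" for a v
  proof -
    have v': "v \<in> carrier (Ext M)" using v by simp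
    have "q (a \<odot>\<^bsub>RExt M\<^esub> v) = a \<odot>\<^bsub>RExt M\<^esub> ?f (\<rho> (q v))" by (simp only: qsm[OF a v] fr[OF v])
    also have "\<dots> = ?f (a \<odot>\<^bsub>RExt U\<^esub> \<rho> (q v))"
      using lhomD(3)[OF fh a rc[OF qc[OF v']]] by simp
    finally show ?thesis using \<rho>(2) RU.smult_closed[OF a rc[OF qc[OF v']]] by simp
  qed
  have lin: "linear_map R (RExt M) Ktriv (\<lambda>v. l (\<rho> (q v)))"
    unfolding linear_map_def
  proof (intro conjI ballI)
    show "(\<lambda>v. l (\<rho> (q v))) \<in> carrier (RExt M) \<rightarrow> carrier Ktriv"
      using lhomD(1)[OF l] rc qc by simp
    show "l (\<rho> (q (v \<oplus>\<^bsub>RExt M\<^esub> w))) = l (\<rho> (q v)) \<oplus>\<^bsub>Ktriv\<^esub> l (\<rho> (q w))" if "v \<in> carrier (RExt M)" "w \<in> carrier (RExt M)" for v w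
      using that additive_mapD(2)[OF \<rho>(1)] lhomD(2)[OF l] rc qc qadd[OF that] by simp
    show "l (\<rho> (q (a \<odot>\<^bsub>RExt M\<^esub> v))) = a \<odot>\<^bsub>Ktriv\<^esub> l (\<rho> (q v))" if "a \<in> carrier R" "v \<in> carrier (RExt M)" for a v
      unfolding rsm[OF that] using that lhomD(3)[OF l that(1)] rc qc by simp
  qed
  have "restrict (\<lambda>v. l (\<rho> (q v))) (carrier (RExt M)) \<in> lhom R (RExt M) Ktriv"
    by (rule restrict_lhom[OF RM.left_module_axioms lin])
  moreover have "restrict (\<lambda>v. l (\<rho> (q v))) (carrier (RExt M)) (?f u) = l u" if u: "u \<in> carrier (Ext U)" for u
  proof -
    have fu: "?f u \<in> carrier (RExt M)" using lhomD(1)[OF fh] u by simp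
    have "h \<zero>\<^bsub>RExt W\<^esub> = \<zero>\<^bsub>RExt M\<^esub>" by (rule additive_map_zero[OF RW.M_abelian RM.M_abelian lhomD(6)[OF h(1)]])
    moreover have "\<ominus>\<^bsub>RExt M\<^esub> \<zero>\<^bsub>RExt M\<^esub> = \<zero>\<^bsub>RExt M\<^esub>" by (rule RM.M.minus_equality[OF RM.M.l_zero]) (rule RM.M.zero_closed)+
    moreover have "?g (?f u) = \<zero>\<^bsub>RExt W\<^esub>" using \<rho>(4) u by simp
    ultimately have "q (?f u) = ?f u" using fu RM.M.r_zero[OF fu] unfolding q_def a_minus_def by metis
    then show ?thesis using fu \<rho>(2) u by simp
  qed
  ultimately show ?thesis by blast
qed

text \<open>Passes from B \<otimes> K to a free module: the extended coordinates are linear over B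
  \<otimes> K, so a vector killed by t has coordinates killed by t. Each of them is a multiple of
  t^(p-1), and the dual basis reassembles the quotients.\<close>

lemma free_kernel:
  fixes F :: "('b, 'f) module"
  assumes ker: "\<And>u. u \<in> carrier KB \<Longrightarrow> \<alpha> t \<otimes>\<^bsub>KB\<^esub> u = \<zero>\<^bsub>KB\<^esub> \<Longrightarrow> \<exists>y\<in>carrier KB. u = \<alpha> (t [^]\<^bsub>R\<^esub> (p - 1)) \<otimes>\<^bsub>KB\<^esub> y"
    and F: "left_module B F"
    and v: "\<forall>i<n::nat. v i \<in> carrier F" and \<pi>: "\<forall>i<n. \<pi> i \<in> lhom B F (regular B)"
    and expand: "\<forall>x\<in>carrier F. x = (\<Oplus>\<^bsub>F\<^esub>i\<in>{..<n}. \<pi> i x \<odot>\<^bsub>F\<^esub> v i)"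
    and w: "w \<in> carrier (Ext F)" "\<alpha> t \<odot>\<^bsub>Ext F\<^esub> w = \<zero>\<^bsub>Ext F\<^esub>"
  shows "\<exists>w'\<in>carrier (Ext F). w = \<alpha> (t [^]\<^bsub>R\<^esub> (p - 1)) \<odot>\<^bsub>Ext F\<^esub> w'"
proof -
  interpret F: left_module B F by (rule F)
  interpret XF: left_module KB "Ext F" by (rule Ext_left_module[OF F])
  interpret KB: ring KB by (rule KB_ring)
  note RL = left_module_regular[OF B.ring_axioms]
  let ?p = "\<lambda>i. extend_map F (regular B) (\<pi> i)" and ?e = "\<lambda>i. tens F (v i) \<one>\<^bsub>K\<^esub>"
  have ph: "?p i \<in> lhom KB (Ext F) (Ext (regular B))" if "i < n" for i
    using extend_map_lhom[OF F RL lhomD(5)] \<pi> that by blast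
  have pp: "?p i (tens F m c) = ptB (\<pi> i m) c" if "i < n" "m \<in> carrier F" "c \<in> carrier K" for i m c
    using extend_map_pure[OF F RL linear_map_scalar[OF lhomD(5)]] \<pi> that by (simp add: tens_regular)
  have pc: "?p i u \<in> carrier KB" if "i < n" "u \<in> carrier (Ext F)" for i u
    using lhomD(1)[OF ph[OF that(1)] that(2)] by (simp add: Ext_regular_simps)
  have padd: "?p i (u \<oplus>\<^bsub>Ext F\<^esub> u') = ?p i u \<oplus>\<^bsub>KB\<^esub> ?p i u'" if "i < n" "u \<in> carrier (Ext F)" "u' \<in> carrier (Ext F)" for i u u'
    using lhomD(2)[OF ph[OF that(1)] that(2,3)] by (simp add: Ext_regular_simps)
  have ec: "?e i \<in> carrier (Ext F)" if "i < n" for i using tens_closed[OF F _ K.one_closed] v that by blast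
  have tc: "(\<lambda>i. ?p i u \<odot>\<^bsub>Ext F\<^esub> ?e i) \<in> {..<n} \<rightarrow> carrier (Ext F)" if "u \<in> carrier (Ext F)" for u
    using pc ec XF.smult_closed that by simp
  have ex: "u = (\<Oplus>\<^bsub>Ext F\<^esub>i\<in>{..<n}. ?p i u \<odot>\<^bsub>Ext F\<^esub> ?e i)" if "u \<in> carrier (Ext F)" for u
    using that
  proof (induction rule: Ext_induct[OF F, consumes 1, case_names pure add])
    case (pure m c)
    have pm: "\<pi> i m \<in> carrier B" if "i < n" for i using lhomD(1)[of "\<pi> i" B F "regular B"] \<pi> that pure(1) by simp
    have ad: "additive_map F (Ext F) (\<lambda>m. tens F m c)"
      using pure by (simp add: additive_map_def tens_closed[OF F] tens_add_left[OF F])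
    have h: "(\<lambda>i. \<pi> i m \<odot>\<^bsub>F\<^esub> v i) \<in> {..<n} \<rightarrow> carrier F" using pm v F.smult_closed by auto
    have "tens F m c = tens F (\<Oplus>\<^bsub>F\<^esub>i\<in>{..<n}. \<pi> i m \<odot>\<^bsub>F\<^esub> v i) c" using bspec[OF expand pure(1)] by simp
    also have "\<dots> = (\<Oplus>\<^bsub>Ext F\<^esub>i\<in>{..<n}. tens F (\<pi> i m \<odot>\<^bsub>F\<^esub> v i) c)"
      by (rule additive_map_finsum[OF F.M_abelian XF.M_abelian ad _ h]) simp
    also have "\<dots> = (\<Oplus>\<^bsub>Ext F\<^esub>i\<in>{..<n}. ?p i (tens F m c) \<odot>\<^bsub>Ext F\<^esub> ?e i)"
    proof (rule XF.M.finsum_cong'[OF refl tc[OF tens_closed[OF F pure]]])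
      show "tens F (\<pi> i m \<odot>\<^bsub>F\<^esub> v i) c = ?p i (tens F m c) \<odot>\<^bsub>Ext F\<^esub> ?e i" if "i \<in> {..<n}" for i
        using pm that v pure by (simp add: pp smult_Ext_pure[OF F])
    qed
    finally show ?case .
  next
    case (add u u')
    have "(\<Oplus>\<^bsub>Ext F\<^esub>i\<in>{..<n}. ?p i (u \<oplus>\<^bsub>Ext F\<^esub> u') \<odot>\<^bsub>Ext F\<^esub> ?e i) =
      (\<Oplus>\<^bsub>Ext F\<^esub>i\<in>{..<n}. ?p i u \<odot>\<^bsub>Ext F\<^esub> ?e i \<oplus>\<^bsub>Ext F\<^esub> ?p i u' \<odot>\<^bsub>Ext F\<^esub> ?e i)"
      using add(1,2) pc ec XF.smult_closed
      by (intro XF.M.finsum_cong'[OF refl]) (simp_all add: padd XF.smult_l_distr)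
    also have "\<dots> = u \<oplus>\<^bsub>Ext F\<^esub> u'"
      using XF.M.finsum_addf[OF tc[OF add(1)] tc[OF add(2)]] add.IH by simp
    finally show ?case by simp
  qed
  have "\<exists>y\<in>carrier KB. ?p i w = \<alpha> (t [^]\<^bsub>R\<^esub> (p - 1)) \<otimes>\<^bsub>KB\<^esub> y" if i: "i < n" for i
  proof (rule ker[OF pc[OF i w(1)]])
    have "\<alpha> t \<otimes>\<^bsub>KB\<^esub> ?p i w = ?p i (\<alpha> t \<odot>\<^bsub>Ext F\<^esub> w)"
      using lhomD(3)[OF ph[OF i] alpha_closed[OF t_closed] w(1)] by (simp add: KB_mult)
    also have "\<dots> = \<zero>\<^bsub>KB\<^esub>"
      unfolding w(2) using additive_map_zero[OF XF.M_abelian Ext_abelian[OF RL] lhomD(6)[OF ph[OF i]]] by (simp add: Ext_regular_simps)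
    finally show "\<alpha> t \<otimes>\<^bsub>KB\<^esub> ?p i w = \<zero>\<^bsub>KB\<^esub>" .
  qed
  then have "\<forall>i. \<exists>y. i < n \<longrightarrow> y \<in> carrier KB \<and> ?p i w = \<alpha> (t [^]\<^bsub>R\<^esub> (p - 1)) \<otimes>\<^bsub>KB\<^esub> y" by blast
  then obtain y where y: "\<forall>i. i < n \<longrightarrow> y i \<in> carrier KB \<and> ?p i w = \<alpha> (t [^]\<^bsub>R\<^esub> (p - 1)) \<otimes>\<^bsub>KB\<^esub> y i"
    by (elim choice[THEN exE])
  have tp: "\<alpha> (t [^]\<^bsub>R\<^esub> (p - 1)) \<in> carrier KB" by (rule alpha_closed[OF pow_t_closed])
  have yc: "(\<lambda>i. y i \<odot>\<^bsub>Ext F\<^esub> ?e i) \<in> {..<n} \<rightarrow> carrier (Ext F)" using y ec XF.smult_closed by simp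
  have "w = (\<Oplus>\<^bsub>Ext F\<^esub>i\<in>{..<n}. ?p i w \<odot>\<^bsub>Ext F\<^esub> ?e i)" by (rule ex[OF w(1)])
  also have "\<dots> = (\<Oplus>\<^bsub>Ext F\<^esub>i\<in>{..<n}. \<alpha> (t [^]\<^bsub>R\<^esub> (p - 1)) \<odot>\<^bsub>Ext F\<^esub> (y i \<odot>\<^bsub>Ext F\<^esub> ?e i))"
    using y ec tp XF.smult_closed by (intro XF.M.finsum_cong'[OF refl]) (simp_all add: XF.smult_assoc)
  also have "\<dots> = \<alpha> (t [^]\<^bsub>R\<^esub> (p - 1)) \<odot>\<^bsub>Ext F\<^esub> (\<Oplus>\<^bsub>Ext F\<^esub>i\<in>{..<n}. y i \<odot>\<^bsub>Ext F\<^esub> ?e i)"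
    by (rule XF.smult_finsum_right[OF tp _ yc, symmetric]) simp
  finally show ?thesis using XF.M.finsum_closed[OF yc] by blast
qed

text \<open>Let \<open>N\<close> be the image of \<open>U\<close> in \<open>F\<close>.  The extension property says that \<open>N \<inter> t F = t N\<close>.  As the
  kernel of \<open>t\<close> on \<open>F\<close> is \<open>t^(p-1) F\<close>, one descends from \<open>t^j v \<in> N\<close> with \<open>j < p\<close> to \<open>v \<in> t F + N\<close>,
  which for \<open>j = p - 1\<close> is the projectivity criterion for \<open>F / N\<close>.\<close>

lemma projective_of_extension:
  fixes U :: "('b, 'u) module" and F :: "('b, 'f) module" and W :: "('b, 'w) module"
  assumes U: "left_module B U" "finitely_generated k (V U)" and F: "left_module B F"
    and W: "left_module B W" "finitely_generated k (V W)"
    and f: "f \<in> lhom B U F" and g: "g \<in> lhom B F W"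
    and exact: "inj_on f (carrier U)" "f ` carrier U = {y \<in> carrier F. g y = \<zero>\<^bsub>W\<^esub>}" "g ` carrier F = carrier W"
    and ker: "\<And>w. w \<in> carrier (Ext F) \<Longrightarrow> \<alpha> t \<odot>\<^bsub>Ext F\<^esub> w = \<zero>\<^bsub>Ext F\<^esub> \<Longrightarrow>
        \<exists>w'\<in>carrier (Ext F). w = \<alpha> (t [^]\<^bsub>R\<^esub> (p - 1)) \<odot>\<^bsub>Ext F\<^esub> w'"
    and extension: "\<forall>l\<in>lhom R (RExt U) Ktriv. \<exists>m\<in>lhom R (RExt F) Ktriv. \<forall>u\<in>carrier (Ext U). m (extend_map U F f u) = l u"
  shows "projective_module R (RExt W)"
proof -
  let ?f = "extend_map U F f" and ?g = "extend_map F W g"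
  have fh: "?f \<in> lhom R (RExt U) (RExt F)" and gh: "?g \<in> lhom R (RExt F) (RExt W)"
    using RExt_lhom extend_map_lhom[OF U(1) F lhomD(5)[OF f]] extend_map_lhom[OF F W(1) lhomD(5)[OF g]] by blast+
  let ?U = "RExt U" and ?F = "RExt F" and ?W = "RExt W"
  have LU: "left_module R ?U" and LF: "left_module R ?F" and LW: "left_module R ?W"
    using RExt_left_module U(1) F W(1) by blast+
  interpret RU: left_module R ?U by (rule LU)
  interpret RF: left_module R ?F by (rule LF)
  interpret RW: left_module R ?W by (rule LW)
  obtain \<rho> where \<rho>: "additive_map (Ext F) (Ext U) \<rho>"
    "\<forall>u\<in>carrier (Ext U). \<rho> (?f u) = u"
    "\<forall>v\<in>carrier (Ext F). ?g v = \<zero>\<^bsub>Ext W\<^esub> \<longrightarrow> ?f (\<rho> v) = v"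
    "\<forall>u\<in>carrier (Ext U). ?g (?f u) = \<zero>\<^bsub>Ext W\<^esub>"
    "?g ` carrier (Ext F) = carrier (Ext W)"
    using Ext_split[OF U(1) F W f g exact] .
  have gf: "?g (?f u) = \<zero>\<^bsub>?W\<^esub>" if "u \<in> carrier ?U" for u using \<rho>(4) that by simp
  have gker: "\<exists>u\<in>carrier ?U. v = ?f u" if "v \<in> carrier ?F" "?g v = \<zero>\<^bsub>?W\<^esub>" for v
    using \<rho>(3) that additive_mapD(1)[OF \<rho>(1), of v] by (intro bexI[of _ "\<rho> v"]) simp_all
  have ker': "\<exists>w'\<in>carrier ?F. w = t [^]\<^bsub>R\<^esub> (p - 1) \<odot>\<^bsub>?F\<^esub> w'" if "w \<in> carrier ?F" "t \<odot>\<^bsub>?F\<^esub> w = \<zero>\<^bsub>?F\<^esub>" for w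
    using ker[of w] that by simp
  have fD: "u \<in> carrier ?U \<Longrightarrow> ?f u \<in> carrier ?F" "a \<in> carrier R \<Longrightarrow> u \<in> carrier ?U \<Longrightarrow> ?f (a \<odot>\<^bsub>?U\<^esub> u) = a \<odot>\<^bsub>?F\<^esub> ?f u"
    "u \<in> carrier ?U \<Longrightarrow> u' \<in> carrier ?U \<Longrightarrow> ?f (u \<oplus>\<^bsub>?U\<^esub> u') = ?f u \<oplus>\<^bsub>?F\<^esub> ?f u'" for u u' a
    using lhomD(1)[OF fh] lhomD(3)[OF fh] lhomD(2)[OF fh] by blast+
  \<comment> \<open>Otherwise a K-linear l vanishes on t U but not at u. It extends to a functional
    m on F, and m sends f u = t v to zero because t acts trivially on K.\<close>
  have divide: "\<exists>u'\<in>carrier ?U. u = t \<odot>\<^bsub>?U\<^esub> u'" if u: "u \<in> carrier ?U" and v: "v \<in> carrier ?F" "?f u = t \<odot>\<^bsub>?F\<^esub> v" for u v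
  proof (rule ccontr)
    assume contra: "\<not> ?thesis"
    let ?S = "(\<lambda>x. t \<odot>\<^bsub>?U\<^esub> x) ` carrier ?U"
    have S: "submodule ?S K (restr \<epsilon> ?U)" by (rule submodule_eps[OF LU image_submodule[OF LU t_closed]])
    have KU: "left_module K (restr \<epsilon> ?U)" by (rule left_module_restr[OF K.ring_axioms R.ring_axioms eps_hom LU])
    have uS: "u \<notin> ?S" "u \<in> carrier (restr \<epsilon> ?U)" using contra u by auto
    obtain l where l: "linear_map K (restr \<epsilon> ?U) (regular K) l" "\<And>y. y \<in> ?S \<Longrightarrow> l y = \<zero>\<^bsub>K\<^esub>" "l u \<noteq> \<zero>\<^bsub>K\<^esub>"
      using K.separate[OF KU KExt_fg[OF U] S uS(2,1)] by metis
    have lD: "x \<in> carrier ?U \<Longrightarrow> l x \<in> carrier K" "x \<in> carrier ?U \<Longrightarrow> y \<in> carrier ?U \<Longrightarrow> l (x \<oplus>\<^bsub>?U\<^esub> y) = l x \<oplus>\<^bsub>K\<^esub> l y"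
      "c \<in> carrier K \<Longrightarrow> x \<in> carrier ?U \<Longrightarrow> l (\<epsilon> c \<odot>\<^bsub>?U\<^esub> x) = c \<otimes>\<^bsub>K\<^esub> l x" for x y c
      using linear_mapD[OF l(1)] by simp_all
    \<comment> \<open>Since r = \<epsilon> (aug r) + t s and l vanishes on t U, K-linearity of l
      already gives R-linearity into the trivial module.\<close>
    have lsm: "l (r \<odot>\<^bsub>?U\<^esub> x) = aug r \<otimes>\<^bsub>K\<^esub> l x" if r: "r \<in> carrier R" and x: "x \<in> carrier ?U" for r x
    proof -
      obtain s where s: "s \<in> carrier R" "r = \<epsilon> (aug r) \<oplus>\<^bsub>R\<^esub> t \<otimes>\<^bsub>R\<^esub> s" using decompose[OF r] .
      have sx: "s \<odot>\<^bsub>?U\<^esub> x \<in> carrier ?U" by (rule RU.smult_closed[OF s(1) x])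
      have e: "\<epsilon> (aug r) \<in> carrier R" using eps_closed aug_closed r by blast
      have "r \<odot>\<^bsub>?U\<^esub> x = \<epsilon> (aug r) \<odot>\<^bsub>?U\<^esub> x \<oplus>\<^bsub>?U\<^esub> (t \<otimes>\<^bsub>R\<^esub> s) \<odot>\<^bsub>?U\<^esub> x"
        using RU.smult_l_distr[OF e R.m_closed[OF t_closed s(1)] x] s(2) by metis
      also have "(t \<otimes>\<^bsub>R\<^esub> s) \<odot>\<^bsub>?U\<^esub> x = t \<odot>\<^bsub>?U\<^esub> (s \<odot>\<^bsub>?U\<^esub> x)" by (rule RU.smult_assoc[OF t_closed s(1) x])
      finally have "l (r \<odot>\<^bsub>?U\<^esub> x) = l (\<epsilon> (aug r) \<odot>\<^bsub>?U\<^esub> x) \<oplus>\<^bsub>K\<^esub> l (t \<odot>\<^bsub>?U\<^esub> (s \<odot>\<^bsub>?U\<^esub> x))"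
        using lD(2)[OF RU.smult_closed[OF e x] RU.smult_closed[OF t_closed sx]] by metis
      moreover have "l (t \<odot>\<^bsub>?U\<^esub> (s \<odot>\<^bsub>?U\<^esub> x)) = \<zero>\<^bsub>K\<^esub>" using l(2) sx by blast
      ultimately show ?thesis using lD(3)[OF aug_closed[OF r] x] lD(1)[OF x] aug_closed[OF r] by simp
    qed
    have lin: "linear_map R ?U Ktriv l" unfolding linear_map_def
    proof (intro conjI ballI)
      show "l \<in> carrier ?U \<rightarrow> carrier Ktriv" using lD(1) by simp
      show "l (x \<oplus>\<^bsub>?U\<^esub> y) = l x \<oplus>\<^bsub>Ktriv\<^esub> l y" if "x \<in> carrier ?U" "y \<in> carrier ?U" for x y using lD(2)[OF that] by simp
      show "l (r \<odot>\<^bsub>?U\<^esub> x) = r \<odot>\<^bsub>Ktriv\<^esub> l x" if "r \<in> carrier R" "x \<in> carrier ?U" for r x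
        using lsm[OF that] by simp
    qed
    obtain m where m: "m \<in> lhom R ?F Ktriv" "\<forall>x\<in>carrier (Ext U). m (?f x) = restrict l (carrier ?U) x"
      using extension restrict_lhom[OF LU lin] by blast
    have "l u = m (t \<odot>\<^bsub>?F\<^esub> v)" using bspec[OF m(2), of u] u v(2) by simp
    also have "\<dots> = aug t \<otimes>\<^bsub>K\<^esub> m v" using lhomD(3)[OF m(1) t_closed v(1)] by simp
    also have "\<dots> = \<zero>\<^bsub>K\<^esub>" using lhomD(1)[OF m(1) v(1)] by (simp add: aug_t)
    finally show False using l(3) by simp
  qed
  have descend: "\<exists>v'\<in>carrier ?F. \<exists>u\<in>carrier ?U. v = t \<odot>\<^bsub>?F\<^esub> v' \<oplus>\<^bsub>?F\<^esub> ?f u"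
    if "v \<in> carrier ?F" "u0 \<in> carrier ?U" "t [^]\<^bsub>R\<^esub> j \<odot>\<^bsub>?F\<^esub> v = ?f u0" "j \<le> p - 1" for v u0 and j :: nat
    using that
  proof (induction j arbitrary: v u0)
    case 0
    have "v = t \<odot>\<^bsub>?F\<^esub> \<zero>\<^bsub>?F\<^esub> \<oplus>\<^bsub>?F\<^esub> ?f u0"
      using 0(1,3) RF.smult_one[OF 0(1)] RF.smult_zero_right[OF t_closed] RF.M.l_zero[OF 0(1)] by (simp del: restr_simps)
    then show ?case using 0(2) RF.M.zero_closed by blast
  next
    case (Suc j)
    note v = Suc.prems(1) and u0 = Suc.prems(2)
    have tjv: "t [^]\<^bsub>R\<^esub> j \<odot>\<^bsub>?F\<^esub> v \<in> carrier ?F" by (rule RF.smult_closed[OF pow_t_closed v])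
    have e1: "?f u0 = t \<odot>\<^bsub>?F\<^esub> (t [^]\<^bsub>R\<^esub> j \<odot>\<^bsub>?F\<^esub> v)" using Suc.prems(3) pow_smult(2)[OF LF v, of j] by metis
    obtain u1 where u1: "u1 \<in> carrier ?U" "u0 = t \<odot>\<^bsub>?U\<^esub> u1" using divide[OF u0 tjv e1] by blast
    have fu1: "?f u1 \<in> carrier ?F" by (rule fD(1)[OF u1(1)])
    let ?d = "t [^]\<^bsub>R\<^esub> j \<odot>\<^bsub>?F\<^esub> v \<ominus>\<^bsub>?F\<^esub> ?f u1"
    have d: "?d \<in> carrier ?F" using tjv fu1 by (rule RF.M.minus_closed)
    have "t \<odot>\<^bsub>?F\<^esub> ?d = t \<odot>\<^bsub>?F\<^esub> (t [^]\<^bsub>R\<^esub> j \<odot>\<^bsub>?F\<^esub> v) \<ominus>\<^bsub>?F\<^esub> t \<odot>\<^bsub>?F\<^esub> ?f u1"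
      by (rule RF.smult_diff_right[OF t_closed tjv fu1])
    also have "t \<odot>\<^bsub>?F\<^esub> ?f u1 = t \<odot>\<^bsub>?F\<^esub> (t [^]\<^bsub>R\<^esub> j \<odot>\<^bsub>?F\<^esub> v)"
      using fD(2)[OF t_closed u1(1)] u1(2) e1 by metis
    finally have "t \<odot>\<^bsub>?F\<^esub> ?d = \<zero>\<^bsub>?F\<^esub>"
      using RF.smult_diff_cancel[OF RF.smult_closed[OF t_closed tjv] RF.smult_closed[OF t_closed tjv]] by metis
    then obtain y where y: "y \<in> carrier ?F" "?d = t [^]\<^bsub>R\<^esub> (p - 1) \<odot>\<^bsub>?F\<^esub> y" using ker'[OF d] by blast
    \<comment> \<open>Here j + 1 \<le> p - 1, so the truncated difference p - 2 - j is exact and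
      t^(p-1) y = t^j (t z).\<close>
    define z where "z = t [^]\<^bsub>R\<^esub> (p - 2 - j) \<odot>\<^bsub>?F\<^esub> y"
    have z: "z \<in> carrier ?F" unfolding z_def by (rule RF.smult_closed[OF pow_t_closed y(1)])
    have tz: "t \<odot>\<^bsub>?F\<^esub> z \<in> carrier ?F" by (rule RF.smult_closed[OF t_closed z])
    have "Suc j + (p - 2 - j) = p - 1" using Suc.prems(4) by simp
    then have "t [^]\<^bsub>R\<^esub> (p - 1) = t [^]\<^bsub>R\<^esub> Suc j \<otimes>\<^bsub>R\<^esub> t [^]\<^bsub>R\<^esub> (p - 2 - j)"
      using R.nat_pow_mult[OF t_closed, of "Suc j" "p - 2 - j"] by metis
    then have dz: "?d = t [^]\<^bsub>R\<^esub> j \<odot>\<^bsub>?F\<^esub> (t \<odot>\<^bsub>?F\<^esub> z)"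
      using y RF.smult_assoc[OF pow_t_closed pow_t_closed y(1), of "Suc j" "p - 2 - j"] pow_smult(1)[OF LF z, of j]
      unfolding z_def by metis
    \<comment> \<open>Subtracting t z does not change v modulo t F, and t^j of the result lies in
      the image of U: the exponent has dropped by one.\<close>
    let ?v = "v \<ominus>\<^bsub>?F\<^esub> t \<odot>\<^bsub>?F\<^esub> z"
    have vc: "?v \<in> carrier ?F" using v tz by (rule RF.M.minus_closed)
    have "t [^]\<^bsub>R\<^esub> j \<odot>\<^bsub>?F\<^esub> ?v = t [^]\<^bsub>R\<^esub> j \<odot>\<^bsub>?F\<^esub> v \<ominus>\<^bsub>?F\<^esub> ?d"
      unfolding dz by (rule RF.smult_diff_right[OF pow_t_closed v tz])
    also have "\<dots> = ?f u1"
      using tjv fu1 by (simp add: a_minus_def RF.M.minus_add RF.M.r_neg2 del: restr_simps)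
    finally obtain v' u where vu: "v' \<in> carrier ?F" "u \<in> carrier ?U" "?v = t \<odot>\<^bsub>?F\<^esub> v' \<oplus>\<^bsub>?F\<^esub> ?f u"
      using Suc.IH[OF vc u1(1)] Suc.prems(4) by (metis Suc_leD)
    have "v = t \<odot>\<^bsub>?F\<^esub> z \<oplus>\<^bsub>?F\<^esub> ?v"
      using v tz by (simp add: a_minus_def RF.M.a_lcomm RF.M.r_neg del: restr_simps)
    also have "\<dots> = t \<odot>\<^bsub>?F\<^esub> (z \<oplus>\<^bsub>?F\<^esub> v') \<oplus>\<^bsub>?F\<^esub> ?f u"
      unfolding vu(3) using z vu tz fD(1)[OF vu(2)] RF.smult_closed[OF t_closed vu(1)]
      by (simp add: RF.smult_r_distr[OF t_closed] RF.M.a_assoc del: restr_simps)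
    finally show ?case using RF.M.a_closed[OF z vu(1)] vu(2) by blast
  qed
  show ?thesis
  proof (rule projective_criterion[OF LW RExt_fg[OF W]])
    fix m assume m: "m \<in> carrier ?W" "t [^]\<^bsub>R\<^esub> (p - 1) \<odot>\<^bsub>?W\<^esub> m = \<zero>\<^bsub>?W\<^esub>"
    have "m \<in> ?g ` carrier ?F" using m(1) \<rho>(5) by simp
    then obtain v where v: "v \<in> carrier ?F" "m = ?g v" by (elim imageE)
    have "?g (t [^]\<^bsub>R\<^esub> (p - 1) \<odot>\<^bsub>?F\<^esub> v) = \<zero>\<^bsub>?W\<^esub>" using lhomD(3)[OF gh pow_t_closed v(1)] m(2) v(2) by metis
    then obtain u0 where u0: "u0 \<in> carrier ?U" "t [^]\<^bsub>R\<^esub> (p - 1) \<odot>\<^bsub>?F\<^esub> v = ?f u0"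
      using gker[OF RF.smult_closed[OF pow_t_closed v(1)]] by blast
    obtain v' u where vu: "v' \<in> carrier ?F" "u \<in> carrier ?U" "v = t \<odot>\<^bsub>?F\<^esub> v' \<oplus>\<^bsub>?F\<^esub> ?f u"
      using descend[OF v(1) u0 le_refl] by blast
    have "m = ?g (t \<odot>\<^bsub>?F\<^esub> v') \<oplus>\<^bsub>?W\<^esub> ?g (?f u)"
      unfolding v(2) vu(3) by (rule lhomD(2)[OF gh RF.smult_closed[OF t_closed vu(1)] fD(1)[OF vu(2)]])
    also have "\<dots> = t \<odot>\<^bsub>?W\<^esub> ?g v'"
      using gf[OF vu(2)] lhomD(3)[OF gh t_closed vu(1)] RW.M.r_zero[OF RW.smult_closed[OF t_closed lhomD(1)[OF gh vu(1)]]] by metis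
    finally show "\<exists>m'\<in>carrier ?W. m = t \<odot>\<^bsub>?W\<^esub> m'" using lhomD(1)[OF gh vu(1)] by blast
  qed
qed

end

section \<open>Group algebras\<close>

lemma fd_modules_iff: "M \<in> fd_modules k B \<longleftrightarrow> left_module B M \<and> finitely_generated k (restr (scalar B) M)"
  by (simp add: fd_modules_def)

lemma restr_carrier_update: "restr \<phi> (M\<lparr>carrier := S\<rparr>) = (restr \<phi> M)\<lparr>carrier := S\<rparr>"
  by (simp add: restr_def)

text \<open>Links the K-action of the record \<open>ext_algebra\<close>, for which \<alpha> is
  linear by definition, with the condition \<open>alpha_eps\<close> on pure tensors.\<close>

lemma (in scalar_extension) smult_one_KB:
  assumes d: "d \<in> carrier K"
  shows "d \<odot>\<^bsub>KB\<^esub> \<one>\<^bsub>KB\<^esub> = ptB \<one>\<^bsub>B\<^esub> d"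
proof -
  have add: "ptB b (c \<oplus>\<^bsub>K\<^esub> c') = ptB b c \<oplus>\<^bsub>BE.T\<^esub> ptB b c'"
    if "b \<in> carrier B" "c \<in> carrier K" "c' \<in> carrier K" for b c c'
    using BE.pure_tensor_add_right[of b c c'] that by simp
  have bal: "balanced_map k B E BE.T (\<lambda>b c. ptB b (d \<otimes>\<^bsub>K\<^esub> c))"
    using d ring_hom_closed[OF emb] BE.pure_tensor_smult
    by (simp add: balanced_map_def BE.pure_tensor_closed BE.pure_tensor_add_left add K.r_distr K.m_lcomm)
  have "tensor_lift (tensor_algebra k B E) h u = tensor_lift BE.T h u" for h :: "'b \<Rightarrow> 'd \<Rightarrow> _" and u
    by (rule tensor_lift_cong) (simp_all add: tensor_algebra_def)
  then have "d \<odot>\<^bsub>KB\<^esub> u = tensor_lift BE.T (\<lambda>b c. ptB b (d \<otimes>\<^bsub>K\<^esub> c)) u" for u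
    by (simp add: ext_algebra_def Let_def ext_space_def restr_def)
  then show ?thesis
    using BE.tensor_lift_pure[OF BE.tensor_abelian_group bal, of "\<one>\<^bsub>B\<^esub>" "\<one>\<^bsub>K\<^esub>"] d by (simp add: KB_simps(4))
qed

context pi_setting
begin

text \<open>\<open>flat_kernel\<close> asks for finite generation of B \<otimes> K over K; this
  comes from \<open>KExt_fg\<close> for the regular module, whose extension has the same carrier,
  addition and action.\<close>

lemma KB_kernel:
  assumes flat: "flat_module R (restr \<alpha> (regular KB))" and fgB: "finitely_generated k (V (regular B))"
    and u: "u \<in> carrier KB" "\<alpha> t \<otimes>\<^bsub>KB\<^esub> u = \<zero>\<^bsub>KB\<^esub>"
  shows "\<exists>y\<in>carrier KB. u = \<alpha> (t [^]\<^bsub>R\<^esub> (p - 1)) \<otimes>\<^bsub>KB\<^esub> y"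
proof -
  note RL = left_module_regular[OF B.ring_axioms]
  have L1: "left_module K (restr \<epsilon> (RExt (regular B)))"
    by (rule left_module_restr[OF K.ring_axioms R.ring_axioms eps_hom RExt_left_module[OF RL]])
  have L2: "left_module K (restr \<epsilon> (restr \<alpha> (regular KB)))"
    by (rule left_module_restr[OF K.ring_axioms R.ring_axioms eps_hom RKB_left_module])
  have "finitely_generated K (restr \<epsilon> (restr \<alpha> (regular KB)))"
    by (rule finitely_generated_image[OF L1 L2 _ _ KExt_fg[OF RL fgB], of "\<lambda>x. x"])
       (simp_all add: linear_map_def Ext_regular_simps KB_mult)
  from flat_kernel[OF flat this, of u] u show ?thesis by simp
qed

text \<open>From left to right every exact sequence ending in W is treated alike. In the other
  direction one sequence decides, the one given by a free cover of W.\<close>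

theorem projective_iff_additive:
  fixes W :: "('b, nat \<Rightarrow> 'c) module"
  assumes flat: "flat_module R (restr \<alpha> (regular KB))" and fgB: "finitely_generated k (V (regular B))"
    and W: "W \<in> fd_modules k B"
  shows "projective_module R (RExt W) \<longleftrightarrow>
    (\<forall>U\<in>fd_modules k B. \<forall>M\<in>fd_modules k B. \<forall>f g. short_exact B U M W f g \<longrightarrow>
      int (composition_length (end_ring B Delta) (HomD U)) - int (composition_length (end_ring B Delta) (HomD M)) +
      int (composition_length (end_ring B Delta) (HomD W)) = 0)" (is "?P \<longleftrightarrow> ?A")
proof
  have W': "left_module B W" "finitely_generated k (V W)" using W by (simp_all add: fd_modules_iff)
  {
    assume P: ?P
    show ?A
    proof (intro ballI allI impI)
      fix U M :: "('b, nat \<Rightarrow> 'c) module" and f g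
      assume "U \<in> fd_modules k B" "M \<in> fd_modules k B" and se: "short_exact B U M W f g"
      then have U: "left_module B U" "finitely_generated k (V U)" and M: "left_module B M" "finitely_generated k (V M)"
        by (simp_all add: fd_modules_iff)
      have f: "f \<in> lhom B U M" and g: "g \<in> lhom B M W"
        and ex: "inj_on f (carrier U)" "f ` carrier U = {y \<in> carrier M. g y = \<zero>\<^bsub>W\<^esub>}" "g ` carrier M = carrier W"
        using se by (simp_all add: short_exact_def)
      show "int (composition_length (end_ring B Delta) (HomD U)) - int (composition_length (end_ring B Delta) (HomD M)) +
          int (composition_length (end_ring B Delta) (HomD W)) = 0"
        unfolding chi_exact_iff[OF U M W' f g ex] extension_iff[OF U(1) M(1) f]
        using extend_of_projective[OF U(1) M W' f g ex P] by blast
    qed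
  }
  {
    assume A: ?A
    interpret W: left_module B W by (rule W'(1))
    obtain F :: "('b, nat \<Rightarrow> 'c) module" and g n v \<pi> where F: "left_module B F" "finitely_generated k (V F)"
      and g: "g \<in> lhom B F W" "g ` carrier F = carrier W"
      and free: "\<forall>i<n. v i \<in> carrier F" "\<forall>i<n. \<pi> i \<in> lhom B F (regular B)"
        "\<forall>x\<in>carrier F. x = (\<Oplus>\<^bsub>F\<^esub>i\<in>{..<n::nat}. \<pi> i x \<odot>\<^bsub>F\<^esub> v i)"
      using free_cover[OF W' fgB] .
    \<comment> \<open>The kernel of the cover keeps the record of F with a smaller carrier, so it
      has the type demanded by \<open>fd_modules\<close>.\<close>
    let ?S = "{x \<in> carrier F. g x = \<zero>\<^bsub>W\<^esub>}"
    let ?U = "F\<lparr>carrier := ?S\<rparr>"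
    have S: "submodule ?S B F"
      using submodule_vimage_linear[OF F(1) W'(1) lhomD(5)[OF g(1)] W.zero_submodule] by simp
    have U: "left_module B ?U" by (rule left_module_submodule[OF F(1) S])
    have gV: "g ` carrier (V F) = carrier (V W)" using g(2) by simp
    have fgU: "finitely_generated k (V ?U)"
      using finitely_generated_kernel[OF k.field_axioms V_left_module[OF F(1)] V_left_module[OF W'(1)] F(2) W'(2)
          linear_map_scalar[OF lhomD(5)[OF g(1)]] gV]
      by (simp add: restr_carrier_update)
    let ?f = "\<lambda>x\<in>carrier ?U. x"
    have f: "?f \<in> lhom B ?U F" by (rule restrict_lhom[OF U]) (simp add: linear_map_def)
    have ex: "inj_on ?f (carrier ?U)" "?f ` carrier ?U = {y \<in> carrier F. g y = \<zero>\<^bsub>W\<^esub>}"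
      by (auto simp: inj_on_def)
    have se: "short_exact B ?U F W ?f g" unfolding short_exact_def using f g ex by blast
    have "?U \<in> fd_modules k B" "F \<in> fd_modules k B" using U fgU F by (simp_all add: fd_modules_iff)
    with A se have "int (composition_length (end_ring B Delta) (HomD ?U)) - int (composition_length (end_ring B Delta) (HomD F)) +
          int (composition_length (end_ring B Delta) (HomD W)) = 0" by blast
    then have ext: "\<forall>l\<in>lhom R (RExt ?U) Ktriv. \<exists>m\<in>lhom R (RExt F) Ktriv. \<forall>u\<in>carrier (Ext ?U). m (extend_map ?U F ?f u) = l u"
      unfolding chi_exact_iff[OF U fgU F W' f g(1) ex g(2)] extension_iff[OF U F(1) f] .
    show ?P
      by (rule projective_of_extension[OF U fgU F(1) W' f g(1) ex g(2) _ ext])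
         (rule free_kernel[OF KB_kernel[OF flat fgB] F(1) free])
  }
qed

end

section \<open>The group algebra of a finite group scheme\<close>

context finite_group_scheme
begin

abbreviation "GA \<equiv> group_algebra k G"

lemma GA_simps:
  "carrier GA = lhom k G (regular k)" "f \<oplus>\<^bsub>GA\<^esub> g = (\<lambda>x\<in>carrier G. f x \<oplus>\<^bsub>k\<^esub> g x)"
  "\<zero>\<^bsub>GA\<^esub> = (\<lambda>x\<in>carrier G. \<zero>\<^bsub>k\<^esub>)" "c \<odot>\<^bsub>GA\<^esub> f = (\<lambda>a\<in>carrier G. c \<otimes>\<^bsub>k\<^esub> f a)"
  "f \<otimes>\<^bsub>GA\<^esub> g = (\<lambda>a\<in>carrier G. tensor_lift k (\<lambda>x y. f x \<otimes>\<^bsub>k\<^esub> g y) (comult G a))"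
  by (simp_all add: group_algebra_def hom_module_def)

lemma G_left_module: "left_module k G"
  by (rule left_module_of_module[OF A.module_axioms])

lemma GA_D:
  assumes "f \<in> carrier GA"
  shows "x \<in> carrier G \<Longrightarrow> f x \<in> carrier k"
    and "x \<in> carrier G \<Longrightarrow> y \<in> carrier G \<Longrightarrow> f (x \<oplus>\<^bsub>G\<^esub> y) = f x \<oplus>\<^bsub>k\<^esub> f y"
    and "c \<in> carrier k \<Longrightarrow> x \<in> carrier G \<Longrightarrow> f (c \<odot>\<^bsub>G\<^esub> x) = c \<otimes>\<^bsub>k\<^esub> f x"
    and "x \<notin> carrier G \<Longrightarrow> f x = undefined"
  using lhomD[OF assms[unfolded GA_simps]] by simp_all

lemma GA_I:
  assumes "\<And>x. x \<in> carrier G \<Longrightarrow> f x \<in> carrier k"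
    and "\<And>x y. x \<in> carrier G \<Longrightarrow> y \<in> carrier G \<Longrightarrow> f (x \<oplus>\<^bsub>G\<^esub> y) = f x \<oplus>\<^bsub>k\<^esub> f y"
    and "\<And>c x. c \<in> carrier k \<Longrightarrow> x \<in> carrier G \<Longrightarrow> f (c \<odot>\<^bsub>G\<^esub> x) = c \<otimes>\<^bsub>k\<^esub> f x"
  shows "(\<lambda>x\<in>carrier G. f x) \<in> carrier GA"
  unfolding GA_simps by (rule restrict_lhom[OF G_left_module]) (use assms in \<open>simp add: linear_map_def\<close>)

lemma GA_eqI:
  assumes "f \<in> carrier GA" "g \<in> carrier GA" "\<And>x. x \<in> carrier G \<Longrightarrow> f x = g x"
  shows "f = g"
  using assms unfolding GA_simps by (rule lhom_eqI)

lemma GA_module: "module k GA"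
proof (rule moduleI)
  show "cring k" by (rule k.is_cring)
  have rg: "operator_group k (regular k)"
    by (rule operator_group_left_module[OF left_module_regular[OF k.ring_axioms]])
  show "abelian_group GA"
    by (rule abelian_group_cong[OF hom_module_abelian[OF G_left_module rg]])
       (simp_all add: group_algebra_def hom_module_def)
  show "a \<odot>\<^bsub>GA\<^esub> f \<in> carrier GA" if "a \<in> carrier k" "f \<in> carrier GA" for a f
    unfolding GA_simps(4) using that GA_D[OF that(2)] by (intro GA_I) (simp_all add: k.r_distr k.m_lcomm)
qed (auto simp: GA_simps(2,4) GA_D fun_eq_iff k.l_distr k.r_distr k.m_assoc k.m_lcomm restrict_def intro!: GA_I)

sublocale GG: tensor_product k G G
  by (simp add: tensor_product_def A.module_axioms)

lemma comult_closed: "a \<in> carrier G \<Longrightarrow> comult G a \<in> carrier GG.T"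
  using comult_hom by (auto simp: algebra_hom_def linear_map_def tensor_algebra_def)

lemma product_balanced:
  assumes "f \<in> carrier GA" "g \<in> carrier GA"
  shows "balanced_map k G G k (\<lambda>x y. f x \<otimes>\<^bsub>k\<^esub> g y)"
  using GA_D[OF assms(1)] GA_D[OF assms(2)] unfolding balanced_map_def
  by (simp add: k.l_distr k.r_distr k.m_ac)

lemma mult_additive:
  assumes "f \<in> carrier GA" "g \<in> carrier GA"
  shows "additive_map GG.T k (tensor_lift k (\<lambda>x y. f x \<otimes>\<^bsub>k\<^esub> g y))"
  by (rule GG.tensor_lift_additive[OF k.abelian_group_axioms product_balanced[OF assms]])

text \<open>The convolution product at a is a function of the tensor \<open>comult G a\<close>. Both
  sides are additive functions of an arbitrary tensor, so the scalar may be moved on pure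
  tensors.\<close>

lemma GA_algebra_over:
  assumes "ring GA"
  shows "algebra_over k GA"
proof -
  interpret B: ring GA by fact
  interpret M: module k GA by (rule GA_module)
  have *: "c \<otimes>\<^bsub>k\<^esub> tensor_lift k (\<lambda>x y. f x \<otimes>\<^bsub>k\<^esub> g y) u = tensor_lift k (\<lambda>x y. f' x \<otimes>\<^bsub>k\<^esub> g' y) u"
    if c: "c \<in> carrier k" and fg: "f \<in> carrier GA" "g \<in> carrier GA" "f' \<in> carrier GA" "g' \<in> carrier GA"
      and eq: "\<And>x y. x \<in> carrier G \<Longrightarrow> y \<in> carrier G \<Longrightarrow> c \<otimes>\<^bsub>k\<^esub> (f x \<otimes>\<^bsub>k\<^esub> g y) = f' x \<otimes>\<^bsub>k\<^esub> g' y"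
      and u: "u \<in> carrier GG.T" for c f g f' g' u
  proof (rule GG.additive_map_tensor_eqI[OF _ mult_additive[OF fg(3,4)] u])
    show "additive_map GG.T k (\<lambda>u. c \<otimes>\<^bsub>k\<^esub> tensor_lift k (\<lambda>x y. f x \<otimes>\<^bsub>k\<^esub> g y) u)"
      using additive_mapD[OF mult_additive[OF fg(1,2)]] c by (simp add: additive_map_def k.r_distr)
    show "c \<otimes>\<^bsub>k\<^esub> tensor_lift k (\<lambda>x y. f x \<otimes>\<^bsub>k\<^esub> g y) (GG.pt x y) = tensor_lift k (\<lambda>x y. f' x \<otimes>\<^bsub>k\<^esub> g' y) (GG.pt x y)"
      if "x \<in> carrier G" "y \<in> carrier G" for x y
      using eq[OF that] that
      by (simp add: GG.tensor_lift_pure[OF k.abelian_group_axioms product_balanced[OF fg(1,2)]]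
          GG.tensor_lift_pure[OF k.abelian_group_axioms product_balanced[OF fg(3,4)]])
  qed
  show ?thesis
  proof (intro algebra_over.intro algebra_over_axioms.intro)
    show "field k" by (rule k.field_axioms)
    show "ring GA" by fact
    show "module k GA" by (rule GA_module)
    fix c f g assume c: "c \<in> carrier k" and f: "f \<in> carrier GA" and g: "g \<in> carrier GA"
    have cf: "c \<odot>\<^bsub>GA\<^esub> f \<in> carrier GA" "c \<odot>\<^bsub>GA\<^esub> g \<in> carrier GA" using c f g by simp_all
    show "c \<odot>\<^bsub>GA\<^esub> (f \<otimes>\<^bsub>GA\<^esub> g) = (c \<odot>\<^bsub>GA\<^esub> f) \<otimes>\<^bsub>GA\<^esub> g"
    proof (rule GA_eqI)
      fix a assume a: "a \<in> carrier G"
      show "(c \<odot>\<^bsub>GA\<^esub> (f \<otimes>\<^bsub>GA\<^esub> g)) a = ((c \<odot>\<^bsub>GA\<^esub> f) \<otimes>\<^bsub>GA\<^esub> g) a"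
        using a c GA_D(1)[OF f] GA_D(1)[OF g] *[OF c f g cf(1) g _ comult_closed[OF a]]
        by (simp add: GA_simps(4,5) k.m_assoc)
    qed (use c f g cf in simp_all)
    show "c \<odot>\<^bsub>GA\<^esub> (f \<otimes>\<^bsub>GA\<^esub> g) = f \<otimes>\<^bsub>GA\<^esub> (c \<odot>\<^bsub>GA\<^esub> g)"
    proof (rule GA_eqI)
      fix a assume a: "a \<in> carrier G"
      show "(c \<odot>\<^bsub>GA\<^esub> (f \<otimes>\<^bsub>GA\<^esub> g)) a = (f \<otimes>\<^bsub>GA\<^esub> (c \<odot>\<^bsub>GA\<^esub> g)) a"
        using a c GA_D(1)[OF f] GA_D(1)[OF g] *[OF c f g f cf(2) _ comult_closed[OF a]]
        by (simp add: GA_simps(4,5) k.m_lcomm)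
    qed (use c f g cf in simp_all)
  qed
qed

text \<open>The coordinate functions d b of a basis of k[G] generate the dual space, because f is
  the sum of the d b weighted by the values f b.\<close>

lemma GA_fg: "finitely_generated k GA"
proof -
  interpret L: left_module k G by (rule G_left_module)
  interpret M: module k GA by (rule GA_module)
  have LM: "left_module k GA" by (rule left_module_of_module[OF GA_module])
  obtain B0 where B0: "generates_modulo k G {\<zero>\<^bsub>G\<^esub>} B0"
    using L.finitely_generated_modulo[OF finite_dim L.zero_submodule] .
  obtain B where B: "generates_modulo k G {\<zero>\<^bsub>G\<^esub>} B"
    and min: "\<forall>c\<in>B \<rightarrow> carrier k. lincomb G c B \<in> {\<zero>\<^bsub>G\<^esub>} \<longrightarrow> (\<forall>b\<in>B. c b \<notin> Units k)"
    using L.minimal_generators[OF L.zero_submodule B0] .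
  have fin: "finite B" "B \<subseteq> carrier G" using B by (auto simp: generates_modulo_def)
  have ind: "independent_modulo k G {\<zero>\<^bsub>G\<^esub>} B"
    using min unfolding independent_modulo_def k.field_Units by blast
  obtain co where co': "\<forall>x\<in>carrier G. co x \<in> B \<rightarrow> carrier k"
    "\<forall>x\<in>carrier G. x \<ominus>\<^bsub>G\<^esub> lincomb G (co x) B \<in> {\<zero>\<^bsub>G\<^esub>}"
    "\<forall>x\<in>carrier G. \<forall>c\<in>B \<rightarrow> carrier k. x \<ominus>\<^bsub>G\<^esub> lincomb G c B \<in> {\<zero>\<^bsub>G\<^esub>} \<longrightarrow> (\<forall>b\<in>B. co x b = c b)"
    "\<forall>x\<in>carrier G. \<forall>y\<in>carrier G. \<forall>b\<in>B. co (x \<oplus>\<^bsub>G\<^esub> y) b = co x b \<oplus>\<^bsub>k\<^esub> co y b"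
    "\<forall>r\<in>carrier k. \<forall>x\<in>carrier G. \<forall>b\<in>B. co (r \<odot>\<^bsub>G\<^esub> x) b = r \<otimes>\<^bsub>k\<^esub> co x b"
    using L.coordinates[OF L.zero_submodule B ind] .
  have coc: "co x b \<in> carrier k" if "x \<in> carrier G" "b \<in> B" for x b using co'(1) that by blast
  define d where "d b = (\<lambda>x\<in>carrier G. co x b)" for b
  have d: "d b \<in> carrier GA" if "b \<in> B" for b
    unfolding d_def by (rule GA_I) (use co'(4,5) coc that in simp_all)
  have "carrier GA \<subseteq> S" if S: "submodule S k GA" "d ` B \<subseteq> S" for S
  proof
    interpret LM: left_module k GA by (rule LM)
    fix f assume f: "f \<in> carrier GA"
    \<comment> \<open>Partial sums over subsets C of the basis: each step adds a multiple of some d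
      b, so they all stay in S.\<close>
    have "(\<lambda>x\<in>carrier G. \<Oplus>\<^bsub>k\<^esub>b\<in>C. co x b \<otimes>\<^bsub>k\<^esub> f b) \<in> S" if "C \<subseteq> B" for C
      using finite_subset[OF that fin(1)] that
    proof (induction C)
      case empty
      have "(\<lambda>x\<in>carrier G. \<zero>\<^bsub>k\<^esub>) \<in> S" using LM.submodule_closed(2)[OF S(1)] unfolding GA_simps(3) .
      then show ?case unfolding k.finsum_empty .
    next
      case (insert b C)
      have b: "b \<in> B" "b \<in> carrier G" using insert.prems fin(2) by auto
      have fc: "f b' \<in> carrier k" if "b' \<in> insert b C" for b' using GA_D(1)[OF f] that insert.prems fin(2) by blast
      have "f b \<odot>\<^bsub>GA\<^esub> d b \<oplus>\<^bsub>GA\<^esub> (\<lambda>x\<in>carrier G. \<Oplus>\<^bsub>k\<^esub>b\<in>C. co x b \<otimes>\<^bsub>k\<^esub> f b) \<in> S"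
      proof (rule LM.submodule_closed(3)[OF S(1) LM.submodule_closed(5)[OF S(1)]])
        show "f b \<in> carrier k" using fc by blast
        show "d b \<in> S" using S(2) b by blast
        show "(\<lambda>x\<in>carrier G. \<Oplus>\<^bsub>k\<^esub>b\<in>C. co x b \<otimes>\<^bsub>k\<^esub> f b) \<in> S" using insert.IH insert.prems by blast
      qed
      also have "f b \<odot>\<^bsub>GA\<^esub> d b \<oplus>\<^bsub>GA\<^esub> (\<lambda>x\<in>carrier G. \<Oplus>\<^bsub>k\<^esub>b\<in>C. co x b \<otimes>\<^bsub>k\<^esub> f b) =
        (\<lambda>x\<in>carrier G. \<Oplus>\<^bsub>k\<^esub>b\<in>insert b C. co x b \<otimes>\<^bsub>k\<^esub> f b)"
        unfolding GA_simps(2,4) d_def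
      proof (rule restrict_ext)
        fix x assume x: "x \<in> carrier G"
        have "(\<lambda>b. co x b \<otimes>\<^bsub>k\<^esub> f b) \<in> C \<rightarrow> carrier k" "co x b \<otimes>\<^bsub>k\<^esub> f b \<in> carrier k"
          using coc[OF x] fc insert.prems by auto
        then show "(\<lambda>a\<in>carrier G. f b \<otimes>\<^bsub>k\<^esub> (\<lambda>x\<in>carrier G. co x b) a) x \<oplus>\<^bsub>k\<^esub> (\<lambda>x\<in>carrier G. \<Oplus>\<^bsub>k\<^esub>b\<in>C. co x b \<otimes>\<^bsub>k\<^esub> f b) x =
          (\<Oplus>\<^bsub>k\<^esub>b\<in>insert b C. co x b \<otimes>\<^bsub>k\<^esub> f b)"
          using x insert.hyps coc[OF x b(1)] fc by (simp add: k.m_comm)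
      qed
      finally show ?case .
    qed
    from this[of B] have FS: "(\<lambda>x\<in>carrier G. \<Oplus>\<^bsub>k\<^esub>b\<in>B. co x b \<otimes>\<^bsub>k\<^esub> f b) \<in> S" by simp
    have "f = (\<lambda>x\<in>carrier G. \<Oplus>\<^bsub>k\<^esub>b\<in>B. co x b \<otimes>\<^bsub>k\<^esub> f b)"
    proof (rule GA_eqI[OF f])
      show "(\<lambda>x\<in>carrier G. \<Oplus>\<^bsub>k\<^esub>b\<in>B. co x b \<otimes>\<^bsub>k\<^esub> f b) \<in> carrier GA" using FS LM.submodule_closed(1)[OF S(1)] by blast
      fix x assume x: "x \<in> carrier G"
      have cx: "co x \<in> B \<rightarrow> carrier k" using co'(1) x by blast
      have "x = lincomb G (co x) B"
        using abelian_group.eq_of_diff_zero[OF L.M_abelian x L.lincomb_closed[OF fin(2) cx]] co'(2) x by blast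
      then have "f x = f (\<Oplus>\<^bsub>G\<^esub>b\<in>B. co x b \<odot>\<^bsub>G\<^esub> b)" unfolding lincomb_def by simp
      also have "\<dots> = (\<Oplus>\<^bsub>k\<^esub>b\<in>B. f (co x b \<odot>\<^bsub>G\<^esub> b))"
        by (rule additive_map_finsum[OF L.M_abelian k.abelian_group_axioms _ fin(1) L.term_closed[OF fin(2) cx]])
           (use GA_D[OF f] in \<open>simp add: additive_map_def\<close>)
      also have "\<dots> = (\<Oplus>\<^bsub>k\<^esub>b\<in>B. co x b \<otimes>\<^bsub>k\<^esub> f b)"
        using GA_D[OF f] coc[OF x] fin(2) by (intro k.finsum_cong') (auto simp: subset_iff)
      finally show "f x = (\<lambda>x\<in>carrier G. \<Oplus>\<^bsub>k\<^esub>b\<in>B. co x b \<otimes>\<^bsub>k\<^esub> f b) x" using x by simp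
    qed
    then show "f \<in> S" using FS by metis
  qed
  then show ?thesis unfolding finitely_generated_iff[OF LM]
    using fin(1) d by (intro exI[of _ "d ` B"]) auto
qed

text \<open>The group algebra, the quotient of K[X] and the point module form an instance of
  \<open>pi_setting\<close>. For W in mod G, membership in the two sides is then the equivalence
  \<open>projective_iff_additive\<close>.\<close>

lemma Thick_eq_Adloc:
  assumes p: "p > 0" and pi: "pi_point k G p K \<iota> \<alpha>"
  shows "Thick k G p K \<iota> \<alpha> = Adloc k G (chi k G (point_module k G p K \<iota> \<alpha>))"
proof -
  have "projective_module (trunc_ring K p) (restr \<alpha> (ext_module k K \<iota> GA W)) \<longleftrightarrow>
    (\<forall>U\<in>mod_G k G. \<forall>V\<in>mod_G k G. \<forall>f g. short_exact GA U V W f g \<longrightarrow>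
      int (chi k G (point_module k G p K \<iota> \<alpha>) U) - int (chi k G (point_module k G p K \<iota> \<alpha>) V) +
      int (chi k G (point_module k G p K \<iota> \<alpha>) W) = 0)" if W: "W \<in> mod_G k G" for W
  proof -
    \<comment> \<open>A module over the group algebra presupposes that the latter is a ring, so coassociativity and
      the counit axioms are not used.\<close>
    have rGA: "ring GA" using W left_module_ring by (auto simp: mod_G_def fd_modules_iff)
    interpret AO: algebra_over k GA by (rule GA_algebra_over[OF rGA])
    have K: "field K" and emb: "\<iota> \<in> ring_hom k K" and ah: "algebra_hom K (trunc_algebra K p) (ext_group_algebra k K \<iota> G) \<alpha>"
      and flat: "flat_module (trunc_ring K p) (restr \<alpha> (regular (ext_group_algebra k K \<iota> G)))"
      using pi by (simp_all add: pi_point_def)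
    interpret SE: scalar_extension k K GA \<iota>
      using AO.algebra_over_axioms K emb by (simp add: scalar_extension_def scalar_extension_axioms_def)
    interpret TR: truncated_ring K "trunc_ring K p" "trunc_eps K p" "trunc_aug K" "trunc_var K p" p
      by (rule truncated_ring_trunc[OF K p])
    have lin: "linear_map K (trunc_algebra K p) SE.KB \<alpha>" and one: "\<alpha> \<one>\<^bsub>trunc_ring K p\<^esub> = \<one>\<^bsub>SE.KB\<^esub>"
      and mult: "\<forall>x\<in>carrier (trunc_ring K p). \<forall>y\<in>carrier (trunc_ring K p).
        \<alpha> (x \<otimes>\<^bsub>trunc_ring K p\<^esub> y) = \<alpha> x \<otimes>\<^bsub>SE.KB\<^esub> \<alpha> y"
      using ah by (simp_all add: algebra_hom_def trunc_algebra_simps ext_group_algebra_def)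
    have ahom: "\<alpha> \<in> ring_hom (trunc_ring K p) SE.KB"
      using linear_mapD(1,2)[OF lin] one mult by (intro ring_hom_memI) (simp_all add: trunc_algebra_simps)
    \<comment> \<open>Linearity of \<alpha> refers to the K-actions of the two algebra records;
      evaluated at the unit it becomes the condition on scalars that \<open>pi_setting\<close> asks
      for.\<close>
    have aeps: "\<alpha> (trunc_eps K p c) = SE.ptB \<one>\<^bsub>GA\<^esub> c" if c: "c \<in> carrier K" for c
    proof -
      have "trunc_eps K p c = c \<odot>\<^bsub>trunc_algebra K p\<^esub> \<one>\<^bsub>trunc_ring K p\<^esub>"
        using TR.eps_closed[OF c] by (simp add: trunc_algebra_simps)
      then have "\<alpha> (trunc_eps K p c) = c \<odot>\<^bsub>SE.KB\<^esub> \<one>\<^bsub>SE.KB\<^esub>"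
        using linear_mapD(3)[OF lin c, of "\<one>\<^bsub>trunc_ring K p\<^esub>"] one by (simp add: trunc_algebra_simps)
      then show ?thesis using SE.smult_one_KB[OF c] by simp
    qed
    interpret PS: pi_setting k K GA \<iota> "trunc_ring K p" "trunc_eps K p" "trunc_aug K" "trunc_var K p" p \<alpha>
      using SE.scalar_extension_axioms TR.truncated_ring_axioms ahom aeps
      by (simp add: pi_setting_def pi_setting_axioms_def)
    have LM: "left_module k GA" by (rule left_module_of_module[OF GA_module])
    have fgR: "finitely_generated k (restr (scalar GA) (regular GA))"
      by (rule finitely_generated_image[OF LM AO.V_left_module[OF left_module_regular[OF rGA]] _ _ GA_fg, of "\<lambda>x. x"])
         (simp_all add: linear_map_def AO.scalar_mult)
    have pm: "point_module k G p K \<iota> \<alpha> = PS.Delta"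
      by (simp add: point_module_def ext_group_algebra_def trunc_trivial_eq ext_incl_def[abs_def])
    show ?thesis
      using PS.projective_iff_additive[OF flat[unfolded ext_group_algebra_def] fgR W[unfolded mod_G_def]]
      unfolding pm chi_def mod_G_def .
  qed
  then show ?thesis unfolding Thick_def Adloc_def by blast
qed

end

theorem corollary8p2:
  fixes k :: "'c ring" and G :: "('c, 'a) hopf" and p :: nat
    and K :: "'d ring" and \<iota> :: "'c \<Rightarrow> 'd" and \<alpha> :: "(nat \<Rightarrow> 'd) set \<Rightarrow> ('a \<Rightarrow> 'c, 'd) tens"
    and L :: "'e ring" and \<kappa> :: "'c \<Rightarrow> 'e" and \<beta> :: "(nat \<Rightarrow> 'e) set \<Rightarrow> ('a \<Rightarrow> 'c, 'e) tens"
  assumes "finite_group_scheme k G"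
    and "has_char k p" and "p > 0"
    and "pi_point k G p K \<iota> \<alpha>" and "pi_point k G p L \<kappa> \<beta>"
  shows "pi_equivalent k G p K \<iota> \<alpha> L \<kappa> \<beta> \<longleftrightarrow>
    subadditive_equivalent k G
      (chi k G (point_module k G p K \<iota> \<alpha>)) (chi k G (point_module k G p L \<kappa> \<beta>))"
  unfolding pi_equivalent_def subadditive_equivalent_def
  using finite_group_scheme.Thick_eq_Adloc[OF assms(1,3,4)] finite_group_scheme.Thick_eq_Adloc[OF assms(1,3,5)]
  by simp

end
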